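(* Let $G$ be an abelian group, let $k$ be a commutative $G$-ring and let $\delta\in k$ be invertible. For $G$-Brauer algebras over $k$, the map $$\mathrm{Tor}_{q}^{G\mathcal{B}_{n-1}(\delta)}(\mathbf{1},\mathbf{1})\rightarrow \mathrm{Tor}_{q}^{G\mathcal{B}_n(\delta)}(\mathbf{1},\mathbf{1})$$ induced by the inclusion $G\mathcal{B}_{n-1}(\delta)\rightarrow G\mathcal{B}_{n}(\delta)$ is an isomorphism for $n\geqslant 2q+2$.
   Context: A commutative $G$-ring is a unital commutative ring $k$ together with a group homomorphism $G\to\mathrm{Aut}(k)$ to the group of ring automorphisms; the action of $g\in G$ on $\lambda\in k$ is written $g\lambda$. A $G$-Brauer $n$-diagram is a graph on two columns (left and right) of $n$ nodes in which each node is connected to exactly one other node by an edge (left-to-left, right-to-right and left-to-right edges are all allowed), and each edge is labelled by an element of $G$. The $G$-Brauer algebra $G\mathcal{B}_n(\delta)$ consists of formal $k$-linear combinations of $G$-Brauer $n$-diagrams. The product $x\cdot y$ of two diagrams is the $k$-bilinear extension of: identify the right-hand nodes of $x$ with the left-hand nodes of $y$, forget the middle nodes, label each edge formed by concatenation with the product of the group elements along it, and replace each closed loop formed in the middle by a factor $g\delta\in k$, where $g\in G$ is the product of all the labels on the loop. The inclusion $G\mathcal{B}_{n-1}(\delta)\to G\mathcal{B}_n(\delta)$ sends an $(n-1)$-diagram to the $n$-diagram obtained by adding an extra node at the end of each column and joining these two nodes by a horizontal edge labelled $1\in G$. The trivial module $\mathbf{1}$ is a copy of $k$ (as a left and as a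 right module) on which diagrams with no left-to-left and no right-to-right connections act as $1$ and all other diagrams act as $0$. *)

theory Defs
  imports "HOL-Algebra.Algebra"
begin

section \<open>Modules over a not necessarily commutative ring\<close>

text \<open>
  The library locale \<^locale>\<open>module\<close> requires a commutative ring of scalars.  The library record
  is reused; as in the library, its \<open>mult\<close> and \<open>one\<close> fields carry no meaning for a module.
\<close>

locale left_module = R?: ring R + M?: abelian_group M
  for R :: "('a, 'r) ring_scheme" (structure) and M :: "('a, 'm, 's) module_scheme" (structure) +
  assumes lsmult_closed:
      "\<lbrakk>a \<in> carrier R; x \<in> carrier M\<rbrakk> \<Longrightarrow> a \<odot>\<^bsub>M\<^esub> x \<in> carrier M"
    and lsmult_l_distr:
      "\<lbrakk>a \<in> carrier R; b \<in> carrier R; x \<in> carrier M\<rbrakk> \<Longrightarrow>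
        (a \<oplus>\<^bsub>R\<^esub> b) \<odot>\<^bsub>M\<^esub> x = a \<odot>\<^bsub>M\<^esub> x \<oplus>\<^bsub>M\<^esub> b \<odot>\<^bsub>M\<^esub> x"
    and lsmult_r_distr:
      "\<lbrakk>a \<in> carrier R; x \<in> carrier M; y \<in> carrier M\<rbrakk> \<Longrightarrow>
        a \<odot>\<^bsub>M\<^esub> (x \<oplus>\<^bsub>M\<^esub> y) = a \<odot>\<^bsub>M\<^esub> x \<oplus>\<^bsub>M\<^esub> a \<odot>\<^bsub>M\<^esub> y"
    and lsmult_assoc:
      "\<lbrakk>a \<in> carrier R; b \<in> carrier R; x \<in> carrier M\<rbrakk> \<Longrightarrow>
        (a \<otimes>\<^bsub>R\<^esub> b) \<odot>\<^bsub>M\<^esub> x = a \<odot>\<^bsub>M\<^esub> (b \<odot>\<^bsub>M\<^esub> x)"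
    and lsmult_one:
      "x \<in> carrier M \<Longrightarrow> \<one>\<^bsub>R\<^esub> \<odot>\<^bsub>M\<^esub> x = x"

text \<open>Additive maps \<open>f\<close> with \<open>f (a \<odot> x) = \<phi> a \<odot> f x\<close>, i.e. homomorphisms into the module
  obtained by restriction of scalars along \<open>\<phi>\<close>.\<close>

definition semilinear_hom ::
  "('a, 'r) ring_scheme \<Rightarrow> ('a \<Rightarrow> 'b) \<Rightarrow> ('a, 'm, 's) module_scheme \<Rightarrow>
    ('b, 'n, 't) module_scheme \<Rightarrow> ('m \<Rightarrow> 'n) set" where
  "semilinear_hom A \<phi> M N =
    {f \<in> carrier M \<rightarrow> carrier N.
      (\<forall>x\<in>carrier M. \<forall>y\<in>carrier M. f (x \<oplus>\<^bsub>M\<^esub> y) = f x \<oplus>\<^bsub>N\<^esub> f y) \<and>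
      (\<forall>a\<in>carrier A. \<forall>x\<in>carrier M. f (a \<odot>\<^bsub>M\<^esub> x) = \<phi> a \<odot>\<^bsub>N\<^esub> f x)}"

abbreviation linear_hom ::
  "('a, 'r) ring_scheme \<Rightarrow> ('a, 'm, 's) module_scheme \<Rightarrow>
    ('a, 'n, 't) module_scheme \<Rightarrow> ('m \<Rightarrow> 'n) set" where
  "linear_hom A \<equiv> semilinear_hom A (\<lambda>a. a)"

definition finsupp :: "('a, 'r) ring_scheme \<Rightarrow> 's set \<Rightarrow> ('s \<Rightarrow> 'a) set" where
  "finsupp A S =
    {f. (\<forall>s\<in>S. f s \<in> carrier A) \<and> (\<forall>s. s \<notin> S \<longrightarrow> f s = \<zero>\<^bsub>A\<^esub>) \<and> finite {s. f s \<noteq> \<zero>\<^bsub>A\<^esub>}}"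

definition free_module :: "('a, 'r) ring_scheme \<Rightarrow> 's set \<Rightarrow> ('a, 's \<Rightarrow> 'a) module" where
  "free_module A S =
    \<lparr>carrier = finsupp A S, monoid.mult = undefined, one = undefined,
     ring.zero = (\<lambda>_. \<zero>\<^bsub>A\<^esub>), ring.add = (\<lambda>f g s. f s \<oplus>\<^bsub>A\<^esub> g s),
     smult = (\<lambda>a f s. a \<otimes>\<^bsub>A\<^esub> f s)\<rparr>"

text \<open>Projective modules are the direct summands of free modules.  Index sets inside the type of
  the module suffice: a projective module is a summand of the free module on its own carrier.\<close>

definition projective_module :: "('a, 'r) ring_scheme \<Rightarrow> ('a, 'p, 's) module_scheme \<Rightarrow> bool" where
  "projective_module A P \<longleftrightarrow> left_module A P \<and>
    (\<exists>S :: 'p set. \<exists>i \<in> linear_hom A P (free_module A S). \<exists>r \<in> linear_hom A (free_module A S) P.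
      \<forall>x\<in>carrier P. r (i x) = x)"


section \<open>Tensor products\<close>

text \<open>In \<open>M \<otimes> N\<close> the first argument is a right module; for it \<open>a \<odot> x\<close> stands for \<open>x \<cdot> a\<close>.\<close>

definition tensor_relations ::
  "('a, 'r) ring_scheme \<Rightarrow> ('a, 'm, 's) module_scheme \<Rightarrow> ('a, 'n, 't) module_scheme \<Rightarrow>
    ('m \<times> 'n \<Rightarrow>\<^sub>0 int) set" where
  "tensor_relations A M N =
    {frag_of (x \<oplus>\<^bsub>M\<^esub> x', y) - frag_of (x, y) - frag_of (x', y) | x x' y.
      x \<in> carrier M \<and> x' \<in> carrier M \<and> y \<in> carrier N} \<union>
    {frag_of (x, y \<oplus>\<^bsub>N\<^esub> y') - frag_of (x, y) - frag_of (x, y') | x y y'.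
      x \<in> carrier M \<and> y \<in> carrier N \<and> y' \<in> carrier N} \<union>
    {frag_of (a \<odot>\<^bsub>M\<^esub> x, y) - frag_of (x, a \<odot>\<^bsub>N\<^esub> y) | a x y.
      a \<in> carrier A \<and> x \<in> carrier M \<and> y \<in> carrier N}"

definition tensor_kernel ::
  "('a, 'r) ring_scheme \<Rightarrow> ('a, 'm, 's) module_scheme \<Rightarrow> ('a, 'n, 't) module_scheme \<Rightarrow>
    ('m \<times> 'n \<Rightarrow>\<^sub>0 int) set" where
  "tensor_kernel A M N =
    generate (free_Abelian_group (carrier M \<times> carrier N)) (tensor_relations A M N)"

definition tensor_product ::
  "('a, 'r) ring_scheme \<Rightarrow> ('a, 'm, 's) module_scheme \<Rightarrow> ('a, 'n, 't) module_scheme \<Rightarrow>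
    ('m \<times> 'n \<Rightarrow>\<^sub>0 int) set monoid" where
  "tensor_product A M N =
    free_Abelian_group (carrier M \<times> carrier N) Mod tensor_kernel A M N"

text \<open>The map \<open>M \<otimes> N \<rightarrow> M' \<otimes> N'\<close> with \<open>x \<otimes> y \<mapsto> g x \<otimes> f y\<close> on cosets; as in the library's
  treatment of factor groups, a map on cosets is obtained by \<^const>\<open>the_elem\<close>.\<close>

definition tensor_map ::
  "('b, 'r) ring_scheme \<Rightarrow> ('b, 'm1, 's) module_scheme \<Rightarrow> ('b, 'n1, 't) module_scheme \<Rightarrow>
    ('m \<Rightarrow> 'm1) \<Rightarrow> ('n \<Rightarrow> 'n1) \<Rightarrow> ('m \<times> 'n \<Rightarrow>\<^sub>0 int) set \<Rightarrow> ('m1 \<times> 'n1 \<Rightarrow>\<^sub>0 int) set" where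
  "tensor_map B M' N' g f \<xi> =
    the_elem ((\<lambda>c. r_coset (free_Abelian_group (carrier M' \<times> carrier N')) (tensor_kernel B M' N')
        (frag_extend (\<lambda>(x, y). frag_of (g x, f y)) c)) ` \<xi>)"


section \<open>Homology of chain complexes of abelian groups\<close>

text \<open>Complexes are indexed so that \<open>d i\<close> maps \<open>C (i + 1)\<close> to \<open>C i\<close>.\<close>

fun cycles :: "(nat \<Rightarrow> 'x monoid) \<Rightarrow> (nat \<Rightarrow> 'x \<Rightarrow> 'x) \<Rightarrow> nat \<Rightarrow> 'x set" where
  "cycles C d 0 = carrier (C 0)"
| "cycles C d (Suc q) = kernel (C (Suc q)) (C q) (d q)"

definition boundaries :: "(nat \<Rightarrow> 'x monoid) \<Rightarrow> (nat \<Rightarrow> 'x \<Rightarrow> 'x) \<Rightarrow> nat \<Rightarrow> 'x set" where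
  "boundaries C d q = d q ` carrier (C (Suc q))"

definition homology :: "(nat \<Rightarrow> 'x monoid) \<Rightarrow> (nat \<Rightarrow> 'x \<Rightarrow> 'x) \<Rightarrow> nat \<Rightarrow> 'x set monoid" where
  "homology C d q = (C q\<lparr>carrier := cycles C d q\<rparr>) Mod boundaries C d q"

definition homology_map ::
  "(nat \<Rightarrow> 'y monoid) \<Rightarrow> (nat \<Rightarrow> 'y \<Rightarrow> 'y) \<Rightarrow> (nat \<Rightarrow> 'x \<Rightarrow> 'y) \<Rightarrow> nat \<Rightarrow> 'x set \<Rightarrow> 'y set" where
  "homology_map C' d' f q \<xi> = the_elem ((\<lambda>z. boundaries C' d' q #>\<^bsub>C' q\<^esub> f q z) ` \<xi>)"


section \<open>Tor\<close>

record ('a, 'p, 'n) augmented_complex =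
  obj :: "nat \<Rightarrow> ('a, 'p) module"
  diff :: "nat \<Rightarrow> 'p \<Rightarrow> 'p"  \<comment> \<open>\<open>diff i\<close> maps \<open>obj (i + 1)\<close> to \<open>obj i\<close>\<close>
  aug :: "'p \<Rightarrow> 'n"

definition projective_resolution ::
  "('a, 'r) ring_scheme \<Rightarrow> ('a, 'n, 's) module_scheme \<Rightarrow> ('a, 'p, 'n) augmented_complex \<Rightarrow> bool" where
  "projective_resolution A N P \<longleftrightarrow>
    (\<forall>i. projective_module A (obj P i)) \<and>
    (\<forall>i. diff P i \<in> linear_hom A (obj P (Suc i)) (obj P i)) \<and>
    aug P \<in> linear_hom A (obj P 0) N \<and>
    aug P ` carrier (obj P 0) = carrier N \<and>
    diff P 0 ` carrier (obj P (Suc 0)) = a_kernel (obj P 0) N (aug P) \<and>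
    (\<forall>i. diff P (Suc i) ` carrier (obj P (Suc (Suc i))) =
      a_kernel (obj P (Suc i)) (obj P i) (diff P i))"

definition Tor_complex ::
  "('a, 'r) ring_scheme \<Rightarrow> ('a, 'm, 's) module_scheme \<Rightarrow> ('a, 'p, 'n) augmented_complex \<Rightarrow>
    nat \<Rightarrow> ('m \<times> 'p \<Rightarrow>\<^sub>0 int) set monoid" where
  "Tor_complex A M P i = tensor_product A M (obj P i)"

definition Tor_diff ::
  "('a, 'r) ring_scheme \<Rightarrow> ('a, 'm, 's) module_scheme \<Rightarrow> ('a, 'p, 'n) augmented_complex \<Rightarrow>
    nat \<Rightarrow> ('m \<times> 'p \<Rightarrow>\<^sub>0 int) set \<Rightarrow> ('m \<times> 'p \<Rightarrow>\<^sub>0 int) set" where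
  "Tor_diff A M P i = tensor_map A M (obj P i) (\<lambda>x. x) (diff P i)"

text \<open>\<open>Tor\<^sub>q(M, N)\<close> over \<open>A\<close>, computed from a projective resolution \<open>P\<close> of \<open>N\<close>.\<close>

definition Tor ::
  "('a, 'r) ring_scheme \<Rightarrow> ('a, 'm, 's) module_scheme \<Rightarrow> ('a, 'p, 'n) augmented_complex \<Rightarrow>
    nat \<Rightarrow> ('m \<times> 'p \<Rightarrow>\<^sub>0 int) set set monoid" where
  "Tor A M P q = homology (Tor_complex A M P) (Tor_diff A M P) q"

text \<open>Chain maps \<open>P \<rightarrow> Q\<close> that are semilinear along \<open>\<phi>\<close> and cover \<open>h : N \<rightarrow> N'\<close>, for
  resolutions \<open>P\<close> of \<open>N\<close> and \<open>Q\<close> of \<open>N'\<close>.\<close>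

definition comparison_map ::
  "('a, 'r) ring_scheme \<Rightarrow> ('a \<Rightarrow> 'b) \<Rightarrow> ('n \<Rightarrow> 'n1) \<Rightarrow> ('a, 'p, 'n) augmented_complex \<Rightarrow>
    ('b, 'q, 'n1) augmented_complex \<Rightarrow> (nat \<Rightarrow> 'p \<Rightarrow> 'q) \<Rightarrow> bool" where
  "comparison_map A \<phi> h P Q f \<longleftrightarrow>
    (\<forall>i. f i \<in> semilinear_hom A \<phi> (obj P i) (obj Q i)) \<and>
    (\<forall>i. \<forall>x\<in>carrier (obj P (Suc i)). f i (diff P i x) = diff Q i (f (Suc i) x)) \<and>
    (\<forall>x\<in>carrier (obj P 0). aug Q (f 0 x) = h (aug P x))"

text \<open>The map \<open>Tor\<^sub>q(M, N) \<rightarrow> Tor\<^sub>q(M', N')\<close> over \<open>A \<rightarrow> B\<close> induced by \<open>g : M \<rightarrow> M'\<close> and a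
  comparison map \<open>f\<close>.\<close>

definition Tor_map ::
  "('b, 'r) ring_scheme \<Rightarrow> ('b, 'm1, 's) module_scheme \<Rightarrow> ('b, 'q, 'n1) augmented_complex \<Rightarrow>
    ('m \<Rightarrow> 'm1) \<Rightarrow> (nat \<Rightarrow> 'p \<Rightarrow> 'q) \<Rightarrow> nat \<Rightarrow>
    ('m \<times> 'p \<Rightarrow>\<^sub>0 int) set set \<Rightarrow> ('m1 \<times> 'q \<Rightarrow>\<^sub>0 int) set set" where
  "Tor_map B M' Q g f q =
    homology_map (Tor_complex B M' Q) (Tor_diff B M' Q)
      (\<lambda>i. tensor_map B M' (obj Q i) g (f i)) q"


section \<open>Commutative G-rings\<close>

definition commutative_G_ring ::
  "('g, 'x) monoid_scheme \<Rightarrow> ('k, 'y) ring_scheme \<Rightarrow> ('g \<Rightarrow> 'k \<Rightarrow> 'k) \<Rightarrow> bool" where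
  "commutative_G_ring G k act \<longleftrightarrow>
    cring k \<and> group_action G (carrier k) act \<and> (\<forall>g\<in>carrier G. act g \<in> ring_iso k k)"


section \<open>G-Brauer diagrams\<close>

datatype node = LNode nat | RNode nat

definition nodes :: "nat \<Rightarrow> node set" where
  "nodes n = LNode ` {..<n} \<union> RNode ` {..<n}"

text \<open>A labelled edge is a pair of its set of end points and its label; a diagram is its set of
  labelled edges.\<close>

type_synonym 'g diagram = "(node set \<times> 'g) set"

definition diagrams :: "('g, 'x) monoid_scheme \<Rightarrow> nat \<Rightarrow> 'g diagram set" where
  "diagrams G n =
    {D. (\<forall>(e, g)\<in>D. g \<in> carrier G \<and> (\<exists>u\<in>nodes n. \<exists>v\<in>nodes n. u \<noteq> v \<and> e = {u, v})) \<and>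
        (\<forall>v\<in>nodes n. \<exists>!p. p \<in> D \<and> v \<in> fst p)}"

text \<open>
  Gluing \<open>x\<close> and \<open>y\<close>: the glued graph has three columns of nodes, the nodes \<open>RNode i\<close> of \<open>x\<close> and
  \<open>LNode i\<close> of \<open>y\<close> being identified with \<open>Middle i\<close>.  Its edges form the disjoint union
  \<open>x <+> y\<close>, since an edge of \<open>x\<close> and an edge of \<open>y\<close> may have the same end points.
\<close>

datatype glued_node = OuterL nat | Middle nat | OuterR nat

fun glued_ends :: "(node set \<times> 'g) + (node set \<times> 'g) \<Rightarrow> glued_node set" where
  "glued_ends (Inl (e, g)) = case_node OuterL Middle ` e"
| "glued_ends (Inr (e, g)) = case_node Middle OuterR ` e"

definition edge_label :: "(node set \<times> 'g) + (node set \<times> 'g) \<Rightarrow> 'g" where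
  "edge_label a = case_sum snd snd a"

text \<open>Connected components of the glued graph, as sets of edges.\<close>

definition components ::
  "'g diagram \<Rightarrow> 'g diagram \<Rightarrow> ((node set \<times> 'g) + (node set \<times> 'g)) set set" where
  "components x y =
    (x <+> y) // {(a, b). a \<in> x <+> y \<and> b \<in> x <+> y \<and> glued_ends a \<inter> glued_ends b \<noteq> {}}\<^sup>*"

text \<open>The nodes of a component that survive in the product: two end points for a path, none for a
  closed loop in the middle.\<close>

definition outer_ends :: "((node set \<times> 'g) + (node set \<times> 'g)) set \<Rightarrow> node set" where
  "outer_ends C = case_node OuterL OuterR -` (\<Union>a\<in>C. glued_ends a)"

definition component_label ::
  "('g, 'x) monoid_scheme \<Rightarrow> ((node set \<times> 'g) + (node set \<times> 'g)) set \<Rightarrow> 'g" where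
  "component_label G C = finprod G edge_label C"

definition glue :: "('g, 'x) monoid_scheme \<Rightarrow> 'g diagram \<Rightarrow> 'g diagram \<Rightarrow> 'g diagram" where
  "glue G x y =
    {(outer_ends C, component_label G C) | C. C \<in> components x y \<and> outer_ends C \<noteq> {}}"

definition loop_factor ::
  "('g, 'x) monoid_scheme \<Rightarrow> ('k, 'y) ring_scheme \<Rightarrow> ('g \<Rightarrow> 'k \<Rightarrow> 'k) \<Rightarrow> 'k \<Rightarrow>
    'g diagram \<Rightarrow> 'g diagram \<Rightarrow> 'k" where
  "loop_factor G k act \<delta> x y =
    finprod k (\<lambda>C. act (component_label G C) \<delta>) {C \<in> components x y. outer_ends C = {}}"

definition identity_diagram :: "('g, 'x) monoid_scheme \<Rightarrow> nat \<Rightarrow> 'g diagram" where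
  "identity_diagram G n = {({LNode i, RNode i}, \<one>\<^bsub>G\<^esub>) | i. i < n}"

definition add_strand :: "('g, 'x) monoid_scheme \<Rightarrow> nat \<Rightarrow> 'g diagram \<Rightarrow> 'g diagram" where
  "add_strand G m x = insert ({LNode m, RNode m}, \<one>\<^bsub>G\<^esub>) x"


section \<open>G-Brauer algebras\<close>

definition GB ::
  "('g, 'x) monoid_scheme \<Rightarrow> ('k, 'y) ring_scheme \<Rightarrow> ('g \<Rightarrow> 'k \<Rightarrow> 'k) \<Rightarrow> 'k \<Rightarrow> nat \<Rightarrow>
    ('g diagram \<Rightarrow> 'k) ring" where
  "GB G k act \<delta> n =
    \<lparr>carrier = finsupp k (diagrams G n),
     monoid.mult = (\<lambda>a b d. finsum k (\<lambda>(x, y). a x \<otimes>\<^bsub>k\<^esub> b y \<otimes>\<^bsub>k\<^esub> loop_factor G k act \<delta> x y)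
       {(x, y). a x \<noteq> \<zero>\<^bsub>k\<^esub> \<and> b y \<noteq> \<zero>\<^bsub>k\<^esub> \<and> glue G x y = d}),
     one = (\<lambda>d. if d = identity_diagram G n then \<one>\<^bsub>k\<^esub> else \<zero>\<^bsub>k\<^esub>),
     ring.zero = (\<lambda>_. \<zero>\<^bsub>k\<^esub>),
     ring.add = (\<lambda>a b d. a d \<oplus>\<^bsub>k\<^esub> b d)\<rparr>"

text \<open>The inclusion of the algebra on \<open>m\<close> strands into that on \<open>m + 1\<close> strands.\<close>

definition GB_inclusion ::
  "('g, 'x) monoid_scheme \<Rightarrow> ('k, 'y) ring_scheme \<Rightarrow> nat \<Rightarrow> ('g diagram \<Rightarrow> 'k) \<Rightarrow>
    'g diagram \<Rightarrow> 'k" where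
  "GB_inclusion G k m a = (\<lambda>d. finsum k a {x. a x \<noteq> \<zero>\<^bsub>k\<^esub> \<and> add_strand G m x = d})"

definition only_horizontal :: "'g diagram \<Rightarrow> bool" where
  "only_horizontal x \<longleftrightarrow> (\<forall>(e, g)\<in>x. \<exists>i j. e = {LNode i, RNode j})"

text \<open>The trivial module.  Since \<open>k\<close> is commutative, the same record serves as the left and as the
  right module, for every number of strands.\<close>

definition trivial_module :: "('k, 'y) ring_scheme \<Rightarrow> ('g diagram \<Rightarrow> 'k, 'k) module" where
  "trivial_module k =
    \<lparr>carrier = carrier k, monoid.mult = monoid.mult k, one = one k, ring.zero = ring.zero k, ring.add = ring.add k,
     smult = (\<lambda>a c. finsum k a {x. a x \<noteq> \<zero>\<^bsub>k\<^esub> \<and> only_horizontal x} \<otimes>\<^bsub>k\<^esub> c)\<rparr>"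

end

(*
  Let I be the ideal of GB_n spanned by the diagrams with a cup or cap; GB_n / I is the group ring
  of the wreath product W_n of G with the symmetric group.  For a left cup t the span of the
  diagrams containing t is a right ideal J_t with a left identity, a multiple of a cup-cap diagram;
  this is where delta must be invertible.  The same idempotents show that J M is acyclic for every
  resolution M and every finite intersection J of such ideals, hence, by Mayer-Vietoris, also for
  their sum I.  So M / I M resolves the trivial module over k[W_n], and Tor over GB_n is the
  homology of W_n with coefficients in k.

  Stability for W_n follows from the complex of injective words in letters labelled by G, which is
  exact below the top degree and on whose words of length p the group W_n acts simply transitively
  modulo W_{n-p}.  The double complex of coinvariants gives a spectral sequence argument by
  induction on q: the differential from the homology of W_{n-p-1} to that of W_{n-p} is an
  alternating sum of p + 1 maps that all agree, because they differ by elements of W_n that commute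
  with W_{n-p-1}.

  A resolution over W_{n-1} is compared with the restriction of one over W_n through the mapping
  cone of the given chain map, which is exact and relatively projective, hence null-homotopic.

  All modules are handled as quotients of free abelian groups: elements live in an ambient group,
  and the laws hold modulo a subgroup.
*)
theory Submission
  imports Defs "HOL-Library.Product_Plus" "HOL-Combinatorics.Permutations"
begin

section \<open>Abelian groups presented as quotients\<close>

text \<open>The resolutions and the comparison map are arbitrary, so the proof works with the given
  \<open>P\<close>, \<open>Q\<close>, \<open>f\<close>; projectivity enters only through dual bases.
  Associativity of gluing is awkward to verify on graphs. It is read off from the data instead: a
  resolution consists of modules over a ring, so \<open>GB\<close> is one. Since the augmentation is
  linear and onto k, the character \<open>\<epsilon>\<close> of the trivial module is
  multiplicative. As loop factors are units, both facts pass from elements to single diagrams: the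
  gluing of two diagrams is a diagram, and it is horizontal exactly when both factors are. This
  needs 1 and 0 to differ in k; over the zero ring all tensor products vanish and the claim is
  treated apart. G may be infinite, and then there are infinitely many left cups. An element of a
  module involves only finitely many diagrams, so unions of finitely many ideals suffice. The
  constant in 2q+2 arises as follows. Surjectivity in degree q needs a kernel of the word complex to
  be acyclic in degree q-1. Each such statement consumes stability with two letters fewer, and the
  available range is spent exactly at 2(q-1)+4 letters.\<close>

definition subgrp :: "'a::ab_group_add set \<Rightarrow> bool" where
  "subgrp N \<longleftrightarrow> 0 \<in> N \<and> (\<forall>x\<in>N. \<forall>y\<in>N. x - y \<in> N)"

lemma subgrp_zero: "subgrp N \<Longrightarrow> 0 \<in> N"
  by (simp add: subgrp_def)

lemma subgrp_diff: "subgrp N \<Longrightarrow> x \<in> N \<Longrightarrow> y \<in> N \<Longrightarrow> x - y \<in> N"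
  by (simp add: subgrp_def)

lemma subgrp_minus: "subgrp N \<Longrightarrow> x \<in> N \<Longrightarrow> - x \<in> N"
  using subgrp_diff[of N 0 x] by (simp add: subgrp_zero)

lemma subgrp_add: "subgrp N \<Longrightarrow> x \<in> N \<Longrightarrow> y \<in> N \<Longrightarrow> x + y \<in> N"
  using subgrp_diff[of N x "- y"] by (simp add: subgrp_minus)

lemma subgrp_sum: "subgrp N \<Longrightarrow> (\<And>i. i \<in> A \<Longrightarrow> f i \<in> N) \<Longrightarrow> sum f A \<in> N"
  by (induction A rule: infinite_finite_induct) (auto simp: subgrp_zero subgrp_add)

lemma subgrp_trans: "subgrp N \<Longrightarrow> x - y \<in> N \<Longrightarrow> y - z \<in> N \<Longrightarrow> x - z \<in> N"
  using subgrp_add[of N "x - y" "y - z"] by simp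

lemma subgrp_sym: "subgrp N \<Longrightarrow> x - y \<in> N \<Longrightarrow> y - x \<in> N"
  using subgrp_minus[of N "x - y"] by simp

lemma subgrp_cong: "subgrp N \<Longrightarrow> x - y \<in> N \<Longrightarrow> x \<in> N \<longleftrightarrow> y \<in> N"
  using subgrp_add[of N "x - y" y] subgrp_diff[of N x "x - y"] by auto

abbreviation addv :: "('a::ab_group_add \<Rightarrow> 'b::ab_group_add) \<Rightarrow> bool" where
  "addv \<equiv> Modules.additive"

lemma addvI: "(\<And>x y. f (x + y) = f x + f y) \<Longrightarrow> addv f"
  by (simp add: Modules.additive_def)

lemmas addv_add = Modules.additive.add
lemmas addv_zero = Modules.additive.zero
lemmas addv_diff = Modules.additive.diff
lemmas addv_minus = Modules.additive.minus
lemmas addv_sum = Modules.additive.sum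

section \<open>A double complex argument\<close>

text \<open>\<open>N p\<close> plays the role of the kernel of the projection to the coinvariants under the subgroup fixing \<open>p\<close>
  letters, and \<open>e p\<close> that of the differential of the complex of injective words.  On homology \<open>e p\<close> is the
  inclusion for even \<open>p\<close> and zero for odd \<open>p\<close>.\<close>

locale stability_complex =
  fixes N :: "nat \<Rightarrow> nat \<Rightarrow> 'a::ab_group_add set"
    and d :: "nat \<Rightarrow> 'a \<Rightarrow> 'a"
    and e :: "nat \<Rightarrow> nat \<Rightarrow> 'a \<Rightarrow> 'a"
    and m :: nat
  assumes N: "subgrp (N p i)"
    and d_add: "addv (d i)"
    and d_N: "x \<in> N p (Suc i) \<Longrightarrow> d i x \<in> N p i"
    and d_d: "d i (d (Suc i) x) \<in> N p i"
    and e_add: "addv (e p i)"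
    and e_zero: "e 0 i x - x \<in> N 0 i"
    and e_N: "\<lbrakk>p + 1 \<le> m; x \<in> N (Suc p) i\<rbrakk> \<Longrightarrow> e p i x \<in> N p i"
    and e_e: "p + 2 \<le> m \<Longrightarrow> e p i (e (Suc p) i x) \<in> N p i"
    and d_e: "p + 1 \<le> m \<Longrightarrow> d i (e p (Suc i) x) - e p i (d i x) \<in> N p i"
    and e_exact: "\<lbrakk>p + 2 \<le> m; e p i x \<in> N p i\<rbrakk> \<Longrightarrow> \<exists>y. x - e (Suc p) i y \<in> N (Suc p) i"
    and e_even: "\<lbrakk>p + 1 \<le> m; even p; i > 0 \<Longrightarrow> d (i - 1) x \<in> N (Suc p) (i - 1)\<rbrakk>
      \<Longrightarrow> \<exists>v. e p i x - x - d i v \<in> N p i"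
    and e_odd: "\<lbrakk>p + 1 \<le> m; odd p; i > 0 \<Longrightarrow> d (i - 1) x \<in> N (Suc p) (i - 1)\<rbrakk>
      \<Longrightarrow> \<exists>v. e p i x - d i v \<in> N p i"
begin

text \<open>In the comments below D(p) is the complex of quotients by \<open>N p\<close>, and K(p)
  is the kernel of \<open>e p\<close> from D(p+1) to D(p). The element represents a cycle of D(p);
  in degree 0 there is no condition.\<close>

definition cyc :: "nat \<Rightarrow> nat \<Rightarrow> 'a \<Rightarrow> bool" where
  "cyc p i x \<longleftrightarrow> (i > 0 \<longrightarrow> d (i - 1) x \<in> N p (i - 1))"

text \<open>The natural map from D(p+1) to D(p) is represented by the identity of the ambient group.
  It is used here instead of \<open>e p\<close>, which agrees with it on homology only for even
  p.\<close>

definition stab_surj :: "nat \<Rightarrow> nat \<Rightarrow> bool" where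
  "stab_surj p i \<longleftrightarrow> (\<forall>y. cyc p i y \<longrightarrow> (\<exists>x v. cyc (Suc p) i x \<and> y - x - d i v \<in> N p i))"

definition stab_inj :: "nat \<Rightarrow> nat \<Rightarrow> bool" where
  "stab_inj p i \<longleftrightarrow> (\<forall>x v. cyc (Suc p) i x \<and> x - d i v \<in> N p i \<longrightarrow> (\<exists>w. x - d i w \<in> N (Suc p) i))"

text \<open>This is the vanishing of the i-th homology of K(p), to be shown for even p.\<close>

definition ker_acyclic :: "nat \<Rightarrow> nat \<Rightarrow> bool" where
  "ker_acyclic p i \<longleftrightarrow> (\<forall>x. e p i x \<in> N p i \<and> cyc (Suc p) i x \<longrightarrow>
    (\<exists>y. e p (Suc i) y \<in> N p (Suc i) \<and> x - d i y \<in> N (Suc p) i))"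

text \<open>The i-th homology of K(p) injects into that of D(p+1). For odd p the map
  \<open>e p\<close> is zero on homology, so K(p) cannot be expected to be acyclic and this weaker
  property takes the place of \<open>ker_acyclic\<close>.\<close>

definition ker_inj :: "nat \<Rightarrow> nat \<Rightarrow> bool" where
  "ker_inj p i \<longleftrightarrow> (\<forall>a t. e p i a \<in> N p i \<and> cyc (Suc p) i a \<and> a - d i t \<in> N (Suc p) i \<longrightarrow>
    (\<exists>z. e p (Suc i) z \<in> N p (Suc i) \<and> a - d i z \<in> N (Suc p) i))"

lemma cyc_diff: "cyc p i x \<Longrightarrow> cyc p i y \<Longrightarrow> cyc p i (x - y)"
  by (auto simp: cyc_def addv_diff[OF d_add] intro: subgrp_diff[OF N])

lemma cyc_d: "cyc p i (d i x)"
proof (cases i)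
  case (Suc j)
  then show ?thesis using d_d[of j x p] by (simp add: cyc_def)
qed (simp add: cyc_def)

lemma e_cong: "p + 1 \<le> m \<Longrightarrow> x - y \<in> N (Suc p) i \<Longrightarrow> e p i x - e p i y \<in> N p i"
  using e_N[of p "x - y" i] by (simp add: addv_diff[OF e_add])

lemma d_cong: "x - y \<in> N p (Suc i) \<Longrightarrow> d i x - d i y \<in> N p i"
  using d_N[of "x - y" p i] by (simp add: addv_diff[OF d_add])

lemma e_homotopic_even:
  "\<lbrakk>p + 1 \<le> m; even p; cyc (Suc p) i x\<rbrakk> \<Longrightarrow> \<exists>v. e p i x - x - d i v \<in> N p i"
  by (rule e_even) (auto simp: cyc_def)

lemma e_homotopic_odd:
  "\<lbrakk>p + 1 \<le> m; odd p; cyc (Suc p) i x\<rbrakk> \<Longrightarrow> \<exists>v. e p i x - d i v \<in> N p i"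
  by (rule e_odd) (auto simp: cyc_def)

text \<open>Exactness gives a short exact sequence from K(p+1) through D(p+2) to K(p). The
  obstruction to lifting the cycle x is its image under the connecting map, the class of d t in
  K(p+1). That class vanishes in D(p+2), so either acyclicity or injectivity for K(p+1) in degree
  i-1 removes it.\<close>

lemma cycle_lift:
  assumes p: "p + 2 \<le> m" and x: "cyc (Suc p) i x" and xt: "x - e (Suc p) i t \<in> N (Suc p) i"
    and K: "i > 0 \<Longrightarrow> ker_acyclic (Suc p) (i - 1) \<or> ker_inj (Suc p) (i - 1)"
  obtains t' where "x - e (Suc p) i t' \<in> N (Suc p) i" "cyc (Suc (Suc p)) i t'"
proof (cases i)
  case 0
  then show ?thesis using that xt by (auto simp: cyc_def)
next
  case (Suc j)
  have dx: "d j x \<in> N (Suc p) j" using x Suc by (simp add: cyc_def)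
  have "d j (e (Suc p) i t) \<in> N (Suc p) j"
    using d_cong[of x "e (Suc p) i t" "Suc p" j] xt dx Suc subgrp_cong[OF N] by blast
  then have edt: "e (Suc p) j (d j t) \<in> N (Suc p) j"
    using d_e[of "Suc p" j t] p Suc subgrp_cong[OF N] by auto
  have "\<exists>z. e (Suc p) (Suc j) z \<in> N (Suc p) (Suc j) \<and> d j t - d j z \<in> N (Suc (Suc p)) j"
    using K Suc edt cyc_d[of "Suc (Suc p)" j t] subgrp_zero[OF N]
    unfolding ker_acyclic_def ker_inj_def by (metis diff_Suc_1 diff_self zero_less_Suc)
  then obtain z where z: "e (Suc p) i z \<in> N (Suc p) i" "d j t - d j z \<in> N (Suc (Suc p)) j"
    using Suc by auto
  have "x - e (Suc p) i (t - z) = (x - e (Suc p) i t) + e (Suc p) i z"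
    by (simp add: addv_diff[OF e_add])
  then have "x - e (Suc p) i (t - z) \<in> N (Suc p) i" using xt z(1) subgrp_add[OF N] by metis
  moreover have "cyc (Suc (Suc p)) i (t - z)"
    using z(2) Suc by (simp add: cyc_def addv_diff[OF d_add])
  ultimately show ?thesis by (rule that)
qed

text \<open>A class of K(p) lifts to a cycle b of D(p+2). Since p+1 is even,
  \<open>e (Suc p)\<close> is homologous to the inclusion, so b bounds in D(p+1) if a does.
  Injectivity of stabilisation makes b bound in D(p+2), and \<open>e (Suc p)\<close> carries this
  bounding chain into K(p).\<close>

lemma ker_inj_step:
  assumes p: "p + 2 \<le> m" "odd p" and si: "stab_inj (Suc p) i"
    and ka: "i > 0 \<Longrightarrow> ker_acyclic (Suc p) (i - 1)"
  shows "ker_inj p i"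
  unfolding ker_inj_def
proof (intro allI impI, elim conjE)
  fix a t assume a: "e p i a \<in> N p i" "cyc (Suc p) i a" "a - d i t \<in> N (Suc p) i"
  obtain b0 where b0: "a - e (Suc p) i b0 \<in> N (Suc p) i" using e_exact[OF p(1) a(1)] by blast
  obtain b where b: "a - e (Suc p) i b \<in> N (Suc p) i" "cyc (Suc (Suc p)) i b"
    using cycle_lift[OF p(1) a(2) b0] ka by blast
  obtain v where v: "e (Suc p) i b - b - d i v \<in> N (Suc p) i"
    using e_homotopic_even[of "Suc p" i b] b(2) p by auto
  have "b - d i (t - v) = (a - d i t) - (e (Suc p) i b - b - d i v) - (a - e (Suc p) i b)"
    by (simp add: addv_diff[OF d_add])
  then have "b - d i (t - v) \<in> N (Suc p) i"
    using subgrp_diff[OF N] a(3) v b(1) by metis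
  then obtain w where w: "b - d i w \<in> N (Suc (Suc p)) i"
    using si b(2) unfolding stab_inj_def by blast
  let ?z = "e (Suc p) (Suc i) w"
  have "e (Suc p) i b - e (Suc p) i (d i w) \<in> N (Suc p) i"
    using e_cong[of "Suc p" b "d i w" i] w p by auto
  moreover have "e (Suc p) i (d i w) - d i ?z \<in> N (Suc p) i"
    using d_e[of "Suc p" i w] p subgrp_sym[OF N] by auto
  ultimately have "a - d i ?z \<in> N (Suc p) i"
    using subgrp_trans[OF N b(1)] subgrp_trans[OF N] by blast
  moreover have "e p (Suc i) ?z \<in> N p (Suc i)" using e_e p by auto
  ultimately show "\<exists>z. e p (Suc i) z \<in> N p (Suc i) \<and> a - d i z \<in> N (Suc p) i" by blast
qed

text \<open>A cycle of K(p) lifts to a cycle t of D(p+2). Surjectivity of stabilisation and evenness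
  of p+2 make t homologous to an image under \<open>e (Suc (Suc p))\<close>, which the next map
  \<open>e (Suc p)\<close> kills. What remains is the boundary of an element of K(p).\<close>

lemma ker_acyclic_step:
  assumes p: "p + 3 \<le> m" "even p" and ss: "stab_surj (Suc (Suc p)) i"
    and ki: "i > 0 \<Longrightarrow> ker_inj (Suc p) (i - 1)"
  shows "ker_acyclic p i"
  unfolding ker_acyclic_def
proof (intro allI impI, elim conjE)
  fix x assume x: "e p i x \<in> N p i" "cyc (Suc p) i x"
  have p2: "p + 2 \<le> m" using p by simp
  obtain t0 where t0: "x - e (Suc p) i t0 \<in> N (Suc p) i" using e_exact[OF p2 x(1)] by blast
  obtain t where t: "x - e (Suc p) i t \<in> N (Suc p) i" "cyc (Suc (Suc p)) i t"
    using cycle_lift[OF p2 x(2) t0] ki by blast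
  obtain r v where r: "cyc (Suc (Suc (Suc p))) i r" "t - r - d i v \<in> N (Suc (Suc p)) i"
    using ss t(2) unfolding stab_surj_def by blast
  obtain v' where v': "e (Suc (Suc p)) i r - r - d i v' \<in> N (Suc (Suc p)) i"
    using e_homotopic_even[of "Suc (Suc p)" i r] r(1) p by auto
  let ?er = "e (Suc (Suc p)) i r"
  have "t - (?er + d i (v - v')) = (t - r - d i v) - (?er - r - d i v')"
    by (simp add: addv_diff[OF d_add])
  then have "t - (?er + d i (v - v')) \<in> N (Suc (Suc p)) i"
    using subgrp_diff[OF N r(2) v'] by metis
  then have "e (Suc p) i t - e (Suc p) i (?er + d i (v - v')) \<in> N (Suc p) i"
    using e_cong[of "Suc p"] p by auto
  moreover have "e (Suc p) i (?er + d i (v - v')) - e (Suc p) i (d i (v - v')) \<in> N (Suc p) i"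
    using e_e[of "Suc p" i r] p by (simp add: addv_add[OF e_add])
  moreover have "e (Suc p) i (d i (v - v')) - d i (e (Suc p) (Suc i) (v - v')) \<in> N (Suc p) i"
    using d_e[of "Suc p" i "v - v'"] p subgrp_sym[OF N] by auto
  ultimately have "x - d i (e (Suc p) (Suc i) (v - v')) \<in> N (Suc p) i"
    using subgrp_trans[OF N t(1)] subgrp_trans[OF N] by blast
  moreover have "e p (Suc i) (e (Suc p) (Suc i) (v - v')) \<in> N p (Suc i)" using e_e p by auto
  ultimately show "\<exists>y. e p (Suc i) y \<in> N p (Suc i) \<and> x - d i y \<in> N (Suc p) i" by blast
qed

text \<open>Unwinding the two steps alternates between even and odd p, raising p and lowering the
  degree by one each time. The bound is the one under which \<open>stab_surj\<close> is available at
  p+2 in degree i; along the recursion 2i+p does not increase.\<close>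

lemma ker_acyclic_range:
  assumes IH: "\<And>p' i'. \<lbrakk>i' < q; 2 * i' + p' + 2 \<le> m\<rbrakk> \<Longrightarrow> stab_surj p' i' \<and> stab_inj p' i'"
  shows "\<lbrakk>even p; i < q; 2 * i + p + 4 \<le> m\<rbrakk> \<Longrightarrow> ker_acyclic p i"
proof (induction i arbitrary: p rule: less_induct)
  case (less i)
  show ?case
  proof (rule ker_acyclic_step)
    show "ker_inj (Suc p) (i - 1)" if "i > 0"
    proof (rule ker_inj_step)
      show "ker_acyclic (Suc (Suc p)) (i - 1 - 1)" if "i - 1 > 0"
        by (rule less.IH) (use that less.prems in auto)
      show "stab_inj (Suc (Suc p)) (i - 1)"
        using IH[of "i - 1" "Suc (Suc p)"] less.prems that by auto
    qed (use less.prems that in auto)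
    show "stab_surj (Suc (Suc p)) i"
      using IH[of i "Suc (Suc p)"] less.prems by auto
  qed (use less.prems in auto)
qed

text \<open>Both parts are the long exact sequence of K(0) -> D(1) -> D(0). Surjectivity uses
  \<open>ker_acyclic\<close> for p = 0 in degree q-1, injectivity uses it for p = 2 in degree q-2;
  the bound 2i+p+4 is 2q+2 in both cases.\<close>

lemma stability_step:
  assumes m: "2 * q + 2 \<le> m"
    and IH: "\<And>p' i'. \<lbrakk>i' < q; 2 * i' + p' + 2 \<le> m\<rbrakk> \<Longrightarrow> stab_surj p' i' \<and> stab_inj p' i'"
  shows "stab_surj 0 q \<and> stab_inj 0 q"
proof
  note K = ker_acyclic_range[OF IH]
  show "stab_surj 0 q"
    unfolding stab_surj_def
  proof (intro allI impI)
    fix y assume y: "cyc 0 q y"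
    \<comment> \<open>The cycle y of D(0), read in D(1), has a boundary that dies in D(0), so this
      boundary is a cycle of K(0). Acyclicity of K(0) supplies the correction z.\<close>
    have "\<exists>z. z \<in> N 0 q \<and> cyc (Suc 0) q (y - z)"
    proof (cases q)
      case 0
      then show ?thesis using subgrp_zero[OF N] by (auto simp: cyc_def)
    next
      case (Suc j)
      have "d j y \<in> N 0 j" using y Suc by (simp add: cyc_def)
      then have "e 0 j (d j y) \<in> N 0 j" using e_zero[of j "d j y"] subgrp_cong[OF N] by blast
      moreover have "ker_acyclic 0 j" by (rule K) (use Suc m in auto)
      ultimately obtain z where z: "e 0 q z \<in> N 0 q" "d j y - d j z \<in> N (Suc 0) j"
        using cyc_d[of "Suc 0" j y] Suc unfolding ker_acyclic_def by blast
      then have "z \<in> N 0 q" using e_zero[of q z] subgrp_cong[OF N] by blast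
      then show ?thesis using z Suc by (auto simp: cyc_def addv_diff[OF d_add])
    qed
    then obtain z where z: "z \<in> N 0 q" "cyc (Suc 0) q (y - z)" by blast
    have "y - (y - z) - d q 0 \<in> N 0 q" using z by (simp add: addv_zero[OF d_add])
    then show "\<exists>x v. cyc (Suc 0) q x \<and> y - x - d q v \<in> N 0 q" using z(2) by blast
  qed
  show "stab_inj 0 q"
    unfolding stab_inj_def
  proof (intro allI impI, elim conjE)
    fix x v assume x: "cyc (Suc 0) q x" "x - d q v \<in> N 0 q"
    have "e 0 q (x - d q v) \<in> N 0 q"
      using e_zero[of q "x - d q v"] x(2) subgrp_cong[OF N] by blast
    then obtain b0 where b0: "(x - d q v) - e (Suc 0) q b0 \<in> N (Suc 0) q"
      using e_exact[of 0 q] m by auto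
    have ki: "ker_inj (Suc 0) (q - 1)" if "q > 0"
    proof (rule ker_inj_step)
      show "ker_acyclic (Suc (Suc 0)) (q - 1 - 1)" if "q - 1 > 0"
        by (rule K) (use that m in auto)
      show "stab_inj (Suc (Suc 0)) (q - 1)" using IH[of "q - 1" "Suc (Suc 0)"] that m by auto
    qed (use m that in auto)
    have "cyc (Suc 0) q (x - d q v)" using cyc_diff[OF x(1) cyc_d] .
    then obtain b where b: "(x - d q v) - e (Suc 0) q b \<in> N (Suc 0) q" "cyc (Suc (Suc 0)) q b"
      using cycle_lift[of 0 q "x - d q v" b0] b0 ki m by auto
    \<comment> \<open>The lift b of x - d v is a cycle of D(2), and \<open>e (Suc 0)\<close> is null
      on homology because 1 is odd; hence x is already a boundary in D(1).\<close>
    obtain w where w: "e (Suc 0) q b - d q w \<in> N (Suc 0) q"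
      using e_homotopic_odd[of "Suc 0" q b] b(2) m by auto
    have "x - d q (v + w) = ((x - d q v) - e (Suc 0) q b) + (e (Suc 0) q b - d q w)"
      by (simp add: addv_add[OF d_add])
    then have "x - d q (v + w) \<in> N (Suc 0) q" using subgrp_add[OF N b(1) w] by metis
    then show "\<exists>w. x - d q w \<in> N (Suc 0) q" by blast
  qed
qed

end

section \<open>Generated subgroups and additive maps out of free abelian groups\<close>

definition addspan :: "'a::ab_group_add set \<Rightarrow> 'a set" where
  "addspan B = \<Inter> {N. subgrp N \<and> B \<subseteq> N}"

lemma subgrp_addspan: "subgrp (addspan B)"
  by (auto simp: addspan_def subgrp_def)

lemma addspan_incl: "x \<in> B \<Longrightarrow> x \<in> addspan B"
  by (auto simp: addspan_def)

lemma addspan_least: "subgrp N \<Longrightarrow> B \<subseteq> N \<Longrightarrow> addspan B \<subseteq> N"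
  by (auto simp: addspan_def)

lemma addspan_mono: "B \<subseteq> Y \<Longrightarrow> addspan B \<subseteq> addspan Y"
  by (rule addspan_least[OF subgrp_addspan]) (auto intro: addspan_incl)

lemma subgrp_preimage: "addv f \<Longrightarrow> subgrp N \<Longrightarrow> subgrp (f -` N)"
  by (auto simp: subgrp_def addv_zero addv_diff)

lemma addv_addspan:
  assumes "addv f" "subgrp N" "\<And>x. x \<in> B \<Longrightarrow> f x \<in> N" "x \<in> addspan B"
  shows "f x \<in> N"
  using addspan_least[OF subgrp_preimage[OF assms(1,2)], of B] assms(3,4) by auto

lemma subgrp_sum_cong:
  "subgrp N \<Longrightarrow> (\<And>i. i \<in> A \<Longrightarrow> f i - g i \<in> N) \<Longrightarrow> sum f A - sum g A \<in> N"
  unfolding sum_subtractf[symmetric] by (rule subgrp_sum)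

lemma subgrp_diff_cong: "subgrp N \<Longrightarrow> x - x' \<in> N \<Longrightarrow> y - y' \<in> N \<Longrightarrow> (x - y) - (x' - y') \<in> N"
  using subgrp_diff[of N "x - x'" "y - y'"] by (simp add: algebra_simps)

lemma subgrp_add_cong: "subgrp N \<Longrightarrow> x - x' \<in> N \<Longrightarrow> y - y' \<in> N \<Longrightarrow> (x + y) - (x' + y') \<in> N"
  using subgrp_add[of N "x - x'" "y - y'"] by (simp add: algebra_simps)

lemma addv_frag_extend: "addv (frag_extend f)"
  by (rule addvI) (rule frag_extend_add)

lemma addv_extension:
  obtains h :: "('p \<Rightarrow>\<^sub>0 int) \<Rightarrow> 'b::ab_group_add" where "addv h" "\<And>x. h (frag_of x) = g x"
proof -
  define Z :: "'b monoid" where "Z = \<lparr>carrier = UNIV, monoid.mult = (+), one = 0\<rparr>"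
  have "comm_group Z"
  proof (rule comm_groupI)
    show "\<exists>y\<in>carrier Z. y \<otimes>\<^bsub>Z\<^esub> x = \<one>\<^bsub>Z\<^esub>" if "x \<in> carrier Z" for x
      by (rule bexI[of _ "- x"]) (simp_all add: Z_def)
  qed (simp_all add: Z_def add.assoc add.commute)
  then obtain h where "h \<in> hom (free_Abelian_group UNIV) Z" "\<And>x. h (frag_of x) = g x"
    using comm_group.free_Abelian_group_universal[of Z g UNIV] by (auto simp: Z_def)
  moreover from this have "addv h"
    by (intro addvI) (auto simp: hom_def Z_def)
  ultimately show ?thesis by (intro that)
qed

section \<open>Modules with a group action, presented as quotients\<close>

text \<open>\<open>op c w\<close> is the action of the element \<open>c \<cdot> w\<close> of the group ring of \<open>\<Gamma>\<close> over \<open>k\<close>, where \<open>w\<close> is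
  restricted to the subset \<open>H\<close> of \<open>\<Gamma>\<close>; all laws hold modulo \<open>E\<close> only.\<close>

definition kmod :: "('k, 'y) ring_scheme \<Rightarrow> ('w, 'z) monoid_scheme \<Rightarrow> 'w set \<Rightarrow>
    'a::ab_group_add set \<Rightarrow> ('k \<Rightarrow> 'w \<Rightarrow> 'a \<Rightarrow> 'a) \<Rightarrow> bool" where
  "kmod k \<Gamma> H E op \<longleftrightarrow> subgrp E \<and>
    (\<forall>a\<in>carrier k. \<forall>w\<in>H. addv (op a w) \<and> (\<forall>x\<in>E. op a w x \<in> E) \<and>
      (\<forall>b\<in>carrier k. \<forall>x. op (a \<oplus>\<^bsub>k\<^esub> b) w x - (op a w x + op b w x) \<in> E) \<and>
      (\<forall>b\<in>carrier k. \<forall>v\<in>H. \<forall>x. op a w (op b v x) - op (a \<otimes>\<^bsub>k\<^esub> b) (w \<otimes>\<^bsub>\<Gamma>\<^esub> v) x \<in> E)) \<and>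
    (\<forall>x. op \<one>\<^bsub>k\<^esub> \<one>\<^bsub>\<Gamma>\<^esub> x - x \<in> E)"

lemma kmodD:
  assumes "kmod k \<Gamma> H E op"
  shows "subgrp E"
    and "\<And>a w. \<lbrakk>a \<in> carrier k; w \<in> H\<rbrakk> \<Longrightarrow> addv (op a w)"
    and "\<And>a w x. \<lbrakk>a \<in> carrier k; w \<in> H; x \<in> E\<rbrakk> \<Longrightarrow> op a w x \<in> E"
    and "\<And>a b w x. \<lbrakk>a \<in> carrier k; b \<in> carrier k; w \<in> H\<rbrakk> \<Longrightarrow>
      op (a \<oplus>\<^bsub>k\<^esub> b) w x - (op a w x + op b w x) \<in> E"
    and "\<And>a b w v x. \<lbrakk>a \<in> carrier k; b \<in> carrier k; w \<in> H; v \<in> H\<rbrakk> \<Longrightarrow>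
      op a w (op b v x) - op (a \<otimes>\<^bsub>k\<^esub> b) (w \<otimes>\<^bsub>\<Gamma>\<^esub> v) x \<in> E"
    and "\<And>x. op \<one>\<^bsub>k\<^esub> \<one>\<^bsub>\<Gamma>\<^esub> x - x \<in> E"
  using assms by (auto simp: kmod_def)

lemma kmod_cong_op:
  assumes "kmod k \<Gamma> H E op" "a \<in> carrier k" "w \<in> H" "x - y \<in> E"
  shows "op a w x - op a w y \<in> E"
  using kmodD(3)[OF assms] by (simp add: addv_diff[OF kmodD(2)[OF assms(1-3)]])

lemma kmod_mono: "kmod k \<Gamma> H E op \<Longrightarrow> H' \<subseteq> H \<Longrightarrow> kmod k \<Gamma> H' E op"
  unfolding kmod_def by blast

definition lin :: "('k, 'y) ring_scheme \<Rightarrow> 'w set \<Rightarrow>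
    'a::ab_group_add set \<Rightarrow> ('k \<Rightarrow> 'w \<Rightarrow> 'a \<Rightarrow> 'a) \<Rightarrow>
    'b::ab_group_add set \<Rightarrow> ('k \<Rightarrow> 'w \<Rightarrow> 'b \<Rightarrow> 'b) \<Rightarrow> ('a \<Rightarrow> 'b) \<Rightarrow> bool" where
  "lin k H E op E' op' h \<longleftrightarrow> addv h \<and> (\<forall>x\<in>E. h x \<in> E') \<and>
    (\<forall>a\<in>carrier k. \<forall>w\<in>H. \<forall>x. h (op a w x) - op' a w (h x) \<in> E')"

lemma linD:
  assumes "lin k H E op E' op' h"
  shows "addv h" "\<And>x. x \<in> E \<Longrightarrow> h x \<in> E'"
    "\<And>a w x. \<lbrakk>a \<in> carrier k; w \<in> H\<rbrakk> \<Longrightarrow> h (op a w x) - op' a w (h x) \<in> E'"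
  using assms by (auto simp: lin_def)

lemma lin_cong:
  "lin k H E op E' op' h \<Longrightarrow> x - y \<in> E \<Longrightarrow> h x - h y \<in> E'"
  using linD(2)[of k H E op E' op' h "x - y"] by (simp add: addv_diff[OF linD(1)])

lemma lin_mono: "lin k H E op E' op' h \<Longrightarrow> H' \<subseteq> H \<Longrightarrow> lin k H' E op E' op' h"
  unfolding lin_def by blast

lemma lin_comp:
  assumes g: "lin k H E op E' op' g" and h: "lin k H E' op' E'' op'' h" and E'': "subgrp E''"
  shows "lin k H E op E'' op'' (\<lambda>x. h (g x))"
  unfolding lin_def
proof (intro conjI ballI allI)
  show "addv (\<lambda>x. h (g x))"
    by (rule addvI) (simp add: addv_add[OF linD(1)[OF g]] addv_add[OF linD(1)[OF h]])
  show "h (g x) \<in> E''" if "x \<in> E" for x using linD(2)[OF h linD(2)[OF g that]] .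
  show "h (g (op a w x)) - op'' a w (h (g x)) \<in> E''" if "a \<in> carrier k" "w \<in> H" for a w x
    using subgrp_trans[OF E'' lin_cong[OF h linD(3)[OF g that]] linD(3)[OF h that]] .
qed

lemma lin_diff:
  assumes g: "lin k H E op E' op' g" and h: "lin k H E op E' op' h"
    and E': "kmod k \<Gamma> H E' op'"
  shows "lin k H E op E' op' (\<lambda>x. g x - h x)"
  unfolding lin_def
proof (intro conjI ballI allI)
  show "addv (\<lambda>x. g x - h x)"
    by (rule addvI) (simp add: addv_add[OF linD(1)[OF g]] addv_add[OF linD(1)[OF h]])
  show "g x - h x \<in> E'" if "x \<in> E" for x
    using subgrp_diff[OF kmodD(1)[OF E'] linD(2)[OF g that] linD(2)[OF h that]] .
  show "g (op a w x) - h (op a w x) - op' a w (g x - h x) \<in> E'" if "a \<in> carrier k" "w \<in> H" for a w x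
    using subgrp_diff_cong[OF kmodD(1)[OF E'] linD(3)[OF g that] linD(3)[OF h that]]
    by (simp add: addv_diff[OF kmodD(2)[OF E' that]])
qed

text \<open>The dual basis lemma's description of a direct summand of the free module with basis \<open>S\<close>.\<close>

definition dual_basis :: "('k, 'y) ring_scheme \<Rightarrow> ('w, 'z) monoid_scheme \<Rightarrow>
    'a::ab_group_add set \<Rightarrow> ('k \<Rightarrow> 'w \<Rightarrow> 'a \<Rightarrow> 'a) \<Rightarrow> 's set \<Rightarrow> ('s \<Rightarrow> 'a) \<Rightarrow>
    ('a \<Rightarrow> 's \<Rightarrow> 'w \<Rightarrow> 'k) \<Rightarrow> bool" where
  "dual_basis k \<Gamma> E op S u c \<longleftrightarrow>
    (\<forall>x. \<forall>s\<in>S. \<forall>w\<in>carrier \<Gamma>. c x s w \<in> carrier k) \<and>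
    (\<forall>x. finite {(s, w). s \<in> S \<and> w \<in> carrier \<Gamma> \<and> c x s w \<noteq> \<zero>\<^bsub>k\<^esub>}) \<and>
    (\<forall>x y. \<forall>s\<in>S. \<forall>w\<in>carrier \<Gamma>. c (x + y) s w = c x s w \<oplus>\<^bsub>k\<^esub> c y s w) \<and>
    (\<forall>x\<in>E. \<forall>s\<in>S. \<forall>w\<in>carrier \<Gamma>. c x s w = \<zero>\<^bsub>k\<^esub>) \<and>
    (\<forall>a\<in>carrier k. \<forall>v\<in>carrier \<Gamma>. \<forall>x. \<forall>s\<in>S. \<forall>w\<in>carrier \<Gamma>.
      c (op a v x) s (v \<otimes>\<^bsub>\<Gamma>\<^esub> w) = a \<otimes>\<^bsub>k\<^esub> c x s w) \<and>
    (\<forall>x. x - (\<Sum>(s, w) | s \<in> S \<and> w \<in> carrier \<Gamma> \<and> c x s w \<noteq> \<zero>\<^bsub>k\<^esub>. op (c x s w) w (u s)) \<in> E)"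

lemma dual_basisD:
  assumes "dual_basis k \<Gamma> E op S u c"
  shows "\<And>x s w. \<lbrakk>s \<in> S; w \<in> carrier \<Gamma>\<rbrakk> \<Longrightarrow> c x s w \<in> carrier k"
    and "\<And>x. finite {(s, w). s \<in> S \<and> w \<in> carrier \<Gamma> \<and> c x s w \<noteq> \<zero>\<^bsub>k\<^esub>}"
    and "\<And>x y s w. \<lbrakk>s \<in> S; w \<in> carrier \<Gamma>\<rbrakk> \<Longrightarrow> c (x + y) s w = c x s w \<oplus>\<^bsub>k\<^esub> c y s w"
    and "\<And>x s w. \<lbrakk>x \<in> E; s \<in> S; w \<in> carrier \<Gamma>\<rbrakk> \<Longrightarrow> c x s w = \<zero>\<^bsub>k\<^esub>"
    and "\<And>a v x s w. \<lbrakk>a \<in> carrier k; v \<in> carrier \<Gamma>; s \<in> S; w \<in> carrier \<Gamma>\<rbrakk> \<Longrightarrow>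
      c (op a v x) s (v \<otimes>\<^bsub>\<Gamma>\<^esub> w) = a \<otimes>\<^bsub>k\<^esub> c x s w"
    and "\<And>x. x - (\<Sum>(s, w) | s \<in> S \<and> w \<in> carrier \<Gamma> \<and> c x s w \<noteq> \<zero>\<^bsub>k\<^esub>. op (c x s w) w (u s)) \<in> E"
  using assms by (auto simp: dual_basis_def)

locale kmod_dual_basis =
  fixes k :: "('k, 'y) ring_scheme" and \<Gamma> :: "('w, 'z) monoid_scheme"
    and E :: "('p \<Rightarrow>\<^sub>0 int) set" and op :: "'k \<Rightarrow> 'w \<Rightarrow> ('p \<Rightarrow>\<^sub>0 int) \<Rightarrow> ('p \<Rightarrow>\<^sub>0 int)"
    and S :: "'s set" and u :: "'s \<Rightarrow> ('p \<Rightarrow>\<^sub>0 int)" and c :: "('p \<Rightarrow>\<^sub>0 int) \<Rightarrow> 's \<Rightarrow> 'w \<Rightarrow> 'k"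
  assumes k: "cring k" and \<Gamma>: "group \<Gamma>"
    and kmod: "kmod k \<Gamma> (carrier \<Gamma>) E op" and db: "dual_basis k \<Gamma> E op S u c"
begin

interpretation k: cring k by (rule k)
interpretation \<Gamma>: group \<Gamma> by (rule \<Gamma>)

abbreviation supp :: "('p \<Rightarrow>\<^sub>0 int) \<Rightarrow> ('s \<times> 'w) set" where
  "supp x \<equiv> {(s, w). s \<in> S \<and> w \<in> carrier \<Gamma> \<and> c x s w \<noteq> \<zero>\<^bsub>k\<^esub>}"

text \<open>A map is prescribed on the terms of the dual basis expansion. The resulting formula is
  additive only modulo E', because \<open>L\<close> is. A genuinely additive map is recovered by
  using the formula on the generators \<open>frag_of p\<close> and extending freely; this is why the
  ambient group is free abelian.\<close>

lemma extension:
  fixes L :: "'k \<Rightarrow> 's \<Rightarrow> 'w \<Rightarrow> 'b::ab_group_add"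
  assumes E': "subgrp E'"
    and L: "\<And>a b s w. \<lbrakk>a \<in> carrier k; b \<in> carrier k; s \<in> S; w \<in> carrier \<Gamma>\<rbrakk> \<Longrightarrow>
      L (a \<oplus>\<^bsub>k\<^esub> b) s w - (L a s w + L b s w) \<in> E'"
  obtains \<phi> where "addv \<phi>" "\<And>x. x \<in> E \<Longrightarrow> \<phi> x \<in> E'"
    "\<And>x. \<phi> x - (\<Sum>(s, w)\<in>supp x. L (c x s w) s w) \<in> E'"
    "\<And>a v x. \<lbrakk>a \<in> carrier k; v \<in> carrier \<Gamma>\<rbrakk> \<Longrightarrow>
      \<phi> (op a v x) - (\<Sum>(s, w)\<in>supp x. L (a \<otimes>\<^bsub>k\<^esub> c x s w) s (v \<otimes>\<^bsub>\<Gamma>\<^esub> w)) \<in> E'"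
proof -
  note cc = dual_basisD(1)[OF db]
  define \<psi> where "\<psi> x A = (\<Sum>(s, w)\<in>A. L (c x s w) s w)" for x A
  have L0: "L \<zero>\<^bsub>k\<^esub> s w \<in> E'" if "s \<in> S" "w \<in> carrier \<Gamma>" for s w
    using L[of "\<zero>\<^bsub>k\<^esub>" "\<zero>\<^bsub>k\<^esub>" s w] that subgrp_minus[OF E'] by fastforce
  \<comment> \<open>Terms with coefficient zero contribute only elements of E', so several elements
    can be compared over one common index set.\<close>
  have enlarge: "\<psi> x A - \<psi> x (supp x) \<in> E'" if A: "finite A" "supp x \<subseteq> A" "A \<subseteq> S \<times> carrier \<Gamma>" for x A
  proof -
    have "\<psi> x A = \<psi> x (A - supp x) + \<psi> x (supp x)"
      unfolding \<psi>_def using A by (simp add: sum.subset_diff)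
    moreover have "\<psi> x (A - supp x) \<in> E'"
      unfolding \<psi>_def by (rule subgrp_sum[OF E']) (use A L0 in auto)
    ultimately show ?thesis by simp
  qed
  have add: "\<psi> (x + y) (supp (x + y)) - (\<psi> x (supp x) + \<psi> y (supp y)) \<in> E'" for x y
  proof -
    let ?A = "supp x \<union> supp y \<union> supp (x + y)"
    have fin: "finite ?A" using dual_basisD(2)[OF db] by auto
    have en: "\<psi> z ?A - \<psi> z (supp z) \<in> E'" if "z \<in> {x, y, x + y}" for z
      by (rule enlarge) (use fin that in auto)
    have "\<psi> (x + y) ?A - (\<Sum>(s, w)\<in>?A. L (c x s w) s w + L (c y s w) s w) \<in> E'"
      unfolding \<psi>_def
      by (rule subgrp_sum_cong[OF E']) (auto simp: dual_basisD(3)[OF db] intro!: L cc)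
    then have "\<psi> (x + y) ?A - (\<psi> x ?A + \<psi> y ?A) \<in> E'"
      unfolding \<psi>_def sum.distrib[symmetric] by (simp add: case_prod_beta)
    then have "\<psi> (x + y) ?A - (\<psi> x (supp x) + \<psi> y (supp y)) \<in> E'"
      using subgrp_trans[OF E' _ subgrp_add_cong[OF E' en[of x] en[of y]]] by simp
    then show ?thesis
      using subgrp_trans[OF E' subgrp_sym[OF E' en[of "x + y"]]] by blast
  qed
  obtain \<phi> :: "('p \<Rightarrow>\<^sub>0 int) \<Rightarrow> 'b" where \<phi>: "addv \<phi>"
      "\<And>p. \<phi> (frag_of p) = \<psi> (frag_of p) (supp (frag_of p))"
    by (rule addv_extension[where g = "\<lambda>p. \<psi> (frag_of p) (supp (frag_of p))"]) blast
  have main: "\<phi> x - \<psi> x (supp x) \<in> E'" for x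
  proof -
    have "Poly_Mapping.keys x \<subseteq> UNIV" by simp
    then show ?thesis
    proof (induction x rule: frag_induction)
      case zero
      have "\<psi> 0 (supp 0) \<in> E'" using add[of 0 0] subgrp_minus[OF E'] by fastforce
      then show ?case using subgrp_minus[OF E'] by (simp add: addv_zero[OF \<phi>(1)])
    next
      case (one p)
      then show ?case using \<phi>(2) subgrp_zero[OF E'] by simp
    next
      case (diff a b)
      have "\<psi> a (supp a) - (\<psi> (a - b) (supp (a - b)) + \<psi> b (supp b)) \<in> E'"
        using add[of "a - b" b] by simp
      then have "(\<phi> a - \<psi> a (supp a)) - (\<phi> b - \<psi> b (supp b)) +
          (\<psi> a (supp a) - (\<psi> (a - b) (supp (a - b)) + \<psi> b (supp b))) \<in> E'"
        using subgrp_add[OF E' subgrp_diff[OF E' diff]] by blast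
      then show ?case by (simp add: addv_diff[OF \<phi>(1)] algebra_simps)
    qed
  qed
  show ?thesis
  proof
    show "addv \<phi>" by (rule \<phi>)
    show "\<phi> x - (\<Sum>(s, w)\<in>supp x. L (c x s w) s w) \<in> E'" for x
      using main[of x] unfolding \<psi>_def .
    show "\<phi> x \<in> E'" if "x \<in> E" for x
    proof -
      have "supp x = {}" using dual_basisD(4)[OF db that] by auto
      from arg_cong[OF this, of "\<psi> x"] have "\<psi> x (supp x) = 0" by (simp add: \<psi>_def)
      then show ?thesis using main[of x] by simp
    qed
    fix a v x assume av: "a \<in> carrier k" "v \<in> carrier \<Gamma>"
    \<comment> \<open>Acting by v translates the group coordinate, so the support of the result lies
      in the translate of the support of x. It may be smaller, as a may annihilate
      coefficients.\<close>
    let ?g = "\<lambda>(s, w). (s, v \<otimes>\<^bsub>\<Gamma>\<^esub> w)"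
    have inj: "inj_on ?g (supp x)" using av by (auto simp: inj_on_def)
    have "supp (op a v x) \<subseteq> ?g ` supp x"
    proof clarify
      fix s w assume s: "s \<in> S" "w \<in> carrier \<Gamma>" "c (op a v x) s w \<noteq> \<zero>\<^bsub>k\<^esub>"
      have w: "w = v \<otimes>\<^bsub>\<Gamma>\<^esub> (inv\<^bsub>\<Gamma>\<^esub> v \<otimes>\<^bsub>\<Gamma>\<^esub> w)" using av s by (simp add: \<Gamma>.m_assoc[symmetric])
      have "c (op a v x) s w = a \<otimes>\<^bsub>k\<^esub> c x s (inv\<^bsub>\<Gamma>\<^esub> v \<otimes>\<^bsub>\<Gamma>\<^esub> w)"
        using dual_basisD(5)[OF db av s(1), of "inv\<^bsub>\<Gamma>\<^esub> v \<otimes>\<^bsub>\<Gamma>\<^esub> w" x] w av s by simp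
      then have "c x s (inv\<^bsub>\<Gamma>\<^esub> v \<otimes>\<^bsub>\<Gamma>\<^esub> w) \<noteq> \<zero>\<^bsub>k\<^esub>" using s av by auto
      then show "(s, w) \<in> ?g ` supp x" using w s av by (intro image_eqI[of _ _ "(s, inv\<^bsub>\<Gamma>\<^esub> v \<otimes>\<^bsub>\<Gamma>\<^esub> w)"]) auto
    qed
    then have A: "\<psi> (op a v x) (?g ` supp x) - \<psi> (op a v x) (supp (op a v x)) \<in> E'"
      by (intro enlarge) (use dual_basisD(2)[OF db] av in auto)
    have B: "\<psi> (op a v x) (?g ` supp x) =
        (\<Sum>(s, w)\<in>supp x. L (a \<otimes>\<^bsub>k\<^esub> c x s w) s (v \<otimes>\<^bsub>\<Gamma>\<^esub> w))"
      unfolding \<psi>_def sum.reindex[OF inj]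
      by (intro sum.cong refl) (use dual_basisD(5)[OF db av] in auto)
    show "\<phi> (op a v x) - (\<Sum>(s, w)\<in>supp x. L (a \<otimes>\<^bsub>k\<^esub> c x s w) s (v \<otimes>\<^bsub>\<Gamma>\<^esub> w)) \<in> E'"
      using subgrp_trans[OF E' main subgrp_sym[OF E' A]] unfolding B .
  qed
qed

text \<open>A module projective over the group ring of \<Gamma> stays projective over that of a
  subgroup H: representatives of the right cosets of H multiply the basis. The map e need not be
  onto, as it suffices that every value of h lies in its image modulo E3.\<close>

lemma lifting:
  fixes E2 :: "'b::ab_group_add set" and E3 :: "'c::ab_group_add set"
  assumes H: "subgroup H \<Gamma>"
    and M2: "kmod k \<Gamma> H E2 op2" and M3: "kmod k \<Gamma> H E3 op3"
    and e: "lin k H E2 op2 E3 op3 e" and h: "lin k H E op E3 op3 h"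
    and eh: "\<And>x. \<exists>y. h x - e y \<in> E3"
  obtains \<phi> where "lin k H E op E2 op2 \<phi>" "\<And>x. h x - e (\<phi> x) \<in> E3"
proof -
  interpret H: subgroup H \<Gamma> by (rule H)
  have HG: "H \<subseteq> carrier \<Gamma>" by (rule H.subset)
  note E2 = kmodD(1)[OF M2] and E3 = kmodD(1)[OF M3]
  note cc = dual_basisD(1)[OF db]
  \<comment> \<open>The chosen representative depends on the coset alone, so w = v w * t w with v w
    in H, and multiplication by H from the left changes only v.\<close>
  define t where "t w = (SOME t. t \<in> H #>\<^bsub>\<Gamma>\<^esub> w)" for w
  define v where "v w = w \<otimes>\<^bsub>\<Gamma>\<^esub> inv\<^bsub>\<Gamma>\<^esub> (t w)" for w
  have t: "t w \<in> H #>\<^bsub>\<Gamma>\<^esub> w" if "w \<in> carrier \<Gamma>" for w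
    unfolding t_def by (rule someI) (rule \<Gamma>.rcos_self[OF that H])
  then have tc: "t w \<in> carrier \<Gamma>" if "w \<in> carrier \<Gamma>" for w
    using that \<Gamma>.r_coset_subset_G[OF HG that] by blast
  have vH: "v w \<in> H" if w: "w \<in> carrier \<Gamma>" for w
  proof -
    obtain h0 where h0: "h0 \<in> H" "t w = h0 \<otimes>\<^bsub>\<Gamma>\<^esub> w" using t[OF w] by (auto simp: r_coset_def)
    then have "v w = inv\<^bsub>\<Gamma>\<^esub> h0"
      unfolding v_def h0(2) using w H.mem_carrier[OF h0(1)]
      by (simp add: \<Gamma>.inv_mult_group \<Gamma>.m_assoc[symmetric])
    then show ?thesis using h0 by simp
  qed
  have vt: "v w \<otimes>\<^bsub>\<Gamma>\<^esub> t w = w" if "w \<in> carrier \<Gamma>" for w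
    unfolding v_def using that tc[OF that] by (simp add: \<Gamma>.m_assoc)
  have th: "t (h0 \<otimes>\<^bsub>\<Gamma>\<^esub> w) = t w" "v (h0 \<otimes>\<^bsub>\<Gamma>\<^esub> w) = h0 \<otimes>\<^bsub>\<Gamma>\<^esub> v w" if "h0 \<in> H" "w \<in> carrier \<Gamma>" for h0 w
  proof -
    have h0: "h0 \<in> carrier \<Gamma>" using that by simp
    have "H #>\<^bsub>\<Gamma>\<^esub> (h0 \<otimes>\<^bsub>\<Gamma>\<^esub> w) = H #>\<^bsub>\<Gamma>\<^esub> w"
      using \<Gamma>.coset_mult_assoc[OF HG h0 that(2)] \<Gamma>.coset_join2[OF h0 H that(1)] by simp
    then show tt: "t (h0 \<otimes>\<^bsub>\<Gamma>\<^esub> w) = t w" by (simp add: t_def)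
    show "v (h0 \<otimes>\<^bsub>\<Gamma>\<^esub> w) = h0 \<otimes>\<^bsub>\<Gamma>\<^esub> v w"
      unfolding v_def tt using h0 that tc[OF that(2)] by (simp add: \<Gamma>.m_assoc)
  qed
  define l where "l s w = (SOME y. h (op \<one>\<^bsub>k\<^esub> w (u s)) - e y \<in> E3)" for s w
  have l: "h (op \<one>\<^bsub>k\<^esub> w (u s)) - e (l s w) \<in> E3" for s w
    unfolding l_def by (rule someI_ex) (rule eh)
  \<comment> \<open>Values are chosen freely at the coset representatives and transported by
    H-linearity along v w.\<close>
  define L where "L a s w = op2 a (v w) (l s (t w))" for a s w
  have LL: "L (a \<oplus>\<^bsub>k\<^esub> b) s w - (L a s w + L b s w) \<in> E2"
    if "a \<in> carrier k" "b \<in> carrier k" "s \<in> S" "w \<in> carrier \<Gamma>" for a b s w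
    unfolding L_def by (rule kmodD(4)[OF M2 that(1,2) vH[OF that(4)]])
  obtain \<phi> where \<phi>: "addv \<phi>" "\<And>x. x \<in> E \<Longrightarrow> \<phi> x \<in> E2"
    "\<And>x. \<phi> x - (\<Sum>(s, w)\<in>supp x. L (c x s w) s w) \<in> E2"
    "\<And>a v x. \<lbrakk>a \<in> carrier k; v \<in> carrier \<Gamma>\<rbrakk> \<Longrightarrow>
      \<phi> (op a v x) - (\<Sum>(s, w)\<in>supp x. L (a \<otimes>\<^bsub>k\<^esub> c x s w) s (v \<otimes>\<^bsub>\<Gamma>\<^esub> w)) \<in> E2"
    by (rule extension[of E2 L, OF E2 LL]) (assumption+, rule that)
  have "lin k H E op E2 op2 \<phi>"
    unfolding lin_def
  proof (intro conjI ballI allI)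
    fix a h0 x assume a: "a \<in> carrier k" "h0 \<in> H"
    have h0: "h0 \<in> carrier \<Gamma>" using a by simp
    have A: "(\<Sum>(s, w)\<in>supp x. L (a \<otimes>\<^bsub>k\<^esub> c x s w) s (h0 \<otimes>\<^bsub>\<Gamma>\<^esub> w)) -
        (\<Sum>(s, w)\<in>supp x. op2 a h0 (L (c x s w) s w)) \<in> E2"
    proof (rule subgrp_sum_cong[OF E2], clarify)
      fix s w assume s: "s \<in> S" "w \<in> carrier \<Gamma>"
      show "L (a \<otimes>\<^bsub>k\<^esub> c x s w) s (h0 \<otimes>\<^bsub>\<Gamma>\<^esub> w) - op2 a h0 (L (c x s w) s w) \<in> E2"
        unfolding L_def th[OF a(2) s(2)]
        by (rule subgrp_sym[OF E2 kmodD(5)[OF M2 a(1) cc[OF s] a(2) vH[OF s(2)]]])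
    qed
    have B: "(\<Sum>(s, w)\<in>supp x. op2 a h0 (L (c x s w) s w)) =
        op2 a h0 (\<Sum>(s, w)\<in>supp x. L (c x s w) s w)"
      by (simp add: addv_sum[OF kmodD(2)[OF M2 a]] case_prod_beta)
    have C: "op2 a h0 (\<phi> x) - op2 a h0 (\<Sum>(s, w)\<in>supp x. L (c x s w) s w) \<in> E2"
      by (rule kmod_cong_op[OF M2 a \<phi>(3)])
    show "\<phi> (op a h0 x) - op2 a h0 (\<phi> x) \<in> E2"
      by (rule subgrp_trans[OF E2 \<phi>(4)[OF a(1) h0] subgrp_trans[OF E2 A[unfolded B] subgrp_sym[OF E2 C]]])
  qed (use \<phi> in auto)
  moreover have "h x - e (\<phi> x) \<in> E3" for x
  proof -
    have A: "h x - h (\<Sum>(s, w)\<in>supp x. op (c x s w) w (u s)) \<in> E3"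
      by (rule lin_cong[OF h dual_basisD(6)[OF db]])
    have B: "h (\<Sum>(s, w)\<in>supp x. op (c x s w) w (u s)) = (\<Sum>(s, w)\<in>supp x. h (op (c x s w) w (u s)))"
      by (simp add: addv_sum[OF linD(1)[OF h]] case_prod_beta)
    have C: "e (\<Sum>(s, w)\<in>supp x. L (c x s w) s w) = (\<Sum>(s, w)\<in>supp x. e (L (c x s w) s w))"
      by (simp add: addv_sum[OF linD(1)[OF e]] case_prod_beta)
    have D: "(\<Sum>(s, w)\<in>supp x. h (op (c x s w) w (u s))) - (\<Sum>(s, w)\<in>supp x. e (L (c x s w) s w)) \<in> E3"
    proof (rule subgrp_sum_cong[OF E3], clarify)
      fix s w assume s: "s \<in> S" "w \<in> carrier \<Gamma>"
      let ?a = "c x s w"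
      have a: "?a \<in> carrier k" by (rule cc[OF s])
      have "op ?a (v w) (op \<one>\<^bsub>k\<^esub> (t w) (u s)) - op ?a w (u s) \<in> E"
        using kmodD(5)[OF kmod a k.one_closed, of "v w" "t w" "u s"] vH[OF s(2)] tc[OF s(2)] vt[OF s(2)] a by simp
      then have "h (op ?a w (u s)) - h (op ?a (v w) (op \<one>\<^bsub>k\<^esub> (t w) (u s))) \<in> E3"
        using lin_cong[OF h] subgrp_sym[OF E3] by blast
      moreover have "h (op ?a (v w) (op \<one>\<^bsub>k\<^esub> (t w) (u s))) - op3 ?a (v w) (h (op \<one>\<^bsub>k\<^esub> (t w) (u s))) \<in> E3"
        by (rule linD(3)[OF h a vH[OF s(2)]])
      moreover have "op3 ?a (v w) (h (op \<one>\<^bsub>k\<^esub> (t w) (u s))) - op3 ?a (v w) (e (l s (t w))) \<in> E3"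
        by (rule kmod_cong_op[OF M3 a vH[OF s(2)] l])
      moreover have "op3 ?a (v w) (e (l s (t w))) - e (L ?a s w) \<in> E3"
        unfolding L_def by (rule subgrp_sym[OF E3 linD(3)[OF e a vH[OF s(2)]]])
      ultimately show "h (op ?a w (u s)) - e (L ?a s w) \<in> E3" using subgrp_trans[OF E3] by blast
    qed
    have F: "e (\<phi> x) - e (\<Sum>(s, w)\<in>supp x. L (c x s w) s w) \<in> E3"
      by (rule lin_cong[OF e \<phi>(3)])
    show ?thesis
      by (rule subgrp_trans[OF E3 A[unfolded B] subgrp_trans[OF E3 D[folded C] subgrp_sym[OF E3 F]]])
  qed
  ultimately show ?thesis by (rule that)
qed

end

section \<open>Null homotopies and coinvariants\<close>

definition coinv :: "('k, 'y) ring_scheme \<Rightarrow> 'w set \<Rightarrow> 'a::ab_group_add set \<Rightarrow>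
    ('k \<Rightarrow> 'w \<Rightarrow> 'a \<Rightarrow> 'a) \<Rightarrow> 'a set" where
  "coinv k H E op = addspan (E \<union> {op \<one>\<^bsub>k\<^esub> w x - x | w x. w \<in> H})"

lemma subgrp_coinv: "subgrp (coinv k H E op)"
  by (simp add: coinv_def subgrp_addspan)

lemma coinv_incl: "x \<in> E \<Longrightarrow> x \<in> coinv k H E op"
  by (auto simp: coinv_def intro: addspan_incl)

lemma coinv_action: "w \<in> H \<Longrightarrow> op \<one>\<^bsub>k\<^esub> w x - x \<in> coinv k H E op"
  by (auto simp: coinv_def intro: addspan_incl)

lemma coinv_mono: "H \<subseteq> H' \<Longrightarrow> coinv k H E op \<subseteq> coinv k H' E op"
  unfolding coinv_def by (intro addspan_mono) auto

lemma addv_coinv: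
  assumes "addv f" "subgrp N" "\<And>x. x \<in> E \<Longrightarrow> f x \<in> N"
    "\<And>w x. w \<in> H \<Longrightarrow> f (op \<one>\<^bsub>k\<^esub> w x) - f x \<in> N" "x \<in> coinv k H E op"
  shows "f x \<in> N"
proof (rule addv_addspan[OF assms(1,2)])
  show "x \<in> addspan (E \<union> {op \<one>\<^bsub>k\<^esub> w x - x | w x. w \<in> H})"
    using assms(5) by (simp add: coinv_def)
qed (auto simp: addv_diff[OF assms(1)] intro: assms)

lemma lin_coinv:
  assumes h: "lin k H E op E' op' h" and k: "\<one>\<^bsub>k\<^esub> \<in> carrier k" and x: "x \<in> coinv k H E op"
  shows "h x \<in> coinv k H E' op'"
proof (rule addv_coinv[OF linD(1)[OF h] subgrp_coinv _ _ x])
  show "h x \<in> coinv k H E' op'" if "x \<in> E" for x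
    using linD(2)[OF h that] by (rule coinv_incl)
  show "h (op \<one>\<^bsub>k\<^esub> w x) - h x \<in> coinv k H E' op'" if "w \<in> H" for w x
    by (rule subgrp_trans[OF subgrp_coinv coinv_incl coinv_action]) (rule linD(3)[OF h k that], rule that)
qed

text \<open>The assumption \<open>lift\<close> is all that is used of projectivity. Thereby one
  argument serves both a restricted projective resolution and a mapping cone. Exactness is required
  in positive degrees only; the homology in degree 0 is left open.\<close>

locale kcomplex =
  fixes k :: "('k, 'y) ring_scheme" and \<Gamma> :: "('w, 'z) monoid_scheme" and H :: "'w set"
    and E :: "nat \<Rightarrow> 'a::ab_group_add set" and op :: "nat \<Rightarrow> 'k \<Rightarrow> 'w \<Rightarrow> 'a \<Rightarrow> 'a"
    and d :: "nat \<Rightarrow> 'a \<Rightarrow> 'a"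
  assumes k: "cring k"
    and kmod: "kmod k \<Gamma> H (E i) (op i)"
    and lin_d: "lin k H (E (Suc i)) (op (Suc i)) (E i) (op i) (d i)"
    and d_d: "d i (d (Suc i) x) \<in> E i"
    and exact: "d i x \<in> E i \<Longrightarrow> \<exists>y. x - d (Suc i) y \<in> E (Suc i)"
    and lift: "\<lbrakk>lin k H (E i) (op i) (E i) (op i) h; \<And>x. \<exists>y. h x - d i y \<in> E i\<rbrakk> \<Longrightarrow>
      \<exists>\<phi>. lin k H (E i) (op i) (E (Suc i)) (op (Suc i)) \<phi> \<and> (\<forall>x. h x - d i (\<phi> x) \<in> E i)"
begin

lemma E: "subgrp (E i)"
  by (rule kmodD(1)[OF kmod])

text \<open>A chain endomorphism that is zero on the homology in degree 0 is null-homotopic. Each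
  stage asserts only a pair of consecutive components of a homotopy, which is enough to continue the
  induction.\<close>

lemma null_homotopy:
  assumes h: "\<And>i. lin k H (E i) (op i) (E i) (op i) (h i)"
    and hd: "\<And>i x. d i (h (Suc i) x) - h i (d i x) \<in> E i"
    and h0: "\<And>x. \<exists>y. h 0 x - d 0 y \<in> E 0"
  shows "\<exists>s s'. lin k H (E i) (op i) (E (Suc i)) (op (Suc i)) s \<and>
    (i > 0 \<longrightarrow> lin k H (E (i - 1)) (op (i - 1)) (E i) (op i) s') \<and>
    (\<forall>x. h i x - d i (s x) - (if i = 0 then 0 else s' (d (i - 1) x)) \<in> E i)"
proof (induction i)
  case 0
  then show ?case using lift[OF h h0] by auto
next
  case (Suc i)
  then obtain s s' where s: "lin k H (E i) (op i) (E (Suc i)) (op (Suc i)) s"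
    and s': "i > 0 \<Longrightarrow> lin k H (E (i - 1)) (op (i - 1)) (E i) (op i) s'"
    and st: "\<And>x. h i x - d i (s x) - (if i = 0 then 0 else s' (d (i - 1) x)) \<in> E i"
    by blast
  let ?g = "\<lambda>x. h (Suc i) x - s (d i x)"
  have g: "lin k H (E (Suc i)) (op (Suc i)) (E (Suc i)) (op (Suc i)) ?g"
    by (rule lin_diff[OF h lin_comp[OF lin_d s E] kmod])
  have "\<exists>y. ?g x - d (Suc i) y \<in> E (Suc i)" for x
  proof (rule exact)
    have "(if i = 0 then 0 else s' (d (i - 1) (d i x))) \<in> E i"
    proof (cases i)
      case (Suc j)
      then show ?thesis using linD(2)[OF s', of "d (i - 1) (d i x)"] d_d[of j x] by simp
    qed (simp add: subgrp_zero[OF E])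
    from subgrp_add[OF E st[of "d i x"] this] have 1: "h i (d i x) - d i (s (d i x)) \<in> E i"
      by simp
    have "d i (?g x) = (d i (h (Suc i) x) - h i (d i x)) + (h i (d i x) - d i (s (d i x)))"
      by (simp add: addv_diff[OF linD(1)[OF lin_d]])
    then show "d i (?g x) \<in> E i" using subgrp_add[OF E hd[of i x] 1] by metis
  qed
  from lift[OF g this] obtain \<phi> where
    "lin k H (E (Suc i)) (op (Suc i)) (E (Suc (Suc i))) (op (Suc (Suc i))) \<phi>"
    "\<And>x. ?g x - d (Suc i) (\<phi> x) \<in> E (Suc i)" by blast
  then show ?case
    using s by (intro exI[of _ \<phi>] exI[of _ s]) (simp add: algebra_simps)
qed

text \<open>The homotopy is H-linear and so descends to coinvariants, where its second term vanishes
  on cycles.\<close>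

lemma null_on_coinv:
  assumes h: "\<And>i. lin k H (E i) (op i) (E i) (op i) (h i)"
    and hd: "\<And>i x. d i (h (Suc i) x) - h i (d i x) \<in> E i"
    and h0: "\<And>x. \<exists>y. h 0 x - d 0 y \<in> E 0"
    and x: "i > 0 \<Longrightarrow> d (i - 1) x \<in> coinv k H (E (i - 1)) (op (i - 1))"
  shows "\<exists>v. h i x - d i v \<in> coinv k H (E i) (op i)"
proof -
  obtain s s' where s': "i > 0 \<Longrightarrow> lin k H (E (i - 1)) (op (i - 1)) (E i) (op i) s'"
    and st: "h i x - d i (s x) - (if i = 0 then 0 else s' (d (i - 1) x)) \<in> E i"
    using null_homotopy[OF h hd h0, of i] by blast
  have "(if i = 0 then 0 else s' (d (i - 1) x)) \<in> coinv k H (E i) (op i)"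
    using lin_coinv[OF s' cring.cring_simprules(6)[OF k] x] by (auto simp: subgrp_zero[OF subgrp_coinv])
  from subgrp_add[OF subgrp_coinv coinv_incl[OF st] this]
  have "h i x - d i (s x) \<in> coinv k H (E i) (op i)" by simp
  then show ?thesis by blast
qed

end

section \<open>Comparison of resolutions\<close>

text \<open>The two sides are treated asymmetrically: the first complex has dual bases over H as a
  group of its own, the second over \<Gamma> and is only restricted to H. The assumptions
  \<open>surj0\<close> and \<open>inj0\<close> say that f is an isomorphism on homology in degree
  0.\<close>

locale resolution_comparison =
  fixes k :: "('k, 'y) ring_scheme" and \<Gamma> :: "('w, 'z) monoid_scheme" and H :: "'w set"
    and E :: "nat \<Rightarrow> ('p \<Rightarrow>\<^sub>0 int) set" and op :: "nat \<Rightarrow> 'k \<Rightarrow> 'w \<Rightarrow> ('p \<Rightarrow>\<^sub>0 int) \<Rightarrow> ('p \<Rightarrow>\<^sub>0 int)"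
    and d :: "nat \<Rightarrow> ('p \<Rightarrow>\<^sub>0 int) \<Rightarrow> ('p \<Rightarrow>\<^sub>0 int)"
    and S :: "nat \<Rightarrow> 's set" and u c
    and E' :: "nat \<Rightarrow> ('q \<Rightarrow>\<^sub>0 int) set" and op' :: "nat \<Rightarrow> 'k \<Rightarrow> 'w \<Rightarrow> ('q \<Rightarrow>\<^sub>0 int) \<Rightarrow> ('q \<Rightarrow>\<^sub>0 int)"
    and d' :: "nat \<Rightarrow> ('q \<Rightarrow>\<^sub>0 int) \<Rightarrow> ('q \<Rightarrow>\<^sub>0 int)"
    and S' :: "nat \<Rightarrow> 't set" and u' c'
    and f :: "nat \<Rightarrow> ('p \<Rightarrow>\<^sub>0 int) \<Rightarrow> ('q \<Rightarrow>\<^sub>0 int)"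
  assumes \<Gamma>: "group \<Gamma>" and H: "subgroup H \<Gamma>"
    and P: "kmod_dual_basis k (\<Gamma>\<lparr>carrier := H\<rparr>) (E i) (op i) (S i) (u i) (c i)"
    and Q: "kmod_dual_basis k \<Gamma> (E' i) (op' i) (S' i) (u' i) (c' i)"
    and lin_d: "lin k H (E (Suc i)) (op (Suc i)) (E i) (op i) (d i)"
    and lin_d': "lin k H (E' (Suc i)) (op' (Suc i)) (E' i) (op' i) (d' i)"
    and lin_f: "lin k H (E i) (op i) (E' i) (op' i) (f i)"
    and d_d: "d i (d (Suc i) x) \<in> E i" and d'_d': "d' i (d' (Suc i) y) \<in> E' i"
    and f_d: "f i (d i x) - d' i (f (Suc i) x) \<in> E' i"
    and exact: "d i x \<in> E i \<Longrightarrow> \<exists>w. x - d (Suc i) w \<in> E (Suc i)"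
    and exact': "d' i y \<in> E' i \<Longrightarrow> \<exists>w. y - d' (Suc i) w \<in> E' (Suc i)"
    and surj0: "\<exists>x v. y - f 0 x - d' 0 v \<in> E' 0"
    and inj0: "f 0 x + d' 0 v \<in> E' 0 \<Longrightarrow> \<exists>w. x - d 0 w \<in> E 0"
begin

lemma k: "cring k"
  using Q by (simp add: kmod_dual_basis_def)

lemma kmodP: "kmod k \<Gamma> H (E i) (op i)"
  using kmod_dual_basis.kmod[OF P[of i]] by (simp add: kmod_def)

lemma kmodQ: "kmod k \<Gamma> H (E' i) (op' i)"
  by (rule kmod_mono[OF kmod_dual_basis.kmod[OF Q]]) (rule subgroup.subset[OF H])

text \<open>The mapping cone has the first complex shifted by one. In degree 0 that component is
  divided out completely, which makes it the zero module.\<close>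

definition Ec :: "nat \<Rightarrow> (('p \<Rightarrow>\<^sub>0 int) \<times> ('q \<Rightarrow>\<^sub>0 int)) set" where
  "Ec i = (if i = 0 then UNIV else E (i - 1)) \<times> E' i"

definition opc :: "nat \<Rightarrow> 'k \<Rightarrow> 'w \<Rightarrow> ('p \<Rightarrow>\<^sub>0 int) \<times> ('q \<Rightarrow>\<^sub>0 int) \<Rightarrow> ('p \<Rightarrow>\<^sub>0 int) \<times> ('q \<Rightarrow>\<^sub>0 int)" where
  "opc i a w z = (op (i - 1) a w (fst z), op' i a w (snd z))"

definition dc :: "nat \<Rightarrow> ('p \<Rightarrow>\<^sub>0 int) \<times> ('q \<Rightarrow>\<^sub>0 int) \<Rightarrow> ('p \<Rightarrow>\<^sub>0 int) \<times> ('q \<Rightarrow>\<^sub>0 int)" where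
  "dc i z = (if i = 0 then 0 else - d (i - 1) (fst z), f i (fst z) + d' i (snd z))"

lemmas addv_d = linD(1)[OF lin_d] and addv_d' = linD(1)[OF lin_d'] and addv_f = linD(1)[OF lin_f]
lemmas subE = kmodD(1)[OF kmodP] and subE' = kmodD(1)[OF kmodQ]

lemma kmod_cone: "kmod k \<Gamma> H (Ec i) (opc i)"
proof -
  have "subgrp (Ec i)"
    using subE subE' by (auto simp: subgrp_def Ec_def zero_prod_def)
  moreover have "addv (opc i a w)" if "a \<in> carrier k" "w \<in> H" for a w
    by (rule addvI) (simp add: opc_def addv_add[OF kmodD(2)[OF kmodP that]] addv_add[OF kmodD(2)[OF kmodQ that]])
  moreover have "opc i a w z \<in> Ec i" if "a \<in> carrier k" "w \<in> H" "z \<in> Ec i" for a w z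
    using that kmodD(3)[OF kmodP] kmodD(3)[OF kmodQ] by (auto simp: Ec_def opc_def split: if_splits)
  moreover have "opc i (a \<oplus>\<^bsub>k\<^esub> b) w z - (opc i a w z + opc i b w z) \<in> Ec i"
    if "a \<in> carrier k" "b \<in> carrier k" "w \<in> H" for a b w z
    using kmodD(4)[OF kmodP that] kmodD(4)[OF kmodQ that] by (auto simp: Ec_def opc_def)
  moreover have "opc i a w (opc i b v z) - opc i (a \<otimes>\<^bsub>k\<^esub> b) (w \<otimes>\<^bsub>\<Gamma>\<^esub> v) z \<in> Ec i"
    if "a \<in> carrier k" "b \<in> carrier k" "w \<in> H" "v \<in> H" for a b w v z
    using kmodD(5)[OF kmodP that] kmodD(5)[OF kmodQ that] by (auto simp: Ec_def opc_def)
  moreover have "opc i \<one>\<^bsub>k\<^esub> \<one>\<^bsub>\<Gamma>\<^esub> z - z \<in> Ec i" for z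
    using kmodD(6)[OF kmodP] kmodD(6)[OF kmodQ] by (cases z) (auto simp: Ec_def opc_def)
  ultimately show ?thesis unfolding kmod_def by blast
qed

lemma lin_dc: "lin k H (Ec (Suc i)) (opc (Suc i)) (Ec i) (opc i) (dc i)"
  unfolding lin_def
proof (intro conjI ballI allI)
  show "addv (dc i)"
    by (rule addvI) (simp add: dc_def addv_add[OF addv_d] addv_add[OF addv_d'] addv_add[OF addv_f])
  show "dc i z \<in> Ec i" if z: "z \<in> Ec (Suc i)" for z
  proof -
    have "d (i - 1) (fst z) \<in> E (i - 1)" if "i > 0"
      using linD(2)[OF lin_d[of "i - 1"]] z that by (auto simp: Ec_def)
    moreover have "f i (fst z) + d' i (snd z) \<in> E' i"
      using z by (auto simp: Ec_def intro!: subgrp_add[OF subE'] linD(2)[OF lin_f] linD(2)[OF lin_d'])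
    ultimately show ?thesis by (auto simp: Ec_def dc_def intro: subgrp_minus[OF subE])
  qed
  show "dc i (opc (Suc i) a w z) - opc i a w (dc i z) \<in> Ec i"
    if aw: "a \<in> carrier k" "w \<in> H" for a w z
  proof -
    have "op (i - 1) a w (d (i - 1) (fst z)) - d (i - 1) (op i a w (fst z)) \<in> E (i - 1)" if "i > 0"
      using subgrp_sym[OF subE linD(3)[OF lin_d[of "i - 1"] aw]] that by auto
    moreover have "f i (op i a w (fst z)) + d' i (op' (Suc i) a w (snd z)) -
        (op' i a w (f i (fst z)) + op' i a w (d' i (snd z))) \<in> E' i"
      by (rule subgrp_add_cong[OF subE' linD(3)[OF lin_f aw] linD(3)[OF lin_d' aw]])
    ultimately show ?thesis
      by (auto simp: Ec_def dc_def opc_def addv_add[OF kmodD(2)[OF kmodQ aw]]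
          addv_minus[OF kmodD(2)[OF kmodP aw]] addv_zero[OF kmodD(2)[OF kmodP aw]])
  qed
qed

lemma dc_dc: "dc i (dc (Suc i) z) \<in> Ec i"
proof -
  have "d (i - 1) (d i (fst z)) \<in> E (i - 1)" if "i > 0"
    using d_d[of "i - 1" "fst z"] that by simp
  moreover have "- (f i (d i (fst z)) - d' i (f (Suc i) (fst z))) + d' i (d' (Suc i) (snd z)) \<in> E' i"
    by (rule subgrp_add[OF subE' subgrp_minus[OF subE' f_d] d'_d'])
  ultimately show ?thesis
    by (auto simp: Ec_def dc_def addv_minus[OF addv_f] addv_minus[OF addv_d] addv_add[OF addv_d'] algebra_simps)
qed

text \<open>If (x, y) is a cycle then x bounds some w, by exactness or, in degree 0, by
  \<open>inj0\<close>. Then y + f w is a cycle of the second complex and bounds as well.\<close>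

lemma cone_exact:
  assumes z: "dc i z \<in> Ec i" shows "\<exists>z'. z - dc (Suc i) z' \<in> Ec (Suc i)"
proof -
  obtain x y where xy: "z = (x, y)" by (cases z)
  have fd: "f i x + d' i y \<in> E' i" using z by (simp add: Ec_def dc_def xy)
  have "\<exists>w. x - d i w \<in> E i"
  proof (cases i)
    case 0
    then show ?thesis using inj0 fd by simp
  next
    case (Suc j)
    then have "- d j x \<in> E j" using z by (simp add: Ec_def dc_def xy)
    then have "d j x \<in> E j" using subgrp_minus[OF subE] by fastforce
    then show ?thesis using exact Suc by simp
  qed
  then obtain w where w: "x - d i w \<in> E i" by blast
  have "f i x - f i (d i w) \<in> E' i" by (rule lin_cong[OF lin_f w])
  then have "f i x - d' i (f (Suc i) w) \<in> E' i" using subgrp_trans[OF subE' _ f_d] by blast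
  from subgrp_diff[OF subE' fd this] have "d' i (y + f (Suc i) w) \<in> E' i"
    by (simp add: addv_add[OF addv_d'])
  then obtain v where v: "y + f (Suc i) w - d' (Suc i) v \<in> E' (Suc i)" using exact' by blast
  have "z - dc (Suc i) (- w, v) \<in> Ec (Suc i)"
    using w v by (simp add: Ec_def dc_def xy addv_minus[OF addv_d] addv_minus[OF addv_f] algebra_simps)
  then show ?thesis by blast
qed

text \<open>The two halves of the cone are lifted separately, since additivity splits every map on
  pairs. Both halves have the lifting property for H-linear maps, although for different
  reasons.\<close>

lemma cone_lift:
  assumes h: "lin k H (Ec i) (opc i) (Ec i) (opc i) h" and eh: "\<And>z. \<exists>y. h z - dc i y \<in> Ec i"
  shows "\<exists>\<phi>. lin k H (Ec i) (opc i) (Ec (Suc i)) (opc (Suc i)) \<phi> \<and> (\<forall>z. h z - dc i (\<phi> z) \<in> Ec i)"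
proof -
  note sub = kmodD(1)[OF kmod_cone]
  \<comment> \<open>For the first half H itself is the ambient group, so the coset argument in
    \<open>lifting\<close> is applied with H inside H.\<close>
  have H': "subgroup H (\<Gamma>\<lparr>carrier := H\<rparr>)"
    using group.subgroup_self[OF subgroup.subgroup_is_group[OF H \<Gamma>]] by simp
  have split: "h (x, y) = h (x, 0) + h (0, y)" for x y
    using addv_add[OF linD(1)[OF h], of "(x, 0)" "(0, y)"] by simp
  have h2: "lin k H (E' i) (op' i) (Ec i) (opc i) (\<lambda>y. h (0, y))"
    unfolding lin_def
  proof (intro conjI ballI allI)
    show "addv (\<lambda>y. h (0, y))"
      by (rule addvI) (simp flip: addv_add[OF linD(1)[OF h]])
    show "h (0, y) \<in> Ec i" if "y \<in> E' i" for y
      using that by (intro linD(2)[OF h]) (simp add: Ec_def subgrp_zero[OF subE])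
    show "h (0, op' i a w y) - opc i a w (h (0, y)) \<in> Ec i" if aw: "a \<in> carrier k" "w \<in> H" for a w y
      using linD(3)[OF h aw, of "(0, y)"] by (simp add: opc_def addv_zero[OF kmodD(2)[OF kmodP aw]])
  qed
  obtain \<phi>2 where \<phi>2: "lin k H (E' i) (op' i) (Ec (Suc i)) (opc (Suc i)) \<phi>2"
    "\<And>y. h (0, y) - dc i (\<phi>2 y) \<in> Ec i"
    by (rule kmod_dual_basis.lifting[OF Q H kmod_cone kmod_cone lin_dc h2 eh]) (rule that)
  have "\<exists>\<phi>1. addv \<phi>1 \<and> (\<forall>x\<in>(if i = 0 then UNIV else E (i - 1)). \<phi>1 x \<in> Ec (Suc i)) \<and>
      (\<forall>a\<in>carrier k. \<forall>w\<in>H. \<forall>x. \<phi>1 (op (i - 1) a w x) - opc (Suc i) a w (\<phi>1 x) \<in> Ec (Suc i)) \<and>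
      (\<forall>x. h (x, 0) - dc i (\<phi>1 x) \<in> Ec i)"
  proof (cases i)
    case 0
    have "opc (Suc i) a w 0 = 0" if "a \<in> carrier k" "w \<in> H" for a w
      using addv_zero[OF kmodD(2)[OF kmod_cone that]] .
    moreover have "h (x, 0) \<in> Ec i" for x
      by (rule linD(2)[OF h]) (simp add: Ec_def 0 subgrp_zero[OF subE'])
    ultimately show ?thesis
      by (intro exI[of _ "\<lambda>x. 0"]) (auto simp: addv_zero[OF linD(1)[OF lin_dc]]
          intro: subgrp_zero[OF sub] addvI)
  next
    case (Suc j)
    have h1: "lin k H (E j) (op j) (Ec i) (opc i) (\<lambda>x. h (x, 0))"
      unfolding lin_def
    proof (intro conjI ballI allI)
      show "addv (\<lambda>x. h (x, 0))"
        by (rule addvI) (simp flip: addv_add[OF linD(1)[OF h]])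
      show "h (x, 0) \<in> Ec i" if "x \<in> E j" for x
        using that Suc by (intro linD(2)[OF h]) (simp add: Ec_def subgrp_zero[OF subE'])
      show "h (op j a w x, 0) - opc i a w (h (x, 0)) \<in> Ec i" if aw: "a \<in> carrier k" "w \<in> H" for a w x
        using linD(3)[OF h aw, of "(x, 0)"] Suc by (simp add: opc_def addv_zero[OF kmodD(2)[OF kmodQ aw]])
    qed
    have M: "kmod k (\<Gamma>\<lparr>carrier := H\<rparr>) H (Ec i) (opc i)" for i
      using kmod_cone by (simp add: kmod_def)
    obtain \<phi>1 where "lin k H (E j) (op j) (Ec (Suc i)) (opc (Suc i)) \<phi>1"
      "\<And>x. h (x, 0) - dc i (\<phi>1 x) \<in> Ec i"
      by (rule kmod_dual_basis.lifting[OF P H' M M lin_dc h1 eh]) (rule that)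
    then show ?thesis using Suc by (intro exI[of _ \<phi>1]) (simp add: lin_def)
  qed
  then obtain \<phi>1 where \<phi>1: "addv \<phi>1"
      "\<And>x. x \<in> (if i = 0 then UNIV else E (i - 1)) \<Longrightarrow> \<phi>1 x \<in> Ec (Suc i)"
      "\<And>a w x. a \<in> carrier k \<Longrightarrow> w \<in> H \<Longrightarrow>
        \<phi>1 (op (i - 1) a w x) - opc (Suc i) a w (\<phi>1 x) \<in> Ec (Suc i)"
      "\<And>x. h (x, 0) - dc i (\<phi>1 x) \<in> Ec i"
    by blast
  let ?\<phi> = "\<lambda>z. \<phi>1 (fst z) + \<phi>2 (snd z)"
  have "lin k H (Ec i) (opc i) (Ec (Suc i)) (opc (Suc i)) ?\<phi>"
    unfolding lin_def
  proof (intro conjI ballI allI)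
    show "addv ?\<phi>"
      by (rule addvI) (simp add: addv_add[OF \<phi>1(1)] addv_add[OF linD(1)[OF \<phi>2(1)]])
    show "?\<phi> z \<in> Ec (Suc i)" if "z \<in> Ec i" for z
      using that by (intro subgrp_add[OF sub] \<phi>1(2) linD(2)[OF \<phi>2(1)]) (auto simp: Ec_def split: if_splits)
    show "?\<phi> (opc i a w z) - opc (Suc i) a w (?\<phi> z) \<in> Ec (Suc i)"
      if aw: "a \<in> carrier k" "w \<in> H" for a w z
      using subgrp_add_cong[OF sub \<phi>1(3)[OF aw] linD(3)[OF \<phi>2(1) aw]]
      by (simp add: opc_def[of i] addv_add[OF kmodD(2)[OF kmod_cone aw]])
  qed
  moreover have "h z - dc i (?\<phi> z) \<in> Ec i" for z
    using subgrp_add_cong[OF sub \<phi>1(4)[of "fst z"] \<phi>2(2)[of "snd z"]] split[of "fst z" "snd z"]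
    by (simp add: addv_add[OF linD(1)[OF lin_dc]])
  ultimately show ?thesis by blast
qed

lemma kcomplex_cone: "kcomplex k \<Gamma> H Ec opc dc"
  by (rule kcomplex.intro) (blast intro: k kmod_cone lin_dc dc_dc cone_exact cone_lift)+

abbreviation "NP i \<equiv> coinv k H (E i) (op i)"
abbreviation "NQ i \<equiv> coinv k H (E' i) (op' i)"

lemma one_k: "\<one>\<^bsub>k\<^esub> \<in> carrier k"
  using cring.cring_simprules(6)[OF k] .

lemma coinv_coneI:
  assumes H: "i > 0 \<Longrightarrow> x \<in> NP (i - 1)" and y: "y \<in> NQ i"
  shows "(x, y) \<in> coinv k H (Ec i) (opc i)"
proof -
  let ?C = "coinv k H (Ec i) (opc i)"
  have "(x, 0) \<in> ?C"
  proof (cases "i = 0")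
    case True
    then show ?thesis by (intro coinv_incl) (simp add: Ec_def subgrp_zero[OF subE'])
  next
    case False
    show ?thesis
    proof (rule addv_coinv[where f = "\<lambda>x. (x, 0)", OF _ subgrp_coinv])
      show "x \<in> NP (i - 1)" using H False by simp
      show "addv (\<lambda>x. (x, 0) :: _ \<times> ('q \<Rightarrow>\<^sub>0 int))" by (rule addvI) simp
      show "(x, 0) \<in> ?C" if "x \<in> E (i - 1)" for x
        using that False by (intro coinv_incl) (simp add: Ec_def subgrp_zero[OF subE'])
      show "(op (i - 1) \<one>\<^bsub>k\<^esub> w x, 0) - (x, 0) \<in> ?C" if "w \<in> H" for w x
        using coinv_action[where E = "Ec i" and op = "opc i" and k = k, OF that, of "(x, 0)"] that
        by (simp add: opc_def addv_zero[OF kmodD(2)[OF kmodQ one_k]])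
    qed
  qed
  moreover have "(0, y) \<in> ?C"
  proof (rule addv_coinv[where f = "\<lambda>y. (0, y)", OF _ subgrp_coinv _ _ y])
    show "addv (\<lambda>y. (0, y) :: ('p \<Rightarrow>\<^sub>0 int) \<times> _)" by (rule addvI) simp
    show "(0, y) \<in> ?C" if "y \<in> E' i" for y
      using that by (intro coinv_incl) (simp add: Ec_def subgrp_zero[OF subE])
    show "(0, op' i \<one>\<^bsub>k\<^esub> w y) - (0, y) \<in> ?C" if "w \<in> H" for w y
      using coinv_action[where E = "Ec i" and op = "opc i" and k = k, OF that, of "(0, y)"] that
      by (simp add: opc_def addv_zero[OF kmodD(2)[OF kmodP one_k]])
  qed
  ultimately have "(x, 0) + (0, y) \<in> ?C" using subgrp_add[OF subgrp_coinv] by blast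
  then show ?thesis by simp
qed

lemma coinv_coneD:
  assumes z: "z \<in> coinv k H (Ec i) (opc i)"
  shows "i > 0 \<Longrightarrow> fst z \<in> NP (i - 1)" and "snd z \<in> NQ i"
proof -
  show "fst z \<in> NP (i - 1)" if "i > 0"
    by (rule addv_coinv[OF _ subgrp_coinv _ _ z])
      (use that in \<open>auto simp: Ec_def opc_def intro: addvI coinv_incl coinv_action\<close>)
  show "snd z \<in> NQ i"
    by (rule addv_coinv[OF _ subgrp_coinv _ _ z])
      (auto simp: Ec_def opc_def intro: addvI coinv_incl coinv_action)
qed

text \<open>The identity of the cone is null-homotopic, so the cone stays exact after passing to
  coinvariants.\<close>

lemma cone_coinv_exact:
  assumes z: "i > 0 \<Longrightarrow> dc (i - 1) z \<in> coinv k H (Ec (i - 1)) (opc (i - 1))"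
  shows "\<exists>v. z - dc i v \<in> coinv k H (Ec i) (opc i)"
proof -
  interpret C: kcomplex k \<Gamma> H Ec opc dc by (rule kcomplex_cone)
  have "\<exists>v. (\<lambda>i z. z) i z - dc i v \<in> coinv k H (Ec i) (opc i)"
  proof (rule C.null_on_coinv[where h = "\<lambda>i z. z", OF _ _ _ z])
    show "lin k H (Ec i) (opc i) (Ec i) (opc i) (\<lambda>z. z)" for i
      by (auto simp: lin_def subgrp_zero[OF C.E] intro: addvI)
    show "dc i z - dc i z \<in> Ec i" for i z by (simp add: subgrp_zero[OF C.E])
    \<comment> \<open>The homology of the cone in degree 0 is the cokernel of f in degree 0, which
      \<open>surj0\<close> makes zero.\<close>
    show "\<exists>y. z - dc 0 y \<in> Ec 0" for z
    proof -
      obtain x v where "snd z - f 0 x - d' 0 v \<in> E' 0" using surj0 by blast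
      then have "z - dc 0 (x, v) \<in> Ec 0" by (cases z) (simp add: Ec_def dc_def algebra_simps)
      then show ?thesis by blast
    qed
  qed
  then show ?thesis .
qed

text \<open>The pair (x, -v) is a cycle of the cone of coinvariants precisely because f x is bounded
  by v. The first component of a bounding chain bounds x, up to the sign of the cone
  differential.\<close>

theorem comparison_inj:
  assumes x: "q > 0 \<Longrightarrow> d (q - 1) x \<in> NP (q - 1)" and fx: "f q x - d' q v \<in> NQ q"
  shows "\<exists>w. x - d q w \<in> NP q"
proof -
  have "dc q (x, - v) \<in> coinv k H (Ec q) (opc q)"
    using x fx by (auto simp: dc_def addv_minus[OF addv_d'] intro!: coinv_coneI subgrp_minus[OF subgrp_coinv])
  then obtain z where "(x, - v) - dc (Suc q) z \<in> coinv k H (Ec (Suc q)) (opc (Suc q))"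
    using cone_coinv_exact[of "Suc q" "(x, - v)"] by auto
  from coinv_coneD(1)[OF this] have "x - d q (- fst z) \<in> NP q"
    by (simp add: dc_def addv_minus[OF addv_d])
  then show ?thesis by blast
qed

text \<open>Here (0, y) is a cycle of the cone, and a bounding chain consists of a cycle x and a
  homology from f x to y.\<close>

theorem comparison_surj:
  assumes y: "q > 0 \<Longrightarrow> d' (q - 1) y \<in> NQ (q - 1)"
  shows "\<exists>x w. (q > 0 \<longrightarrow> d (q - 1) x \<in> NP (q - 1)) \<and> y - f q x - d' q w \<in> NQ q"
proof -
  have "dc (q - 1) (0, y) \<in> coinv k H (Ec (q - 1)) (opc (q - 1))" if "q > 0"
    using y that by (auto simp: dc_def addv_zero[OF addv_d] addv_zero[OF addv_f]
        intro!: coinv_coneI subgrp_zero[OF subgrp_coinv])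
  then obtain z where z: "(0, y) - dc q z \<in> coinv k H (Ec q) (opc q)"
    using cone_coinv_exact[of q "(0, y)"] by auto
  have "q > 0 \<longrightarrow> d (q - 1) (fst z) \<in> NP (q - 1)"
    using coinv_coneD(1)[OF z] by (simp add: dc_def)
  moreover have "y - f q (fst z) - d' q (snd z) \<in> NQ q"
    using coinv_coneD(2)[OF z] by (simp add: dc_def algebra_simps)
  ultimately show ?thesis by blast
qed

end

section \<open>The complex of injective words with labelled letters\<close>

lemma frag_extend_mem:
  assumes "subgrp N" "\<And>v. v \<in> Poly_Mapping.keys z \<Longrightarrow> f v \<in> N"
  shows "frag_extend f z \<in> N"
  using subset_refl[of "Poly_Mapping.keys z"] assms(2)
proof -
  have "Poly_Mapping.keys z \<subseteq> Poly_Mapping.keys z" by simp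
  then show ?thesis
    by (induction z rule: frag_induction)
      (use assms in \<open>auto simp: frag_extend_diff subgrp_zero intro: subgrp_diff\<close>)
qed

lemma subgrp_keys: "subgrp {z :: 'p \<Rightarrow>\<^sub>0 int. Poly_Mapping.keys z \<subseteq> A}"
  using keys_diff by (fastforce simp: subgrp_def)

lemma frag_extend_compose:
  "addv h \<Longrightarrow> h (frag_extend f z) = frag_extend (\<lambda>v. h (f v)) z"
proof -
  assume h: "addv h"
  have "Poly_Mapping.keys z \<subseteq> UNIV" by simp
  then show ?thesis
    by (induction z rule: frag_induction) (simp_all add: frag_extend_diff addv_zero[OF h] addv_diff[OF h])
qed

lemma addv_frag_expansion: "addv h \<Longrightarrow> h z = frag_extend (\<lambda>v. h (frag_of v)) z"
  using frag_extend_compose[of h frag_of z] by (simp flip: frag_expansion)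

lemma frag_cmul_diff2: "frag_cmul c (a - b) = frag_cmul c a - frag_cmul c b"
  using frag_cmul_distrib2[of c "a - b" b] by simp

lemma frag_cmul_mem: "subgrp N \<Longrightarrow> z \<in> N \<Longrightarrow> frag_cmul n z \<in> N"
  by (rule frag_closure_minus_cmul[where P = "\<lambda>z. z \<in> N"]) (auto intro: subgrp_zero subgrp_diff)

section \<open>Faces and boundary of words\<close>

definition del :: "nat \<Rightarrow> 'l list \<Rightarrow> 'l list" where
  "del j v = take j v @ drop (Suc j) v"

definition word_diff :: "'l list \<Rightarrow> ('l list \<Rightarrow>\<^sub>0 int)" where
  "word_diff v = (\<Sum>j<length v. frag_cmul ((-1) ^ j) (frag_of (del j v)))"

definition bd :: "('l list \<Rightarrow>\<^sub>0 int) \<Rightarrow> ('l list \<Rightarrow>\<^sub>0 int)" where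
  "bd = frag_extend word_diff"

definition pre :: "'l list \<Rightarrow> ('l list \<Rightarrow>\<^sub>0 int) \<Rightarrow> ('l list \<Rightarrow>\<^sub>0 int)" where
  "pre u = frag_extend (\<lambda>v. frag_of (u @ v))"

lemma addv_bd: "addv bd" and addv_pre: "addv (pre u)"
  by (simp_all add: bd_def pre_def addv_frag_extend)

lemma bd_of [simp]: "bd (frag_of v) = word_diff v" and pre_of [simp]: "pre u (frag_of v) = frag_of (u @ v)"
  by (simp_all add: bd_def pre_def)

lemma length_del: "j < length v \<Longrightarrow> length (del j v) = length v - 1"
  by (simp add: del_def)

lemma del_0: "del 0 (x # v) = v"
  by (simp add: del_def)

lemma del_append_ge: "del (length p + j) (p @ w) = p @ del j w"
  by (simp add: del_def)

lemma del_append_less: "j < length p \<Longrightarrow> del j (p @ w) = del j p @ w"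
  by (simp add: del_def)

lemma pre_cmul: "pre u (frag_cmul n z) = frag_cmul n (pre u z)"
  by (simp add: pre_def frag_extend_cmul)

lemma bd_cmul: "bd (frag_cmul n z) = frag_cmul n (bd z)"
  by (simp add: bd_def frag_extend_cmul)

lemma word_diff_Nil [simp]: "word_diff [] = 0"
  by (simp add: word_diff_def)

lemma sum_lessThan_add:
  fixes f :: "nat \<Rightarrow> 'a::comm_monoid_add"
  shows "(\<Sum>j<m + n. f j) = (\<Sum>j<m. f j) + (\<Sum>j<n. f (m + j))"
  by (induction n) (simp_all add: add.assoc)

text \<open>Deletions in the prefix and deletions in the remainder are separated; passing the prefix
  costs the sign given by its length.\<close>

lemma word_diff_append:
  "word_diff (p @ w) = (\<Sum>j<length p. frag_cmul ((-1) ^ j) (frag_of (del j p @ w))) +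
    frag_cmul ((-1) ^ length p) (pre p (word_diff w))"
proof -
  have "word_diff (p @ w) = (\<Sum>j<length p + length w. frag_cmul ((-1) ^ j) (frag_of (del j (p @ w))))"
    by (simp add: word_diff_def)
  also have "\<dots> = (\<Sum>j<length p. frag_cmul ((-1) ^ j) (frag_of (del j (p @ w)))) +
      (\<Sum>j<length w. frag_cmul ((-1) ^ (length p + j)) (frag_of (del (length p + j) (p @ w))))"
    by (rule sum_lessThan_add)
  also have "(\<Sum>j<length p. frag_cmul ((-1) ^ j) (frag_of (del j (p @ w)))) =
      (\<Sum>j<length p. frag_cmul ((-1) ^ j) (frag_of (del j p @ w)))"
    by (intro sum.cong refl) (simp add: del_append_less)
  also have "(\<Sum>j<length w. frag_cmul ((-1) ^ (length p + j)) (frag_of (del (length p + j) (p @ w)))) =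
      frag_cmul ((-1) ^ length p) (pre p (word_diff w))"
    by (simp add: del_append_ge word_diff_def addv_sum[OF addv_pre] pre_cmul frag_cmul_sum power_add)
  finally show ?thesis .
qed

lemma word_diff_Cons: "word_diff (x # v) = frag_of v - pre [x] (word_diff v)"
  using word_diff_append[of "[x]" v] by (simp add: del_0)

text \<open>Prefixing a fixed letter contracts the complex of all words. For injective words it is
  available only where the letter does not occur, and this is the whole difficulty of
  exactness.\<close>

lemma bd_pre_Cons: "bd (pre [x] z) = z - pre [x] (bd z)"
proof -
  have "Poly_Mapping.keys z \<subseteq> UNIV" by simp
  then show ?thesis
    by (induction z rule: frag_induction)
      (simp_all add: addv_zero[OF addv_bd] addv_zero[OF addv_pre] addv_diff[OF addv_bd] addv_diff[OF addv_pre]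
        word_diff_Cons)
qed

lemma bd_word_diff: "bd (word_diff v) = 0"
  by (induction v) (simp_all add: addv_zero[OF addv_bd] addv_diff[OF addv_bd] word_diff_Cons bd_pre_Cons
      addv_zero[OF addv_pre])

lemma bd_bd: "bd (bd z) = 0"
proof -
  have "Poly_Mapping.keys z \<subseteq> UNIV" by simp
  then show ?thesis
    by (induction z rule: frag_induction) (simp_all add: addv_zero[OF addv_bd] addv_diff[OF addv_bd] bd_word_diff)
qed

definition inj_words :: "'g set \<Rightarrow> nat set \<Rightarrow> nat \<Rightarrow> (nat \<times> 'g) list set" where
  "inj_words A B l = {v. length v = l \<and> distinct (map fst v) \<and> set v \<subseteq> B \<times> A}"

definition chains :: "'g set \<Rightarrow> nat set \<Rightarrow> nat \<Rightarrow> ((nat \<times> 'g) list \<Rightarrow>\<^sub>0 int) set" where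
  "chains A B l = {z. Poly_Mapping.keys z \<subseteq> inj_words A B l}"

lemma subgrp_chains: "subgrp (chains A B l)"
  unfolding chains_def by (rule subgrp_keys)

lemma chain_of: "v \<in> inj_words A B l \<Longrightarrow> frag_of v \<in> chains A B l"
  by (simp add: chains_def)

lemma del_split:
  assumes "j < length v" obtains a x b where "v = a @ x # b" "length a = j" "del j v = a @ b"
  using that[of "take j v" "v ! j" "drop (Suc j) v"] assms by (simp add: del_def id_take_nth_drop[symmetric])

lemma del_inj_words: "v \<in> inj_words A B (Suc l) \<Longrightarrow> j < Suc l \<Longrightarrow> del j v \<in> inj_words A B l"
proof -
  assume v: "v \<in> inj_words A B (Suc l)" "j < Suc l"
  then have "j < length v" by (simp add: inj_words_def)
  then obtain a x b where "v = a @ x # b" "length a = j" "del j v = a @ b"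
    by (rule del_split)
  then show ?thesis using v by (auto simp: inj_words_def)
qed

lemma word_diff_chain: "v \<in> inj_words A B (Suc l) \<Longrightarrow> word_diff v \<in> chains A B l"
  unfolding word_diff_def
  by (intro subgrp_sum[OF subgrp_chains] frag_cmul_mem[OF subgrp_chains] chain_of del_inj_words)
    (auto simp: inj_words_def)

lemma bd_chain: "z \<in> chains A B (Suc l) \<Longrightarrow> bd z \<in> chains A B l"
  unfolding bd_def
  by (rule frag_extend_mem[OF subgrp_chains], rule word_diff_chain) (auto simp: chains_def)

text \<open>This reads off the part of a chain carried by words with prefix p, with the prefix
  removed; \<open>pre p\<close> puts the prefix back.\<close>

definition strip :: "'l list \<Rightarrow> ('l list \<Rightarrow>\<^sub>0 int) \<Rightarrow> ('l list \<Rightarrow>\<^sub>0 int)" where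
  "strip p = frag_extend (\<lambda>v. if take (length p) v = p then frag_of (drop (length p) v) else 0)"

lemma addv_strip: "addv (strip p)"
  by (simp add: strip_def addv_frag_extend)

lemma strip_of: "strip p (frag_of v) = (if take (length p) v = p then frag_of (drop (length p) v) else 0)"
  by (simp add: strip_def)

text \<open>These sets filter the words by the position of the letter b; b does not occur at all in
  the words of \<open>low b 0\<close>.\<close>

definition low :: "nat \<Rightarrow> nat \<Rightarrow> (nat \<times> 'g) list set" where
  "low b s = {v. \<forall>i<length v. fst (v ! i) = b \<longrightarrow> i < s}"

text \<open>Deleting a letter at position at most s moves the letter at position s+1 to position s.
  That letter is not b, because b occurs only up to position s, so the prefix p, which has b there,
  is lost. Only deletions behind the prefix remain visible.\<close>

lemma strip_del:
  assumes v: "v \<in> inj_words A B l" "v \<in> low b (Suc s)" and j: "j < length v"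
    and p: "length p = Suc s" "fst (p ! s) = b"
  shows "strip p (frag_of (del j v)) =
    (if take (Suc s) v = p \<and> s < j then frag_of (del (j - Suc s) (drop (Suc s) v)) else 0)"
proof (cases "take (Suc s) v = p \<and> s < j")
  case True
  then have "v = p @ drop (Suc s) v" by (metis append_take_drop_id)
  moreover have "del (length p + (j - Suc s)) (p @ drop (Suc s) v) = p @ del (j - Suc s) (drop (Suc s) v)"
    by (rule del_append_ge)
  ultimately have "del j v = p @ del (j - Suc s) (drop (Suc s) v)" using True p by simp
  then show ?thesis using True p by (simp add: strip_of)
next
  case False
  have "take (Suc s) (del j v) \<noteq> p"
  proof
    assume t: "take (Suc s) (del j v) = p"
    have len: "Suc s \<le> length (del j v)" using t p by (metis length_take min.cobounded1 min_def)
    have ds: "fst (del j v ! s) = b" using t p by (metis lessI nth_take)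
    have l2: "Suc s < length v" using len j by (simp add: length_del)
    show False
    proof (cases "j \<le> s")
      case True
      then have "del j v ! s = v ! Suc s" using l2 j by (simp add: del_def nth_append)
      then show False using ds v(2) l2 by (auto simp: low_def)
    next
      case False': False
      then have "take (Suc s) (del j v) = take (Suc s) v" by (simp add: del_def min_def)
      then show False using False False' t by simp
    qed
  qed
  then show ?thesis using False p by (auto simp: strip_of)
qed

text \<open>Stripping is therefore a chain map up to sign, and the stripped part of a cycle is again
  a cycle.\<close>

lemma strip_word_diff:
  assumes v: "v \<in> inj_words A B l" "v \<in> low b (Suc s)" and p: "length p = Suc s" "fst (p ! s) = b"
  shows "strip p (word_diff v) = frag_cmul ((-1) ^ Suc s) (bd (strip p (frag_of v)))"
proof -
  have eq: "strip p (word_diff v) = (\<Sum>j<length v. frag_cmul ((-1) ^ j)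
      (if take (Suc s) v = p \<and> s < j then frag_of (del (j - Suc s) (drop (Suc s) v)) else 0))"
    unfolding word_diff_def addv_sum[OF addv_strip]
  proof (intro sum.cong refl)
    fix j assume "j \<in> {..<length v}"
    then show "strip p (frag_cmul ((-1) ^ j) (frag_of (del j v))) = frag_cmul ((-1) ^ j)
      (if take (Suc s) v = p \<and> s < j then frag_of (del (j - Suc s) (drop (Suc s) v)) else 0)"
      using strip_del[OF v _ p, of j] by (simp add: strip_def frag_extend_cmul)
  qed
  show ?thesis
  proof (cases "take (Suc s) v = p")
    case False
    then show ?thesis unfolding eq by (simp add: strip_of p addv_zero[OF addv_bd])
  next
    case True
    define w where "w = drop (Suc s) v"
    have vw: "v = p @ w" using append_take_drop_id[of "Suc s" v] True by (simp add: w_def)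
    have "strip p (word_diff v) = (\<Sum>j<Suc s + length w. frag_cmul ((-1) ^ j)
      (if s < j then frag_of (del (j - Suc s) w) else 0))"
      unfolding eq w_def[symmetric] using True vw p(1) by (simp add: length_append)
    also have "\<dots> = (\<Sum>j<length w. frag_cmul ((-1) ^ (Suc s + j)) (frag_of (del j w)))"
      unfolding sum_lessThan_add by simp
    also have "\<dots> = frag_cmul ((-1) ^ Suc s) (word_diff w)"
      by (simp add: word_diff_def frag_cmul_sum power_add)
    finally show ?thesis using vw p by (simp add: strip_of)
  qed
qed

text \<open>Deleting a letter of p removes b or shifts it to a position below s, and b does not
  occur in y. Modulo lower words the boundary therefore acts on y alone.\<close>

lemma bd_pre_low:
  assumes p: "length p = Suc s" "distinct (map fst p)" "fst (p ! s) = b"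
    and y: "\<And>v. v \<in> Poly_Mapping.keys y \<Longrightarrow> b \<notin> fst ` set v"
  shows "bd (pre p y) - frag_cmul ((-1) ^ Suc s) (pre p (bd y)) \<in> {z. Poly_Mapping.keys z \<subseteq> low b s}"
proof -
  let ?L = "{z. Poly_Mapping.keys z \<subseteq> low b s}"
  let ?h = "\<lambda>y. bd (pre p y) - frag_cmul ((-1) ^ Suc s) (pre p (bd y))"
  have h: "addv ?h"
    by (rule addvI) (simp add: addv_add[OF addv_bd] addv_add[OF addv_pre] frag_cmul_distrib2)
  have "?h y = frag_extend (\<lambda>v. ?h (frag_of v)) y"
    by (rule addv_frag_expansion[OF h])
  moreover have "?h (frag_of v) \<in> ?L" if v: "v \<in> Poly_Mapping.keys y" for v
  proof -
    have "?h (frag_of v) = (\<Sum>j<Suc s. frag_cmul ((-1) ^ j) (frag_of (del j p @ v)))"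
      using word_diff_append[of p v] p by simp
    moreover have "frag_of (del j p @ v) \<in> ?L" if j: "j < Suc s" for j
    proof -
      have bv: "fst x \<noteq> b" if "x \<in> set v" for x using y[OF v] that by auto
      have "i < s" if i: "i < length (del j p @ v)" "fst ((del j p @ v) ! i) = b" for i
      proof (rule ccontr)
        assume "\<not> i < s"
        then have "(del j p @ v) ! i = v ! (i - s)" "i - s < length v"
          using i(1) p j by (auto simp: nth_append length_del)
        then show False using bv i(2) nth_mem by metis
      qed
      then show ?thesis by (auto simp: low_def)
    qed
    ultimately show ?thesis
      by (simp only:) (intro subgrp_sum[OF subgrp_keys] frag_cmul_mem[OF subgrp_keys], simp)
  qed
  ultimately show ?thesis by (simp only:) (rule frag_extend_mem[OF subgrp_keys])
qed

lemma pre_chain: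
  assumes p: "p \<in> inj_words A B l" and y: "y \<in> chains A (B - fst ` set p) l'"
  shows "pre p y \<in> chains A B (l + l')"
  unfolding pre_def
proof (rule frag_extend_mem[OF subgrp_chains])
  fix v assume "v \<in> Poly_Mapping.keys y"
  then have "v \<in> inj_words A (B - fst ` set p) l'" using y by (auto simp: chains_def)
  then have "p @ v \<in> inj_words A B (l + l')" using p by (force simp: inj_words_def)
  then show "frag_of (p @ v) \<in> chains A B (l + l')" by (rule chain_of)
qed

lemma strip_chain:
  assumes z: "z \<in> chains A B (l + l')" and p: "length p = l"
  shows "strip p z \<in> chains A (B - fst ` set p) l'"
  unfolding strip_def
proof (rule frag_extend_mem[OF subgrp_chains])
  fix v assume "v \<in> Poly_Mapping.keys z"
  then have v: "v \<in> inj_words A B (l + l')" using z by (auto simp: chains_def)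
  show "(if take (length p) v = p then frag_of (drop (length p) v) else 0) \<in> chains A (B - fst ` set p) l'"
  proof (cases "take (length p) v = p")
    case True
    then obtain w where "v = p @ w" by (metis append_take_drop_id)
    moreover from this have "w \<in> inj_words A (B - fst ` set p) l'"
      using v p by (force simp: inj_words_def)
    ultimately show ?thesis by (simp add: chain_of)
  qed (simp add: subgrp_zero[OF subgrp_chains])
qed

text \<open>Removing the highest position at which \<open>b\<close> occurs: the words with a fixed prefix ending in \<open>b\<close>
  at this position form a cycle on a smaller alphabet.\<close>

lemma push_down:
  assumes fin: "finite B" and b: "b \<in> B" and l: "l < card B"
    and IH: "\<And>B' l' z. \<lbrakk>finite B'; card B' < card B; l' < card B'; z \<in> chains A B' l'; bd z = 0\<rbrakk>
      \<Longrightarrow> \<exists>y\<in>chains A B' (Suc l'). bd y = z"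
    and z: "z \<in> chains A B l" "bd z = 0" "Poly_Mapping.keys z \<subseteq> low b (Suc s)"
  shows "\<exists>y\<in>chains A B (Suc l). Poly_Mapping.keys (z - bd y) \<subseteq> low b s"
proof (cases "Suc s \<le> l")
  case False
  have "v \<in> low b s" if "v \<in> Poly_Mapping.keys z" for v
    using that False z(1,3) by (force simp: chains_def inj_words_def low_def)
  then show ?thesis by (intro bexI[of _ 0]) (auto simp: addv_zero[OF addv_bd] subgrp_zero[OF subgrp_chains])
next
  case True
  define l' where "l' = l - Suc s"
  have ll: "l = Suc s + l'" using True by (simp add: l'_def)
  \<comment> \<open>These are the prefixes of the words in z that have b exactly at position s;
    there are finitely many.\<close>
  define PP where "PP = take (Suc s) ` (Poly_Mapping.keys z - low b s)"
  have finPP: "finite PP" by (simp add: PP_def)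
  have word: "v \<in> inj_words A B l" if "v \<in> Poly_Mapping.keys z" for v using that z(1) by (auto simp: chains_def)
  have PP: "p \<in> inj_words A B (Suc s)" "fst (p ! s) = b" if p: "p \<in> PP" for p
  proof -
    obtain v where v: "v \<in> Poly_Mapping.keys z" "v \<notin> low b s" "p = take (Suc s) v" using p by (auto simp: PP_def)
    have w: "v \<in> inj_words A B l" by (rule word[OF v(1)])
    show "p \<in> inj_words A B (Suc s)"
      using w True v(3) by (auto simp: inj_words_def take_map[symmetric] dest: in_set_takeD)
    obtain i where i: "i < length v" "fst (v ! i) = b" "\<not> i < s" using v(2) by (auto simp: low_def)
    moreover have "i < Suc s" using v(1) z(3) i by (auto simp: low_def)
    ultimately show "fst (p ! s) = b" using v(3) by (metis le_less_Suc_eq lessI not_less nth_take)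
  qed
  have "\<exists>y\<in>chains A (B - fst ` set p) (Suc l'). bd y = strip p z" if p: "p \<in> PP" for p
  proof (rule IH)
    note pw = PP[OF p]
    have sub: "fst ` set p \<subseteq> B" and c: "card (fst ` set p) = Suc s" and lp: "length p = Suc s"
      using pw(1) distinct_card[of "map fst p"] by (auto simp: inj_words_def)
    \<comment> \<open>The prefix uses up s+1 letters of the alphabet and s+1 letters of the word, so
      the strict inequality between length and size of the alphabet persists.\<close>
    have "card (B - fst ` set p) = card B - Suc s"
      using card_Diff_subset[of "fst ` set p" B] sub c by simp
    then show "card (B - fst ` set p) < card B" "l' < card (B - fst ` set p)" using l ll by auto
    show "strip p z \<in> chains A (B - fst ` set p) l'" using strip_chain[of z A B "Suc s" l' p] z(1) ll lp by simp
    have "strip p (bd z) = frag_extend (\<lambda>v. strip p (word_diff v)) z"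
      unfolding bd_def by (rule frag_extend_compose[OF addv_strip])
    also have "\<dots> = frag_extend (\<lambda>v. frag_cmul ((-1) ^ Suc s) (bd (strip p (frag_of v)))) z"
    proof (rule frag_extend_eq)
      fix v assume v: "v \<in> Poly_Mapping.keys z"
      show "strip p (word_diff v) = frag_cmul ((-1) ^ Suc s) (bd (strip p (frag_of v)))"
        using strip_word_diff[OF word[OF v] _ lp pw(2)] z(3) v by auto
    qed
    also have "\<dots> = frag_cmul ((-1) ^ Suc s) (bd (strip p z))"
    proof -
      have "addv (\<lambda>z. frag_cmul ((-1) ^ Suc s) (bd (strip p z)))"
        by (rule addvI) (simp add: addv_add[OF addv_bd] addv_add[OF addv_strip] frag_cmul_distrib2)
      from addv_frag_expansion[OF this, of z] show ?thesis by simp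
    qed
    finally show "bd (strip p z) = 0" using z(2) by (simp add: addv_zero[OF addv_strip])
  qed (use fin in simp)
  then obtain y where y: "\<And>p. p \<in> PP \<Longrightarrow> y p \<in> chains A (B - fst ` set p) (Suc l')"
      "\<And>p. p \<in> PP \<Longrightarrow> bd (y p) = strip p z" by metis
  \<comment> \<open>The sign cancels the one produced by moving the boundary past a prefix of length
    s+1.\<close>
  define Y where "Y = (\<Sum>p\<in>PP. frag_cmul ((-1) ^ Suc s) (pre p (y p)))"
  let ?L = "{z :: (nat \<times> 'a) list \<Rightarrow>\<^sub>0 int. Poly_Mapping.keys z \<subseteq> low b s}"
  have "Y \<in> chains A B (Suc l)"
    unfolding Y_def
  proof (intro subgrp_sum[OF subgrp_chains] frag_cmul_mem[OF subgrp_chains])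
    show "pre p (y p) \<in> chains A B (Suc l)" if "p \<in> PP" for p
      using pre_chain[OF PP(1)[OF that] y(1)[OF that]] ll by simp
  qed
  moreover have "z - bd Y \<in> ?L"
  proof -
    have 1: "bd Y - (\<Sum>p\<in>PP. pre p (strip p z)) \<in> ?L"
      unfolding Y_def addv_sum[OF addv_bd]
    proof (rule subgrp_sum_cong[OF subgrp_keys])
      fix p assume p: "p \<in> PP"
      have bp: "b \<in> fst ` set p" using PP[OF p] by (auto simp: inj_words_def intro!: image_eqI[of _ _ "p ! s"])
      have "bd (pre p (y p)) - frag_cmul ((-1) ^ Suc s) (pre p (bd (y p))) \<in> ?L"
      proof (rule bd_pre_low)
        show "b \<notin> fst ` set v" if "v \<in> Poly_Mapping.keys (y p)" for v
          using y(1)[OF p] that bp by (force simp: chains_def inj_words_def)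
      qed (use PP[OF p] in \<open>auto simp: inj_words_def\<close>)
      from frag_cmul_mem[OF subgrp_keys this, of "(-1) ^ Suc s"]
      have "frag_cmul ((-1) ^ Suc s) (bd (pre p (y p))) - pre p (bd (y p)) \<in> ?L"
        by (simp add: frag_cmul_diff2 flip: power_mult_distrib)
      then show "bd (frag_cmul ((-1) ^ Suc s) (pre p (y p))) - pre p (strip p z) \<in> ?L"
        by (simp add: bd_cmul y(2)[OF p])
    qed
    \<comment> \<open>Subtracting the parts with the prefixes in \<open>PP\<close> from z removes
      exactly the words having b at position s.\<close>
    let ?h = "\<lambda>z. z - (\<Sum>p\<in>PP. pre p (strip p z))"
    have h: "addv ?h"
      by (rule addvI) (simp add: addv_add[OF addv_pre] addv_add[OF addv_strip] sum.distrib)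
    have "?h (frag_of v) \<in> ?L" if v: "v \<in> Poly_Mapping.keys z" for v
    proof -
      have st: "pre p (strip p (frag_of v)) = (if take (Suc s) v = p then frag_of v else 0)" if "p \<in> PP" for p
        using PP(1)[OF that] append_take_drop_id[of "Suc s" v]
        by (auto simp: strip_of inj_words_def addv_zero[OF addv_pre] simp del: append_take_drop_id)
      then have sum: "(\<Sum>p\<in>PP. pre p (strip p (frag_of v))) = (if take (Suc s) v \<in> PP then frag_of v else 0)"
        using finPP by (simp add: sum.delta cong: sum.cong)
      show ?thesis
      proof (cases "v \<in> low b s")
        case True
        have "take (Suc s) v \<notin> PP"
        proof
          assume "take (Suc s) v \<in> PP"
          from PP[OF this] have "length (take (Suc s) v) = Suc s" "fst (v ! s) = b" by (auto simp: inj_words_def)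
          moreover from this have "s < length v" by (simp add: min_def split: if_splits)
          ultimately show False using True by (auto simp: low_def)
        qed
        then show ?thesis using sum True by simp
      next
        case False
        then have "take (Suc s) v \<in> PP" using v by (auto simp: PP_def)
        then show ?thesis using sum by simp
      qed
    qed
    then have "frag_extend (\<lambda>v. ?h (frag_of v)) z \<in> ?L" by (rule frag_extend_mem[OF subgrp_keys])
    then have 2: "?h z \<in> ?L" unfolding addv_frag_expansion[OF h, of z] .
    have "z - bd Y = ?h z - (bd Y - (\<Sum>p\<in>PP. pre p (strip p z)))" by simp
    also have "\<dots> \<in> ?L" by (rule subgrp_diff[OF subgrp_keys 2 1])
    finally show ?thesis .
  qed
  ultimately show ?thesis by blast
qed

text \<open>The outer induction is on the size of the alphabet. The inner one, with
  \<open>push_down\<close> as its step, lowers the highest position of a letter b until b does not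
  occur, when prefixing b bounds the cycle.\<close>

theorem inj_words_exact:
  assumes A: "a \<in> A" and "finite B" "l < card B" "z \<in> chains A B l" "bd z = 0"
  shows "\<exists>y\<in>chains A B (Suc l). bd y = z"
  using assms(2-5)
proof (induction "card B" arbitrary: B l z rule: less_induct)
  case less
  obtain b where b: "b \<in> B" using less.prems by fastforce
  have "\<exists>y\<in>chains A B (Suc l). bd y = z" if "z \<in> chains A B l" "bd z = 0" "Poly_Mapping.keys z \<subseteq> low b s" for s z
    using that
  proof (induction s arbitrary: z)
    case 0
    have 1: "[(b, a)] \<in> inj_words A B 1" using A b by (simp add: inj_words_def)
    have "z \<in> chains A (B - fst ` set [(b, a)]) l"
      using 0 by (force simp: chains_def inj_words_def low_def in_set_conv_nth)
    from pre_chain[OF 1 this] have "pre [(b, a)] z \<in> chains A B (Suc l)" by simp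
    moreover have "bd (pre [(b, a)] z) = z" using 0 by (simp add: bd_pre_Cons addv_zero[OF addv_pre])
    ultimately show ?case by blast
  next
    case (Suc s)
    obtain y where y: "y \<in> chains A B (Suc l)" "Poly_Mapping.keys (z - bd y) \<subseteq> low b s"
      using push_down[OF less.prems(1) b less.prems(2) less.hyps Suc.prems] by blast
    have "\<exists>y'\<in>chains A B (Suc l). bd y' = z - bd y"
      by (rule Suc.IH) (use y Suc.prems in \<open>auto simp: bd_bd addv_diff[OF addv_bd] intro: subgrp_diff[OF subgrp_chains] bd_chain\<close>)
    then obtain y' where "y' \<in> chains A B (Suc l)" "bd y' = z - bd y" by blast
    then have "y + y' \<in> chains A B (Suc l)" "bd (y + y') = z"
      using y by (auto simp: addv_add[OF addv_bd] intro: subgrp_add[OF subgrp_chains])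
    then show ?case by blast
  qed
  moreover have "Poly_Mapping.keys z \<subseteq> low b l"
    using less.prems by (auto simp: chains_def inj_words_def low_def)
  ultimately show ?case using less.prems by blast
qed

text \<open>Exactness of a bounded-below complex of free abelian groups yields a contraction in the
  exact range. It is constructed by length, and a single function serves all lengths because a word
  determines its own length.\<close>

lemma inj_words_contraction:
  assumes A: "a \<in> A" and B: "finite B"
  obtains s where "\<And>l v. l < card B \<Longrightarrow> v \<in> inj_words A B l \<Longrightarrow> s v \<in> chains A B (Suc l)"
    "\<And>l v. l < card B \<Longrightarrow> v \<in> inj_words A B l \<Longrightarrow> frag_of v = bd (s v) + frag_extend s (word_diff v)"
proof -
  have "\<exists>s. \<forall>l v. l < L \<longrightarrow> v \<in> inj_words A B l \<longrightarrow> s v \<in> chains A B (Suc l) \<and>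
      frag_of v = bd (s v) + frag_extend s (word_diff v)" if "L \<le> card B" for L
    using that
  proof (induction L)
    case 0
    then show ?case by simp
  next
    case (Suc L)
    then obtain s where s: "\<And>l v. l < L \<Longrightarrow> v \<in> inj_words A B l \<Longrightarrow> s v \<in> chains A B (Suc l)"
      "\<And>l v. l < L \<Longrightarrow> v \<in> inj_words A B l \<Longrightarrow> frag_of v = bd (s v) + frag_extend s (word_diff v)"
      by (meson Suc_leD)
    \<comment> \<open>The element v - s (bd v) is a cycle by the homotopy identity in the previous
      length, so by exactness there is a chain to choose.\<close>
    define t where "t v = (if length v < L then s v else
      SOME y. y \<in> chains A B (Suc L) \<and> bd y = frag_of v - frag_extend s (word_diff v))" for v
    have keys: "u \<in> inj_words A B (L - 1) \<and> L > 0"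
      if "v \<in> inj_words A B l" "l \<le> L" "u \<in> Poly_Mapping.keys (word_diff v)" "l = L" for l u v
      using that word_diff_chain[of v A B "L - 1"] by (cases L) (auto simp: chains_def inj_words_def)
    have "t v \<in> chains A B (Suc L) \<and> bd (t v) = frag_of v - frag_extend s (word_diff v)"
      if v: "v \<in> inj_words A B L" for v
    proof -
      let ?z = "frag_of v - frag_extend s (word_diff v)"
      have "frag_extend s (word_diff v) \<in> chains A B L"
        by (rule frag_extend_mem[OF subgrp_chains]) (use keys[OF v] s(1)[of "L - 1"] in fastforce)
      then have 1: "?z \<in> chains A B L" using subgrp_diff[OF subgrp_chains chain_of[OF v]] by blast
      have "bd (frag_extend s (word_diff v)) = frag_extend (\<lambda>u. bd (s u)) (word_diff v)"
        by (rule frag_extend_compose[OF addv_bd])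
      also have "\<dots> = frag_extend (\<lambda>u. frag_of u - frag_extend s (word_diff u)) (word_diff v)"
      proof (rule frag_extend_eq)
        fix u assume "u \<in> Poly_Mapping.keys (word_diff v)"
        then have "u \<in> inj_words A B (L - 1)" "L - 1 < L" using keys[OF v] by auto
        from s(2)[OF this(2,1)] show "bd (s u) = frag_of u - frag_extend s (word_diff u)" by (simp add: algebra_simps)
      qed
      also have "\<dots> = word_diff v - frag_extend s (bd (word_diff v))"
      proof -
        have "addv (\<lambda>z. z - frag_extend s (bd z))"
          by (rule addvI) (simp add: addv_add[OF addv_bd] frag_extend_add)
        from addv_frag_expansion[OF this, of "word_diff v"] show ?thesis by simp
      qed
      finally have "bd ?z = 0" by (simp add: bd_word_diff addv_diff[OF addv_bd])
      then have "\<exists>y. y \<in> chains A B (Suc L) \<and> bd y = ?z"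
        using inj_words_exact[OF A B _ 1] Suc.prems by auto
      from someI_ex[OF this] show ?thesis using v by (simp add: t_def inj_words_def)
    qed
    moreover have "t v = s v" if "v \<in> inj_words A B l" "l < L" for l v
      using that by (simp add: t_def inj_words_def)
    moreover have "frag_extend t (word_diff v) = frag_extend s (word_diff v)" if "v \<in> inj_words A B l" "l < Suc L" for l v
    proof (rule frag_extend_eq)
      fix u assume "u \<in> Poly_Mapping.keys (word_diff v)"
      then have "length u < L"
        using word_diff_chain[of v A B "l - 1"] that by (cases l) (auto simp: chains_def inj_words_def)
      then show "t u = s u" by (simp add: t_def)
    qed
    ultimately show ?case
      using s by (intro exI[of _ t]) (auto simp: less_Suc_eq)
  qed
  from this[of "card B"] show ?thesis using that by blast
qed

section \<open>Wreath products\<close>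

text \<open>The element \<open>w\<close> stands for the diagram joining the left node \<open>i\<close> to the right node \<open>fst (w i)\<close>
  by an edge labelled \<open>snd (w i)\<close>.\<close>

definition wreath :: "('g, 'x) monoid_scheme \<Rightarrow> nat \<Rightarrow> (nat \<Rightarrow> nat \<times> 'g) monoid" where
  "wreath G n = \<lparr>carrier = {w. (fst \<circ> w) permutes {..<n} \<and> (\<forall>i. snd (w i) \<in> carrier G) \<and>
      (\<forall>i\<ge>n. snd (w i) = \<one>\<^bsub>G\<^esub>)},
    monoid.mult = (\<lambda>v w i. (fst (w (fst (v i))), snd (v i) \<otimes>\<^bsub>G\<^esub> snd (w (fst (v i))))),
    one = (\<lambda>i. (i, \<one>\<^bsub>G\<^esub>))\<rparr>"

lemma wreath_mult: "(v \<otimes>\<^bsub>wreath G n\<^esub> w) i = (fst (w (fst (v i))), snd (v i) \<otimes>\<^bsub>G\<^esub> snd (w (fst (v i))))"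
  by (simp add: wreath_def)

lemma wreath_one: "\<one>\<^bsub>wreath G n\<^esub> = (\<lambda>i. (i, \<one>\<^bsub>G\<^esub>))"
  by (simp add: wreath_def)

lemma wreath_mult_eq: "(\<otimes>\<^bsub>wreath G m\<^esub>) = (\<otimes>\<^bsub>wreath G n\<^esub>)" and wreath_one_eq: "\<one>\<^bsub>wreath G m\<^esub> = \<one>\<^bsub>wreath G n\<^esub>"
  by (simp_all add: wreath_def)

lemma wreath_carrier: "w \<in> carrier (wreath G n) \<longleftrightarrow> (fst \<circ> w) permutes {..<n} \<and>
    (\<forall>i. snd (w i) \<in> carrier G) \<and> (\<forall>i\<ge>n. snd (w i) = \<one>\<^bsub>G\<^esub>)"
  by (simp add: wreath_def)

lemma wreathD:
  assumes "w \<in> carrier (wreath G n)"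
  shows "snd (w i) \<in> carrier G" and "i \<ge> n \<Longrightarrow> w i = (i, \<one>\<^bsub>G\<^esub>)"
    and "i < n \<Longrightarrow> fst (w i) < n" and "fst (w i) = fst (w j) \<longleftrightarrow> i = j"
proof -
  have p: "(fst \<circ> w) permutes {..<n}" using assms by (simp add: wreath_carrier)
  show "snd (w i) \<in> carrier G" "i \<ge> n \<Longrightarrow> w i = (i, \<one>\<^bsub>G\<^esub>)"
    using assms permutes_not_in[OF p, of i] by (auto simp: wreath_carrier prod_eq_iff)
  show "i < n \<Longrightarrow> fst (w i) < n" using permutes_in_image[OF p, of i] by simp
  show "fst (w i) = fst (w j) \<longleftrightarrow> i = j"
    using permutes_inj[OF p] by (auto simp: inj_def)
qed

lemma wreath_mono:
  assumes "m \<le> n" shows "carrier (wreath G m) \<subseteq> carrier (wreath G n)"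
proof
  fix w assume w: "w \<in> carrier (wreath G m)"
  then have "(fst \<circ> w) permutes {..<n}"
    using permutes_subset[of "fst \<circ> w" "{..<m}" "{..<n}"] assms by (auto simp: wreath_carrier)
  then show "w \<in> carrier (wreath G n)" using w assms by (auto simp: wreath_carrier)
qed

lemma wreath_smaller:
  assumes "w \<in> carrier (wreath G n)" "\<And>i. m \<le> i \<Longrightarrow> i < n \<Longrightarrow> w i = (i, \<one>\<^bsub>G\<^esub>)"
  shows "w \<in> carrier (wreath G m)"
proof -
  have p: "(fst \<circ> w) permutes {..<n}" using assms(1) by (simp add: wreath_carrier)
  have fix_ge: "w i = (i, \<one>\<^bsub>G\<^esub>)" if "i \<ge> m" for i
    using that assms(2) wreathD(2)[OF assms(1)] by (cases "i < n") auto
  have "(fst \<circ> w) permutes {..<m}"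
    by (rule permutes_superset[OF p]) (auto simp: fix_ge)
  then show ?thesis using wreathD(1)[OF assms(1)] fix_ge by (simp add: wreath_carrier)
qed

lemma group_wreath:
  assumes "group G" shows "group (wreath G n)"
proof -
  interpret group G by (rule assms)
  show ?thesis
  proof (rule groupI)
    fix v w assume v: "v \<in> carrier (wreath G n)" and w: "w \<in> carrier (wreath G n)"
    have "fst \<circ> (v \<otimes>\<^bsub>wreath G n\<^esub> w) = (fst \<circ> w) \<circ> (fst \<circ> v)"
      by (auto simp: wreath_mult)
    moreover have "((fst \<circ> w) \<circ> (fst \<circ> v)) permutes {..<n}"
      using v w by (intro permutes_compose) (auto simp: wreath_carrier)
    ultimately show "v \<otimes>\<^bsub>wreath G n\<^esub> w \<in> carrier (wreath G n)"
      unfolding wreath_carrier using wreathD(1,2)[OF v] wreathD(1,2)[OF w] by (auto simp: wreath_mult)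
    fix x assume x: "x \<in> carrier (wreath G n)"
    show "v \<otimes>\<^bsub>wreath G n\<^esub> w \<otimes>\<^bsub>wreath G n\<^esub> x = v \<otimes>\<^bsub>wreath G n\<^esub> (w \<otimes>\<^bsub>wreath G n\<^esub> x)"
      using wreathD(1)[OF v] wreathD(1)[OF w] wreathD(1)[OF x]
      by (intro ext) (auto simp: wreath_mult m_assoc)
  next
    show "\<one>\<^bsub>wreath G n\<^esub> \<in> carrier (wreath G n)"
      using permutes_id[of "{..<n}"] by (simp add: wreath_carrier wreath_one comp_def id_def)
  next
    fix v assume v: "v \<in> carrier (wreath G n)"
    show "\<one>\<^bsub>wreath G n\<^esub> \<otimes>\<^bsub>wreath G n\<^esub> v = v"
      using wreathD(1)[OF v] by (intro ext) (auto simp: wreath_mult wreath_one prod_eq_iff)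
    let ?p = "fst \<circ> v"
    have p: "?p permutes {..<n}" using v by (simp add: wreath_carrier)
    let ?w = "\<lambda>i. (inv_into UNIV ?p i, inv\<^bsub>G\<^esub> snd (v (inv_into UNIV ?p i)))"
    have "?w \<in> carrier (wreath G n)"
      unfolding wreath_carrier
    proof (intro conjI allI impI)
      show "(fst \<circ> ?w) permutes {..<n}"
        using permutes_inv[OF p] by (simp add: comp_def)
      show "snd (?w i) \<in> carrier G" for i using wreathD(1)[OF v] by simp
      show "snd (?w i) = \<one>\<^bsub>G\<^esub>" if "i \<ge> n" for i
        using that permutes_not_in[OF permutes_inv[OF p], of i] wreathD(2)[OF v that] by simp
    qed
    moreover have "?w \<otimes>\<^bsub>wreath G n\<^esub> v = \<one>\<^bsub>wreath G n\<^esub>"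
      using wreathD(1)[OF v] permutes_inverses(1)[OF p] by (intro ext) (simp add: wreath_mult wreath_one)
    ultimately show "\<exists>w\<in>carrier (wreath G n). w \<otimes>\<^bsub>wreath G n\<^esub> v = \<one>\<^bsub>wreath G n\<^esub>" by blast
  qed
qed

lemma subgroup_wreath:
  assumes "group G" "m \<le> n" shows "subgroup (carrier (wreath G m)) (wreath G n)"
proof -
  interpret m: group "wreath G m" by (rule group_wreath[OF assms(1)])
  interpret n: group "wreath G n" by (rule group_wreath[OF assms(1)])
  have sub: "carrier (wreath G m) \<subseteq> carrier (wreath G n)" by (rule wreath_mono[OF assms(2)])
  show ?thesis
  proof (rule n.subgroupI[OF sub])
    show "carrier (wreath G m) \<noteq> {}" using m.one_closed by blast
    fix v w assume v: "v \<in> carrier (wreath G m)" and w: "w \<in> carrier (wreath G m)"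
    show "v \<otimes>\<^bsub>wreath G n\<^esub> w \<in> carrier (wreath G m)"
      using m.m_closed[OF v w] unfolding wreath_mult_eq[of G m n] .
    have "inv\<^bsub>wreath G m\<^esub> v \<otimes>\<^bsub>wreath G n\<^esub> v = \<one>\<^bsub>wreath G n\<^esub>"
      using m.l_inv[OF v] unfolding wreath_mult_eq[of G m n] wreath_one_eq[of G m n] .
    then have "inv\<^bsub>wreath G n\<^esub> v = inv\<^bsub>wreath G m\<^esub> v"
      using n.inv_equality v m.inv_closed[OF v] sub by blast
    then show "inv\<^bsub>wreath G n\<^esub> v \<in> carrier (wreath G m)" using m.inv_closed[OF v] by simp
  qed
qed

lemma wreath_as_subgroup: "wreath G m = (wreath G n)\<lparr>carrier := carrier (wreath G m)\<rparr>"
  by (simp add: wreath_def)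

section \<open>Injective words as cosets of wreath products\<close>

definition word_of :: "nat \<Rightarrow> nat \<Rightarrow> (nat \<Rightarrow> nat \<times> 'g) \<Rightarrow> (nat \<times> 'g) list" where
  "word_of n m w = map w [m..<n]"

text \<open>The word records the values of w on the points from m on, so two elements with the same
  word differ by a factor on the left that fixes these points.\<close>

lemma wreath_same_word:
  assumes G: "group G" and v: "v \<in> carrier (wreath G n)" and w: "w \<in> carrier (wreath G n)"
    and eq: "word_of n m v = word_of n m w"
  obtains x where "x \<in> carrier (wreath G m)" "v = x \<otimes>\<^bsub>wreath G n\<^esub> w"
proof -
  interpret G: group G by (rule G)
  interpret group "wreath G n" by (rule group_wreath[OF G])
  let ?x = "v \<otimes>\<^bsub>wreath G n\<^esub> inv\<^bsub>wreath G n\<^esub> w"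
  have x: "?x \<in> carrier (wreath G n)" using v w by simp
  have vx: "v = ?x \<otimes>\<^bsub>wreath G n\<^esub> w" using v w by (simp add: m_assoc)
  have "?x \<in> carrier (wreath G m)"
  proof (rule wreath_smaller[OF x])
    fix i assume i: "m \<le> i" "i < n"
    have "v i = w i" using eq i by (auto simp: word_of_def)
    moreover have "v i = (fst (w (fst (?x i))), snd (?x i) \<otimes>\<^bsub>G\<^esub> snd (w (fst (?x i))))"
      by (subst vx) (rule wreath_mult)
    ultimately have e: "fst (w (fst (?x i))) = fst (w i)" "snd (?x i) \<otimes>\<^bsub>G\<^esub> snd (w (fst (?x i))) = snd (w i)"
      by (metis fst_conv, metis snd_conv)
    then have "fst (?x i) = i" using wreathD(4)[OF w] by blast
    moreover from this e(2) have "snd (?x i) = \<one>\<^bsub>G\<^esub>"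
      using wreathD(1)[OF w] wreathD(1)[OF x] by simp
    ultimately show "?x i = (i, \<one>\<^bsub>G\<^esub>)" by (simp add: prod_eq_iff)
  qed
  then show ?thesis using vx by (rule that)
qed

lemma word_of_mult:
  assumes "group G" "x \<in> carrier (wreath G m)" "w \<in> carrier (wreath G n)"
  shows "word_of n m (x \<otimes>\<^bsub>wreath G n\<^esub> w) = word_of n m w"
proof -
  interpret group G by fact
  show ?thesis
    using wreathD(2)[OF assms(2)] wreathD(1)[OF assms(3)]
    by (auto simp: word_of_def wreath_mult prod_eq_iff)
qed

lemma word_of_inj_words:
  assumes w: "w \<in> carrier (wreath G n)"
  shows "word_of n m w \<in> inj_words (carrier G) {..<n} (n - m)"
proof -
  have "inj_on (\<lambda>i. fst (w i)) {m..<n}" by (rule inj_onI) (simp add: wreathD(4)[OF w])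
  then have "distinct (map (\<lambda>i. fst (w i)) [m..<n])" by (simp add: distinct_map)
  then have "distinct (map fst (map w [m..<n]))" by (simp only: map_map comp_def)
  moreover have "w i \<in> {..<n} \<times> carrier G" if "i \<in> {m..<n}" for i
    using wreathD(1,3)[OF w] that by (simp add: mem_Times_iff)
  ultimately show ?thesis by (simp add: inj_words_def word_of_def image_subset_iff)
qed

text \<open>Together with \<open>wreath_same_word\<close> this identifies the injective words of
  length n-m with the cosets of \<open>wreath G m\<close> in \<open>wreath G n\<close>.\<close>

lemma word_of_surj:
  assumes G: "group G" and m: "m \<le> n" and v: "v \<in> inj_words (carrier G) {..<n} (n - m)"
  obtains w where "w \<in> carrier (wreath G n)" "word_of n m w = v"
proof -
  let ?I = "fst ` set v"
  have len: "length v = n - m" and dist: "distinct (map fst v)" and sub: "set v \<subseteq> {..<n} \<times> carrier G"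
    using v by (auto simp: inj_words_def)
  have I: "?I \<subseteq> {..<n}" using sub by auto
  have cI: "card ?I = n - m" using distinct_card[OF dist] len by simp
  have "card ({..<n} - ?I) = card {..<m}" using card_Diff_subset[OF _ I] cI m by simp
  then obtain h where h: "bij_betw h {..<m} ({..<n} - ?I)"
    using finite_same_card_bij[of "{..<m}" "{..<n} - ?I"] by auto
  define w where "w i = (if i < m then (h i, \<one>\<^bsub>G\<^esub>) else if i < n then v ! (i - m) else (i, \<one>\<^bsub>G\<^esub>))" for i
  have "bij_betw (fst \<circ> w) ({..<m} \<union> {m..<n}) (({..<n} - ?I) \<union> ?I)"
  proof (rule bij_betw_combine)
    show "bij_betw (fst \<circ> w) {..<m} ({..<n} - ?I)"
      using h by (rule bij_betw_cong[THEN iffD1, rotated]) (simp add: w_def)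
    have 1: "bij_betw (\<lambda>i. map fst v ! i) {..<n - m} ?I"
      using bij_betw_nth[OF dist, of "{..<n - m}"] len by simp
    have 2: "bij_betw (\<lambda>i. i - m) {m..<n} {..<n - m}"
      by (rule bij_betwI[of _ _ _ "\<lambda>i. i + m"]) auto
    show "bij_betw (fst \<circ> w) {m..<n} ?I"
      using bij_betw_trans[OF 2 1]
      by (rule bij_betw_cong[THEN iffD1, rotated]) (use len in \<open>auto simp: w_def\<close>)
  qed auto
  moreover have "{..<m} \<union> {m..<n} = {..<n}" "({..<n} - ?I) \<union> ?I = {..<n}" using m I by auto
  ultimately have "(fst \<circ> w) permutes {..<n}"
    by (intro bij_imp_permutes) (auto simp: w_def)
  moreover have "snd (w i) \<in> carrier G" for i
    using subsetD[OF sub nth_mem[of "i - m" v]] len G by (auto simp: w_def group.is_monoid mem_Times_iff)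
  ultimately have "w \<in> carrier (wreath G n)" using m by (auto simp: wreath_carrier w_def)
  moreover have "word_of n m w = v"
    by (rule nth_equalityI) (use len in \<open>auto simp: word_of_def w_def\<close>)
  ultimately show ?thesis by (rule that)
qed

text \<open>This unlabelled cycle sends b to b+j and moves the points in between down by one. It is
  made so that multiplication by it deletes a letter of a word.\<close>

definition shift_perm :: "('g, 'x) monoid_scheme \<Rightarrow> nat \<Rightarrow> nat \<Rightarrow> nat \<Rightarrow> nat \<times> 'g" where
  "shift_perm G b j i = (if i = b then b + j else if b < i \<and> i \<le> b + j then i - 1 else i, \<one>\<^bsub>G\<^esub>)"

lemma shift_perm_closed:
  assumes "group G" "b + j < n" shows "shift_perm G b j \<in> carrier (wreath G n)"
proof -
  interpret group G by fact
  have "(fst \<circ> shift_perm G b j) permutes {..<n}"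
  proof (rule bij_imp_permutes)
    show "bij_betw (fst \<circ> shift_perm G b j) {..<n} {..<n}"
      by (rule bij_betwI[of _ _ _ "\<lambda>i. if i = b + j then b else if b \<le> i \<and> i < b + j then i + 1 else i"])
        (use assms(2) in \<open>auto simp: shift_perm_def split: if_splits\<close>)
    show "(fst \<circ> shift_perm G b j) i = i" if "i \<notin> {..<n}" for i
      using that assms(2) by (auto simp: shift_perm_def)
  qed
  then show ?thesis by (auto simp: wreath_carrier shift_perm_def)
qed

text \<open>The cycle moves only points from b on, and x only points below b.\<close>

lemma shift_perm_commute:
  assumes "group G" "x \<in> carrier (wreath G b)"
  shows "shift_perm G b j \<otimes>\<^bsub>wreath G n\<^esub> x = x \<otimes>\<^bsub>wreath G n\<^esub> shift_perm G b j"
proof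
  interpret group G by fact
  fix i
  show "(shift_perm G b j \<otimes>\<^bsub>wreath G n\<^esub> x) i = (x \<otimes>\<^bsub>wreath G n\<^esub> shift_perm G b j) i"
  proof (cases "i < b")
    case True
    then show ?thesis using wreathD(1,3)[OF assms(2), of i] by (auto simp: wreath_mult shift_perm_def)
  next
    case False
    then show ?thesis using wreathD(2)[OF assms(2)] by (auto simp: wreath_mult shift_perm_def)
  qed
qed

text \<open>After the shift the position b carries the letter formerly at b+j. As the word now
  starts at b+1, that letter is the one that disappears, so left multiplication realises the j-th
  face map.\<close>

lemma word_of_shift_perm:
  assumes "group G" "w \<in> carrier (wreath G n)" "b < m" "m \<le> n" "j < m - b"
  shows "word_of n (Suc b) (shift_perm G b j \<otimes>\<^bsub>wreath G n\<^esub> w) = del j (map w [b..<m]) @ map w [m..<n]"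
proof -
  interpret group G by fact
  have "word_of n (Suc b) (shift_perm G b j \<otimes>\<^bsub>wreath G n\<^esub> w) =
      map (\<lambda>i. w (if i \<le> b + j then i - 1 else i)) [Suc b..<n]"
    unfolding word_of_def
    by (rule map_cong[OF refl])
      (auto simp: wreath_mult shift_perm_def prod_eq_iff wreathD(1)[OF assms(2)])
  also have "\<dots> = del j (map w [b..<m]) @ map w [m..<n]"
  proof (rule nth_equalityI)
    show "length (map (\<lambda>i. w (if i \<le> b + j then i - 1 else i)) [Suc b..<n]) =
        length (del j (map w [b..<m]) @ map w [m..<n])"
      using assms(3-5) by (simp add: length_del)
    fix i assume i: "i < length (map (\<lambda>i. w (if i \<le> b + j then i - 1 else i)) [Suc b..<n])"
    have "(del j (map w [b..<m]) @ map w [m..<n]) ! i = w (if i < j then b + i else Suc (b + i))"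
      using i assms(3-5) by (auto simp: nth_append length_del del_def min_def add.commute)
    then show "map (\<lambda>i. w (if i \<le> b + j then i - 1 else i)) [Suc b..<n] ! i =
        (del j (map w [b..<m]) @ map w [m..<n]) ! i"
      using i by auto
  qed
  finally show ?thesis .
qed

lemma addv_frag_cmul:
  fixes f :: "('c \<Rightarrow>\<^sub>0 int) \<Rightarrow> ('d \<Rightarrow>\<^sub>0 int)"
  shows "addv f \<Longrightarrow> f (frag_cmul a y) = frag_cmul a (f y)"
proof -
  assume f: "addv f"
  \<comment> \<open>Writing a multiple as the value of a homomorphism out of the infinite cyclic
    group reduces the claim to the compatibility of additive maps with
    \<open>frag_extend\<close>.\<close>
  have 1: "frag_cmul a z = frag_extend (\<lambda>_::unit. z) (frag_cmul a (frag_of ()))" for z :: "'c \<Rightarrow>\<^sub>0 int"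
    by (simp add: frag_extend_cmul)
  have 2: "frag_cmul a z = frag_extend (\<lambda>_::unit. z) (frag_cmul a (frag_of ()))" for z :: "'d \<Rightarrow>\<^sub>0 int"
    by (simp add: frag_extend_cmul)
  show ?thesis unfolding 1[of y] 2[of "f y"] by (rule frag_extend_compose[OF f])
qed

section \<open>Homological stability for wreath products\<close>

locale wreath_resolution =
  fixes G :: "('g, 'x) monoid_scheme" and k :: "('k, 'y) ring_scheme" and n :: nat
    and E :: "nat \<Rightarrow> ('p \<Rightarrow>\<^sub>0 int) set"
    and op :: "nat \<Rightarrow> 'k \<Rightarrow> (nat \<Rightarrow> nat \<times> 'g) \<Rightarrow> ('p \<Rightarrow>\<^sub>0 int) \<Rightarrow> ('p \<Rightarrow>\<^sub>0 int)"
    and d :: "nat \<Rightarrow> ('p \<Rightarrow>\<^sub>0 int) \<Rightarrow> ('p \<Rightarrow>\<^sub>0 int)"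
    and S :: "nat \<Rightarrow> 's set" and u c
  assumes G: "group G"
    and basis: "kmod_dual_basis k (wreath G n) (E i) (op i) (S i) (u i) (c i)"
    and lin_d: "lin k (carrier (wreath G n)) (E (Suc i)) (op (Suc i)) (E i) (op i) (d i)"
    and d_d: "d i (d (Suc i) x) \<in> E i"
    and exact: "d i x \<in> E i \<Longrightarrow> \<exists>y. x - d (Suc i) y \<in> E (Suc i)"
    and trivial_H0: "w \<in> carrier (wreath G n) \<Longrightarrow> \<exists>y. op 0 \<one>\<^bsub>k\<^esub> w x - x - d 0 y \<in> E 0"
begin

abbreviation "W \<equiv> wreath G n"

lemma k: "cring k" using basis by (simp add: kmod_dual_basis_def)
lemma kmodW: "kmod k W (carrier W) (E i) (op i)" by (rule kmod_dual_basis.kmod[OF basis])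
lemma db: "dual_basis k W (E i) (op i) (S i) (u i) (c i)" by (rule kmod_dual_basis.db[OF basis])
lemma group_W: "group W" by (rule group_wreath[OF G])
lemma subE: "subgrp (E i)" by (rule kmodD(1)[OF kmodW])

sublocale k: cring k by (rule k)
sublocale W: group W by (rule group_W)

lemma addv_op: "a \<in> carrier k \<Longrightarrow> w \<in> carrier W \<Longrightarrow> addv (op i a w)"
  by (rule kmodD(2)[OF kmodW])

lemma addv_d: "addv (d i)" by (rule linD(1)[OF lin_d])

abbreviation supp :: "nat \<Rightarrow> ('p \<Rightarrow>\<^sub>0 int) \<Rightarrow> ('s \<times> (nat \<Rightarrow> nat \<times> 'g)) set" where
  "supp i x \<equiv> {(s, w). s \<in> S i \<and> w \<in> carrier W \<and> c i x s w \<noteq> \<zero>\<^bsub>k\<^esub>}"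

section \<open>Coinvariants under smaller wreath products and the map induced by the face
  maps\<close>

definition C :: "nat \<Rightarrow> nat \<Rightarrow> ('p \<Rightarrow>\<^sub>0 int) set" where
  "C m i = coinv k (carrier (wreath G m)) (E i) (op i)"

lemma subC: "subgrp (C m i)" by (simp add: C_def subgrp_coinv)

lemma E_C: "x \<in> E i \<Longrightarrow> x \<in> C m i" by (simp add: C_def coinv_incl)

lemma C_mono: "m \<le> m' \<Longrightarrow> C m i \<subseteq> C m' i"
  unfolding C_def by (intro coinv_mono wreath_mono)

lemma C_Suc: "x \<in> C (m - Suc p) i \<Longrightarrow> x \<in> C (m - p) i"
  by (rule subsetD[OF C_mono[of "m - Suc p" "m - p"]]) simp_all

lemma d_C: "m \<le> n \<Longrightarrow> x \<in> C m (Suc i) \<Longrightarrow> d i x \<in> C m i"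
  unfolding C_def by (rule lin_coinv[OF lin_mono[OF lin_d wreath_mono]]) auto

lemma kmod_sub: "m \<le> n \<Longrightarrow> kmod k W (carrier (wreath G m)) (E i) (op i)"
  by (rule kmod_mono[OF kmodW wreath_mono])

lemma kcomplex_sub:
  assumes m: "m \<le> n" shows "kcomplex k W (carrier (wreath G m)) E op d"
proof
  show "kmod k W (carrier (wreath G m)) (E i) (op i)" for i by (rule kmod_sub[OF m])
  show l: "lin k (carrier (wreath G m)) (E (Suc i)) (op (Suc i)) (E i) (op i) (d i)" for i
    by (rule lin_mono[OF lin_d wreath_mono[OF m]])
  show "d i (d (Suc i) x) \<in> E i" for i x by (rule d_d)
  show "\<exists>y. x - d (Suc i) y \<in> E (Suc i)" if "d i x \<in> E i" for i x by (rule exact[OF that])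
  show "\<exists>\<phi>. lin k (carrier (wreath G m)) (E i) (op i) (E (Suc i)) (op (Suc i)) \<phi> \<and> (\<forall>x. h x - d i (\<phi> x) \<in> E i)"
    if h: "lin k (carrier (wreath G m)) (E i) (op i) (E i) (op i) h" and eh: "\<And>x. \<exists>y. h x - d i y \<in> E i" for i h
  proof -
    obtain \<phi> where "lin k (carrier (wreath G m)) (E i) (op i) (E (Suc i)) (op (Suc i)) \<phi>"
      "\<And>x. h x - d i (\<phi> x) \<in> E i"
      by (rule kmod_dual_basis.lifting[OF basis subgroup_wreath[OF G m] kmod_sub[OF m] kmod_sub[OF m] l h eh])
        (rule that)
    then show ?thesis by blast
  qed
qed

text \<open>An element centralising \<open>wreath G m\<close> acts by chain maps linear over that
  subgroup. It is the identity on homology in degree 0 by \<open>trivial_H0\<close>, hence homotopic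
  to the identity, and it acts trivially on the homology of the coinvariants.\<close>

lemma central_action:
  assumes m: "m \<le> n" and w: "w \<in> carrier W"
    and comm: "\<And>v. v \<in> carrier (wreath G m) \<Longrightarrow> w \<otimes>\<^bsub>W\<^esub> v = v \<otimes>\<^bsub>W\<^esub> w"
  shows "lin k (carrier (wreath G m)) (E i) (op i) (E i) (op i) (op i \<one>\<^bsub>k\<^esub> w)"
    and "(i > 0 \<Longrightarrow> d (i - 1) x \<in> C m (i - 1)) \<Longrightarrow> \<exists>v. op i \<one>\<^bsub>k\<^esub> w x - x - d i v \<in> C m i"
proof -
  have l: "lin k (carrier (wreath G m)) (E i) (op i) (E i) (op i) (op i \<one>\<^bsub>k\<^esub> w)" for i
    unfolding lin_def
  proof (intro conjI ballI allI)
    show "addv (op i \<one>\<^bsub>k\<^esub> w)" by (rule addv_op[OF k.one_closed w])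
    show "op i \<one>\<^bsub>k\<^esub> w x \<in> E i" if "x \<in> E i" for x by (rule kmodD(3)[OF kmodW k.one_closed w that])
    fix a v x assume a: "a \<in> carrier k" and v: "v \<in> carrier (wreath G m)"
    have vW: "v \<in> carrier W" using v wreath_mono[OF m] by blast
    have "op i \<one>\<^bsub>k\<^esub> w (op i a v x) - op i a (w \<otimes>\<^bsub>W\<^esub> v) x \<in> E i"
      using kmodD(5)[OF kmodW k.one_closed a w vW, of i x] a by simp
    moreover have "op i a v (op i \<one>\<^bsub>k\<^esub> w x) - op i a (w \<otimes>\<^bsub>W\<^esub> v) x \<in> E i"
      using kmodD(5)[OF kmodW a k.one_closed vW w, of i x] a comm[OF v] by simp
    ultimately show "op i \<one>\<^bsub>k\<^esub> w (op i a v x) - op i a v (op i \<one>\<^bsub>k\<^esub> w x) \<in> E i"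
      by (rule subgrp_trans[OF subE _ subgrp_sym[OF subE]])
  qed
  show "lin k (carrier (wreath G m)) (E i) (op i) (E i) (op i) (op i \<one>\<^bsub>k\<^esub> w)" by (rule l)
  assume x: "i > 0 \<Longrightarrow> d (i - 1) x \<in> C m (i - 1)"
  interpret K: kcomplex k W "carrier (wreath G m)" E op d by (rule kcomplex_sub[OF m])
  have id: "lin k (carrier (wreath G m)) (E i) (op i) (E i) (op i) (\<lambda>x. x)" for i
    by (auto simp: lin_def subgrp_zero[OF subE] intro: addvI)
  have "\<exists>v. (\<lambda>i x. op i \<one>\<^bsub>k\<^esub> w x - x) i x - d i v \<in> coinv k (carrier (wreath G m)) (E i) (op i)"
  proof (rule K.null_on_coinv[where h = "\<lambda>i x. op i \<one>\<^bsub>k\<^esub> w x - x"])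
    show "lin k (carrier (wreath G m)) (E i) (op i) (E i) (op i) (\<lambda>x. op i \<one>\<^bsub>k\<^esub> w x - x)" for i
      by (rule lin_diff[OF l id kmod_sub[OF m]])
    show "d i (op (Suc i) \<one>\<^bsub>k\<^esub> w x - x) - (op i \<one>\<^bsub>k\<^esub> w (d i x) - d i x) \<in> E i" for i x
      using linD(3)[OF lin_d k.one_closed w, of i x] by (simp add: addv_diff[OF addv_d])
    show "\<exists>y. op 0 \<one>\<^bsub>k\<^esub> w x - x - d 0 y \<in> E 0" for x by (rule trivial_H0[OF w])
    show "d (i - 1) x \<in> coinv k (carrier (wreath G m)) (E (i - 1)) (op (i - 1))" if "i > 0"
      using x[OF that] by (simp add: C_def)
  qed
  then show "\<exists>v. op i \<one>\<^bsub>k\<^esub> w x - x - d i v \<in> C m i" by (simp add: C_def)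
qed

text \<open>This is the alternating sum of the face maps deleting one of the first p+1 letters,
  lifted to group elements. The identity as default for p not below m makes \<open>e m 0\<close> the
  identity also for m = 0.\<close>

definition e :: "nat \<Rightarrow> nat \<Rightarrow> nat \<Rightarrow> ('p \<Rightarrow>\<^sub>0 int) \<Rightarrow> ('p \<Rightarrow>\<^sub>0 int)" where
  "e m p i x = (if p < m then
    (\<Sum>j\<le>p. frag_cmul ((-1) ^ j) (op i \<one>\<^bsub>k\<^esub> (shift_perm G (m - Suc p) j) x)) else x)"

lemma shift_closed: "p < m \<Longrightarrow> m \<le> n \<Longrightarrow> j \<le> p \<Longrightarrow> shift_perm G (m - Suc p) j \<in> carrier W"
  by (rule shift_perm_closed[OF G]) simp

lemma addv_e:
  assumes "m \<le> n" shows "addv (e m p i)"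
proof (cases "p < m")
  case True
  have "op i \<one>\<^bsub>k\<^esub> (shift_perm G (m - Suc p) j) (x + y) = op i \<one>\<^bsub>k\<^esub> (shift_perm G (m - Suc p) j) x +
      op i \<one>\<^bsub>k\<^esub> (shift_perm G (m - Suc p) j) y" if "j \<le> p" for j x y
    by (rule addv_add[OF addv_op[OF k.one_closed shift_closed[OF True assms that]]])
  then have "e m p i (x + y) = e m p i x + e m p i y" for x y
    using True by (simp add: e_def sum.distrib[symmetric] frag_cmul_distrib2[symmetric])
  then show ?thesis by (rule addvI)
qed (auto simp: e_def intro: addvI)

lemma e_E:
  assumes "m \<le> n" "x \<in> E i" shows "e m p i x \<in> E i"
proof (cases "p < m")
  case True
  have "(\<Sum>j\<le>p. frag_cmul ((-1) ^ j) (op i \<one>\<^bsub>k\<^esub> (shift_perm G (m - Suc p) j) x)) \<in> E i"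
    by (intro subgrp_sum[OF subE] frag_cmul_mem[OF subE] kmodD(3)[OF kmodW k.one_closed _ assms(2)])
      (simp add: shift_closed True assms)
  then show ?thesis using True by (simp add: e_def)
qed (simp add: e_def assms)

lemma e_cong: "m \<le> n \<Longrightarrow> x - y \<in> E i \<Longrightarrow> e m p i x - e m p i y \<in> E i"
  using e_E[of m "x - y" i p] by (simp add: addv_diff[OF addv_e])

text \<open>Each shift commutes with the group on m-p-1 points and so respects its coinvariants;
  passing to m-p points only enlarges the subgroup divided out.\<close>

lemma e_C:
  assumes "p < m" "m \<le> n" "x \<in> C (m - Suc p) i" shows "e m p i x \<in> C (m - p) i"
proof -
  have "op i \<one>\<^bsub>k\<^esub> (shift_perm G (m - Suc p) j) x \<in> C (m - Suc p) i" if "j \<le> p" for j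
    unfolding C_def
  proof (rule lin_coinv[OF central_action(1)])
    show "shift_perm G (m - Suc p) j \<in> carrier W" by (rule shift_closed) (use assms that in auto)
    show "shift_perm G (m - Suc p) j \<otimes>\<^bsub>W\<^esub> v = v \<otimes>\<^bsub>W\<^esub> shift_perm G (m - Suc p) j"
      if "v \<in> carrier (wreath G (m - Suc p))" for v
      by (rule shift_perm_commute[OF G that])
    show "x \<in> coinv k (carrier (wreath G (m - Suc p))) (E i) (op i)" using assms(3) by (simp add: C_def)
  qed (use assms in auto)
  then have "(\<Sum>j\<le>p. frag_cmul ((-1) ^ j) (op i \<one>\<^bsub>k\<^esub> (shift_perm G (m - Suc p) j) x)) \<in> C (m - Suc p) i"
    by (intro subgrp_sum[OF subC] frag_cmul_mem[OF subC]) simp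
  then have "e m p i x \<in> C (m - Suc p) i" using assms(1) by (simp add: e_def)
  then show ?thesis by (rule C_Suc)
qed

lemma d_e:
  assumes "p < m" "m \<le> n" shows "d i (e m p (Suc i) x) - e m p i (d i x) \<in> E i"
proof -
  have "(\<Sum>j\<le>p. frag_cmul ((-1) ^ j) (d i (op (Suc i) \<one>\<^bsub>k\<^esub> (shift_perm G (m - Suc p) j) x))) -
      (\<Sum>j\<le>p. frag_cmul ((-1) ^ j) (op i \<one>\<^bsub>k\<^esub> (shift_perm G (m - Suc p) j) (d i x))) \<in> E i"
  proof (rule subgrp_sum_cong[OF subE])
    fix j assume "j \<in> {..p}"
    then have "shift_perm G (m - Suc p) j \<in> carrier W" using assms by (intro shift_closed) auto
    from frag_cmul_mem[OF subE linD(3)[OF lin_d k.one_closed this, of i x], of "(-1) ^ j"]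
    show "frag_cmul ((-1) ^ j) (d i (op (Suc i) \<one>\<^bsub>k\<^esub> (shift_perm G (m - Suc p) j) x)) -
      frag_cmul ((-1) ^ j) (op i \<one>\<^bsub>k\<^esub> (shift_perm G (m - Suc p) j) (d i x)) \<in> E i"
      by (simp add: frag_cmul_diff2)
  qed
  moreover have "d i (frag_cmul a y) = frag_cmul a (d i y)" for a y
  by (rule addv_frag_cmul[OF addv_d])
  ultimately show ?thesis using assms(1) by (simp add: e_def addv_sum[OF addv_d])
qed

text \<open>By \<open>central_action\<close> all p+1 summands are homologous to x, and their
  alternating sum leaves one copy of x or none.\<close>

lemma e_homotopy:
  assumes "p < m" "m \<le> n" and x: "i > 0 \<Longrightarrow> d (i - 1) x \<in> C (m - Suc p) (i - 1)"
  shows "\<exists>v. e m p i x - (if even p then x else 0) - d i v \<in> C (m - p) i"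
proof -
  let ?w = "shift_perm G (m - Suc p)"
  have "\<exists>v. op i \<one>\<^bsub>k\<^esub> (?w j) x - x - d i v \<in> C (m - Suc p) i" if "j \<le> p" for j
  proof (rule central_action(2))
    show "?w j \<in> carrier W" by (rule shift_closed[OF assms(1,2) that])
    show "?w j \<otimes>\<^bsub>W\<^esub> v = v \<otimes>\<^bsub>W\<^esub> ?w j" if "v \<in> carrier (wreath G (m - Suc p))" for v
      by (rule shift_perm_commute[OF G that])
  qed (use assms in auto)
  then obtain v where v: "\<And>j. j \<le> p \<Longrightarrow> op i \<one>\<^bsub>k\<^esub> (?w j) x - x - d i (v j) \<in> C (m - Suc p) i" by metis
  have dcmul: "d i (frag_cmul a y) = frag_cmul a (d i y)" for a y
  by (rule addv_frag_cmul[OF addv_d])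
  have alt: "(\<Sum>j\<le>p. frag_cmul ((-1) ^ j) x) = (if even p then x else 0)"
    by (induction p) auto
  have A: "(\<Sum>j\<le>p. frag_cmul ((-1) ^ j) (op i \<one>\<^bsub>k\<^esub> (?w j) x - x - d i (v j))) \<in> C (m - Suc p) i"
    by (intro subgrp_sum[OF subC] frag_cmul_mem[OF subC] v) simp
  have B: "(\<Sum>j\<le>p. frag_cmul ((-1) ^ j) (op i \<one>\<^bsub>k\<^esub> (?w j) x - x - d i (v j))) =
      e m p i x - (if even p then x else 0) - d i (\<Sum>j\<le>p. frag_cmul ((-1) ^ j) (v j))"
    unfolding alt[symmetric] using assms(1)
    by (simp add: e_def frag_cmul_diff2 sum_subtractf addv_sum[OF addv_d] dcmul)
  show ?thesis using C_Suc[OF A] unfolding B by blast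
qed

section \<open>Transfer of identities from words to the resolution\<close>

definition \<Phi> :: "nat \<Rightarrow> 'k \<Rightarrow> 's \<Rightarrow> ((nat \<Rightarrow> nat \<times> 'g) \<Rightarrow>\<^sub>0 int) \<Rightarrow> ('p \<Rightarrow>\<^sub>0 int)" where
  "\<Phi> i a s = frag_extend (\<lambda>w. op i a w (u i s))"

lemma addv_\<Phi>: "addv (\<Phi> i a s)" by (simp add: \<Phi>_def addv_frag_extend)

lemma \<Phi>_of [simp]: "\<Phi> i a s (frag_of w) = op i a w (u i s)" by (simp add: \<Phi>_def)

definition wordf :: "nat \<Rightarrow> ((nat \<Rightarrow> nat \<times> 'g) \<Rightarrow>\<^sub>0 int) \<Rightarrow> ((nat \<times> 'g) list \<Rightarrow>\<^sub>0 int)" where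
  "wordf b = frag_extend (\<lambda>w. frag_of (word_of n b w))"

lemma addv_wordf: "addv (wordf b)" by (simp add: wordf_def addv_frag_extend)

abbreviation "WF \<equiv> {\<eta> :: (nat \<Rightarrow> nat \<times> 'g) \<Rightarrow>\<^sub>0 int. Poly_Mapping.keys \<eta> \<subseteq> carrier W}"

text \<open>The kernel of the map from the group ring to formal sums of words is generated by
  differences of elements in one coset of \<open>wreath G b\<close>. Such differences vanish in the
  coinvariants, so identities between words become identities in the resolution.\<close>

lemma \<Phi>_coinv:
  assumes b: "b \<le> n" and a: "a \<in> carrier k" and \<eta>: "\<eta> \<in> WF" and 0: "wordf b \<eta> = 0"
  shows "\<Phi> i a s \<eta> \<in> C b i"
proof -
  \<comment> \<open>Subtracting the chosen representative of each coset writes an element with zero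
    word as a sum of such differences.\<close>
  define r where "r v = (SOME w. w \<in> carrier W \<and> word_of n b w = v)" for v
  have r: "r (word_of n b w) \<in> carrier W \<and> word_of n b (r (word_of n b w)) = word_of n b w"
    if "w \<in> carrier W" for w
    unfolding r_def by (rule someI[where x = w]) (use that in auto)
  let ?h = "\<lambda>\<eta>. \<Phi> i a s (\<eta> - frag_extend (\<lambda>v. frag_of (r v)) (wordf b \<eta>))"
  have h: "addv ?h"
    by (rule addvI) (simp add: addv_add[OF addv_\<Phi>] addv_diff[OF addv_\<Phi>] addv_add[OF addv_wordf] frag_extend_add)
  have "frag_extend (\<lambda>w. ?h (frag_of w)) \<eta> \<in> C b i"
  proof (rule frag_extend_mem[OF subC])
    fix w assume "w \<in> Poly_Mapping.keys \<eta>"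
    then have w: "w \<in> carrier W" using \<eta> by auto
    let ?w' = "r (word_of n b w)"
    have w': "?w' \<in> carrier W" using r[OF w] by simp
    obtain x where x: "x \<in> carrier (wreath G b)" "w = x \<otimes>\<^bsub>W\<^esub> ?w'"
      using wreath_same_word[OF G w w'] r[OF w] by metis
    have xW: "x \<in> carrier W" using x(1) wreath_mono[OF b] by blast
    have "op i \<one>\<^bsub>k\<^esub> x (op i a ?w' (u i s)) - op i a w (u i s) \<in> E i"
      using kmodD(5)[OF kmodW k.one_closed a xW w', of i "u i s"] x(2) a by simp
    moreover have "op i \<one>\<^bsub>k\<^esub> x (op i a ?w' (u i s)) - op i a ?w' (u i s) \<in> C b i"
      unfolding C_def by (rule coinv_action[OF x(1)])
    ultimately have "op i a w (u i s) - op i a ?w' (u i s) \<in> C b i"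
      using subgrp_trans[OF subC subgrp_sym[OF subC E_C]] by blast
    then show "?h (frag_of w) \<in> C b i" by (simp add: wordf_def addv_diff[OF addv_\<Phi>])
  qed
  then have "?h \<eta> \<in> C b i" unfolding addv_frag_expansion[OF h, of \<eta>] .
  then show ?thesis using 0 by simp
qed

definition ew :: "nat \<Rightarrow> nat \<Rightarrow> (nat \<Rightarrow> nat \<times> 'g) \<Rightarrow> ((nat \<Rightarrow> nat \<times> 'g) \<Rightarrow>\<^sub>0 int)" where
  "ew m p w = (\<Sum>j\<le>p. frag_cmul ((-1) ^ j) (frag_of (shift_perm G (m - Suc p) j \<otimes>\<^bsub>W\<^esub> w)))"

lemma ew_WF: "p < m \<Longrightarrow> m \<le> n \<Longrightarrow> w \<in> carrier W \<Longrightarrow> ew m p w \<in> WF"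
  unfolding ew_def by (intro subgrp_sum[OF subgrp_keys] frag_cmul_mem[OF subgrp_keys]) (simp add: shift_closed)

text \<open>On a basis element \<open>e m p\<close> is left multiplication of the group coordinate,
  recorded by \<open>ew m p\<close>; hence the computations below can be made in the group
  ring.\<close>

lemma e_\<Phi>:
  assumes "p < m" "m \<le> n" "a \<in> carrier k" "\<eta> \<in> WF"
  shows "e m p i (\<Phi> i a s \<eta>) - \<Phi> i a s (frag_extend (ew m p) \<eta>) \<in> E i"
proof -
  let ?h = "\<lambda>\<eta>. e m p i (\<Phi> i a s \<eta>) - \<Phi> i a s (frag_extend (ew m p) \<eta>)"
  have h: "addv ?h"
    by (rule addvI) (simp add: addv_add[OF addv_\<Phi>] addv_add[OF addv_e[OF assms(2)]] frag_extend_add)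
  have "frag_extend (\<lambda>w. ?h (frag_of w)) \<eta> \<in> E i"
  proof (rule frag_extend_mem[OF subE])
    fix w assume "w \<in> Poly_Mapping.keys \<eta>"
    then have w: "w \<in> carrier W" using assms(4) by auto
    have "(\<Sum>j\<le>p. frag_cmul ((-1) ^ j) (op i \<one>\<^bsub>k\<^esub> (shift_perm G (m - Suc p) j) (op i a w (u i s)))) -
      (\<Sum>j\<le>p. frag_cmul ((-1) ^ j) (op i a (shift_perm G (m - Suc p) j \<otimes>\<^bsub>W\<^esub> w) (u i s))) \<in> E i"
    proof (rule subgrp_sum_cong[OF subE])
      fix j assume "j \<in> {..p}"
      then have sc: "shift_perm G (m - Suc p) j \<in> carrier W" using assms by (intro shift_closed) auto
      have "op i \<one>\<^bsub>k\<^esub> (shift_perm G (m - Suc p) j) (op i a w (u i s)) -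
          op i a (shift_perm G (m - Suc p) j \<otimes>\<^bsub>W\<^esub> w) (u i s) \<in> E i"
        using kmodD(5)[OF kmodW k.one_closed assms(3) sc w, of i "u i s"] assms(3) by simp
      from frag_cmul_mem[OF subE this, of "(-1) ^ j"]
      show "frag_cmul ((-1) ^ j) (op i \<one>\<^bsub>k\<^esub> (shift_perm G (m - Suc p) j) (op i a w (u i s))) -
        frag_cmul ((-1) ^ j) (op i a (shift_perm G (m - Suc p) j \<otimes>\<^bsub>W\<^esub> w) (u i s)) \<in> E i"
        by (simp add: frag_cmul_diff2)
    qed
    moreover have "\<Phi> i a s (frag_cmul b z) = frag_cmul b (\<Phi> i a s z)" for b z
      by (simp add: \<Phi>_def frag_extend_cmul)
    ultimately show "?h (frag_of w) \<in> E i"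
      using assms(1) by (simp add: e_def ew_def addv_sum[OF addv_\<Phi>])
  qed
  then show ?thesis unfolding addv_frag_expansion[OF h, of \<eta>] .
qed

definition app :: "(nat \<times> 'g) list \<Rightarrow> ((nat \<times> 'g) list \<Rightarrow>\<^sub>0 int) \<Rightarrow> ((nat \<times> 'g) list \<Rightarrow>\<^sub>0 int)" where
  "app t = frag_extend (\<lambda>v. frag_of (v @ t))"

lemma addv_app: "addv (app t)" by (simp add: app_def addv_frag_extend)

lemma app_of [simp]: "app t (frag_of v) = frag_of (v @ t)" by (simp add: app_def)

text \<open>The first q letters carry the word complex of \<open>wreath G m\<close>, and the last
  n-m letters stay fixed. They label the cosets of \<open>wreath G m\<close> in
  \<open>wreath G n\<close>, that is, the free summands of the restricted group ring.\<close>

definition tdiff :: "nat \<Rightarrow> (nat \<times> 'g) list \<Rightarrow> ((nat \<times> 'g) list \<Rightarrow>\<^sub>0 int)" where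
  "tdiff q v = app (drop q v) (word_diff (take q v))"

lemma word_of_split: "b \<le> m \<Longrightarrow> m \<le> n \<Longrightarrow> word_of n b w = map w [b..<m] @ map w [m..<n]"
  unfolding word_of_def by (metis le_add_diff_inverse map_append upt_add_eq_append)

lemma tdiff_word:
  assumes "p < m" "m \<le> n" "w \<in> carrier W"
  shows "tdiff (Suc p) (word_of n (m - Suc p) w) =
    (\<Sum>j\<le>p. frag_cmul ((-1) ^ j) (frag_of (word_of n (m - p) (shift_perm G (m - Suc p) j \<otimes>\<^bsub>W\<^esub> w))))"
proof -
  let ?b = "m - Suc p"
  have "tdiff (Suc p) (word_of n ?b w) = app (map w [m..<n]) (word_diff (map w [?b..<m]))"
    using assms by (simp add: tdiff_def word_of_split[of ?b m])
  also have "\<dots> = (\<Sum>j\<le>p. frag_cmul ((-1) ^ j) (frag_of (del j (map w [?b..<m]) @ map w [m..<n])))"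
    using assms by (simp add: word_diff_def addv_sum[OF addv_app] addv_frag_cmul[OF addv_app] lessThan_Suc_atMost)
  also have "\<dots> = (\<Sum>j\<le>p. frag_cmul ((-1) ^ j) (frag_of (word_of n (m - p) (shift_perm G (m - Suc p) j \<otimes>\<^bsub>W\<^esub> w))))"
  proof (rule sum.cong[OF refl])
    fix j assume "j \<in> {..p}"
    then have "word_of n (Suc ?b) (shift_perm G ?b j \<otimes>\<^bsub>W\<^esub> w) = del j (map w [?b..<m]) @ map w [m..<n]"
      by (intro word_of_shift_perm[OF G assms(3)]) (use assms in auto)
    moreover have "Suc ?b = m - p" using assms by simp
    ultimately show "frag_cmul ((-1) ^ j) (frag_of (del j (map w [?b..<m]) @ map w [m..<n])) =
        frag_cmul ((-1) ^ j) (frag_of (word_of n (m - p) (shift_perm G (m - Suc p) j \<otimes>\<^bsub>W\<^esub> w)))"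
      by simp
  qed
  finally show ?thesis .
qed

lemma wordf_ew:
  assumes "p < m" "m \<le> n" "\<eta> \<in> WF"
  shows "wordf (m - p) (frag_extend (ew m p) \<eta>) = frag_extend (tdiff (Suc p)) (wordf (m - Suc p) \<eta>)"
proof -
  have "wordf (m - p) (ew m p w) = tdiff (Suc p) (word_of n (m - Suc p) w)" if "w \<in> carrier W" for w
    unfolding tdiff_word[OF assms(1,2) that] ew_def addv_sum[OF addv_wordf]
    by (simp add: wordf_def frag_extend_cmul)
  then have "frag_extend (\<lambda>w. wordf (m - p) (ew m p w)) \<eta> =
      frag_extend (\<lambda>w. tdiff (Suc p) (word_of n (m - Suc p) w)) \<eta>"
    using assms(3) by (intro frag_extend_eq) auto
  then show ?thesis
    by (simp add: frag_extend_compose[OF addv_wordf] wordf_def frag_extend_compose[OF addv_frag_extend])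
qed

lemma tdiff_app:
  assumes "\<And>v. v \<in> Poly_Mapping.keys z \<Longrightarrow> length v = q"
  shows "frag_extend (tdiff q) (app t z) = app t (bd z)"
proof -
  have "frag_extend (tdiff q) (app t z) = frag_extend (\<lambda>v. tdiff q (v @ t)) z"
    by (simp add: app_def frag_extend_compose[OF addv_frag_extend])
  also have "\<dots> = frag_extend (\<lambda>v. app t (word_diff v)) z"
    by (rule frag_extend_eq) (simp add: tdiff_def assms)
  also have "\<dots> = app t (bd z)" by (simp add: bd_def frag_extend_compose[OF addv_app])
  finally show ?thesis .
qed

lemma tdiff_tdiff:
  assumes "length v \<ge> Suc q" shows "frag_extend (tdiff q) (tdiff (Suc q) v) = 0"
proof -
  have "frag_extend (tdiff q) (tdiff (Suc q) v) = app (drop (Suc q) v) (bd (word_diff (take (Suc q) v)))"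
    unfolding tdiff_def[of "Suc q"]
  proof (rule tdiff_app)
    let ?L = "{z :: (nat \<times> 'g) list \<Rightarrow>\<^sub>0 int. Poly_Mapping.keys z \<subseteq> {w. length w = q}}"
    have "word_diff (take (Suc q) v) \<in> ?L"
      unfolding word_diff_def using assms
      by (intro subgrp_sum[OF subgrp_keys] frag_cmul_mem[OF subgrp_keys]) (simp add: length_del)
    then show "length w = q" if "w \<in> Poly_Mapping.keys (word_diff (take (Suc q) v))" for w
      using that by auto
  qed
  then show ?thesis by (simp add: bd_word_diff addv_zero[OF addv_app])
qed

text \<open>The composite is not zero on the resolution itself. After expansion in the dual basis
  its word vanishes by \<open>tdiff_tdiff\<close>, and \<open>\<Phi>_coinv\<close> shows that it is
  zero in the coinvariants.\<close>

lemma e_e: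
  assumes "p + 2 \<le> m" "m \<le> n" shows "e m p i (e m (Suc p) i x) \<in> C (m - p) i"
proof -
  have ee: "addv (\<lambda>x. e m p i (e m (Suc p) i x))"
    by (rule addvI) (simp add: addv_add[OF addv_e[OF assms(2)]])
  let ?x = "\<Sum>(s, w)\<in>supp i x. op i (c i x s w) w (u i s)"
  have "e m p i (e m (Suc p) i x) - e m p i (e m (Suc p) i ?x) \<in> E i"
    by (intro e_cong assms dual_basisD(6)[OF db])
  moreover have "e m p i (e m (Suc p) i ?x) \<in> C (m - p) i"
    unfolding addv_sum[OF ee]
  proof (rule subgrp_sum[OF subC], clarsimp)
    fix s w assume s: "s \<in> S i" and w: "w \<in> carrier W"
    let ?a = "c i x s w"
    have a: "?a \<in> carrier k" by (rule dual_basisD(1)[OF db s w])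
    have "e m (Suc p) i (op i ?a w (u i s)) - \<Phi> i ?a s (ew m (Suc p) w) \<in> E i"
      using e_\<Phi>[of "Suc p" m ?a "frag_of w" i s] assms a w by simp
    then have "e m p i (e m (Suc p) i (op i ?a w (u i s))) - e m p i (\<Phi> i ?a s (ew m (Suc p) w)) \<in> E i"
      by (rule e_cong[OF assms(2)])
    moreover have ewF: "ew m (Suc p) w \<in> WF" by (rule ew_WF) (use assms w in auto)
    moreover have "e m p i (\<Phi> i ?a s (ew m (Suc p) w)) - \<Phi> i ?a s (frag_extend (ew m p) (ew m (Suc p) w)) \<in> E i"
      by (rule e_\<Phi>[OF _ assms(2) a ewF]) (use assms in auto)
    ultimately have "e m p i (e m (Suc p) i (op i ?a w (u i s))) -
        \<Phi> i ?a s (frag_extend (ew m p) (ew m (Suc p) w)) \<in> E i"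
      using subgrp_trans[OF subE] by blast
    moreover have "\<Phi> i ?a s (frag_extend (ew m p) (ew m (Suc p) w)) \<in> C (m - p) i"
    proof (rule \<Phi>_coinv[OF _ a])
      show "frag_extend (ew m p) (ew m (Suc p) w) \<in> WF"
        by (rule frag_extend_mem[OF subgrp_keys], rule ew_WF) (use assms ewF in auto)
      have "wordf (m - p) (frag_extend (ew m p) (ew m (Suc p) w)) =
          frag_extend (tdiff (Suc p)) (wordf (m - Suc p) (ew m (Suc p) w))"
        by (rule wordf_ew[OF _ assms(2) ewF]) (use assms in auto)
      also have "wordf (m - Suc p) (ew m (Suc p) w) = tdiff (Suc (Suc p)) (word_of n (m - Suc (Suc p)) w)"
        using wordf_ew[of "Suc p" m "frag_of w"] assms w by (simp add: wordf_def)
      also have "frag_extend (tdiff (Suc p)) \<dots> = 0"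
        by (rule tdiff_tdiff) (use assms in \<open>simp add: word_of_def\<close>)
      finally show "wordf (m - p) (frag_extend (ew m p) (ew m (Suc p) w)) = 0" .
    qed (use assms in simp)
    ultimately show "e m p i (e m (Suc p) i (op i ?a w (u i s))) \<in> C (m - p) i"
      using subgrp_cong[OF subC E_C] by blast
  qed
  ultimately show ?thesis using subgrp_cong[OF subC E_C] by blast
qed

text \<open>A contraction of the complex of words on the letters not occurring in the tail \<open>drop q v\<close>,
  lifted to the group.\<close>

lemma lifted_contraction:
  obtains \<sigma> where
    "\<And>m p v. \<lbrakk>p + 2 \<le> m; m \<le> n; v \<in> inj_words (carrier G) {..<n} (Suc p + (n - m))\<rbrakk> \<Longrightarrow> \<sigma> (Suc p) v \<in> WF"
    "\<And>m p v. \<lbrakk>p + 2 \<le> m; m \<le> n; v \<in> inj_words (carrier G) {..<n} (p + (n - m))\<rbrakk> \<Longrightarrow> \<sigma> p v \<in> WF"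
    "\<And>m p v. \<lbrakk>p + 2 \<le> m; m \<le> n; v \<in> inj_words (carrier G) {..<n} (Suc p + (n - m))\<rbrakk> \<Longrightarrow>
      frag_extend (tdiff (Suc (Suc p))) (wordf (m - Suc (Suc p)) (\<sigma> (Suc p) v)) +
      wordf (m - Suc p) (frag_extend (\<sigma> p) (tdiff (Suc p) v)) = frag_of v"
proof -
  interpret G: group G by (rule G)
  let ?P = "\<lambda>B s. (\<forall>l v. l < card B \<longrightarrow> v \<in> inj_words (carrier G) B l \<longrightarrow> s v \<in> chains (carrier G) B (Suc l)) \<and>
      (\<forall>l v. l < card B \<longrightarrow> v \<in> inj_words (carrier G) B l \<longrightarrow> frag_of v = bd (s v) + frag_extend s (word_diff v))"
  \<comment> \<open>One contraction is fixed for every alphabet, so that all words with the same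
    tail use the same one and the homotopy identity can be applied term by term.\<close>
  define s where "s B = (SOME s. ?P B s)" for B
  have P: "?P B (s B)" if B: "finite B" for B
    unfolding s_def
  proof (rule someI_ex[of "?P B"])
    obtain s where "\<And>l v. l < card B \<Longrightarrow> v \<in> inj_words (carrier G) B l \<Longrightarrow> s v \<in> chains (carrier G) B (Suc l)"
      "\<And>l v. l < card B \<Longrightarrow> v \<in> inj_words (carrier G) B l \<Longrightarrow> frag_of v = bd (s v) + frag_extend s (word_diff v)"
      by (rule inj_words_contraction[OF G.one_closed B]) (rule that)
    then show "\<exists>s. ?P B s" by blast
  qed
  have s1: "s B v \<in> chains (carrier G) B (Suc l)"
    if "finite B" "l < card B" "v \<in> inj_words (carrier G) B l" for B l v
    using conjunct1[OF P[OF that(1)]] that(2,3) by simp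
  have s2: "frag_of v = bd (s B v) + frag_extend (s B) (word_diff v)"
    if "finite B" "l < card B" "v \<in> inj_words (carrier G) B l" for B l v
    using conjunct2[OF P[OF that(1)], rule_format, OF that(2,3)] .
  define r where "r v = (SOME w. w \<in> carrier W \<and> word_of n (n - length v) w = v)" for v
  have r: "r v \<in> carrier W \<and> word_of n (n - l) (r v) = v"
    if "v \<in> inj_words (carrier G) {..<n} l" "l \<le> n" for v l
  proof -
    have l: "length v = l" using that(1) by (simp add: inj_words_def)
    have "v \<in> inj_words (carrier G) {..<n} (n - (n - l))" using that by simp
    then obtain w where w: "w \<in> carrier W" "word_of n (n - l) w = v"
      by (rule word_of_surj[OF G diff_le_self])
    show ?thesis unfolding r_def l
      by (rule someI[of "\<lambda>w. w \<in> carrier W \<and> word_of n (n - l) w = v" w]) (simp add: w)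
  qed
  define B where "B t = {..<n} - fst ` set t" for t :: "(nat \<times> 'g) list"
  \<comment> \<open>The contraction acts on the first q letters, over the alphabet left free by the
    tail; the resulting words, with the tail restored, are lifted to the group by r.\<close>
  define \<sigma> where "\<sigma> q v = frag_extend (\<lambda>u. frag_of (r (u @ drop q v))) (s (B (drop q v)) (take q v))" for q v
  have tail: "card (B t) = m \<and> u \<in> inj_words (carrier G) (B t) q \<and> length u = q"
    if "u @ t \<in> inj_words (carrier G) {..<n} (q + (n - m))" "length t = n - m" "m \<le> n" for q m u t
  proof -
    have "card (fst ` set t) = n - m" "fst ` set t \<subseteq> {..<n}"
      using that distinct_card[of "map fst t"] by (auto simp: inj_words_def)
    then have "card (B t) = m" using card_Diff_subset[of "fst ` set t" "{..<n}"] that(3) by (simp add: B_def)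
    moreover have "u \<in> inj_words (carrier G) (B t) q"
    proof -
      have u: "set u \<subseteq> {..<n} \<times> carrier G" "distinct (map fst u)" "length u + length t = q + (n - m)"
          "fst ` set u \<inter> fst ` set t = {}"
        using that(1) by (simp_all add: inj_words_def)
      have "x \<in> ({..<n} - fst ` set t) \<times> carrier G" if "x \<in> set u" for x
      proof -
        have "fst x \<notin> fst ` set t" using that u(4) by blast
        moreover have "x \<in> {..<n} \<times> carrier G" using that u(1) by blast
        ultimately show ?thesis by (simp add: mem_Times_iff)
      qed
      then have "set u \<subseteq> ({..<n} - fst ` set t) \<times> carrier G" by blast
      then show ?thesis using u(2,3) that(2) by (simp add: inj_words_def B_def)
    qed
    ultimately show ?thesis by (simp add: inj_words_def)
  qed
  have splitv: "\<exists>u t. v = u @ t \<and> length t = n - m \<and> take q v = u \<and> drop q v = t"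
    if "v \<in> inj_words (carrier G) {..<n} (q + (n - m))" for v q m
    using that by (intro exI[of _ "take q v"] exI[of _ "drop q v"]) (simp add: inj_words_def)
  have join: "u @ t \<in> inj_words (carrier G) {..<n} (l + (n - m))"
    if "u \<in> inj_words (carrier G) (B t) l" "w @ t \<in> inj_words (carrier G) {..<n} (q + (n - m))" "length t = n - m"
    for u t l w q m
  proof -
    have u: "set u \<subseteq> ({..<n} - fst ` set t) \<times> carrier G" "distinct (map fst u)" "length u = l"
      and t: "set t \<subseteq> {..<n} \<times> carrier G" "distinct (map fst t)"
      using that by (simp_all add: inj_words_def B_def)
    have "fst x \<notin> fst ` set t" if "x \<in> set u" for x
      using subsetD[OF u(1) that] by (simp add: mem_Times_iff)
    then have "fst ` set u \<inter> fst ` set t = {}" by blast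
    moreover have "set u \<subseteq> {..<n} \<times> carrier G" using u(1) by blast
    ultimately show ?thesis using u(2,3) t that(3) by (simp add: inj_words_def)
  qed
  have WF: "\<sigma> q v \<in> WF \<and> wordf (m - Suc q) (\<sigma> q v) = app (drop q v) (s (B (drop q v)) (take q v))"
    if q: "q < m" "m \<le> n" and v: "v \<in> inj_words (carrier G) {..<n} (q + (n - m))" for q m v
  proof -
    obtain u t where ut: "v = u @ t" "length t = n - m" "take q v = u" "drop q v = t" using splitv[OF v] by blast
    have tt: "card (B t) = m" "u \<in> inj_words (carrier G) (B t) q"
      using tail[of u t q m] v ut q by auto
    have sc: "s (B t) u \<in> chains (carrier G) (B t) (Suc q)" by (rule s1) (use tt q in \<open>auto simp: B_def\<close>)
    have rr: "r (w @ t) \<in> carrier W" "word_of n (m - Suc q) (r (w @ t)) = w @ t"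
      if "w \<in> Poly_Mapping.keys (s (B t) u)" for w
    proof -
      have "w \<in> inj_words (carrier G) (B t) (Suc q)" using sc that by (auto simp: chains_def)
      then have "w @ t \<in> inj_words (carrier G) {..<n} (Suc q + (n - m))" using join v ut by blast
      from r[OF this] show "r (w @ t) \<in> carrier W" "word_of n (m - Suc q) (r (w @ t)) = w @ t"
        using q by auto
    qed
    have "\<sigma> q v \<in> WF" unfolding \<sigma>_def ut(3,4) by (rule frag_extend_mem[OF subgrp_keys]) (simp add: rr)
    moreover have "wordf (m - Suc q) (\<sigma> q v) = frag_extend (\<lambda>w. frag_of (word_of n (m - Suc q) (r (w @ t)))) (s (B t) u)"
      unfolding \<sigma>_def ut(3,4) frag_extend_compose[OF addv_wordf] by (simp add: wordf_def)
    moreover have "\<dots> = app t (s (B t) u)"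
      unfolding app_def by (rule frag_extend_eq) (simp add: rr)
    ultimately show ?thesis using ut by simp
  qed
  show ?thesis
  proof (rule that)
    show "\<sigma> (Suc p) v \<in> WF" if "p + 2 \<le> m" "m \<le> n" "v \<in> inj_words (carrier G) {..<n} (Suc p + (n - m))" for m p v
      using WF[of "Suc p" m v] that by simp
    show "\<sigma> p v \<in> WF" if "p + 2 \<le> m" "m \<le> n" "v \<in> inj_words (carrier G) {..<n} (p + (n - m))" for m p v
      using WF[of p m v] that by simp
    fix m p v assume p: "p + 2 \<le> m" "m \<le> n" and v: "v \<in> inj_words (carrier G) {..<n} (Suc p + (n - m))"
    obtain u t where ut: "v = u @ t" "length t = n - m" "take (Suc p) v = u" "drop (Suc p) v = t" using splitv[OF v] by blast
    have tt: "card (B t) = m" "u \<in> inj_words (carrier G) (B t) (Suc p)"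
      using tail[of u t "Suc p" m] v ut p by auto
    have fin: "finite (B t)" by (simp add: B_def)
    have "s (B t) u \<in> chains (carrier G) (B t) (Suc (Suc p))" by (rule s1[OF fin _ tt(2)]) (use tt p in simp)
    then have "frag_extend (tdiff (Suc (Suc p))) (app t (s (B t) u)) = app t (bd (s (B t) u))"
      by (intro tdiff_app) (auto simp: chains_def inj_words_def)
    then have 1: "frag_extend (tdiff (Suc (Suc p))) (wordf (m - Suc (Suc p)) (\<sigma> (Suc p) v)) = app t (bd (s (B t) u))"
      using WF[of "Suc p" m v] p v ut by simp
    have wd: "word_diff u \<in> chains (carrier G) (B t) p" by (rule word_diff_chain[OF tt(2)])
    have "wordf (m - Suc p) (frag_extend (\<sigma> p) (tdiff (Suc p) v)) =
        frag_extend (\<lambda>w. wordf (m - Suc p) (\<sigma> p (w @ t))) (word_diff u)"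
      unfolding tdiff_def ut(3,4) app_def frag_extend_compose[OF addv_wordf]
      by (simp add: frag_extend_compose[OF addv_frag_extend])
    also have "\<dots> = frag_extend (\<lambda>w. app t (s (B t) w)) (word_diff u)"
    proof (rule frag_extend_eq)
      fix w assume "w \<in> Poly_Mapping.keys (word_diff u)"
      then have w: "w \<in> inj_words (carrier G) (B t) p" using wd by (auto simp: chains_def)
      then have "w @ t \<in> inj_words (carrier G) {..<n} (p + (n - m))" using join v ut by blast
      moreover have "length w = p" using w by (simp add: inj_words_def)
      ultimately show "wordf (m - Suc p) (\<sigma> p (w @ t)) = app t (s (B t) w)"
        using WF[of p m "w @ t"] p by simp
    qed
    also have "\<dots> = app t (frag_extend (s (B t)) (word_diff u))"
      by (simp add: frag_extend_compose[OF addv_app])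
    finally have 2: "wordf (m - Suc p) (frag_extend (\<sigma> p) (tdiff (Suc p) v)) =
        app t (frag_extend (s (B t)) (word_diff u))" .
    have "frag_of u = bd (s (B t) u) + frag_extend (s (B t)) (word_diff u)"
      by (rule s2[OF fin _ tt(2)]) (use tt p in simp)
    from arg_cong[OF this, of "app t"] show "frag_extend (tdiff (Suc (Suc p))) (wordf (m - Suc (Suc p)) (\<sigma> (Suc p) v)) +
      wordf (m - Suc p) (frag_extend (\<sigma> p) (tdiff (Suc p) v)) = frag_of v"
      unfolding 1 2 by (simp add: addv_add[OF addv_app] ut(1))
  qed
qed

lemma \<Phi>_add:
  assumes "a \<in> carrier k" "b \<in> carrier k" "\<eta> \<in> WF"
  shows "\<Phi> i (a \<oplus>\<^bsub>k\<^esub> b) s \<eta> - (\<Phi> i a s \<eta> + \<Phi> i b s \<eta>) \<in> E i"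
proof -
  let ?h = "\<lambda>\<eta>. \<Phi> i (a \<oplus>\<^bsub>k\<^esub> b) s \<eta> - (\<Phi> i a s \<eta> + \<Phi> i b s \<eta>)"
  have h: "addv ?h" by (rule addvI) (simp add: addv_add[OF addv_\<Phi>])
  have "frag_extend (\<lambda>w. ?h (frag_of w)) \<eta> \<in> E i"
    by (rule frag_extend_mem[OF subE]) (use assms kmodD(4)[OF kmodW assms(1,2)] in auto)
  then show ?thesis unfolding addv_frag_expansion[OF h, of \<eta>] .
qed

text \<open>The contraction gives x = e y + \<phi> (e x) modulo coinvariance, where y and \<phi> are
  built from \<sigma>. The map \<phi> depends on words only and so descends to coinvariants, so the
  second term vanishes by hypothesis.\<close>

lemma e_exact:
  assumes p: "p + 2 \<le> m" and m: "m \<le> n" and ex: "e m p i x \<in> C (m - p) i"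
  shows "\<exists>y. x - e m (Suc p) i y \<in> C (m - Suc p) i"
proof -
  obtain \<sigma> where \<sigma>1: "\<And>m p v. \<lbrakk>p + 2 \<le> m; m \<le> n; v \<in> inj_words (carrier G) {..<n} (Suc p + (n - m))\<rbrakk> \<Longrightarrow> \<sigma> (Suc p) v \<in> WF"
    and \<sigma>2: "\<And>m p v. \<lbrakk>p + 2 \<le> m; m \<le> n; v \<in> inj_words (carrier G) {..<n} (p + (n - m))\<rbrakk> \<Longrightarrow> \<sigma> p v \<in> WF"
    and \<sigma>3: "\<And>m p v. \<lbrakk>p + 2 \<le> m; m \<le> n; v \<in> inj_words (carrier G) {..<n} (Suc p + (n - m))\<rbrakk> \<Longrightarrow>
      frag_extend (tdiff (Suc (Suc p))) (wordf (m - Suc (Suc p)) (\<sigma> (Suc p) v)) +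
      wordf (m - Suc p) (frag_extend (\<sigma> p) (tdiff (Suc p) v)) = frag_of v"
    by (rule lifted_contraction) (rule that)
  have word1: "word_of n (m - Suc p) w \<in> inj_words (carrier G) {..<n} (Suc p + (n - m))" if "w \<in> carrier W" for w
  proof -
    have "n - (m - Suc p) = Suc p + (n - m)" using p m by linarith
    then show ?thesis using word_of_inj_words[OF that, of "m - Suc p"] by metis
  qed
  have word0: "word_of n (m - p) w \<in> inj_words (carrier G) {..<n} (p + (n - m))" if "w \<in> carrier W" for w
  proof -
    have "n - (m - p) = p + (n - m)" using p m by linarith
    then show ?thesis using word_of_inj_words[OF that, of "m - p"] by metis
  qed
  \<comment> \<open>The contraction is applied to the word of w, so L takes the same value on a
    whole coset of \<open>wreath G (m - p)\<close>.\<close>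
  define L where "L a s w = \<Phi> i a s (\<sigma> p (word_of n (m - p) w))" for a s w
  have L: "L (a \<oplus>\<^bsub>k\<^esub> b) s w - (L a s w + L b s w) \<in> E i"
    if "a \<in> carrier k" "b \<in> carrier k" "s \<in> S i" "w \<in> carrier W" for a b s w
    unfolding L_def by (rule \<Phi>_add[OF that(1,2) \<sigma>2[OF p m word0[OF that(4)]]])
  obtain \<phi> where \<phi>: "addv \<phi>" "\<And>x. x \<in> E i \<Longrightarrow> \<phi> x \<in> E i"
    "\<And>x. \<phi> x - (\<Sum>(s, w)\<in>supp i x. L (c i x s w) s w) \<in> E i"
    "\<And>a v x. \<lbrakk>a \<in> carrier k; v \<in> carrier W\<rbrakk> \<Longrightarrow>
      \<phi> (op i a v x) - (\<Sum>(s, w)\<in>supp i x. L (a \<otimes>\<^bsub>k\<^esub> c i x s w) s (v \<otimes>\<^bsub>W\<^esub> w)) \<in> E i"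
    by (rule kmod_dual_basis.extension[OF basis[of i] subE[of i] L]) (assumption+, rule that)
  have op1: "\<phi> (op i \<one>\<^bsub>k\<^esub> v y) - (\<Sum>(s, w)\<in>supp i y. L (c i y s w) s (v \<otimes>\<^bsub>W\<^esub> w)) \<in> E i"
    if "v \<in> carrier W" for v y
  proof -
    have "(\<Sum>(s, w)\<in>supp i y. L (\<one>\<^bsub>k\<^esub> \<otimes>\<^bsub>k\<^esub> c i y s w) s (v \<otimes>\<^bsub>W\<^esub> w)) =
        (\<Sum>(s, w)\<in>supp i y. L (c i y s w) s (v \<otimes>\<^bsub>W\<^esub> w))"
      by (rule sum.cong[OF refl]) (auto simp: dual_basisD(1)[OF db])
    then show ?thesis using \<phi>(4)[OF k.one_closed that, of y] by simp
  qed
  have \<phi>C: "\<phi> y \<in> E i" if y: "y \<in> C (m - p) i" for y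
  proof (rule addv_coinv[OF \<phi>(1) subE \<phi>(2) _ y[unfolded C_def]])
    fix v x assume v: "v \<in> carrier (wreath G (m - p))"
    have vW: "v \<in> carrier W" by (rule subsetD[OF wreath_mono v]) (use m in simp)
    have eq: "(\<Sum>(s, w)\<in>supp i x. L (c i x s w) s (v \<otimes>\<^bsub>W\<^esub> w)) = (\<Sum>(s, w)\<in>supp i x. L (c i x s w) s w)"
      by (rule sum.cong[OF refl]) (auto simp: L_def word_of_mult[OF G v])
    show "\<phi> (op i \<one>\<^bsub>k\<^esub> v x) - \<phi> x \<in> E i"
      by (rule subgrp_trans[OF subE op1[OF vW, of x, unfolded eq] subgrp_sym[OF subE \<phi>(3)]])
  qed
  \<comment> \<open>This is \<phi> (e x), with the alternating sum of shifted words collected into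
    \<open>tdiff\<close>.\<close>
  define R where "R = (\<Sum>(s, w)\<in>supp i x. \<Phi> i (c i x s w) s (frag_extend (\<sigma> p) (tdiff (Suc p) (word_of n (m - Suc p) w))))"
  have "\<phi> (e m p i x) - R \<in> E i"
  proof -
    let ?w = "shift_perm G (m - Suc p)"
    have "\<phi> (e m p i x) = (\<Sum>j\<le>p. frag_cmul ((-1) ^ j) (\<phi> (op i \<one>\<^bsub>k\<^esub> (?w j) x)))"
      using p by (simp add: e_def addv_sum[OF \<phi>(1)] addv_frag_cmul[OF \<phi>(1)])
    moreover have "(\<Sum>j\<le>p. frag_cmul ((-1) ^ j) (\<phi> (op i \<one>\<^bsub>k\<^esub> (?w j) x))) -
        (\<Sum>j\<le>p. frag_cmul ((-1) ^ j) (\<Sum>(s, w)\<in>supp i x. L (c i x s w) s (?w j \<otimes>\<^bsub>W\<^esub> w))) \<in> E i"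
    proof (rule subgrp_sum_cong[OF subE])
      fix j assume "j \<in> {..p}"
      then have "?w j \<in> carrier W" by (intro shift_closed) (use p m in auto)
      from frag_cmul_mem[OF subE op1[OF this, of x], of "(-1) ^ j"]
      show "frag_cmul ((-1) ^ j) (\<phi> (op i \<one>\<^bsub>k\<^esub> (?w j) x)) -
        frag_cmul ((-1) ^ j) (\<Sum>(s, w)\<in>supp i x. L (c i x s w) s (?w j \<otimes>\<^bsub>W\<^esub> w)) \<in> E i"
        by (simp add: frag_cmul_diff2)
    qed
    moreover have "(\<Sum>j\<le>p. frag_cmul ((-1) ^ j) (\<Sum>(s, w)\<in>supp i x. L (c i x s w) s (?w j \<otimes>\<^bsub>W\<^esub> w))) =
        (\<Sum>(s, w)\<in>supp i x. \<Sum>j\<le>p. frag_cmul ((-1) ^ j) (L (c i x s w) s (?w j \<otimes>\<^bsub>W\<^esub> w)))"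
      unfolding frag_cmul_sum by (subst sum.swap) (simp add: case_prod_beta)
    moreover have "\<dots> = R"
      unfolding R_def
    proof (rule sum.cong[OF refl], clarify)
      fix s w assume w: "w \<in> carrier W"
      show "(\<Sum>j\<le>p. frag_cmul ((-1) ^ j) (L (c i x s w) s (?w j \<otimes>\<^bsub>W\<^esub> w))) =
        \<Phi> i (c i x s w) s (frag_extend (\<sigma> p) (tdiff (Suc p) (word_of n (m - Suc p) w)))"
        using p m by (simp add: tdiff_word[OF _ m w] addv_sum[OF addv_frag_extend] frag_extend_cmul
            addv_sum[OF addv_\<Phi>] addv_frag_cmul[OF addv_\<Phi>] L_def)
    qed
    ultimately show ?thesis by simp
  qed
  then have R: "R \<in> C (m - Suc p) i"
    using \<phi>C[OF ex] subgrp_cong[OF subE] E_C by blast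
  \<comment> \<open>The part of the homotopy identity in which the contraction is applied
    first.\<close>
  define y where "y = (\<Sum>(s, w)\<in>supp i x. \<Phi> i (c i x s w) s (\<sigma> (Suc p) (word_of n (m - Suc p) w)))"
  have "(\<Sum>(s, w)\<in>supp i x. op i (c i x s w) w (u i s)) - (e m (Suc p) i y + R) \<in> C (m - Suc p) i"
    unfolding y_def R_def addv_sum[OF addv_e[OF m]] sum.distrib[symmetric]
  proof (rule subgrp_sum_cong[OF subC], clarify)
    fix s w assume s: "s \<in> S i" and w: "w \<in> carrier W"
    let ?a = "c i x s w" and ?v = "word_of n (m - Suc p) w"
    have a: "?a \<in> carrier k" by (rule dual_basisD(1)[OF db s w])
    note sWF = \<sigma>1[OF p m word1[OF w]]
    have 1: "e m (Suc p) i (\<Phi> i ?a s (\<sigma> (Suc p) ?v)) - \<Phi> i ?a s (frag_extend (ew m (Suc p)) (\<sigma> (Suc p) ?v)) \<in> C (m - Suc p) i"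
      by (rule E_C, rule e_\<Phi>[OF _ m a sWF]) (use p in simp)
    have tWF: "frag_extend (\<sigma> p) (tdiff (Suc p) ?v) \<in> WF"
    proof -
      have "\<sigma> p (word_of n (m - p) (shift_perm G (m - Suc p) j \<otimes>\<^bsub>W\<^esub> w)) \<in> WF" if "j \<le> p" for j
        using p by (intro \<sigma>2[OF p m] word0 W.m_closed[OF shift_closed[OF _ m that] w]) simp
      then have "(\<Sum>j\<le>p. frag_cmul ((-1) ^ j) (\<sigma> p (word_of n (m - p) (shift_perm G (m - Suc p) j \<otimes>\<^bsub>W\<^esub> w)))) \<in> WF"
        by (intro subgrp_sum[OF subgrp_keys] frag_cmul_mem[OF subgrp_keys]) simp
      then show ?thesis
        using p by (simp add: tdiff_word[OF _ m w] addv_sum[OF addv_frag_extend] frag_extend_cmul)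
    qed
    have eWF: "frag_extend (ew m (Suc p)) (\<sigma> (Suc p) ?v) \<in> WF"
      by (rule frag_extend_mem[OF subgrp_keys], rule ew_WF) (use p m sWF in auto)
    have "\<Phi> i ?a s (frag_of w - frag_extend (ew m (Suc p)) (\<sigma> (Suc p) ?v) - frag_extend (\<sigma> p) (tdiff (Suc p) ?v)) \<in> C (m - Suc p) i"
    proof (rule \<Phi>_coinv[OF _ a])
      show "frag_of w - frag_extend (ew m (Suc p)) (\<sigma> (Suc p) ?v) - frag_extend (\<sigma> p) (tdiff (Suc p) ?v) \<in> WF"
        by (intro subgrp_diff[OF subgrp_keys] tWF eWF) (simp add: w)
      have "wordf (m - Suc p) (frag_extend (ew m (Suc p)) (\<sigma> (Suc p) ?v)) =
          frag_extend (tdiff (Suc (Suc p))) (wordf (m - Suc (Suc p)) (\<sigma> (Suc p) ?v))"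
        by (rule wordf_ew[OF _ m sWF]) (use p in simp)
      then have "wordf (m - Suc p) (frag_of w) = wordf (m - Suc p) (frag_extend (ew m (Suc p)) (\<sigma> (Suc p) ?v)) +
          wordf (m - Suc p) (frag_extend (\<sigma> p) (tdiff (Suc p) ?v))"
        using \<sigma>3[OF p m word1[OF w]] by (simp add: wordf_def)
      then show "wordf (m - Suc p) (frag_of w - frag_extend (ew m (Suc p)) (\<sigma> (Suc p) ?v) -
          frag_extend (\<sigma> p) (tdiff (Suc p) ?v)) = 0"
        by (simp add: addv_diff[OF addv_wordf])
    qed (use m in simp)
    note 2 = subgrp_diff[OF subC this 1]
    show "op i ?a w (u i s) - (e m (Suc p) i (\<Phi> i ?a s (\<sigma> (Suc p) ?v)) +
        \<Phi> i ?a s (frag_extend (\<sigma> p) (tdiff (Suc p) ?v))) \<in> C (m - Suc p) i"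
    proof (rule subst[of _ _ "\<lambda>z. z \<in> C (m - Suc p) i", OF _ 2])
    qed (simp add: addv_diff[OF addv_\<Phi>])
  qed
  from subgrp_trans[OF subC E_C[OF dual_basisD(6)[OF db, of x i]] this]
  have "x - (e m (Suc p) i y + R) \<in> C (m - Suc p) i" .
  from subgrp_add[OF subC this R] have "x - e m (Suc p) i y \<in> C (m - Suc p) i" by simp
  then show ?thesis by blast
qed

lemma stability_complex_words:
  assumes m: "m \<le> n" shows "stability_complex (\<lambda>p i. C (m - p) i) d (\<lambda>p i. e m p i) m"
proof (rule stability_complex.intro)
  show "subgrp (C (m - p) i)" for p i by (rule subC)
  show "addv (d i)" for i by (rule addv_d)
  show "d i x \<in> C (m - p) i" if "x \<in> C (m - p) (Suc i)" for x p i by (rule d_C[OF _ that]) (use m in simp)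
  show "d i (d (Suc i) x) \<in> C (m - p) i" for p i x by (rule E_C[OF d_d])
  show "addv (e m p i)" for p i by (rule addv_e[OF m])
  show "e m 0 i x - x \<in> C (m - 0) i" for i x
  proof (cases "0 < m")
    case True
    have "shift_perm G (m - Suc 0) 0 = \<one>\<^bsub>W\<^esub>" by (auto simp: shift_perm_def wreath_one)
    then show ?thesis using True kmodD(6)[OF kmodW] by (auto simp: e_def intro: E_C)
  qed (simp add: e_def subgrp_zero[OF subC])
  show "e m p i x \<in> C (m - p) i" if "p + 1 \<le> m" "x \<in> C (m - Suc p) i" for p x i
    by (rule e_C[OF _ m that(2)]) (use that in simp)
  show "e m p i (e m (Suc p) i x) \<in> C (m - p) i" if "p + 2 \<le> m" for p i x by (rule e_e[OF that m])
  show "d i (e m p (Suc i) x) - e m p i (d i x) \<in> C (m - p) i" if "p + 1 \<le> m" for p i x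
    by (rule E_C[OF d_e[OF _ m]]) (use that in simp)
  show "\<exists>y. x - e m (Suc p) i y \<in> C (m - Suc p) i" if "p + 2 \<le> m" "e m p i x \<in> C (m - p) i" for p i x
    by (rule e_exact[OF that(1) m that(2)])
  show "\<exists>v. e m p i x - x - d i v \<in> C (m - p) i"
    if "p + 1 \<le> m" "even p" "0 < i \<Longrightarrow> d (i - 1) x \<in> C (m - Suc p) (i - 1)" for p i x
    using e_homotopy[OF _ m that(3)] that(1,2) by simp
  show "\<exists>v. e m p i x - d i v \<in> C (m - p) i"
    if "p + 1 \<le> m" "odd p" "0 < i \<Longrightarrow> d (i - 1) x \<in> C (m - Suc p) (i - 1)" for p i x
    using e_homotopy[OF _ m that(3)] that(1,2) by simp
qed

text \<open>The induction runs over all m below n at once, every group acting on the same resolution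
  over \<open>wreath G n\<close>.\<close>

theorem wreath_stability:
  assumes "m \<le> n" "2 * q + 2 \<le> m"
  shows "stability_complex.stab_surj (\<lambda>p i. C (m - p) i) d 0 q \<and> stability_complex.stab_inj (\<lambda>p i. C (m - p) i) d 0 q"
  using assms
proof (induction q arbitrary: m rule: less_induct)
  case (less q)
  interpret M: stability_complex "\<lambda>p i. C (m - p) i" d "\<lambda>p i. e m p i" m
    by (rule stability_complex_words[OF less.prems(1)])
  show ?case
  proof (rule M.stability_step[OF less.prems(2)])
    fix p i assume i: "i < q" "2 * i + p + 2 \<le> m"
    \<comment> \<open>Column p of the double complex for m is column 0 of the one for m-p, so the
      induction hypothesis for m-p applies to it.\<close>
    interpret P: stability_complex "\<lambda>p' i. C (m - p - p') i" d "\<lambda>p' i. e (m - p) p' i" "m - p"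
      by (rule stability_complex_words) (use less.prems(1) in simp)
    have "P.stab_surj 0 i \<and> P.stab_inj 0 i" by (rule less.IH) (use i less.prems in auto)
    then show "M.stab_surj p i \<and> M.stab_inj p i"
      unfolding M.stab_surj_def M.stab_inj_def P.stab_surj_def P.stab_inj_def M.cyc_def P.cyc_def by simp
  qed
qed

end

section \<open>Brauer diagrams\<close>

lemma diagrams_edge:
  assumes "x \<in> diagrams G n" "p \<in> x"
  obtains u v where "u \<in> nodes n" "v \<in> nodes n" "u \<noteq> v" "fst p = {u, v}" "snd p \<in> carrier G"
  using assms by (fastforce simp: diagrams_def)

lemma diagramsI:
  assumes "\<And>p. p \<in> x \<Longrightarrow> snd p \<in> carrier G"
    and "\<And>p. p \<in> x \<Longrightarrow> \<exists>u\<in>nodes n. \<exists>v\<in>nodes n. u \<noteq> v \<and> fst p = {u, v}"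
    and "\<And>v. v \<in> nodes n \<Longrightarrow> \<exists>!p. p \<in> x \<and> v \<in> fst p"
  shows "x \<in> diagrams G n"
  unfolding diagrams_def using assms by (simp add: case_prod_beta)

lemma diagrams_unique:
  assumes "x \<in> diagrams G n" "p \<in> x" "q \<in> x" "v \<in> fst p" "v \<in> fst q"
  shows "p = q"
proof -
  have "v \<in> nodes n" using diagrams_edge[OF assms(1,2)] assms(4) by (metis insert_iff singletonD)
  then show ?thesis using assms by (auto simp: diagrams_def)
qed

lemma diagrams_node:
  assumes "x \<in> diagrams G n" "v \<in> nodes n" obtains p where "p \<in> x" "v \<in> fst p"
  using assms by (auto simp: diagrams_def)

text \<open>Both are perfect matchings of the same nodes, so one inclusion suffices. Products of
  diagrams are computed below by exhibiting only enough components.\<close>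

lemma diagrams_subset_eq:
  assumes x: "x \<in> diagrams G n" and y: "y \<in> diagrams G n" and sub: "x \<subseteq> y"
  shows "x = y"
proof
  show "y \<subseteq> x"
  proof
    fix p assume p: "p \<in> y"
    obtain u v where u: "u \<in> nodes n" "fst p = {u, v}" using diagrams_edge[OF y p] by metis
    obtain q where q: "q \<in> x" "u \<in> fst q" using diagrams_node[OF x u(1)] .
    then have "p = q" using diagrams_unique[OF y p _ _ q(2)] sub u by auto
    then show "p \<in> x" using q by simp
  qed
qed (rule sub)

section \<open>Components of a glued graph\<close>

abbreviation glue_adj :: "'g diagram \<Rightarrow> 'g diagram \<Rightarrow>
    (((node set \<times> 'g) + (node set \<times> 'g)) \<times> ((node set \<times> 'g) + (node set \<times> 'g))) set" where
  "glue_adj x y \<equiv> {(a, b). a \<in> x <+> y \<and> b \<in> x <+> y \<and> glued_ends a \<inter> glued_ends b \<noteq> {}}"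

lemma equiv_glue_adj: "equiv UNIV ((glue_adj x y)\<^sup>*)"
proof (rule equivI)
  show "sym ((glue_adj x y)\<^sup>*)" by (rule sym_rtrancl) (simp add: sym_def Int_commute)
  show "refl_on UNIV ((glue_adj x y)\<^sup>*)" by (rule refl_rtrancl)
  show "trans ((glue_adj x y)\<^sup>*)" by (rule trans_rtrancl)
qed simp

lemma componentE:
  assumes "C \<in> components x y"
  obtains a where "a \<in> x <+> y" "C = (glue_adj x y)\<^sup>* `` {a}"
  using assms unfolding components_def by (rule quotientE) (rule that)

lemma component_nonempty:
  assumes "C \<in> components x y" shows "\<exists>a. a \<in> C \<and> a \<in> x <+> y"
proof -
  obtain a where "a \<in> x <+> y" "C = (glue_adj x y)\<^sup>* `` {a}" using assms by (rule componentE)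
  then show ?thesis by (intro exI[of _ a]) simp
qed

lemma component_subset:
  assumes "C \<in> components x y" shows "C \<subseteq> x <+> y"
proof -
  obtain a where a: "a \<in> x <+> y" "C = (glue_adj x y)\<^sup>* `` {a}" using assms by (rule componentE)
  have reach: "b \<in> x <+> y" if "(a, b) \<in> (glue_adj x y)\<^sup>*" for b
    using that a(1) by (induction rule: rtrancl_induct) (simp, blast)
  show ?thesis
  proof
    fix b assume "b \<in> C"
    then have "(a, b) \<in> (glue_adj x y)\<^sup>*" unfolding a(2) by (rule ImageE) (simp only: singleton_iff)
    then show "b \<in> x <+> y" by (rule reach)
  qed
qed

lemma component_closed:
  assumes C: "C \<in> components x y" and "a \<in> C" "b \<in> x <+> y" "glued_ends a \<inter> glued_ends b \<noteq> {}"
  shows "b \<in> C"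
proof -
  obtain c where c: "C = (glue_adj x y)\<^sup>* `` {c}" using C by (rule componentE)
  have "(a, b) \<in> glue_adj x y" using assms component_subset[OF C] by auto
  moreover have "(c, a) \<in> (glue_adj x y)\<^sup>*" using assms(2) unfolding c by (rule ImageE) (simp only: singleton_iff)
  ultimately have "(c, b) \<in> (glue_adj x y)\<^sup>*" by (rule rtrancl_into_rtrancl[rotated])
  then show ?thesis unfolding c by (rule ImageI) simp
qed

lemma component_eq:
  assumes "C \<in> components x y" "C' \<in> components x y" "a \<in> C" "a \<in> C'"
  shows "C = C'"
proof -
  have "D \<in> UNIV // (glue_adj x y)\<^sup>*" if D': "D \<in> components x y" for D
  proof -
    obtain a where D: "D = (glue_adj x y)\<^sup>* `` {a}" using D' by (rule componentE)
    show ?thesis unfolding D by (rule quotientI) simp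
  qed
  from quotient_disj[OF equiv_glue_adj this[OF assms(1)] this[OF assms(2)]]
  show ?thesis using assms(3,4) by blast
qed

text \<open>All components needed explicitly are stars: every edge is the centre c or meets it. Then
  connectedness takes one step, and closure under adjacency gives maximality.\<close>

lemma componentI:
  assumes sub: "C \<subseteq> x <+> y" and c: "c \<in> C"
    and conn: "\<And>b. b \<in> C \<Longrightarrow> b = c \<or> glued_ends c \<inter> glued_ends b \<noteq> {}"
    and closed: "\<And>a b. \<lbrakk>b \<in> C; a \<in> x <+> y; glued_ends b \<inter> glued_ends a \<noteq> {}\<rbrakk> \<Longrightarrow> a \<in> C"
  shows "C \<in> components x y"
proof -
  have "C = (glue_adj x y)\<^sup>* `` {c}"
  proof
    show "C \<subseteq> (glue_adj x y)\<^sup>* `` {c}"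
    proof
      fix b assume b: "b \<in> C"
      have "(c, b) \<in> (glue_adj x y)\<^sup>*"
      proof (cases "b = c")
        case False
        then have "(c, b) \<in> glue_adj x y" using conn[OF b] subsetD[OF sub b] subsetD[OF sub c] by blast
        then show ?thesis by (rule r_into_rtrancl)
      qed simp
      then show "b \<in> (glue_adj x y)\<^sup>* `` {c}" by (rule ImageI) simp
    qed
    have reach: "b \<in> C" if "(c, b) \<in> (glue_adj x y)\<^sup>*" for b
      using that
    proof (induction rule: rtrancl_induct)
      case (step a b)
      then show ?case using closed[of a b] by blast
    qed (rule c)
    show "(glue_adj x y)\<^sup>* `` {c} \<subseteq> C"
    proof
      fix b assume "b \<in> (glue_adj x y)\<^sup>* `` {c}"
      then have "(c, b) \<in> (glue_adj x y)\<^sup>*" by (rule ImageE) (simp only: singleton_iff)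
      then show "b \<in> C" by (rule reach)
    qed
  qed
  moreover have "(glue_adj x y)\<^sup>* `` {c} \<in> components x y"
    unfolding components_def by (rule quotientI[OF subsetD[OF sub c]])
  ultimately show ?thesis by (simp only:)
qed

lemma glueI: "C \<in> components x y \<Longrightarrow> outer_ends C \<noteq> {} \<Longrightarrow> (outer_ends C, component_label G C) \<in> glue G x y"
  unfolding glue_def by blast

lemma in_outer_ends: "LNode i \<in> outer_ends C \<longleftrightarrow> (\<exists>a\<in>C. OuterL i \<in> glued_ends a)"
  "RNode i \<in> outer_ends C \<longleftrightarrow> (\<exists>a\<in>C. OuterR i \<in> glued_ends a)"
  by (auto simp: outer_ends_def)

lemma glued_ends_Inl: "OuterL i \<in> glued_ends (Inl p) \<longleftrightarrow> LNode i \<in> fst p"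
  "Middle i \<in> glued_ends (Inl p) \<longleftrightarrow> RNode i \<in> fst p" "OuterR i \<notin> glued_ends (Inl p)"
  by (cases p; force split: node.splits)+

lemma glued_ends_Inr: "OuterR i \<in> glued_ends (Inr p) \<longleftrightarrow> RNode i \<in> fst p"
  "Middle i \<in> glued_ends (Inr p) \<longleftrightarrow> LNode i \<in> fst p" "OuterL i \<notin> glued_ends (Inr p)"
  by (cases p; force split: node.splits)+

lemma ex_glued_node: "(\<exists>z :: glued_node. Q z) \<longleftrightarrow> (\<exists>i. Q (OuterL i)) \<or> (\<exists>i. Q (Middle i)) \<or> (\<exists>i. Q (OuterR i))"
  by (metis glued_node.exhaust)

lemma ends_meet:
  "glued_ends a \<inter> glued_ends b \<noteq> {} \<longleftrightarrow> (\<exists>i. OuterL i \<in> glued_ends a \<and> OuterL i \<in> glued_ends b) \<or>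
    (\<exists>i. Middle i \<in> glued_ends a \<and> Middle i \<in> glued_ends b) \<or> (\<exists>i. OuterR i \<in> glued_ends a \<and> OuterR i \<in> glued_ends b)"
  unfolding ex_in_conv[symmetric] ex_glued_node by auto

lemma node_set_eqI: "(\<And>i. LNode i \<in> A \<longleftrightarrow> LNode i \<in> B) \<Longrightarrow> (\<And>i. RNode i \<in> A \<longleftrightarrow> RNode i \<in> B) \<Longrightarrow> A = B"
proof (rule Set.set_eqI)
  show "v \<in> A \<longleftrightarrow> v \<in> B" if "\<And>i. LNode i \<in> A \<longleftrightarrow> LNode i \<in> B" "\<And>i. RNode i \<in> A \<longleftrightarrow> RNode i \<in> B" for v
    using that by (cases v) simp_all
qed

lemma edge_label_simps [simp]: "edge_label (Inl p) = snd p" "edge_label (Inr p) = snd p"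
  by (simp_all add: edge_label_def)

text \<open>A left cup touches no middle node, so it forms a component by itself, whatever is glued
  on the right.\<close>

lemma glue_left_cup:
  assumes "comm_group G" and x: "x \<in> diagrams G n" and y: "y \<in> diagrams G n"
    and t: "({LNode i, LNode j}, g) \<in> x"
  shows "({LNode i, LNode j}, g) \<in> glue G x y"
proof -
  interpret comm_group G by fact
  let ?t = "({LNode i, LNode j}, g)"
  have g: "g \<in> carrier G" using diagrams_edge[OF x t] by auto
  have "{Inl ?t} \<in> components x y"
  proof (rule componentI)
    fix a b assume b: "b \<in> {Inl ?t}" and a: "a \<in> x <+> y" and m: "glued_ends b \<inter> glued_ends a \<noteq> {}"
    show "a \<in> {Inl ?t}"
    proof (cases a)
      case (Inl q)
      then have "\<exists>v. v \<in> fst ?t \<and> v \<in> fst q" using m b by (auto simp: ends_meet glued_ends_Inl)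
      then show ?thesis using diagrams_unique[OF x t, of q] a Inl by auto
    next
      case (Inr q)
      then show ?thesis using m b by (auto simp: ends_meet glued_ends_Inl glued_ends_Inr)
    qed
  qed (use t in auto)
  moreover have "outer_ends {Inl ?t} = {LNode i, LNode j}"
    by (rule node_set_eqI) (auto simp: in_outer_ends glued_ends_Inl simp del: glued_ends.simps)
  moreover have "component_label G {Inl ?t} = g" using g by (simp add: component_label_def)
  ultimately show ?thesis using glueI[of "{Inl ?t}" x y G] by simp
qed

subsection \<open>Permutation diagrams\<close>

definition perm_diagram :: "nat \<Rightarrow> (nat \<Rightarrow> nat \<times> 'g) \<Rightarrow> 'g diagram" where
  "perm_diagram n w = (\<lambda>i. ({LNode i, RNode (fst (w i))}, snd (w i))) ` {..<n}"

lemma perm_diagram_horizontal: "only_horizontal (perm_diagram n w)"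
  by (auto simp: only_horizontal_def perm_diagram_def)

lemma perm_diagram_closed:
  assumes w: "w \<in> carrier (wreath G n)" shows "perm_diagram n w \<in> diagrams G n"
proof -
  have "\<exists>!p. p \<in> perm_diagram n w \<and> v \<in> fst p" if v: "v \<in> nodes n" for v
  proof (cases v)
    case (LNode i)
    then have "i < n" using v by (auto simp: nodes_def)
    then show ?thesis using LNode
      by (intro ex1I[of _ "({LNode i, RNode (fst (w i))}, snd (w i))"]) (auto simp: perm_diagram_def)
  next
    case (RNode j)
    then have "j < n" using v by (auto simp: nodes_def)
    have "(fst \<circ> w) permutes {..<n}" using w by (simp add: wreath_carrier)
    then have "j \<in> (fst \<circ> w) ` {..<n}" using permutes_image[of "fst \<circ> w" "{..<n}"] \<open>j < n\<close> by simp
    then obtain i where i: "i < n" "fst (w i) = j" by (rule imageE) simp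
    then show ?thesis using RNode
      by (intro ex1I[of _ "({LNode i, RNode j}, snd (w i))"]) (auto simp: perm_diagram_def wreathD(4)[OF w])
  qed
  moreover have "\<exists>u\<in>nodes n. \<exists>v\<in>nodes n. u \<noteq> v \<and> fst p = {u, v}" if p: "p \<in> perm_diagram n w" for p
  proof -
    obtain i where i: "i < n" "p = ({LNode i, RNode (fst (w i))}, snd (w i))" using p by (auto simp: perm_diagram_def)
    then show ?thesis using wreathD(3)[OF w i(1)]
      by (intro bexI[of _ "LNode i"] bexI[of _ "RNode (fst (w i))"]) (simp_all add: nodes_def)
  qed
  moreover have "snd p \<in> carrier G" if "p \<in> perm_diagram n w" for p
    using that wreathD(1)[OF w] by (auto simp: perm_diagram_def)
  ultimately show ?thesis by (intro diagramsI)
qed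

lemma perm_diagram_inj:
  assumes "v \<in> carrier (wreath G n)" "w \<in> carrier (wreath G n)" "perm_diagram n v = perm_diagram n w"
  shows "v = w"
proof
  fix i
  show "v i = w i"
  proof (cases "i < n")
    case True
    then have "({LNode i, RNode (fst (v i))}, snd (v i)) \<in> perm_diagram n w"
      using assms(3) by (auto simp: perm_diagram_def)
    then show ?thesis by (auto simp: perm_diagram_def doubleton_eq_iff prod_eq_iff)
  next
    case False
    then show ?thesis using wreathD(2)[OF assms(1), of i] wreathD(2)[OF assms(2), of i] by simp
  qed
qed

text \<open>Without left cups the n left nodes inject into the n right nodes, so there is no room
  for right caps. Looking at left cups alone therefore detects all diagrams that are not
  horizontal.\<close>

lemma no_left_cup_perm:
  assumes x: "x \<in> diagrams G n" and no: "\<And>i j g. ({LNode i, LNode j}, g) \<notin> x"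
    and G: "group G"
  obtains w where "w \<in> carrier (wreath G n)" "x = perm_diagram n w"
proof -
  interpret group G by (rule G)
  have "\<exists>z. ({LNode i, RNode (fst z)}, snd z) \<in> x \<and> fst z < n" if i: "i < n" for i
  proof -
    have "LNode i \<in> nodes n" using i by (simp add: nodes_def)
    then obtain p where p: "p \<in> x" "LNode i \<in> fst p" by (rule diagrams_node[OF x])
    obtain u v where uv: "u \<in> nodes n" "v \<in> nodes n" "fst p = {u, v}" using diagrams_edge[OF x p(1)] by metis
    obtain w where w: "fst p = {LNode i, w}" "w \<in> nodes n" using uv p(2) by (metis insert_commute insert_iff singletonD)
    obtain j where "w = RNode j"
    proof (cases w)
      case (LNode j)
      then show ?thesis using no[of i j "snd p"] p(1) w(1) by (metis prod.collapse)
    qed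
    then have "p = ({LNode i, RNode j}, snd p)" "j < n" using w by (auto simp: prod_eq_iff nodes_def)
    then show ?thesis using p(1) by (intro exI[of _ "(j, snd p)"]) simp
  qed
  then obtain z where z: "\<And>i. i < n \<Longrightarrow> ({LNode i, RNode (fst (z i))}, snd (z i)) \<in> x" "\<And>i. i < n \<Longrightarrow> fst (z i) < n"
    by metis
  define w where "w i = (if i < n then z i else (i, \<one>\<^bsub>G\<^esub>))" for i
  have inj: "inj_on (fst \<circ> w) {..<n}"
  proof (rule inj_onI)
    fix i j assume ij: "i \<in> {..<n}" "j \<in> {..<n}" "(fst \<circ> w) i = (fst \<circ> w) j"
    then have "({LNode i, RNode (fst (z i))}, snd (z i)) = ({LNode j, RNode (fst (z j))}, snd (z j))"
      by (intro diagrams_unique[OF x z(1) z(1), of _ _ "RNode (fst (z i))"]) (auto simp: w_def)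
    then show "i = j" by (auto simp: doubleton_eq_iff)
  qed
  then have bij: "bij_betw (fst \<circ> w) {..<n} {..<n}"
    using z(2) endo_inj_surj[of "{..<n}" "fst \<circ> w"] by (auto simp: bij_betw_def w_def image_subset_iff)
  then have "(fst \<circ> w) permutes {..<n}" by (rule bij_imp_permutes) (simp add: w_def)
  moreover have "snd (z i) \<in> carrier G" if "i < n" for i
    by (rule diagrams_edge[OF x z(1)[OF that]]) simp
  then have "snd (w i) \<in> carrier G" for i by (simp add: w_def)
  ultimately have w: "w \<in> carrier (wreath G n)" by (simp add: wreath_carrier w_def)
  moreover have "perm_diagram n w = x"
    by (rule diagrams_subset_eq[OF perm_diagram_closed[OF w] x]) (auto simp: perm_diagram_def w_def z)
  ultimately show ?thesis using that by blast
qed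

lemma horizontal_perm:
  assumes "x \<in> diagrams G n" "only_horizontal x" "group G"
  obtains w where "w \<in> carrier (wreath G n)" "x = perm_diagram n w"
proof (rule no_left_cup_perm[OF assms(1) _ assms(3)])
  show "({LNode i, LNode j}, g) \<notin> x" for i j g
    using assms(2) by (auto simp: only_horizontal_def doubleton_eq_iff)
qed (rule that)

lemma identity_perm: "identity_diagram G n = perm_diagram n \<one>\<^bsub>wreath G n\<^esub>"
  by (auto simp: identity_diagram_def perm_diagram_def wreath_one)

lemma add_strand_perm:
  "w \<in> carrier (wreath G m) \<Longrightarrow> add_strand G m (perm_diagram m w) = perm_diagram (Suc m) w"
  using wreathD(2)[of w G m m] by (simp add: add_strand_def perm_diagram_def lessThan_Suc)

lemma add_strand_closed:
  assumes "group G" and x: "x \<in> diagrams G m" shows "add_strand G m x \<in> diagrams G (Suc m)"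
proof -
  interpret group G by fact
  let ?s = "({LNode m, RNode m}, \<one>\<^bsub>G\<^esub>)"
  have nodes: "nodes (Suc m) = nodes m \<union> {LNode m, RNode m}" by (auto simp: nodes_def less_Suc_eq)
  have new: "LNode m \<notin> nodes m" "RNode m \<notin> nodes m" by (auto simp: nodes_def)
  have sub: "fst p \<subseteq> nodes m" if "p \<in> x" for p
    using diagrams_edge[OF x that] by (metis empty_subsetI insert_subset)
  have "\<exists>!p. p \<in> insert ?s x \<and> v \<in> fst p" if v: "v \<in> nodes (Suc m)" for v
  proof (cases "v \<in> nodes m")
    case True
    obtain p where p: "p \<in> x" "v \<in> fst p" using diagrams_node[OF x True] .
    show ?thesis
    proof (rule ex1I[of _ p])
      show "q = p" if "q \<in> insert ?s x \<and> v \<in> fst q" for q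
        using that True new diagrams_unique[OF x p(1) _ p(2), of q] by auto
    qed (use p in simp)
  next
    case False
    then have "v \<in> {LNode m, RNode m}" using v nodes by auto
    then show ?thesis
      by (intro ex1I[of _ ?s]) (use False sub in auto)
  qed
  moreover have "\<exists>u\<in>nodes (Suc m). \<exists>v\<in>nodes (Suc m). u \<noteq> v \<and> fst p = {u, v}" "snd p \<in> carrier G" if "p \<in> insert ?s x" for p
  proof -
    show "\<exists>u\<in>nodes (Suc m). \<exists>v\<in>nodes (Suc m). u \<noteq> v \<and> fst p = {u, v}"
    proof (cases "p = ?s")
      case True
      then show ?thesis by (intro bexI[of _ "LNode m"] bexI[of _ "RNode m"]) (simp_all add: nodes)
    next
      case False
      then have "p \<in> x" using that by simp
      then obtain u v where "u \<in> nodes m" "v \<in> nodes m" "u \<noteq> v" "fst p = {u, v}" by (rule diagrams_edge[OF x])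
      then show ?thesis using nodes by blast
    qed
    show "snd p \<in> carrier G" using that diagrams_edge[OF x, of p] by auto
  qed
  ultimately show ?thesis unfolding add_strand_def by (intro diagramsI)
qed

lemma add_strand_horizontal: "only_horizontal (add_strand G m x) \<longleftrightarrow> only_horizontal x"
  by (auto simp: only_horizontal_def add_strand_def)

lemma component_perm_outer:
  assumes "C \<in> components (perm_diagram n v) (perm_diagram n w)" shows "outer_ends C \<noteq> {}"
proof -
  obtain a where "a \<in> C" "a \<in> perm_diagram n v <+> perm_diagram n w" using component_nonempty[OF assms] by blast
  then have "(\<exists>i. OuterL i \<in> glued_ends a) \<or> (\<exists>i. OuterR i \<in> glued_ends a)"
    by (auto simp: perm_diagram_def)
  then show ?thesis using \<open>a \<in> C\<close> in_outer_ends by blast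
qed

text \<open>Each left node lies in a component of two edges, one from either diagram; the
  permutation after composition and the product of the labels are read off from it.\<close>

lemma glue_perm:
  assumes "comm_group G" and v: "v \<in> carrier (wreath G n)" and w: "w \<in> carrier (wreath G n)"
  shows "perm_diagram n (v \<otimes>\<^bsub>wreath G n\<^esub> w) \<subseteq> glue G (perm_diagram n v) (perm_diagram n w)"
proof
  interpret comm_group G by fact
  fix p assume "p \<in> perm_diagram n (v \<otimes>\<^bsub>wreath G n\<^esub> w)"
  then obtain i where i: "i < n" and p: "p = ({LNode i, RNode (fst (w (fst (v i))))}, snd (v i) \<otimes>\<^bsub>G\<^esub> snd (w (fst (v i))))"
    by (auto simp: perm_diagram_def wreath_mult)
  let ?j = "fst (v i)"
  let ?a = "({LNode i, RNode ?j}, snd (v i))" and ?b = "({LNode ?j, RNode (fst (w ?j))}, snd (w ?j))"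
  have j: "?j < n" by (rule wreathD(3)[OF v i])
  have a: "?a \<in> perm_diagram n v" and b: "?b \<in> perm_diagram n w" using i j by (auto simp: perm_diagram_def)
  let ?C = "{Inl ?a, Inr ?b}"
  have "?C \<in> components (perm_diagram n v) (perm_diagram n w)"
  proof (rule componentI)
    show "?C \<subseteq> perm_diagram n v <+> perm_diagram n w" using a b by auto
    show "Inl ?a \<in> ?C" by simp
    show "c = Inl ?a \<or> glued_ends (Inl ?a) \<inter> glued_ends c \<noteq> {}" if "c \<in> ?C" for c
      using that by auto
    fix c d assume c: "c \<in> ?C" and d: "d \<in> perm_diagram n v <+> perm_diagram n w"
      and m: "glued_ends c \<inter> glued_ends d \<noteq> {}"
    show "d \<in> ?C"
    proof (cases d)
      case (Inl q)
      then have q: "q \<in> perm_diagram n v" using d by auto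
      have "\<exists>u. u \<in> fst ?a \<and> u \<in> fst q" using c m Inl by (auto simp: ends_meet glued_ends_Inl glued_ends_Inr)
      then show ?thesis using diagrams_unique[OF perm_diagram_closed[OF v] a q] Inl by auto
    next
      case (Inr q)
      then have q: "q \<in> perm_diagram n w" using d by auto
      have "\<exists>u. u \<in> fst ?b \<and> u \<in> fst q" using c m Inr by (auto simp: ends_meet glued_ends_Inl glued_ends_Inr)
      then show ?thesis using diagrams_unique[OF perm_diagram_closed[OF w] b q] Inr by auto
    qed
  qed
  moreover have "outer_ends ?C = fst p"
    unfolding p by (rule node_set_eqI) (auto simp: in_outer_ends glued_ends_Inl glued_ends_Inr simp del: glued_ends.simps)
  moreover have "component_label G ?C = snd p"
    using wreathD(1)[OF v] wreathD(1)[OF w] by (simp add: component_label_def p)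
  ultimately show "p \<in> glue G (perm_diagram n v) (perm_diagram n w)"
    using glueI[of ?C "perm_diagram n v" "perm_diagram n w" G] p by auto
qed

subsection \<open>Cup-cap diagrams\<close>

text \<open>The left cup carries the label g and the right cap the trivial one, so the loop closed
  against a cup labelled g has label g.\<close>

definition cupcap :: "('g, 'x) monoid_scheme \<Rightarrow> nat \<Rightarrow> nat \<Rightarrow> nat \<Rightarrow> 'g \<Rightarrow> 'g diagram" where
  "cupcap G n i j g = {({LNode i, LNode j}, g), ({RNode i, RNode j}, \<one>\<^bsub>G\<^esub>)} \<union>
    (\<lambda>a. ({LNode a, RNode a}, \<one>\<^bsub>G\<^esub>)) ` ({..<n} - {i, j})"

context
  fixes G :: "('g, 'x) monoid_scheme" and n i j :: nat and g :: 'g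
  assumes G: "comm_group G" and ij: "i < n" "j < n" "i \<noteq> j" and g: "g \<in> carrier G"
begin

interpretation comm_group G by (rule G)

lemma cupcap_closed: "cupcap G n i j g \<in> diagrams G n"
proof -
  have "\<exists>!p. p \<in> cupcap G n i j g \<and> v \<in> fst p" if v: "v \<in> nodes n" for v
  proof (cases v)
    case (LNode a)
    then have "a < n" using v by (auto simp: nodes_def)
    then show ?thesis using LNode
      by (intro ex1I[of _ "if a = i \<or> a = j then ({LNode i, LNode j}, g) else ({LNode a, RNode a}, \<one>\<^bsub>G\<^esub>)"])
        (auto simp: cupcap_def split: if_splits)
  next
    case (RNode a)
    then have "a < n" using v by (auto simp: nodes_def)
    then show ?thesis using RNode
      by (intro ex1I[of _ "if a = i \<or> a = j then ({RNode i, RNode j}, \<one>\<^bsub>G\<^esub>) else ({LNode a, RNode a}, \<one>\<^bsub>G\<^esub>)"])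
        (auto simp: cupcap_def split: if_splits)
  qed
  moreover have "\<exists>u\<in>nodes n. \<exists>v\<in>nodes n. u \<noteq> v \<and> fst p = {u, v}" if p: "p \<in> cupcap G n i j g" for p
  proof -
    have "fst p = {LNode i, LNode j} \<or> fst p = {RNode i, RNode j} \<or> (\<exists>a<n. fst p = {LNode a, RNode a})"
      using p by (auto simp: cupcap_def)
    then consider "fst p = {LNode i, LNode j}" | "fst p = {RNode i, RNode j}" | a where "a < n" "fst p = {LNode a, RNode a}"
      by blast
    then show ?thesis
    proof cases
      case 1
      then show ?thesis using ij by (intro bexI[of _ "LNode i"] bexI[of _ "LNode j"]) (simp_all add: nodes_def)
    next
      case 2
      then show ?thesis using ij by (intro bexI[of _ "RNode i"] bexI[of _ "RNode j"]) (simp_all add: nodes_def)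
    next
      case (3 a)
      then show ?thesis by (intro bexI[of _ "LNode a"] bexI[of _ "RNode a"]) (simp_all add: nodes_def)
    qed
  qed
  moreover have "snd p \<in> carrier G" if "p \<in> cupcap G n i j g" for p
    using that g by (auto simp: cupcap_def)
  ultimately show ?thesis by (intro diagramsI)
qed

lemma cupcap_not_horizontal: "\<not> only_horizontal (cupcap G n i j g)"
  by (auto simp: only_horizontal_def cupcap_def doubleton_eq_iff)

lemma cupcap_edge:
  assumes p: "p \<in> cupcap G n i j g"
  shows "LNode a \<in> fst p \<Longrightarrow> a \<noteq> i \<Longrightarrow> a \<noteq> j \<Longrightarrow> p = ({LNode a, RNode a}, \<one>\<^bsub>G\<^esub>)"
    and "RNode a \<in> fst p \<Longrightarrow> a \<noteq> i \<Longrightarrow> a \<noteq> j \<Longrightarrow> p = ({LNode a, RNode a}, \<one>\<^bsub>G\<^esub>)"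
    and "RNode a \<in> fst p \<Longrightarrow> a = i \<or> a = j \<Longrightarrow> p = ({RNode i, RNode j}, \<one>\<^bsub>G\<^esub>)"
  using p by (auto simp: cupcap_def)

text \<open>The edge meets, at its left ends, only straight strands with trivial label. Its
  component has the same outer ends and the same label. The cup need not occur in x, which lets
  other cups survive multiplication.\<close>

lemma glue_cupcap_edge:
  assumes x: "x \<in> diagrams G n" and p: "p \<in> x" "LNode i \<notin> fst p" "LNode j \<notin> fst p"
  shows "p \<in> glue G (cupcap G n i j g) x"
proof -
  let ?d = "cupcap G n i j g"
  let ?I = "{a. LNode a \<in> fst p}"
  let ?id = "\<lambda>a. Inl ({LNode a, RNode a}, \<one>\<^bsub>G\<^esub>) :: (node set \<times> 'g) + (node set \<times> 'g)"
  let ?C = "insert (Inr p) (?id ` ?I)"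
  obtain u v where uv: "u \<in> nodes n" "v \<in> nodes n" "fst p = {u, v}" "snd p \<in> carrier G"
    using diagrams_edge[OF x p(1)] by metis
  have In: "a < n" "a \<noteq> i" "a \<noteq> j" if "a \<in> ?I" for a
    using that p uv by (auto simp: nodes_def)
  have fin: "finite ?I" using In by (intro finite_subset[of ?I "{..<n}"]) auto
  have C: "?C \<in> components ?d x"
  proof (rule componentI)
    show "?C \<subseteq> ?d <+> x" using p In by (auto simp: cupcap_def)
    show "Inr p \<in> ?C" by simp
    show "c = Inr p \<or> glued_ends (Inr p) \<inter> glued_ends c \<noteq> {}" if "c \<in> ?C" for c
      using that by (auto simp: ends_meet glued_ends_Inl glued_ends_Inr simp del: glued_ends.simps)
    fix c b assume b: "b \<in> ?C" and c: "c \<in> ?d <+> x" and m: "glued_ends b \<inter> glued_ends c \<noteq> {}"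
    show "c \<in> ?C"
    proof (cases c)
      case (Inl q)
      then have q: "q \<in> ?d" using c by auto
      have "\<exists>a\<in>?I. LNode a \<in> fst q \<or> RNode a \<in> fst q"
        using b m Inl by (auto simp: ends_meet glued_ends_Inl glued_ends_Inr simp del: glued_ends.simps)
      then show ?thesis using cupcap_edge(1,2)[OF q] In Inl by blast
    next
      case (Inr q)
      then have q: "q \<in> x" using c by auto
      have "\<exists>u. u \<in> fst p \<and> u \<in> fst q"
        using b m Inr by (auto simp: ends_meet glued_ends_Inl glued_ends_Inr simp del: glued_ends.simps)
      then show ?thesis using diagrams_unique[OF x p(1) q] Inr by auto
    qed
  qed
  have o: "outer_ends ?C = fst p"
    by (rule node_set_eqI) (auto simp: in_outer_ends glued_ends_Inl glued_ends_Inr simp del: glued_ends.simps)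
  have l: "component_label G ?C = snd p"
  proof -
    have "finprod G edge_label (?id ` ?I) = \<one>\<^bsub>G\<^esub>"
      by (rule finprod_one_eqI) auto
    moreover have "edge_label \<in> ?id ` ?I \<rightarrow> carrier G" by auto
    moreover have "finite (?id ` ?I)" "Inr p \<notin> ?id ` ?I" using fin by auto
    ultimately show ?thesis
      using finprod_insert[of "?id ` ?I" "Inr p" edge_label] uv(4) by (simp add: component_label_def)
  qed
  have "(outer_ends ?C, component_label G ?C) \<in> glue G ?d x" by (rule glueI[OF C]) (simp only: o, simp add: uv(3))
  then show ?thesis by (simp only: o l prod.collapse)
qed

lemma glue_cupcap:
  assumes x: "x \<in> diagrams G n" and s: "({LNode i, LNode j}, g) \<in> x"
  shows "x \<subseteq> glue G (cupcap G n i j g) x"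
proof
  fix p assume p: "p \<in> x"
  show "p \<in> glue G (cupcap G n i j g) x"
  proof (cases "LNode i \<in> fst p \<or> LNode j \<in> fst p")
    case True
    then have "p = ({LNode i, LNode j}, g)" using diagrams_unique[OF x p s] by auto
    then show ?thesis using glue_left_cup[OF G cupcap_closed x, of i j g] by (simp add: cupcap_def)
  next
    case False
    then show ?thesis using glue_cupcap_edge[OF x p] by blast
  qed
qed

text \<open>The right cap and the matching left cup close up to a loop, and there is no other: any
  further middle node is attached to a strand leading to an outer node.\<close>

lemma loop_cupcap:
  assumes x: "x \<in> diagrams G n" and s: "({LNode i, LNode j}, g) \<in> x"
    and k: "cring k" and act: "act g \<delta> \<in> carrier k"
  shows "loop_factor G k act \<delta> (cupcap G n i j g) x = act g \<delta>"
proof -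
  interpret k: cring k by (rule k)
  let ?d = "cupcap G n i j g"
  let ?r = "({RNode i, RNode j}, \<one>\<^bsub>G\<^esub>)" and ?s = "({LNode i, LNode j}, g)"
  let ?C = "{Inl ?r, Inr ?s}"
  have r: "?r \<in> ?d" by (simp add: cupcap_def)
  have C: "?C \<in> components ?d x"
  proof (rule componentI)
    show "?C \<subseteq> ?d <+> x" using r s by auto
    show "Inl ?r \<in> ?C" by simp
    show "c = Inl ?r \<or> glued_ends (Inl ?r) \<inter> glued_ends c \<noteq> {}" if "c \<in> ?C" for c
      using that by auto
    fix c b assume b: "b \<in> ?C" and c: "c \<in> ?d <+> x" and m: "glued_ends b \<inter> glued_ends c \<noteq> {}"
    show "c \<in> ?C"
    proof (cases c)
      case (Inl q)
      then have q: "q \<in> ?d" using c by auto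
      have "\<exists>u. u \<in> fst ?r \<and> u \<in> fst q"
        using b m Inl by (auto simp: ends_meet glued_ends_Inl glued_ends_Inr simp del: glued_ends.simps)
      then show ?thesis using diagrams_unique[OF cupcap_closed r q] Inl by auto
    next
      case (Inr q)
      then have q: "q \<in> x" using c by auto
      have "\<exists>u. u \<in> fst ?s \<and> u \<in> fst q"
        using b m Inr by (auto simp: ends_meet glued_ends_Inl glued_ends_Inr simp del: glued_ends.simps)
      then show ?thesis using diagrams_unique[OF x s q] Inr by auto
    qed
  qed
  have oC: "outer_ends ?C = {}"
    by (rule node_set_eqI) (auto simp: in_outer_ends glued_ends_Inl glued_ends_Inr simp del: glued_ends.simps)
  have "C' = ?C" if C': "C' \<in> components ?d x" "outer_ends C' = {}" for C'
  proof -
    have no: "OuterL a \<notin> glued_ends c" "OuterR a \<notin> glued_ends c" if "c \<in> C'" for a c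
      using that C'(2) in_outer_ends by blast+
    obtain c where c: "c \<in> C'" "c \<in> ?d <+> x" using component_nonempty[OF C'(1)] by blast
    have "c \<in> ?C"
    proof (cases c)
      case (Inl q)
      then have q: "q \<in> ?d" using c by auto
      have "\<forall>a. LNode a \<notin> fst q" using no(1)[OF c(1)] Inl by (simp add: glued_ends_Inl)
      then show ?thesis using q Inl by (auto simp: cupcap_def)
    next
      case (Inr q)
      then have q: "q \<in> x" using c by auto
      obtain u v where uv: "u \<in> nodes n" "fst q = {u, v}" using diagrams_edge[OF x q] by metis
      obtain a where a: "u = LNode a" "a < n"
      proof (cases u)
        case (RNode a)
        then show ?thesis using no(2)[OF c(1), of a] Inr uv by (simp add: glued_ends_Inr)
      qed (use uv in \<open>auto simp: nodes_def\<close>)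
      \<comment> \<open>At any other left node a the straight strand of \<open>cupcap\<close> would
        belong to the component and give it an outer end.\<close>
      have "a = i \<or> a = j"
      proof (rule ccontr)
        assume na: "\<not> (a = i \<or> a = j)"
        let ?e = "Inl ({LNode a, RNode a}, \<one>\<^bsub>G\<^esub>) :: (node set \<times> 'g) + (node set \<times> 'g)"
        have "?e \<in> C'"
        proof (rule component_closed[OF C'(1) c(1)])
          show "?e \<in> ?d <+> x" using na a by (auto simp: cupcap_def)
          show "glued_ends c \<inter> glued_ends ?e \<noteq> {}"
            using Inr uv a by (auto simp: ends_meet glued_ends_Inl glued_ends_Inr simp del: glued_ends.simps)
        qed
        then show False using no(1)[of ?e a] by (simp add: glued_ends_Inl del: glued_ends.simps)
      qed
      then have "q = ?s" using diagrams_unique[OF x q s, of u] uv a by auto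
      then show ?thesis using Inr by simp
    qed
    then show ?thesis using component_eq[OF C'(1) C c(1)] by blast
  qed
  then have "{C \<in> components ?d x. outer_ends C = {}} = {?C}" using C oC by blast
  moreover have "component_label G ?C = g" using g by (simp add: component_label_def)
  ultimately show ?thesis using act by (simp add: loop_factor_def k.finprod_singleton)
qed

end

section \<open>Modules as quotients of free abelian groups\<close>

text \<open>A homomorphism from the free abelian group on the whole type onto M that sends
  generators in the carrier to themselves. It makes M a quotient of an additive type by
  \<open>ev_kernel\<close>.\<close>

definition module_ev :: "('a, 'p, 's) module_scheme \<Rightarrow> ('p \<Rightarrow>\<^sub>0 int) \<Rightarrow> 'p" where
  "module_ev M = (SOME h. (\<forall>x y. h (x + y) = h x \<oplus>\<^bsub>M\<^esub> h y) \<and> (\<forall>x. h x \<in> carrier M) \<and>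
    (\<forall>p\<in>carrier M. h (frag_of p) = p))"

definition ev_kernel :: "('a, 'p, 's) module_scheme \<Rightarrow> ('p \<Rightarrow>\<^sub>0 int) set" where
  "ev_kernel M = {x. module_ev M x = \<zero>\<^bsub>M\<^esub>}"

context
  fixes M :: "('a, 'p, 's) module_scheme"
  assumes M: "abelian_group M"
begin

interpretation abelian_group M by (rule M)

lemma module_ev:
  shows "module_ev M (x + y) = module_ev M x \<oplus>\<^bsub>M\<^esub> module_ev M y" and "module_ev M x \<in> carrier M"
    and "p \<in> carrier M \<Longrightarrow> module_ev M (frag_of p) = p"
proof -
  let ?Q = "\<lambda>h. (\<forall>x y. h (x + y) = h x \<oplus>\<^bsub>M\<^esub> h y) \<and> (\<forall>x. h x \<in> carrier M) \<and>
    (\<forall>p\<in>carrier M. h (frag_of p) = p)"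
  let ?F = "free_Abelian_group (carrier M)"
  have "comm_group (add_monoid M)" by (rule a_comm_group)
  then obtain h where h: "h \<in> hom ?F (add_monoid M)" "\<And>x. x \<in> carrier M \<Longrightarrow> h (frag_of x) = x"
    using comm_group.free_Abelian_group_universal[of "add_monoid M" "\<lambda>x. x" "carrier M"] by auto
  \<comment> \<open>Generators outside the carrier are sent to zero before the universal property is
    applied.\<close>
  let ?r = "frag_extend (\<lambda>p. if p \<in> carrier M then frag_of p else 0)"
  have r: "Poly_Mapping.keys (?r x) \<subseteq> carrier M" for x
    using frag_extend_mem[OF subgrp_keys, of x "\<lambda>p. if p \<in> carrier M then frag_of p else 0" "carrier M"] by auto
  have "?Q (\<lambda>x. h (?r x))"
    using h(1) r h(2) by (simp add: hom_def Pi_def frag_extend_add)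
  from someI[of ?Q, OF this] have "?Q (module_ev M)" unfolding module_ev_def .
  then show "module_ev M (x + y) = module_ev M x \<oplus>\<^bsub>M\<^esub> module_ev M y" "module_ev M x \<in> carrier M"
    "p \<in> carrier M \<Longrightarrow> module_ev M (frag_of p) = p" by auto
qed

lemma module_ev_zero: "module_ev M 0 = \<zero>\<^bsub>M\<^esub>"
  using module_ev(1)[of 0 0] module_ev(2)[of 0] by (simp add: add.r_cancel_one')

lemma module_ev_diff: "module_ev M (x - y) = module_ev M x \<ominus>\<^bsub>M\<^esub> module_ev M y"
proof -
  have "module_ev M x = module_ev M (x - y) \<oplus>\<^bsub>M\<^esub> module_ev M y" using module_ev(1)[of "x - y" y] by simp
  then show ?thesis using module_ev(2) by (simp add: minus_eq a_assoc r_neg)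
qed

lemma ev_kernel_diff: "x - y \<in> ev_kernel M \<longleftrightarrow> module_ev M x = module_ev M y"
proof
  note c = module_ev(2)[of x] module_ev(2)[of y]
  assume "x - y \<in> ev_kernel M"
  then have "module_ev M x \<ominus>\<^bsub>M\<^esub> module_ev M y = \<zero>\<^bsub>M\<^esub>" by (simp add: ev_kernel_def module_ev_diff)
  then have "module_ev M x \<ominus>\<^bsub>M\<^esub> module_ev M y \<oplus>\<^bsub>M\<^esub> module_ev M y = module_ev M y" using c by simp
  then show "module_ev M x = module_ev M y" using c by (simp add: minus_eq a_assoc l_neg)
next
  assume "module_ev M x = module_ev M y"
  then show "x - y \<in> ev_kernel M" using module_ev(2)[of y] by (simp add: ev_kernel_def module_ev_diff minus_eq r_neg)
qed

lemma subgrp_ev_kernel: "subgrp (ev_kernel M)"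
  by (simp add: subgrp_def ev_kernel_diff) (simp add: ev_kernel_def module_ev_zero)

end

text \<open>The generator is evaluated before f is applied, since f is controlled only on the
  carrier.\<close>

definition lift_map :: "('a, 'p, 's) module_scheme \<Rightarrow> ('p \<Rightarrow> 'q) \<Rightarrow> ('p \<Rightarrow>\<^sub>0 int) \<Rightarrow> ('q \<Rightarrow>\<^sub>0 int)" where
  "lift_map M f = frag_extend (\<lambda>p. frag_of (f (module_ev M (frag_of p))))"

lemma addv_lift_map: "addv (lift_map M f)"
  by (simp add: lift_map_def addv_frag_extend)

lemma ev_lift_map:
  assumes M: "abelian_group M" and N: "abelian_group N" and f: "f \<in> carrier M \<rightarrow> carrier N"
    and add: "\<And>x y. \<lbrakk>x \<in> carrier M; y \<in> carrier M\<rbrakk> \<Longrightarrow> f (x \<oplus>\<^bsub>M\<^esub> y) = f x \<oplus>\<^bsub>N\<^esub> f y"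
  shows "module_ev N (lift_map M f x) = f (module_ev M x)"
proof -
  interpret M: abelian_group M by (rule M)
  interpret N: abelian_group N by (rule N)
  note ev = module_ev[OF M]
  have fc: "f p \<in> carrier N" if "p \<in> carrier M" for p using f that by auto
  have f0: "f \<zero>\<^bsub>M\<^esub> = \<zero>\<^bsub>N\<^esub>"
    using add[of "\<zero>\<^bsub>M\<^esub>" "\<zero>\<^bsub>M\<^esub>"] fc[OF M.zero_closed] by (simp add: N.add.r_cancel_one')
  have "Poly_Mapping.keys x \<subseteq> UNIV" by simp
  then show ?thesis
  proof (induction x rule: frag_induction)
    case zero
    then show ?case by (simp add: addv_zero[OF addv_lift_map] module_ev_zero[OF N] module_ev_zero[OF M] f0)
  next
    case (one p)
    then show ?case by (simp add: lift_map_def module_ev(3)[OF N] fc ev(2))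
  next
    case (diff a b)
    have "f (module_ev M a) = f (module_ev M (a - b)) \<oplus>\<^bsub>N\<^esub> f (module_ev M b)"
      using add[OF ev(2) ev(2), of "a - b" b] ev(1)[of "a - b" b] by simp
    then have "f (module_ev M (a - b)) = f (module_ev M a) \<ominus>\<^bsub>N\<^esub> f (module_ev M b)"
      using fc[OF ev(2)] by (simp add: N.minus_eq N.a_assoc N.r_neg)
    then show ?case by (simp add: addv_diff[OF addv_lift_map] module_ev_diff[OF N] diff)
  qed
qed

section \<open>G-Brauer algebras\<close>

definition mono :: "('k, 'y) ring_scheme \<Rightarrow> 'k \<Rightarrow> 'd \<Rightarrow> 'd \<Rightarrow> 'k" where
  "mono k a x = (\<lambda>d. if d = x then a else \<zero>\<^bsub>k\<^esub>)"

lemma mono_zero: "mono k \<zero>\<^bsub>k\<^esub> x = (\<lambda>_. \<zero>\<^bsub>k\<^esub>)"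
  by (auto simp: mono_def)

locale GB_algebra =
  fixes G :: "('g, 'x) monoid_scheme" and k :: "('k, 'y) ring_scheme"
    and act :: "'g \<Rightarrow> 'k \<Rightarrow> 'k" and \<delta> :: 'k and n :: nat
  assumes G: "comm_group G" and Gk: "commutative_G_ring G k act" and \<delta>: "\<delta> \<in> Units k"
    and nontrivial: "\<one>\<^bsub>k\<^esub> \<noteq> \<zero>\<^bsub>k\<^esub>"
    and ring_GB: "ring (GB G k act \<delta> n)"
begin

abbreviation "A \<equiv> GB G k act \<delta> n"
abbreviation "D \<equiv> diagrams G n"
abbreviation "loop \<equiv> loop_factor G k act \<delta>"
abbreviation "W \<equiv> wreath G n"
abbreviation "pd \<equiv> perm_diagram n"

sublocale G: comm_group G by (rule G)
lemma cring_k: "cring k" using Gk by (simp add: commutative_G_ring_def)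
sublocale k: cring k by (rule cring_k)
sublocale A: ring A by (rule ring_GB)

lemma W: "group W" by (rule group_wreath[OF G.is_group])

lemma carrier_A: "carrier A = finsupp k D" by (simp add: GB_def)
lemma zero_A: "\<zero>\<^bsub>A\<^esub> = (\<lambda>_. \<zero>\<^bsub>k\<^esub>)" by (simp add: GB_def)
lemma add_A: "a \<oplus>\<^bsub>A\<^esub> b = (\<lambda>d. a d \<oplus>\<^bsub>k\<^esub> b d)" by (simp add: GB_def)
lemma one_A: "\<one>\<^bsub>A\<^esub> = mono k \<one>\<^bsub>k\<^esub> (identity_diagram G n)" by (simp add: GB_def mono_def)
lemma mult_A: "a \<otimes>\<^bsub>A\<^esub> b = (\<lambda>d. finsum k (\<lambda>(x, y). a x \<otimes>\<^bsub>k\<^esub> b y \<otimes>\<^bsub>k\<^esub> loop x y)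
       {(x, y). a x \<noteq> \<zero>\<^bsub>k\<^esub> \<and> b y \<noteq> \<zero>\<^bsub>k\<^esub> \<and> glue G x y = d})" by (simp add: GB_def)

lemma A_val: "a \<in> carrier A \<Longrightarrow> a d \<in> carrier k"
  by (cases "d \<in> D") (auto simp: carrier_A finsupp_def)

lemma A_supp: "a \<in> carrier A \<Longrightarrow> a d \<noteq> \<zero>\<^bsub>k\<^esub> \<Longrightarrow> d \<in> D"
  by (auto simp: carrier_A finsupp_def)

lemma A_fin: "a \<in> carrier A \<Longrightarrow> finite {d. a d \<noteq> \<zero>\<^bsub>k\<^esub>}"
  by (auto simp: carrier_A finsupp_def)

lemma mono_closed: "a \<in> carrier k \<Longrightarrow> x \<in> D \<Longrightarrow> mono k a x \<in> carrier A"
  by (auto simp: carrier_A finsupp_def mono_def)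

lemma mono_add: "a \<in> carrier k \<Longrightarrow> b \<in> carrier k \<Longrightarrow> mono k (a \<oplus>\<^bsub>k\<^esub> b) x = mono k a x \<oplus>\<^bsub>A\<^esub> mono k b x"
  by (auto simp: add_A mono_def)

lemma act_unit:
  assumes g: "g \<in> carrier G" shows "act g \<delta> \<in> Units k"
proof -
  have h: "act g \<in> ring_hom k k" using Gk g by (auto simp: commutative_G_ring_def ring_iso_def)
  have "act g \<delta> \<otimes>\<^bsub>k\<^esub> act g (inv\<^bsub>k\<^esub> \<delta>) = \<one>\<^bsub>k\<^esub>"
    using ring_hom_mult[OF h, of \<delta> "inv\<^bsub>k\<^esub> \<delta>"] ring_hom_one[OF h] \<delta> by (simp add: k.Units_closed)
  moreover have "act g \<delta> \<in> carrier k" "act g (inv\<^bsub>k\<^esub> \<delta>) \<in> carrier k"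
    using ring_hom_closed[OF h] \<delta> by auto
  ultimately show ?thesis by (auto simp: Units_def k.m_comm intro!: bexI[of _ "act g (inv\<^bsub>k\<^esub> \<delta>)"])
qed

text \<open>Ring automorphisms preserve units, so every loop contributes an invertible
  factor.\<close>

lemma loop_unit:
  assumes x: "x \<in> D" and y: "y \<in> D" shows "loop x y \<in> Units k"
proof -
  have lab: "component_label G C \<in> carrier G" if C: "C \<in> components x y" for C
    unfolding component_label_def
  proof (rule G.finprod_closed, rule Pi_I)
    fix a assume "a \<in> C"
    then have "a \<in> x <+> y" using component_subset[OF C] by blast
    then show "edge_label a \<in> carrier G"
      using diagrams_edge[OF x] diagrams_edge[OF y] by (auto elim!: PlusE) (metis snd_conv)+
  qed
  have "finprod k (\<lambda>C. act (component_label G C) \<delta>) B \<in> Units k" if "B \<subseteq> components x y" for B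
    using that
  proof (induction B rule: infinite_finite_induct)
    case (insert C B)
    have "(\<lambda>C. act (component_label G C) \<delta>) \<in> B \<rightarrow> carrier k" "act (component_label G C) \<delta> \<in> Units k"
      using insert.prems lab act_unit by (auto intro!: k.Units_closed)
    then show ?case using insert by (simp add: k.finprod_insert k.Units_closed)
  qed simp_all
  then show ?thesis unfolding loop_factor_def by auto
qed

lemma loop_closed: "x \<in> D \<Longrightarrow> y \<in> D \<Longrightarrow> loop x y \<in> carrier k"
  by (rule k.Units_closed[OF loop_unit])

lemma unit_nonzero: "a \<in> Units k \<Longrightarrow> a \<noteq> \<zero>\<^bsub>k\<^esub>"
  using nontrivial by (auto simp: Units_def)

lemma mono_mult:
  assumes "a \<in> carrier k" "b \<in> carrier k" "x \<in> D" "y \<in> D"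
  shows "mono k a x \<otimes>\<^bsub>A\<^esub> mono k b y = mono k (a \<otimes>\<^bsub>k\<^esub> b \<otimes>\<^bsub>k\<^esub> loop x y) (glue G x y)"
proof
  fix d
  let ?B = "{(x', y'). mono k a x x' \<noteq> \<zero>\<^bsub>k\<^esub> \<and> mono k b y y' \<noteq> \<zero>\<^bsub>k\<^esub> \<and> glue G x' y' = d}"
  have B: "?B = (if a \<noteq> \<zero>\<^bsub>k\<^esub> \<and> b \<noteq> \<zero>\<^bsub>k\<^esub> \<and> glue G x y = d then {(x, y)} else {})"
    by (auto simp: mono_def)
  show "(mono k a x \<otimes>\<^bsub>A\<^esub> mono k b y) d = mono k (a \<otimes>\<^bsub>k\<^esub> b \<otimes>\<^bsub>k\<^esub> loop x y) (glue G x y) d"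
    unfolding mult_A B using assms loop_closed[OF assms(3,4)]
    by (auto simp: mono_def k.finsum_insert)
qed

lemma mult_support:
  assumes a: "a \<in> carrier A" and "b \<in> carrier A" and "(a \<otimes>\<^bsub>A\<^esub> b) d \<noteq> \<zero>\<^bsub>k\<^esub>"
  obtains x y where "x \<in> D" "y \<in> D" "a x \<noteq> \<zero>\<^bsub>k\<^esub>" "b y \<noteq> \<zero>\<^bsub>k\<^esub>" "glue G x y = d"
proof -
  have "{(x, y). a x \<noteq> \<zero>\<^bsub>k\<^esub> \<and> b y \<noteq> \<zero>\<^bsub>k\<^esub> \<and> glue G x y = d} \<noteq> {}"
  proof
    assume "{(x, y). a x \<noteq> \<zero>\<^bsub>k\<^esub> \<and> b y \<noteq> \<zero>\<^bsub>k\<^esub> \<and> glue G x y = d} = {}"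
    then have "(a \<otimes>\<^bsub>A\<^esub> b) d = \<zero>\<^bsub>k\<^esub>" unfolding mult_A by (simp only: k.finsum_empty)
    then show False using assms(3) by simp
  qed
  then obtain x y where "a x \<noteq> \<zero>\<^bsub>k\<^esub>" "b y \<noteq> \<zero>\<^bsub>k\<^esub>" "glue G x y = d" by blast
  then show ?thesis using that A_supp assms by blast
qed

text \<open>No graph argument is made. The product of two basis elements lies in the algebra and is
  a unit multiple of the glued set, so that set lies in the support of an element of the algebra and
  is a diagram.\<close>

lemma glue_closed:
  assumes "x \<in> D" "y \<in> D" shows "glue G x y \<in> D"
proof -
  have "mono k \<one>\<^bsub>k\<^esub> x \<otimes>\<^bsub>A\<^esub> mono k \<one>\<^bsub>k\<^esub> y \<in> carrier A" using assms by (simp add: mono_closed)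
  then have "mono k (loop x y) (glue G x y) \<in> carrier A" using assms by (simp add: mono_mult loop_closed)
  from A_supp[OF this, of "glue G x y"] show ?thesis
    using unit_nonzero[OF loop_unit[OF assms]] by (simp add: mono_def)
qed

lemma pd_closed: "w \<in> carrier W \<Longrightarrow> pd w \<in> D" by (rule perm_diagram_closed)

lemma glue_pd:
  assumes "v \<in> carrier W" "w \<in> carrier W"
  shows "glue G (pd v) (pd w) = pd (v \<otimes>\<^bsub>W\<^esub> w)"
proof -
  interpret W: group W by (rule W)
  show ?thesis
    using diagrams_subset_eq[OF pd_closed[OF W.m_closed[OF assms]]
        glue_closed[OF pd_closed[OF assms(1)] pd_closed[OF assms(2)]] glue_perm[OF G assms]] by simp
qed

lemma loop_pd: "loop (pd v) (pd w) = \<one>\<^bsub>k\<^esub>"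
proof -
  have "{C \<in> components (pd v) (pd w). outer_ends C = {}} = {}" using component_perm_outer by blast
  then show ?thesis unfolding loop_factor_def by (simp only: k.finprod_empty)
qed

lemma one_A_pd: "\<one>\<^bsub>A\<^esub> = mono k \<one>\<^bsub>k\<^esub> (pd \<one>\<^bsub>W\<^esub>)" by (simp add: one_A identity_perm[of G n])

text \<open>The right ideal of the diagrams with a given left cup has a left identity; this is where \<open>\<delta>\<close> must
  be invertible.\<close>

lemma cup_unit:
  assumes ij: "i < n" "j < n" "i \<noteq> j" and g: "g \<in> carrier G" and x: "x \<in> D"
    and s: "({LNode i, LNode j}, g) \<in> x" and a: "a \<in> carrier k"
  shows "mono k (inv\<^bsub>k\<^esub> (act g \<delta>)) (cupcap G n i j g) \<otimes>\<^bsub>A\<^esub> mono k a x = mono k a x"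
proof -
  have c: "cupcap G n i j g \<in> D" by (rule cupcap_closed[OF G ij g])
  have u: "act g \<delta> \<in> Units k" by (rule act_unit[OF g])
  have "glue G (cupcap G n i j g) x = x"
    using diagrams_subset_eq[OF x glue_closed[OF c x] glue_cupcap[OF G ij g x s]] by simp
  moreover have "loop (cupcap G n i j g) x = act g \<delta>"
    by (rule loop_cupcap[where act = act, OF G ij g x s cring_k k.Units_closed[OF u]])
  moreover have "inv\<^bsub>k\<^esub> (act g \<delta>) \<otimes>\<^bsub>k\<^esub> a \<otimes>\<^bsub>k\<^esub> act g \<delta> = a"
  proof -
    have "inv\<^bsub>k\<^esub> (act g \<delta>) \<otimes>\<^bsub>k\<^esub> a = a \<otimes>\<^bsub>k\<^esub> inv\<^bsub>k\<^esub> (act g \<delta>)" using u a by (simp add: k.m_comm)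
    then show ?thesis using u a k.Units_closed[OF u] by (simp add: k.m_assoc)
  qed
  ultimately show ?thesis using a u c x by (simp add: mono_mult)
qed

text \<open>The character through which the algebra acts on the trivial module.\<close>

definition \<epsilon> :: "('g diagram \<Rightarrow> 'k) \<Rightarrow> 'k" where
  "\<epsilon> a = finsum k a {x. a x \<noteq> \<zero>\<^bsub>k\<^esub> \<and> only_horizontal x}"

lemma \<epsilon>_closed: "a \<in> carrier A \<Longrightarrow> \<epsilon> a \<in> carrier k"
  unfolding \<epsilon>_def by (rule k.finsum_closed) (auto intro: A_val)

lemma \<epsilon>_mono: "a \<in> carrier k \<Longrightarrow> \<epsilon> (mono k a x) = (if only_horizontal x then a else \<zero>\<^bsub>k\<^esub>)"
proof -
  assume a: "a \<in> carrier k"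
  have "{y. mono k a x y \<noteq> \<zero>\<^bsub>k\<^esub> \<and> only_horizontal y} = (if a \<noteq> \<zero>\<^bsub>k\<^esub> \<and> only_horizontal x then {x} else {})"
    by (auto simp: mono_def)
  then show ?thesis using a unfolding \<epsilon>_def by (auto simp: mono_def k.finsum_insert)
qed

end

locale GB_resolution = GB_algebra G k act \<delta> n
  for G :: "('g, 'x) monoid_scheme" and k :: "('k, 'y) ring_scheme" and act \<delta> n +
  fixes P :: "('g diagram \<Rightarrow> 'k, 'p, 'k) augmented_complex"
  assumes res: "projective_resolution (GB G k act \<delta> n) (trivial_module k) P"
begin

abbreviation "M i \<equiv> obj P i"

lemma proj: "projective_module A (M i)" using res by (simp add: projective_resolution_def)
lemma module_M: "left_module A (M i)" using proj by (simp add: projective_module_def)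
lemma abelian_M: "abelian_group (M i)" using module_M[of i] by (simp add: left_module_def)

lemma diff_hom: "diff P i \<in> linear_hom A (M (Suc i)) (M i)" using res by (simp add: projective_resolution_def)
lemma aug_hom: "aug P \<in> linear_hom A (M 0) (trivial_module k)" using res by (simp add: projective_resolution_def)
lemma aug_surj: "aug P ` carrier (M 0) = carrier k" using res by (simp add: projective_resolution_def trivial_module_def)

lemma aug_closed: "p \<in> carrier (M 0) \<Longrightarrow> aug P p \<in> carrier k"
  using aug_hom by (auto simp: semilinear_hom_def trivial_module_def)

lemma aug_add: "\<lbrakk>p \<in> carrier (M 0); q \<in> carrier (M 0)\<rbrakk> \<Longrightarrow> aug P (p \<oplus>\<^bsub>M 0\<^esub> q) = aug P p \<oplus>\<^bsub>k\<^esub> aug P q"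
  using aug_hom by (simp add: semilinear_hom_def trivial_module_def)

lemma aug_smult: "\<lbrakk>a \<in> carrier A; p \<in> carrier (M 0)\<rbrakk> \<Longrightarrow> aug P (a \<odot>\<^bsub>M 0\<^esub> p) = \<epsilon> a \<otimes>\<^bsub>k\<^esub> aug P p"
  using aug_hom by (simp add: semilinear_hom_def trivial_module_def \<epsilon>_def)

lemma exact0: "p \<in> carrier (M 0) \<Longrightarrow> aug P p = \<zero>\<^bsub>k\<^esub> \<Longrightarrow> \<exists>q\<in>carrier (M (Suc 0)). p = diff P 0 q"
proof -
  assume p: "p \<in> carrier (M 0)" "aug P p = \<zero>\<^bsub>k\<^esub>"
  have "a_kernel (M 0) (trivial_module k :: ('g diagram \<Rightarrow> 'k, 'k) module) (aug P) = {x \<in> carrier (M 0). aug P x = \<zero>\<^bsub>k\<^esub>}"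
    by (simp add: a_kernel_def' trivial_module_def)
  moreover have "diff P 0 ` carrier (M (Suc 0)) = a_kernel (M 0) (trivial_module k :: ('g diagram \<Rightarrow> 'k, 'k) module) (aug P)"
    using res by (simp add: projective_resolution_def)
  ultimately show ?thesis using p by blast
qed

lemma aug_diff: "q \<in> carrier (M (Suc 0)) \<Longrightarrow> aug P (diff P 0 q) = \<zero>\<^bsub>k\<^esub>"
proof -
  assume q: "q \<in> carrier (M (Suc 0))"
  have "a_kernel (M 0) (trivial_module k :: ('g diagram \<Rightarrow> 'k, 'k) module) (aug P) = {x \<in> carrier (M 0). aug P x = \<zero>\<^bsub>k\<^esub>}"
    by (simp add: a_kernel_def' trivial_module_def)
  moreover have "diff P 0 ` carrier (M (Suc 0)) = a_kernel (M 0) (trivial_module k :: ('g diagram \<Rightarrow> 'k, 'k) module) (aug P)"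
    using res by (simp add: projective_resolution_def)
  ultimately show ?thesis using q by blast
qed

lemma exact_Suc:
  "diff P (Suc i) ` carrier (M (Suc (Suc i))) = {x \<in> carrier (M (Suc i)). diff P i x = \<zero>\<^bsub>M i\<^esub>}"
  using res by (simp add: projective_resolution_def a_kernel_def')

text \<open>The augmentation is linear and onto. Evaluating it at a product acting on an element of
  augmentation 1, in two ways, gives multiplicativity without any analysis of glued
  diagrams.\<close>

lemma \<epsilon>_mult:
  assumes a: "a \<in> carrier A" and b: "b \<in> carrier A" shows "\<epsilon> (a \<otimes>\<^bsub>A\<^esub> b) = \<epsilon> a \<otimes>\<^bsub>k\<^esub> \<epsilon> b"
proof -
  interpret left_module A "M 0" by (rule module_M)
  obtain p where p: "p \<in> carrier (M 0)" "aug P p = \<one>\<^bsub>k\<^esub>" using aug_surj by (metis imageE k.one_closed)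
  have "\<epsilon> (a \<otimes>\<^bsub>A\<^esub> b) \<otimes>\<^bsub>k\<^esub> aug P p = aug P (a \<odot>\<^bsub>M 0\<^esub> (b \<odot>\<^bsub>M 0\<^esub> p))"
    using aug_smult[of "a \<otimes>\<^bsub>A\<^esub> b" p] a b p(1) by (simp add: lsmult_assoc)
  also have "\<dots> = \<epsilon> a \<otimes>\<^bsub>k\<^esub> (\<epsilon> b \<otimes>\<^bsub>k\<^esub> aug P p)"
    using a b p(1) by (simp add: aug_smult lsmult_closed)
  finally show ?thesis using a b p(2) by (simp add: \<epsilon>_closed)
qed

text \<open>Multiplicativity of \<epsilon> on basis elements, together with the loop factor being a
  nonzero unit, decides when a glued diagram is horizontal.\<close>

lemma glue_horizontal:
  assumes "x \<in> D" "y \<in> D" shows "only_horizontal (glue G x y) \<longleftrightarrow> only_horizontal x \<and> only_horizontal y"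
proof -
  have "\<epsilon> (mono k (loop x y) (glue G x y)) = \<epsilon> (mono k \<one>\<^bsub>k\<^esub> x) \<otimes>\<^bsub>k\<^esub> \<epsilon> (mono k \<one>\<^bsub>k\<^esub> y)"
    using \<epsilon>_mult[of "mono k \<one>\<^bsub>k\<^esub> x" "mono k \<one>\<^bsub>k\<^esub> y"] assms by (simp add: mono_mult mono_closed loop_closed)
  then have "(if only_horizontal (glue G x y) then loop x y else \<zero>\<^bsub>k\<^esub>) =
      (if only_horizontal x \<and> only_horizontal y then \<one>\<^bsub>k\<^esub> else \<zero>\<^bsub>k\<^esub>)"
    by (simp add: \<epsilon>_mono loop_closed[OF assms])
  then show ?thesis
    using unit_nonzero[OF loop_unit[OF assms]] nontrivial by (metis (full_types))
qed

text \<open>A horizontal product has horizontal factors, and permutation diagrams multiply as in the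
  group, so only one pair of diagrams contributes to this coefficient.\<close>

lemma mono_pd_coeff:
  assumes a: "a \<in> carrier A" and b: "b \<in> carrier k" and v: "v \<in> carrier W" and w: "w \<in> carrier W"
  shows "(mono k b (pd v) \<otimes>\<^bsub>A\<^esub> a) (pd (v \<otimes>\<^bsub>W\<^esub> w)) = b \<otimes>\<^bsub>k\<^esub> a (pd w)"
proof -
  interpret W: group W by (rule W)
  let ?B = "{(x, y). mono k b (pd v) x \<noteq> \<zero>\<^bsub>k\<^esub> \<and> a y \<noteq> \<zero>\<^bsub>k\<^esub> \<and> glue G x y = pd (v \<otimes>\<^bsub>W\<^esub> w)}"
  have yw: "y = pd w" if y: "a y \<noteq> \<zero>\<^bsub>k\<^esub>" "glue G (pd v) y = pd (v \<otimes>\<^bsub>W\<^esub> w)" for y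
  proof -
    have yD: "y \<in> D" by (rule A_supp[OF a y(1)])
    have "only_horizontal y"
      using glue_horizontal[OF pd_closed[OF v] yD] y(2) perm_diagram_horizontal by metis
    then obtain w' where w': "w' \<in> carrier W" "y = pd w'" using horizontal_perm[OF yD _ G.is_group] by blast
    then have "v \<otimes>\<^bsub>W\<^esub> w' = v \<otimes>\<^bsub>W\<^esub> w"
      using y(2) glue_pd[OF v w'(1)] perm_diagram_inj[OF W.m_closed[OF v w'(1)] W.m_closed[OF v w]] by simp
    then show ?thesis using w' v w by simp
  qed
  have B: "?B = (if b \<noteq> \<zero>\<^bsub>k\<^esub> \<and> a (pd w) \<noteq> \<zero>\<^bsub>k\<^esub> then {(pd v, pd w)} else {})"
  proof -
    have "x = pd v \<and> y = pd w \<and> b \<noteq> \<zero>\<^bsub>k\<^esub>" if "(x, y) \<in> ?B" for x y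
    proof -
      have "x = pd v \<and> b \<noteq> \<zero>\<^bsub>k\<^esub>" using that by (simp add: mono_def split: if_splits)
      moreover from this that have "y = pd w" by (intro yw) simp_all
      ultimately show ?thesis by simp
    qed
    then have "?B \<subseteq> {(pd v, pd w)}" "b = \<zero>\<^bsub>k\<^esub> \<Longrightarrow> ?B = {}" by blast+
    moreover have "(pd v, pd w) \<in> ?B \<longleftrightarrow> b \<noteq> \<zero>\<^bsub>k\<^esub> \<and> a (pd w) \<noteq> \<zero>\<^bsub>k\<^esub>"
      using glue_pd[OF v w] by (simp add: mono_def)
    ultimately show ?thesis by (simp only: split: if_split) blast
  qed
  show ?thesis
    unfolding mult_A B using A_val[OF a] b by (auto simp: mono_def loop_pd k.finsum_insert)
qed

abbreviation "ev i \<equiv> module_ev (M i)"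
abbreviation "E i \<equiv> ev_kernel (M i)"

lemmas ev_add = module_ev(1)[OF abelian_M] and ev_closed = module_ev(2)[OF abelian_M]
  and ev_of = module_ev(3)[OF abelian_M]
lemmas subE = subgrp_ev_kernel[OF abelian_M]
lemmas E_iff = ev_kernel_diff[OF abelian_M]

section \<open>The resolution on free abelian groups\<close>

definition d :: "nat \<Rightarrow> ('p \<Rightarrow>\<^sub>0 int) \<Rightarrow> ('p \<Rightarrow>\<^sub>0 int)" where "d i = lift_map (M (Suc i)) (diff P i)"

definition op :: "nat \<Rightarrow> 'k \<Rightarrow> 'g diagram \<Rightarrow> ('p \<Rightarrow>\<^sub>0 int) \<Rightarrow> ('p \<Rightarrow>\<^sub>0 int)" where
  "op i a x = lift_map (M i) (\<lambda>p. mono k a x \<odot>\<^bsub>M i\<^esub> p)"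

lemma addv_d: "addv (d i)" and addv_op: "addv (op i a x)"
  by (simp_all add: d_def op_def addv_lift_map)

lemma ev_d: "ev i (d i z) = diff P i (ev (Suc i) z)"
  unfolding d_def using diff_hom by (intro ev_lift_map abelian_M) (auto simp: semilinear_hom_def)

lemma ev_op: "\<lbrakk>a \<in> carrier k; x \<in> D\<rbrakk> \<Longrightarrow> ev i (op i a x z) = mono k a x \<odot>\<^bsub>M i\<^esub> ev i z"
proof -
  assume a: "a \<in> carrier k" "x \<in> D"
  interpret left_module A "M i" by (rule module_M)
  show ?thesis unfolding op_def
    by (intro ev_lift_map abelian_M) (simp_all add: lsmult_closed lsmult_r_distr mono_closed a)
qed

lemma diff_closed: "p \<in> carrier (M (Suc i)) \<Longrightarrow> diff P i p \<in> carrier (M i)"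
  using diff_hom[of i] by (auto simp: semilinear_hom_def)

lemma diff_smult: "\<lbrakk>a \<in> carrier A; p \<in> carrier (M (Suc i))\<rbrakk> \<Longrightarrow> diff P i (a \<odot>\<^bsub>M (Suc i)\<^esub> p) = a \<odot>\<^bsub>M i\<^esub> diff P i p"
  using diff_hom[of i] by (simp add: semilinear_hom_def)

lemma d_op: "\<lbrakk>a \<in> carrier k; x \<in> D\<rbrakk> \<Longrightarrow> d i (op (Suc i) a x z) - op i a x (d i z) \<in> E i"
  by (simp add: E_iff ev_d ev_op diff_smult mono_closed ev_closed)

lemma d_d: "d i (d (Suc i) z) \<in> E i"
proof -
  have "diff P (Suc i) (ev (Suc (Suc i)) z) \<in> {x \<in> carrier (M (Suc i)). diff P i x = \<zero>\<^bsub>M i\<^esub>}"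
    unfolding exact_Suc[symmetric] using ev_closed by blast
  then show ?thesis by (simp add: ev_kernel_def ev_d)
qed

lemma exact_d:
  assumes "d i z \<in> E i" shows "\<exists>y. z - d (Suc i) y \<in> E (Suc i)"
proof -
  have "ev (Suc i) z \<in> {x \<in> carrier (M (Suc i)). diff P i x = \<zero>\<^bsub>M i\<^esub>}"
    using assms ev_closed by (simp add: ev_kernel_def ev_d)
  then obtain q where "q \<in> carrier (M (Suc (Suc i)))" "ev (Suc i) z = diff P (Suc i) q"
    unfolding exact_Suc[symmetric] by blast
  then show ?thesis by (intro exI[of _ "frag_of q"]) (simp add: E_iff ev_d ev_of)
qed

lemma exact_0:
  assumes "aug P (ev 0 z) = \<zero>\<^bsub>k\<^esub>" shows "\<exists>y. z - d 0 y \<in> E 0"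
proof -
  obtain q where "q \<in> carrier (M (Suc 0))" "ev 0 z = diff P 0 q" using exact0[OF ev_closed assms] by blast
  then show ?thesis by (intro exI[of _ "frag_of q"]) (simp add: E_iff ev_d ev_of)
qed

lemma d_E: "z \<in> E (Suc i) \<Longrightarrow> d i z \<in> E i"
proof -
  assume z: "z \<in> E (Suc i)"
  then have "ev (Suc i) z = ev (Suc i) 0" by (simp add: ev_kernel_def module_ev_zero[OF abelian_M])
  then have "ev i (d i z) = ev i (d i 0)" by (simp add: ev_d)
  then show ?thesis using E_iff[of "d i z" "d i 0" i] by (simp add: addv_zero[OF addv_d])
qed

lemma op_E: "\<lbrakk>a \<in> carrier k; x \<in> D; z \<in> E i\<rbrakk> \<Longrightarrow> op i a x z \<in> E i"
proof -
  assume z: "a \<in> carrier k" "x \<in> D" "z \<in> E i"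
  then have "ev i z = ev i 0" by (simp add: ev_kernel_def module_ev_zero[OF abelian_M])
  then have "ev i (op i a x z) = ev i (op i a x 0)" by (simp add: ev_op z)
  then show ?thesis using E_iff[of "op i a x z" "op i a x 0" i] by (simp add: addv_zero[OF addv_op])
qed

lemma op_cong: "\<lbrakk>a \<in> carrier k; x \<in> D; y - z \<in> E i\<rbrakk> \<Longrightarrow> op i a x y - op i a x z \<in> E i"
  using op_E[of a x "y - z" i] by (simp add: addv_diff[OF addv_op])

lemma op_op:
  assumes "a \<in> carrier k" "b \<in> carrier k" "x \<in> D" "y \<in> D"
  shows "op i a x (op i b y z) - op i (a \<otimes>\<^bsub>k\<^esub> b \<otimes>\<^bsub>k\<^esub> loop x y) (glue G x y) z \<in> E i"
proof -
  interpret left_module A "M i" by (rule module_M)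
  show ?thesis
    using assms by (simp add: E_iff ev_op loop_closed glue_closed mono_mult[symmetric] lsmult_assoc mono_closed ev_closed)
qed

lemma op_add:
  assumes "a \<in> carrier k" "b \<in> carrier k" "x \<in> D"
  shows "op i (a \<oplus>\<^bsub>k\<^esub> b) x z - (op i a x z + op i b x z) \<in> E i"
proof -
  interpret left_module A "M i" by (rule module_M)
  show ?thesis
    using assms by (simp add: E_iff ev_op ev_add mono_add lsmult_l_distr mono_closed ev_closed)
qed

lemma op_one: "op i \<one>\<^bsub>k\<^esub> (pd \<one>\<^bsub>W\<^esub>) z - z \<in> E i"
proof -
  interpret left_module A "M i" by (rule module_M)
  interpret W: group W by (rule W)
  show ?thesis
    by (simp add: E_iff ev_op pd_closed one_A_pd[symmetric] lsmult_one ev_closed)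
qed

lemma aug_op: "\<lbrakk>a \<in> carrier k; x \<in> D\<rbrakk> \<Longrightarrow>
    aug P (ev 0 (op 0 a x z)) = (if only_horizontal x then a \<otimes>\<^bsub>k\<^esub> aug P (ev 0 z) else \<zero>\<^bsub>k\<^esub>)"
  by (simp add: ev_op aug_smult mono_closed ev_closed \<epsilon>_mono aug_closed)

subsection \<open>Dual bases\<close>

definition proj_data :: "nat \<Rightarrow> 'p set \<times> ('p \<Rightarrow> 'p \<Rightarrow> 'g diagram \<Rightarrow> 'k) \<times> (('p \<Rightarrow> 'g diagram \<Rightarrow> 'k) \<Rightarrow> 'p)" where
  "proj_data i = (SOME (S, \<iota>, r). \<iota> \<in> linear_hom A (M i) (free_module A S) \<and>
    r \<in> linear_hom A (free_module A S) (M i) \<and> (\<forall>x\<in>carrier (M i). r (\<iota> x) = x))"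

definition "S i = fst (proj_data i)"
definition "\<iota> i = fst (snd (proj_data i))"
definition "r i = snd (snd (proj_data i))"

lemma proj_data:
  shows "\<iota> i \<in> linear_hom A (M i) (free_module A (S i))" "r i \<in> linear_hom A (free_module A (S i)) (M i)"
    "x \<in> carrier (M i) \<Longrightarrow> r i (\<iota> i x) = x"
proof -
  let ?Q = "\<lambda>(S :: 'p set, \<iota>, r). \<iota> \<in> linear_hom A (M i) (free_module A S) \<and>
    r \<in> linear_hom A (free_module A S) (M i) \<and> (\<forall>x\<in>carrier (M i). r (\<iota> x) = x)"
  obtain S0 :: "'p set" and \<iota>0 r0 where "\<iota>0 \<in> linear_hom A (M i) (free_module A S0)"
    "r0 \<in> linear_hom A (free_module A S0) (M i)" "\<forall>x\<in>carrier (M i). r0 (\<iota>0 x) = x"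
    using proj[of i] unfolding projective_module_def by (elim conjE exE bexE) (rule that)
  then have "\<exists>z. ?Q z" by (intro exI[of _ "(S0, \<iota>0, r0)"]) simp
  then have "?Q (proj_data i)" unfolding proj_data_def by (rule someI_ex)
  then show "\<iota> i \<in> linear_hom A (M i) (free_module A (S i))" "r i \<in> linear_hom A (free_module A (S i)) (M i)"
    "x \<in> carrier (M i) \<Longrightarrow> r i (\<iota> i x) = x"
    by (auto simp: S_def \<iota>_def r_def case_prod_beta)
qed

definition c :: "nat \<Rightarrow> ('p \<Rightarrow>\<^sub>0 int) \<Rightarrow> 'p \<Rightarrow> 'g diagram \<Rightarrow> 'k" where
  "c i z s = \<iota> i (ev i z) s"

definition u :: "nat \<Rightarrow> 'p \<Rightarrow> ('p \<Rightarrow>\<^sub>0 int)" where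
  "u i s = frag_of (r i (\<lambda>s'. if s' = s then \<one>\<^bsub>A\<^esub> else \<zero>\<^bsub>A\<^esub>))"

lemma \<iota>_closed: "p \<in> carrier (M i) \<Longrightarrow> \<iota> i p \<in> finsupp A (S i)"
  using proj_data(1)[of i] by (auto simp: semilinear_hom_def free_module_def)

lemma \<iota>_val: "p \<in> carrier (M i) \<Longrightarrow> s \<in> S i \<Longrightarrow> \<iota> i p s \<in> carrier A"
  using \<iota>_closed by (auto simp: finsupp_def)

lemma c_A: "s \<in> S i \<Longrightarrow> c i z s \<in> carrier A"
  unfolding c_def by (rule \<iota>_val[OF ev_closed])

lemma c_closed: "s \<in> S i \<Longrightarrow> c i z s x \<in> carrier k"
  by (rule A_val[OF c_A])

lemma c_add: "c i (y + z) s = c i y s \<oplus>\<^bsub>A\<^esub> c i z s"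
  using proj_data(1)[of i] by (simp add: c_def ev_add semilinear_hom_def free_module_def ev_closed)

lemma c_op: "\<lbrakk>a \<in> carrier k; x \<in> D\<rbrakk> \<Longrightarrow> c i (op i a x z) s = mono k a x \<otimes>\<^bsub>A\<^esub> c i z s"
  using proj_data(1)[of i] by (simp add: c_def ev_op semilinear_hom_def free_module_def ev_closed mono_closed)

lemma c_E: "y - z \<in> E i \<Longrightarrow> c i y = c i z"
  by (simp add: E_iff c_def fun_eq_iff)

lemma c_zero: "s \<in> S i \<Longrightarrow> c i 0 s = \<zero>\<^bsub>A\<^esub>"
  using c_add[of i 0 0 s] c_A[of s i 0] by (simp add: A.add.r_cancel_one')

lemma c_minus:
  assumes s: "s \<in> S i" shows "c i (- z) s x = \<ominus>\<^bsub>k\<^esub> c i z s x"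
proof -
  have "c i (- z) s x \<oplus>\<^bsub>k\<^esub> c i z s x = \<zero>\<^bsub>k\<^esub>"
    using c_add[of i "- z" z s] c_zero[OF s] by (simp add: add_A zero_A fun_eq_iff)
  then show ?thesis using c_closed[OF s] k.minus_equality by metis
qed

definition csupp :: "nat \<Rightarrow> ('p \<Rightarrow>\<^sub>0 int) \<Rightarrow> ('p \<times> 'g diagram) set" where
  "csupp i z = {(s, x). s \<in> S i \<and> c i z s x \<noteq> \<zero>\<^bsub>k\<^esub>}"

lemma csupp_finite: "finite (csupp i z)"
proof -
  let ?f = "\<iota> i (ev i z)"
  have f: "?f \<in> finsupp A (S i)" by (rule \<iota>_closed[OF ev_closed])
  have "csupp i z \<subseteq> Sigma {s. ?f s \<noteq> \<zero>\<^bsub>A\<^esub>} (\<lambda>s. {x. ?f s x \<noteq> \<zero>\<^bsub>k\<^esub>})"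
    by (auto simp: csupp_def c_def zero_A)
  moreover have "finite {x. ?f s x \<noteq> \<zero>\<^bsub>k\<^esub>}" for s
  proof (cases "s \<in> S i")
    case True
    then show ?thesis using f A_fin by (auto simp: finsupp_def)
  next
    case False
    then show ?thesis using f by (auto simp: finsupp_def zero_A)
  qed
  moreover have "finite {s. ?f s \<noteq> \<zero>\<^bsub>A\<^esub>}" using f by (simp add: finsupp_def)
  ultimately show ?thesis using finite_subset[OF _ finite_SigmaI] by blast
qed

lemma csupp_D: "(s, x) \<in> csupp i z \<Longrightarrow> s \<in> S i \<and> x \<in> D"
  using A_supp[OF c_A] by (auto simp: csupp_def)

lemma r_hom:
  assumes "y \<in> finsupp A (S i)" "z \<in> finsupp A (S i)"
  shows "r i (y \<oplus>\<^bsub>free_module A (S i)\<^esub> z) = r i y \<oplus>\<^bsub>M i\<^esub> r i z" "r i y \<in> carrier (M i)"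
  using proj_data(2)[of i] assms by (auto simp: semilinear_hom_def free_module_def)

text \<open>Induction on a finite set containing the support, splitting off one coefficient times
  one diagram at a time and using linearity of the retraction.\<close>

lemma dual_basis_free:
  assumes f: "f \<in> finsupp A (S i)" and B: "finite B" "B \<subseteq> S i \<times> D" "\<And>s x. f s x \<noteq> \<zero>\<^bsub>k\<^esub> \<Longrightarrow> (s, x) \<in> B"
  shows "ev i (\<Sum>(s, x)\<in>B. op i (f s x) x (u i s)) = r i f"
  using B f
proof (induction B arbitrary: f rule: finite_induct)
  case empty
  interpret abelian_group "M i" by (rule abelian_M)
  let ?z = "\<lambda>_ :: 'p. \<zero>\<^bsub>A\<^esub>"
  have fz: "f = ?z" using empty.prems(2) by (auto simp: zero_A fun_eq_iff)
  have "?z \<in> finsupp A (S i)" by (simp add: finsupp_def)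
  note r_hom[OF this this]
  moreover have "?z \<oplus>\<^bsub>free_module A (S i)\<^esub> ?z = ?z" by (simp add: free_module_def)
  ultimately have "r i ?z = \<zero>\<^bsub>M i\<^esub>" by (simp add: add.r_cancel_one')
  then show ?case by (simp add: fz module_ev_zero[OF abelian_M])
next
  case (insert b B)
  interpret left_module A "M i" by (rule module_M)
  obtain s x where b: "b = (s, x)" by (cases b)
  have s: "s \<in> S i" and x: "x \<in> D" using insert.prems(1) b by auto
  let ?\<delta> = "\<lambda>s'. if s' = s then \<one>\<^bsub>A\<^esub> else \<zero>\<^bsub>A\<^esub>"
  define f' where "f' = (\<lambda>s' x'. if s' = s \<and> x' = x then \<zero>\<^bsub>k\<^esub> else f s' x')"
  let ?m = "mono k (f s x) x"
  let ?g = "?m \<odot>\<^bsub>free_module A (S i)\<^esub> ?\<delta>"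
  have fsA: "f s' \<in> carrier A" if "s' \<in> S i" for s' using insert.prems(3) that by (simp add: finsupp_def)
  have fk: "f s x \<in> carrier k" by (rule A_val[OF fsA[OF s]])
  have m: "?m \<in> carrier A" by (rule mono_closed[OF fk x])
  have \<delta>f: "?\<delta> \<in> finsupp A (S i)" using s by (auto simp: finsupp_def)
  have g: "?g = (\<lambda>s'. if s' = s then ?m else \<zero>\<^bsub>A\<^esub>)" using m by (auto simp: free_module_def)
  have gf: "?g \<in> finsupp A (S i)" unfolding g using m s by (auto simp: finsupp_def)
  have f'A: "f' s' \<in> carrier A" if s': "s' \<in> S i" for s'
  proof -
    have "{d. f' s' d \<noteq> \<zero>\<^bsub>k\<^esub>} \<subseteq> {d. f s' d \<noteq> \<zero>\<^bsub>k\<^esub>}" by (auto simp: f'_def)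
    then have "finite {d. f' s' d \<noteq> \<zero>\<^bsub>k\<^esub>}" by (rule finite_subset[OF _ A_fin[OF fsA[OF s']]])
    moreover have "\<forall>d\<in>D. f' s' d \<in> carrier k" using A_val[OF fsA[OF s']] by (simp add: f'_def)
    moreover have "\<forall>d. d \<notin> D \<longrightarrow> f' s' d = \<zero>\<^bsub>k\<^esub>" using A_supp[OF fsA[OF s']] by (auto simp: f'_def)
    ultimately show ?thesis by (simp add: carrier_A finsupp_def)
  qed
  have f'f: "f' \<in> finsupp A (S i)"
  proof -
    have "f' s' = \<zero>\<^bsub>A\<^esub>" if "f s' = \<zero>\<^bsub>A\<^esub>" for s' using that by (auto simp: f'_def zero_A)
    then have "{s'. f' s' \<noteq> \<zero>\<^bsub>A\<^esub>} \<subseteq> {s'. f s' \<noteq> \<zero>\<^bsub>A\<^esub>}" "\<And>s'. s' \<notin> S i \<Longrightarrow> f' s' = \<zero>\<^bsub>A\<^esub>"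
      using insert.prems(3) by (auto simp: finsupp_def)
    moreover have "finite {s'. f s' \<noteq> \<zero>\<^bsub>A\<^esub>}" using insert.prems(3) by (simp add: finsupp_def)
    ultimately show ?thesis using f'A finite_subset unfolding finsupp_def by blast
  qed
  have fsum: "f = ?g \<oplus>\<^bsub>free_module A (S i)\<^esub> f'"
  proof (intro ext)
    fix s' x'
    have "f s' x' \<in> carrier k"
      using A_val[OF fsA] insert.prems(3) by (cases "s' \<in> S i") (auto simp: finsupp_def zero_A)
    then show "f s' x' = (?g \<oplus>\<^bsub>free_module A (S i)\<^esub> f') s' x'"
      unfolding g by (auto simp: free_module_def f'_def mono_def zero_A add_A)
  qed
  note rhom = r_hom[of _ i]
  have rsm: "r i ?g = ?m \<odot>\<^bsub>M i\<^esub> r i ?\<delta>"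
    using proj_data(2)[of i] m \<delta>f unfolding semilinear_hom_def
    by (auto simp: free_module_def)
  have same: "(\<Sum>(s, x)\<in>B. op i (f s x) x (u i s)) = (\<Sum>(s, x)\<in>B. op i (f' s x) x (u i s))"
    by (rule sum.cong[OF refl]) (use insert.hyps(2) b in \<open>auto simp: f'_def\<close>)
  have IH: "ev i (\<Sum>(s, x)\<in>B. op i (f' s x) x (u i s)) = r i f'"
    by (rule insert.IH[OF _ _ f'f]) (use insert.prems b in \<open>auto simp: f'_def split: if_splits\<close>)
  have "ev i (u i s) = r i ?\<delta>" unfolding u_def by (rule ev_of[OF rhom(2)[OF \<delta>f \<delta>f]])
  then have "ev i (op i (f s x) x (u i s)) = r i ?g" unfolding rsm by (simp only: ev_op[OF fk x])
  then have "ev i (\<Sum>(s, x)\<in>insert b B. op i (f s x) x (u i s)) = r i ?g \<oplus>\<^bsub>M i\<^esub> r i f'"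
    using insert.hyps b same IH by (simp add: ev_add)
  also have "\<dots> = r i f" using rhom(1)[OF gf f'f] fsum by metis
  finally show ?case .
qed

lemma expansion: "z - (\<Sum>(s, x)\<in>csupp i z. op i (c i z s x) x (u i s)) \<in> E i"
proof -
  have "ev i (\<Sum>(s, x)\<in>csupp i z. op i (\<iota> i (ev i z) s x) x (u i s)) = r i (\<iota> i (ev i z))"
  proof (rule dual_basis_free[OF \<iota>_closed[OF ev_closed] csupp_finite])
    show "csupp i z \<subseteq> S i \<times> D" using csupp_D by auto
    show "(s, x) \<in> csupp i z" if "\<iota> i (ev i z) s x \<noteq> \<zero>\<^bsub>k\<^esub>" for s x
    proof -
      have "s \<in> S i" using that \<iota>_closed[OF ev_closed, of i z] by (auto simp: finsupp_def zero_A)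
      then show ?thesis using that by (simp add: csupp_def c_def)
    qed
  qed
  then show ?thesis by (simp add: E_iff c_def proj_data(3)[OF ev_closed])
qed

end

section \<open>Reduction to the wreath product\<close>

context GB_resolution
begin

text \<open>For a set \<open>B\<close> of diagrams that spans a right ideal \<open>J\<close>, the submodule \<open>J M\<close>.\<close>

definition Msub :: "nat \<Rightarrow> 'g diagram set \<Rightarrow> ('p \<Rightarrow>\<^sub>0 int) set" where
  "Msub i B = {z. \<forall>s\<in>S i. \<forall>x. c i z s x \<noteq> \<zero>\<^bsub>k\<^esub> \<longrightarrow> x \<in> B}"

definition right_ideal :: "'g diagram set \<Rightarrow> bool" where
  "right_ideal B \<longleftrightarrow> (\<forall>x\<in>B \<inter> D. \<forall>y\<in>D. glue G x y \<in> B)"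

lemma subgrp_Msub: "subgrp (Msub i B)"
  unfolding subgrp_def
proof (intro conjI ballI)
  show "0 \<in> Msub i B" by (simp add: Msub_def c_zero zero_A)
  fix y z assume y: "y \<in> Msub i B" and z: "z \<in> Msub i B"
  show "y - z \<in> Msub i B"
    unfolding Msub_def
  proof (intro CollectI ballI allI impI)
    fix s x assume s: "s \<in> S i" and nz: "c i (y - z) s x \<noteq> \<zero>\<^bsub>k\<^esub>"
    have "c i (y - z) s x = c i y s x \<oplus>\<^bsub>k\<^esub> \<ominus>\<^bsub>k\<^esub> c i z s x"
      using c_add[of i y "- z" s] c_minus[OF s, of z x] by (simp add: add_A)
    then have "c i y s x \<noteq> \<zero>\<^bsub>k\<^esub> \<or> c i z s x \<noteq> \<zero>\<^bsub>k\<^esub>" using nz by auto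
    then show "x \<in> B" using y z s by (auto simp: Msub_def)
  qed
qed

lemma E_Msub: "z \<in> E i \<Longrightarrow> z \<in> Msub i B"
  using c_E[of z 0 i] by (simp add: Msub_def c_zero zero_A)

lemma Msub_mono: "B \<subseteq> B' \<Longrightarrow> Msub i B \<subseteq> Msub i B'"
  by (auto simp: Msub_def)

text \<open>That (J M) meets (J' M) in (J meets J') M rests on projectivity of M. With membership
  read off from the coordinates in a free module it is immediate.\<close>

lemma Msub_Int: "Msub i (B \<inter> B') = Msub i B \<inter> Msub i B'"
  by (auto simp: Msub_def)

lemma Msub_op:
  assumes B: "right_ideal B" and a: "a \<in> carrier k" and x: "x \<in> B" "x \<in> D"
  shows "op i a x z \<in> Msub i B"
  unfolding Msub_def
proof (intro CollectI ballI allI impI)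
  fix s y assume s: "s \<in> S i" and nz: "c i (op i a x z) s y \<noteq> \<zero>\<^bsub>k\<^esub>"
  then have "(mono k a x \<otimes>\<^bsub>A\<^esub> c i z s) y \<noteq> \<zero>\<^bsub>k\<^esub>" by (simp add: c_op a x)
  then obtain x' y' where xy: "x' \<in> D" "y' \<in> D" "mono k a x x' \<noteq> \<zero>\<^bsub>k\<^esub>" "glue G x' y' = y"
    by (rule mult_support[OF mono_closed[OF a x(2)] c_A[OF s]])
  then have "x' = x" by (simp add: mono_def split: if_splits)
  then show "y \<in> B" using xy B x by (auto simp: right_ideal_def)
qed

lemma Msub_expansion:
  assumes "z \<in> Msub i B" "(s, x) \<in> csupp i z" shows "s \<in> S i" "x \<in> B" "x \<in> D"
  using assms csupp_D[OF assms(2)] by (auto simp: Msub_def csupp_def)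

lemma Msub_d:
  assumes B: "right_ideal B" and z: "z \<in> Msub (Suc i) B" shows "d i z \<in> Msub i B"
proof -
  let ?x = "\<Sum>(s, x)\<in>csupp (Suc i) z. op (Suc i) (c (Suc i) z s x) x (u (Suc i) s)"
  have "d i (z - ?x) \<in> E i" by (rule d_E[OF expansion])
  then have "d i z - d i ?x \<in> Msub i B" by (simp add: addv_diff[OF addv_d] E_Msub)
  moreover have "d i ?x \<in> Msub i B"
    unfolding addv_sum[OF addv_d]
  proof (rule subgrp_sum[OF subgrp_Msub], clarsimp)
    fix s x assume sx: "(s, x) \<in> csupp (Suc i) z"
    note m = Msub_expansion[OF z sx]
    have "d i (op (Suc i) (c (Suc i) z s x) x (u (Suc i) s)) - op i (c (Suc i) z s x) x (d i (u (Suc i) s)) \<in> Msub i B"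
      by (rule E_Msub[OF d_op[OF c_closed[OF m(1)] m(3)]])
    then show "d i (op (Suc i) (c (Suc i) z s x) x (u (Suc i) s)) \<in> Msub i B"
      using subgrp_cong[OF subgrp_Msub] Msub_op[OF B c_closed[OF m(1)] m(2,3)] by blast
  qed
  ultimately show ?thesis using subgrp_cong[OF subgrp_Msub] by blast
qed

text \<open>The expansion of z is sorted by whether the diagram lies in B; the right ideal property
  keeps each summand in its submodule.\<close>

lemma Msub_Un:
  assumes B: "right_ideal B" "right_ideal B'" and z: "z \<in> Msub i (B \<union> B')"
  obtains y y' where "y \<in> Msub i B" "y' \<in> Msub i B'" "z - (y + y') \<in> E i"
proof -
  let ?t = "\<lambda>(s, x). op i (c i z s x) x (u i s)"
  let ?I = "{(s, x) \<in> csupp i z. x \<in> B}" and ?J = "{(s, x) \<in> csupp i z. x \<notin> B}"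
  have mem: "?t b \<in> Msub i C" if C: "right_ideal C" and b: "b \<in> csupp i z" "snd b \<in> C" for b C
  proof -
    obtain s x where sx: "b = (s, x)" by (cases b)
    note m = Msub_expansion[OF z b(1)[unfolded sx]]
    show ?thesis using Msub_op[OF C c_closed[OF m(1)] _ m(3)] b(2) sx by simp
  qed
  have "sum ?t ?I \<in> Msub i B" by (rule subgrp_sum[OF subgrp_Msub], rule mem[OF B(1)]) auto
  moreover have "sum ?t ?J \<in> Msub i B'"
  proof (rule subgrp_sum[OF subgrp_Msub], rule mem[OF B(2)])
    fix b assume b: "b \<in> ?J"
    then show "b \<in> csupp i z" by auto
    obtain s x where sx: "b = (s, x)" by (cases b)
    then have "(s, x) \<in> csupp i z" "x \<notin> B" using b by auto
    then show "snd b \<in> B'" using Msub_expansion(2)[OF z] sx by auto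
  qed
  moreover have "z - (sum ?t ?I + sum ?t ?J) \<in> E i"
  proof -
    have IJ: "?I \<union> ?J = csupp i z" by auto
    have fin: "finite ?I" "finite ?J" by (rule finite_subset[OF _ csupp_finite[of i z]], blast)+
    have "sum ?t (?I \<union> ?J) = sum ?t ?I + sum ?t ?J" by (rule sum.union_disjoint[OF fin]) auto
    then have "sum ?t (csupp i z) = sum ?t ?I + sum ?t ?J" unfolding IJ .
    from expansion[of z i, unfolded this] show ?thesis .
  qed
  ultimately show ?thesis by (rule that)
qed

text \<open>Degree 0 is included, where the cycle condition is void and every element has to be a
  boundary.\<close>

definition acyclic_on :: "'g diagram set \<Rightarrow> bool" where
  "acyclic_on B \<longleftrightarrow> (\<forall>i. \<forall>z\<in>Msub i B. (i > 0 \<longrightarrow> d (i - 1) z \<in> E (i - 1)) \<longrightarrow>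
    (\<exists>y\<in>Msub (Suc i) B. z - d i y \<in> E i))"

lemma acyclic_onD:
  "\<lbrakk>acyclic_on B; z \<in> Msub i B; i > 0 \<Longrightarrow> d (i - 1) z \<in> E (i - 1)\<rbrakk> \<Longrightarrow> \<exists>y\<in>Msub (Suc i) B. z - d i y \<in> E i"
  by (auto simp: acyclic_on_def)

text \<open>This is the Mayer-Vietoris argument for the sum of two right ideals, made with
  representatives.\<close>

lemma acyclic_Un:
  assumes B: "right_ideal B" "right_ideal B'" and ac: "acyclic_on B" "acyclic_on B'" "acyclic_on (B \<inter> B')"
  shows "acyclic_on (B \<union> B')"
  unfolding acyclic_on_def
proof (intro allI ballI impI)
  fix i z assume z: "z \<in> Msub i (B \<union> B')" and dz: "i > 0 \<longrightarrow> d (i - 1) z \<in> E (i - 1)"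
  obtain z1 z2 where z12: "z1 \<in> Msub i B" "z2 \<in> Msub i B'" "z - (z1 + z2) \<in> E i" by (rule Msub_Un[OF B z])
  \<comment> \<open>The boundary of z1 is minus that of z2, so it is a cycle in the intersection.
    Moving the bounding element t from one summand to the other turns both into cycles.\<close>
  have "\<exists>t\<in>Msub i (B \<inter> B'). i > 0 \<longrightarrow> d (i - 1) (z1 - t) \<in> E (i - 1)"
  proof (cases i)
    case 0
    then show ?thesis using subgrp_zero[OF subgrp_Msub] by blast
  next
    case (Suc j)
    have sum: "d j z1 + d j z2 \<in> E j"
    proof -
      have "d j (z - (z1 + z2)) \<in> E j" using d_E z12(3) Suc by blast
      then have "d j z - d j (z1 + z2) \<in> E j" by (simp add: addv_diff[OF addv_d])
      then have "d j (z1 + z2) \<in> E j" using dz Suc subgrp_cong[OF subE] by auto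
      then show ?thesis by (simp add: addv_add[OF addv_d])
    qed
    have 1: "d j z1 \<in> Msub j B" using Msub_d[OF B(1)] z12(1) Suc by blast
    have "d j z2 \<in> Msub j B'" using Msub_d[OF B(2)] z12(2) Suc by blast
    from subgrp_diff[OF subgrp_Msub E_Msub[OF sum] this] have "d j z1 \<in> Msub j B'" by simp
    with 1 have "d j z1 \<in> Msub j (B \<inter> B')" by (simp add: Msub_Int)
    moreover have "j > 0 \<Longrightarrow> d (j - 1) (d j z1) \<in> E (j - 1)" using d_d[of "j - 1" z1] by simp
    ultimately obtain t where t: "t \<in> Msub (Suc j) (B \<inter> B')" "d j z1 - d j t \<in> E j"
      using acyclic_onD[OF ac(3)] by blast
    then show ?thesis using Suc by (intro bexI[of _ t]) (simp_all add: addv_diff[OF addv_d])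
  qed
  then obtain t where t: "t \<in> Msub i B" "t \<in> Msub i B'" "i > 0 \<Longrightarrow> d (i - 1) (z1 - t) \<in> E (i - 1)"
    by (auto simp: Msub_Int)
  have "z1 - t \<in> Msub i B" by (rule subgrp_diff[OF subgrp_Msub z12(1) t(1)])
  then obtain y1 where y1: "y1 \<in> Msub (Suc i) B" "(z1 - t) - d i y1 \<in> E i"
    using acyclic_onD[OF ac(1) _ t(3)] by blast
  have "d (i - 1) (z2 + t) \<in> E (i - 1)" if i: "i > 0"
  proof -
    have "d (i - 1) (z - (z1 + z2)) \<in> E (i - 1)" using d_E[of "z - (z1 + z2)" "i - 1"] z12(3) i by simp
    from subgrp_diff[OF subE subgrp_diff[OF subE _ t(3)[OF i]] this, of "d (i - 1) z"] dz i
    show ?thesis by (simp add: addv_diff[OF addv_d] addv_add[OF addv_d] algebra_simps)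
  qed
  moreover have "z2 + t \<in> Msub i B'" by (rule subgrp_add[OF subgrp_Msub z12(2) t(2)])
  ultimately obtain y2 where y2: "y2 \<in> Msub (Suc i) B'" "(z2 + t) - d i y2 \<in> E i"
    using acyclic_onD[OF ac(2)] by blast
  have "y1 + y2 \<in> Msub (Suc i) (B \<union> B')"
    using y1(1) y2(1) Msub_mono[of B "B \<union> B'"] Msub_mono[of B' "B \<union> B'"] subgrp_add[OF subgrp_Msub] by blast
  moreover have "z - d i (y1 + y2) \<in> E i"
    using subgrp_add[OF subE z12(3) subgrp_add[OF subE y1(2) y2(2)]]
    by (simp add: addv_add[OF addv_d] algebra_simps)
  ultimately show "\<exists>y\<in>Msub (Suc i) (B \<union> B'). z - d i y \<in> E i" by blast
qed

lemma acyclic_empty: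
  assumes "B \<inter> D = {}" shows "acyclic_on B"
  unfolding acyclic_on_def
proof (intro allI ballI impI)
  fix i z assume z: "z \<in> Msub i B"
  have "b \<notin> csupp i z" for b
    using Msub_expansion(2,3)[OF z, of "fst b" "snd b"] assms by auto
  then have "csupp i z = {}" by blast
  then have "z \<in> E i" using expansion[of z i] by simp
  then show "\<exists>y\<in>Msub (Suc i) B. z - d i y \<in> E i"
    by (intro bexI[of _ 0]) (simp_all add: addv_zero[OF addv_d] subgrp_zero[OF subgrp_Msub])
qed

section \<open>Right ideals cut out by left cups\<close>

definition left_cups :: "(node set \<times> 'g) set" where
  "left_cups = {({LNode i, LNode j}, g) | i j g. i < n \<and> j < n \<and> i \<noteq> j \<and> g \<in> carrier G}"

lemma glue_left_cups: "\<lbrakk>t \<in> left_cups; x \<in> D; y \<in> D; t \<in> x\<rbrakk> \<Longrightarrow> t \<in> glue G x y"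
  using glue_left_cup[OF G] by (auto simp: left_cups_def)

lemma right_ideal_cups:
  assumes "R \<subseteq> left_cups" "F \<subseteq> left_cups"
  shows "right_ideal {x. R \<subseteq> x}" "right_ideal {x. R \<subseteq> x \<and> F \<inter> x \<noteq> {}}"
proof -
  have 1: "R \<subseteq> glue G x y" if "x \<in> D" "y \<in> D" "R \<subseteq> x" for x y
  proof
    fix t assume "t \<in> R"
    then show "t \<in> glue G x y" using glue_left_cups[of t x y] that assms(1) by blast
  qed
  then show "right_ideal {x. R \<subseteq> x}" by (simp add: right_ideal_def)
  have "F \<inter> glue G x y \<noteq> {}" if x: "x \<in> D" "y \<in> D" "F \<inter> x \<noteq> {}" for x y
  proof -
    obtain t where "t \<in> F" "t \<in> x" using x(3) by blast
    then have "t \<in> F \<inter> glue G x y" using glue_left_cups[of t x y] x(1,2) assms(2) by blast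
    then show ?thesis by blast
  qed
  then show "right_ideal {x. R \<subseteq> x \<and> F \<inter> x \<noteq> {}}" using 1 by (simp add: right_ideal_def)
qed

text \<open>The rescaled cup-cap diagram acts as the identity on everything having the cup t. It is
  not horizontal, and it destroys no cup disjoint from t, so several such operators can be applied
  in succession.\<close>

lemma cup_operator:
  assumes t: "t \<in> left_cups"
  obtains a e where "a \<in> carrier k" "e \<in> D" "\<not> only_horizontal e" "t \<in> e"
    "\<And>i z. z \<in> Msub i {x. t \<in> x} \<Longrightarrow> op i a e z - z \<in> E i"
    "\<And>x s. \<lbrakk>x \<in> D; s \<in> x; fst s \<inter> fst t = {}\<rbrakk> \<Longrightarrow> s \<in> glue G e x"
proof -
  obtain i j g where ij: "i < n" "j < n" "i \<noteq> j" and g: "g \<in> carrier G" and t_eq: "t = ({LNode i, LNode j}, g)"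
    using t by (auto simp: left_cups_def)
  let ?e = "cupcap G n i j g" and ?a = "inv\<^bsub>k\<^esub> (act g \<delta>)"
  have a: "?a \<in> carrier k" using act_unit[OF g] by simp
  have e: "?e \<in> D" by (rule cupcap_closed[OF G ij g])
  have id: "op q ?a ?e z - z \<in> E q" if z: "z \<in> Msub q {x. t \<in> x}" for q z
  proof -
    interpret left_module A "M q" by (rule module_M)
    let ?z = "\<Sum>(s, x)\<in>csupp q z. op q (c q z s x) x (u q s)"
    have "op q ?a ?e z - op q ?a ?e ?z \<in> E q" by (rule op_cong[OF a e expansion])
    moreover have "op q ?a ?e ?z - ?z \<in> E q"
      unfolding addv_sum[OF addv_op]
    proof (rule subgrp_sum_cong[OF subE], clarify)
      fix s x assume sx: "(s, x) \<in> csupp q z"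
      note m = Msub_expansion[OF z sx]
      note b = c_closed[OF m(1), of z x]
      have "mono k ?a ?e \<otimes>\<^bsub>A\<^esub> mono k (c q z s x) x = mono k (c q z s x) x"
        by (rule cup_unit[OF ij g m(3) _ b]) (use m(2) t_eq in simp)
      then show "op q ?a ?e (op q (c q z s x) x (u q s)) - op q (c q z s x) x (u q s) \<in> E q"
        using a e b m(3) by (simp add: E_iff ev_op lsmult_assoc[symmetric] mono_closed ev_closed)
    qed
    ultimately have "op q ?a ?e z - ?z \<in> E q" by (rule subgrp_trans[OF subE])
    then show ?thesis by (rule subgrp_trans[OF subE _ subgrp_sym[OF subE expansion]])
  qed
  have keep: "s \<in> glue G ?e x" if "x \<in> D" "s \<in> x" "fst s \<inter> fst t = {}" for x s
    by (rule glue_cupcap_edge[OF G ij g that(1,2)]) (use that(3) t_eq in auto)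
  show ?thesis
    by (rule that[OF a e cupcap_not_horizontal[OF G ij g] _ id keep]) (simp add: t_eq cupcap_def)
qed

text \<open>If z is bounded by some y0, then applying the cup operators to y0, one for each cup of
  R, moves the bounding element into the right ideal. Each operator fixes z modulo relations and
  commutes with the differential.\<close>

lemma push_cups:
  assumes "finite R" "R \<subseteq> left_cups" "\<And>s t. \<lbrakk>s \<in> R; t \<in> R; s \<noteq> t\<rbrakk> \<Longrightarrow> fst s \<inter> fst t = {}"
    and "z \<in> Msub i {x. R \<subseteq> x}" "z - d i y0 \<in> E i"
  shows "\<exists>y\<in>Msub (Suc i) {x. R \<subseteq> x}. z - d i y \<in> E i"
  using assms
proof (induction R rule: finite_induct)
  case empty
  have "y0 \<in> Msub (Suc i) {x. {} \<subseteq> x}" by (simp add: Msub_def)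
  then show ?case using empty.prems by blast
next
  case (insert t R)
  have "z \<in> Msub i {x. R \<subseteq> x}" using insert.prems(3) by (auto simp: Msub_def)
  then obtain y where y: "y \<in> Msub (Suc i) {x. R \<subseteq> x}" "z - d i y \<in> E i"
    using insert.IH[OF _ _ _ insert.prems(4)] insert.prems by auto
  obtain a e where a: "a \<in> carrier k" and e: "e \<in> D" "t \<in> e"
    and id: "\<And>i z. z \<in> Msub i {x. t \<in> x} \<Longrightarrow> op i a e z - z \<in> E i"
    and keep: "\<And>x s. \<lbrakk>x \<in> D; s \<in> x; fst s \<inter> fst t = {}\<rbrakk> \<Longrightarrow> s \<in> glue G e x"
    using cup_operator[of t] insert.prems(1) by (metis insert_subset)
  have "op (Suc i) a e y \<in> Msub (Suc i) {x. insert t R \<subseteq> x}"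
    unfolding Msub_def
  proof (intro CollectI ballI allI impI)
    fix s x assume s: "s \<in> S (Suc i)" and "c (Suc i) (op (Suc i) a e y) s x \<noteq> \<zero>\<^bsub>k\<^esub>"
    then have "(mono k a e \<otimes>\<^bsub>A\<^esub> c (Suc i) y s) x \<noteq> \<zero>\<^bsub>k\<^esub>" by (simp add: c_op a e)
    then obtain e' x' where x': "e' \<in> D" "x' \<in> D" "mono k a e e' \<noteq> \<zero>\<^bsub>k\<^esub>" "c (Suc i) y s x' \<noteq> \<zero>\<^bsub>k\<^esub>" "glue G e' x' = x"
      by (rule mult_support[OF mono_closed[OF a e(1)] c_A[OF s]])
    then have ee: "e' = e" by (simp add: mono_def split: if_splits)
    have Rx: "R \<subseteq> x'" using y(1) s x'(4) by (auto simp: Msub_def)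
    have "t \<in> glue G e x'" using glue_left_cups[of t e x'] insert.prems(1) e x'(2) by auto
    moreover have "r \<in> glue G e x'" if "r \<in> R" for r
    proof (rule keep[OF x'(2)])
      show "r \<in> x'" using that Rx by blast
      show "fst r \<inter> fst t = {}" using insert.prems(2)[of r t] that insert.hyps(2) by auto
    qed
    ultimately show "insert t R \<subseteq> x" using x'(5) ee by blast
  qed
  moreover have "z - d i (op (Suc i) a e y) \<in> E i"
  proof -
    have "z - op i a e z \<in> E i"
      by (rule subgrp_sym[OF subE id]) (use insert.prems(3) in \<open>auto simp: Msub_def\<close>)
    moreover have "op i a e z - op i a e (d i y) \<in> E i" by (rule op_cong[OF a e(1) y(2)])
    moreover have "op i a e (d i y) - d i (op (Suc i) a e y) \<in> E i" by (rule subgrp_sym[OF subE d_op[OF a e(1)]])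
    ultimately show ?thesis using subgrp_trans[OF subE] by blast
  qed
  ultimately show ?case by blast
qed

text \<open>If two cups of R overlap, no diagram contains R. Otherwise z is bounded somewhere in the
  resolution and the bounding element is pushed into the ideal.\<close>

lemma acyclic_cups:
  assumes R: "finite R" "R \<noteq> {}" "R \<subseteq> left_cups" shows "acyclic_on {x. R \<subseteq> x}"
proof (cases "\<exists>s\<in>R. \<exists>t\<in>R. s \<noteq> t \<and> fst s \<inter> fst t \<noteq> {}")
  case True
  then obtain s t v where st: "s \<in> R" "t \<in> R" "s \<noteq> t" "v \<in> fst s" "v \<in> fst t" by blast
  have "{x. R \<subseteq> x} \<inter> D = {}"
    using diagrams_unique[OF _ _ _ st(4,5)] st(1-3) by blast
  then show ?thesis by (rule acyclic_empty)
next
  case False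
  show ?thesis
    unfolding acyclic_on_def
  proof (intro allI ballI impI)
    fix i z assume z: "z \<in> Msub i {x. R \<subseteq> x}" and dz: "i > 0 \<longrightarrow> d (i - 1) z \<in> E (i - 1)"
    have "\<exists>y0. z - d i y0 \<in> E i"
    proof (cases i)
      case (Suc j)
      then show ?thesis using exact_d[of j z] dz by simp
    next
      case 0
      obtain t where t: "t \<in> R" "t \<in> left_cups" using R by blast
      obtain a e where a: "a \<in> carrier k" and e: "e \<in> D" "\<not> only_horizontal e"
        and id: "\<And>i z. z \<in> Msub i {x. t \<in> x} \<Longrightarrow> op i a e z - z \<in> E i"
        using cup_operator[OF t(2)] by metis
      \<comment> \<open>In degree 0 there is no cycle condition to use. Instead z is fixed by a
        diagram that is not horizontal, so its augmentation is zero.\<close>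
      have "op 0 a e z - z \<in> E 0" by (rule id) (use z t 0 in \<open>auto simp: Msub_def\<close>)
      then have "ev 0 z = ev 0 (op 0 a e z)" by (simp add: E_iff)
      then have "aug P (ev 0 z) = \<zero>\<^bsub>k\<^esub>" using aug_op[OF a e(1), of z] e(2) by simp
      then show ?thesis using exact_0 0 by simp
    qed
    then obtain y0 where "z - d i y0 \<in> E i" by blast
    then show "\<exists>y\<in>Msub (Suc i) {x. R \<subseteq> x}. z - d i y \<in> E i"
      using push_cups[OF R(1,3) _ z] False by blast
  qed
qed

text \<open>Adding a cup t to F adds to the union the ideal of diagrams containing t and R. Its
  intersection with the old union has the same form with t added to R, so Mayer-Vietoris closes the
  induction over F once R is allowed to vary.\<close>

lemma acyclic_some_cup:
  assumes "finite F" "F \<subseteq> left_cups" "finite R" "R \<subseteq> left_cups"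
  shows "acyclic_on {x. R \<subseteq> x \<and> F \<inter> x \<noteq> {}}"
  using assms
proof (induction F arbitrary: R rule: finite_induct)
  case empty
  then show ?case by (intro acyclic_empty) simp
next
  case (insert t F)
  let ?B = "{x. R \<subseteq> x \<and> F \<inter> x \<noteq> {}}" and ?C = "{x. insert t R \<subseteq> x}"
  have "acyclic_on (?B \<union> ?C)"
  proof (rule acyclic_Un)
    show "right_ideal ?B" by (rule right_ideal_cups(2)) (use insert.prems in auto)
    show "right_ideal ?C" by (rule right_ideal_cups(1)[of "insert t R" "{}"]) (use insert.prems in auto)
    show "acyclic_on ?B" by (rule insert.IH) (use insert.prems in auto)
    show "acyclic_on ?C" by (rule acyclic_cups) (use insert.prems in auto)
    have "?B \<inter> ?C = {x. insert t R \<subseteq> x \<and> F \<inter> x \<noteq> {}}" by auto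
    moreover have "acyclic_on {x. insert t R \<subseteq> x \<and> F \<inter> x \<noteq> {}}" by (rule insert.IH) (use insert.prems in auto)
    ultimately show "acyclic_on (?B \<inter> ?C)" by simp
  qed
  moreover have "?B \<union> ?C = {x. R \<subseteq> x \<and> insert t F \<inter> x \<noteq> {}}" by auto
  ultimately show ?case by simp
qed

abbreviation "nonhor \<equiv> {x. \<not> only_horizontal x}"

lemma nonhor_left_cup:
  assumes x: "x \<in> D" "\<not> only_horizontal x" obtains t where "t \<in> left_cups" "t \<in> x"
proof -
  have "\<exists>i j g. ({LNode i, LNode j}, g) \<in> x"
  proof (rule ccontr)
    assume "\<not> ?thesis"
    then have no: "({LNode i, LNode j}, g) \<notin> x" for i j g by simp
    obtain w where "x = pd w" by (rule no_left_cup_perm[OF x(1) no G.is_group])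
    then show False using x(2) perm_diagram_horizontal[of n w] by simp
  qed
  then obtain i j g where t: "({LNode i, LNode j}, g) \<in> x" by blast
  obtain v w where v: "v \<in> nodes n" "w \<in> nodes n" "v \<noteq> w" "{LNode i, LNode j} = {v, w}" "g \<in> carrier G"
    by (rule diagrams_edge[OF x(1) t]) simp
  then have "i < n" "j < n" "i \<noteq> j" by (auto simp: nodes_def doubleton_eq_iff)
  then have "({LNode i, LNode j}, g) \<in> left_cups" using v(5) by (auto simp: left_cups_def)
  then show ?thesis using t by (rule that)
qed

lemma left_cup_nonhor: "t \<in> left_cups \<Longrightarrow> t \<in> x \<Longrightarrow> \<not> only_horizontal x"
proof
  assume t: "t \<in> left_cups" "t \<in> x" and h: "only_horizontal x"
  obtain i j g where ij: "t = ({LNode i, LNode j}, g)" using t(1) by (auto simp: left_cups_def)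
  have "case t of (e, g) \<Rightarrow> \<exists>i j. e = {LNode i, RNode j}" using h t(2) unfolding only_horizontal_def by (rule bspec)
  then show False by (auto simp: ij doubleton_eq_iff)
qed

lemma acyclic_nonhor: "acyclic_on nonhor"
  unfolding acyclic_on_def
proof (intro allI ballI impI)
  fix i z assume z: "z \<in> Msub i nonhor" and dz: "i > 0 \<longrightarrow> d (i - 1) z \<in> E (i - 1)"
  \<comment> \<open>One left cup is chosen for each of the finitely many diagrams occurring in z;
    the resulting finite set F takes the place of all cups.\<close>
  define f where "f x = (SOME t. t \<in> left_cups \<and> t \<in> x)" for x :: "'g diagram"
  have f: "f x \<in> left_cups \<and> f x \<in> x" if sx: "(s, x) \<in> csupp i z" for s x
  proof -
    have "x \<in> D" "\<not> only_horizontal x" using Msub_expansion(2,3)[OF z sx] by auto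
    then obtain t where "t \<in> left_cups" "t \<in> x" by (rule nonhor_left_cup)
    then show ?thesis unfolding f_def by (intro someI[of "\<lambda>t. t \<in> left_cups \<and> t \<in> x" t] conjI)
  qed
  define F where "F = (\<lambda>(s, x). f x) ` csupp i z"
  have F: "finite F" "F \<subseteq> left_cups" using csupp_finite[of i z] conjunct1[OF f] unfolding F_def by auto
  let ?B = "{x. {} \<subseteq> x \<and> F \<inter> x \<noteq> {}}"
  have zB: "z \<in> Msub i ?B"
    unfolding Msub_def
  proof (intro CollectI ballI allI impI)
    fix s x assume "s \<in> S i" "c i z s x \<noteq> \<zero>\<^bsub>k\<^esub>"
    then have sx: "(s, x) \<in> csupp i z" by (simp add: csupp_def)
    then have "f x \<in> F" unfolding F_def by (intro image_eqI[of _ _ "(s, x)"]) simp_all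
    then show "{} \<subseteq> x \<and> F \<inter> x \<noteq> {}" using f[OF sx] by blast
  qed
  have ac: "acyclic_on ?B" by (rule acyclic_some_cup[OF F]) simp_all
  obtain y where y: "y \<in> Msub (Suc i) ?B" "z - d i y \<in> E i"
    by (rule bexE[OF acyclic_onD[OF ac zB dz[rule_format]]])
  have "?B \<subseteq> nonhor"
  proof
    fix x assume "x \<in> ?B"
    then obtain t where "t \<in> F" "t \<in> x" by blast
    then show "x \<in> nonhor" using left_cup_nonhor[OF subsetD[OF F(2)]] by simp
  qed
  then have "y \<in> Msub (Suc i) nonhor" using y(1) by (rule subsetD[OF Msub_mono])
  then show "\<exists>y\<in>Msub (Suc i) nonhor. z - d i y \<in> E i" using y(2) by (rule bexI[rotated])
qed

lemma right_ideal_nonhor: "right_ideal nonhor"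
  using glue_horizontal by (auto simp: right_ideal_def)

subsection \<open>The quotient resolution\<close>

abbreviation "I i \<equiv> Msub i nonhor"

definition opW :: "nat \<Rightarrow> 'k \<Rightarrow> (nat \<Rightarrow> nat \<times> 'g) \<Rightarrow> ('p \<Rightarrow>\<^sub>0 int) \<Rightarrow> ('p \<Rightarrow>\<^sub>0 int)" where
  "opW i a w = op i a (pd w)"

definition cW :: "nat \<Rightarrow> ('p \<Rightarrow>\<^sub>0 int) \<Rightarrow> 'p \<Rightarrow> (nat \<Rightarrow> nat \<times> 'g) \<Rightarrow> 'k" where
  "cW i z s w = c i z s (pd w)"

text \<open>The span of the non-horizontal diagrams is a left ideal as well as a right one, so the
  quotient carries an action.\<close>

lemma op_I:
  assumes a: "a \<in> carrier k" and x: "x \<in> D" and z: "z \<in> I i" shows "op i a x z \<in> I i"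
proof -
  let ?z = "\<Sum>(s, y)\<in>csupp i z. op i (c i z s y) y (u i s)"
  have "op i a x z - op i a x ?z \<in> I i" by (rule E_Msub[OF op_cong[OF a x expansion]])
  moreover have "op i a x ?z \<in> I i"
    unfolding addv_sum[OF addv_op]
  proof (rule subgrp_sum[OF subgrp_Msub], clarsimp)
    fix s y assume sy: "(s, y) \<in> csupp i z"
    note m = Msub_expansion[OF z sy]
    let ?b = "a \<otimes>\<^bsub>k\<^esub> c i z s y \<otimes>\<^bsub>k\<^esub> loop x y"
    have "op i a x (op i (c i z s y) y (u i s)) - op i ?b (glue G x y) (u i s) \<in> I i"
      by (rule E_Msub[OF op_op[OF a c_closed[OF m(1)] x m(3)]])
    moreover have "op i ?b (glue G x y) (u i s) \<in> I i"
      by (rule Msub_op[OF right_ideal_nonhor])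
        (use a c_closed[OF m(1)] x m loop_closed glue_closed glue_horizontal in auto)
    ultimately show "op i a x (op i (c i z s y) y (u i s)) \<in> I i" using subgrp_cong[OF subgrp_Msub] by blast
  qed
  ultimately show ?thesis using subgrp_cong[OF subgrp_Msub] by blast
qed

lemma kmod_opW: "kmod k W (carrier W) (I i) (opW i)"
  unfolding kmod_def opW_def
proof (intro conjI ballI allI)
  fix a w assume a: "a \<in> carrier k" and w: "w \<in> carrier W"
  show "addv (op i a (pd w))" by (rule addv_op)
  show "op i a (pd w) z \<in> I i" if "z \<in> I i" for z by (rule op_I[OF a pd_closed[OF w] that])
  show "op i (a \<oplus>\<^bsub>k\<^esub> b) (pd w) z - (op i a (pd w) z + op i b (pd w) z) \<in> I i" if "b \<in> carrier k" for b z
    by (rule E_Msub[OF op_add[OF a that pd_closed[OF w]]])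
  show "op i a (pd w) (op i b (pd v) z) - op i (a \<otimes>\<^bsub>k\<^esub> b) (pd (w \<otimes>\<^bsub>W\<^esub> v)) z \<in> I i"
    if b: "b \<in> carrier k" and v: "v \<in> carrier W" for b v z
    using E_Msub[OF op_op[OF a b pd_closed[OF w] pd_closed[OF v], of i z]] a b
    by (simp add: glue_pd[OF w v] loop_pd)
next
  show "op i \<one>\<^bsub>k\<^esub> (pd \<one>\<^bsub>W\<^esub>) z - z \<in> I i" for z by (rule E_Msub[OF op_one])
qed (rule subgrp_Msub)

text \<open>The basis is kept and the coordinates are restricted to permutation diagrams; the rest
  of each expansion lies in the submodule divided out.\<close>

lemma dual_basis_W: "dual_basis k W (I i) (opW i) (S i) (u i) (cW i)"
  unfolding dual_basis_def
proof (intro conjI ballI allI)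
  show "cW i z s w \<in> carrier k" if "s \<in> S i" for z s w by (simp add: cW_def c_closed that)
  fix z
  have inj: "inj_on (\<lambda>(s, w). (s, pd w)) (UNIV \<times> carrier W)"
    using perm_diagram_inj by (auto simp: inj_on_def)
  let ?B = "{(s, w). s \<in> S i \<and> w \<in> carrier W \<and> cW i z s w \<noteq> \<zero>\<^bsub>k\<^esub>}"
  let ?f = "\<lambda>(s, w). (s, pd w)"
  have injB: "inj_on ?f ?B" by (rule inj_on_subset[OF inj]) auto
  have im: "?f ` ?B = {(s, x) \<in> csupp i z. only_horizontal x}"
  proof
    show "?f ` ?B \<subseteq> {(s, x) \<in> csupp i z. only_horizontal x}"
      using perm_diagram_horizontal by (auto simp: csupp_def cW_def)
    show "{(s, x) \<in> csupp i z. only_horizontal x} \<subseteq> ?f ` ?B"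
    proof clarify
      fix s x assume sx: "(s, x) \<in> csupp i z" "only_horizontal x"
      then obtain w where w: "w \<in> carrier W" "x = pd w" using horizontal_perm[OF _ _ G.is_group, of x n] csupp_D by blast
      then show "(s, x) \<in> ?f ` ?B" using sx(1) by (intro image_eqI[of _ _ "(s, w)"]) (auto simp: csupp_def cW_def)
    qed
  qed
  have "finite (?f ` ?B)" unfolding im by (rule finite_subset[OF _ csupp_finite[of i z]]) auto
  then show "finite ?B" using finite_imageD[OF _ injB] by blast
  show "cW i (z + y) s w = cW i z s w \<oplus>\<^bsub>k\<^esub> cW i y s w" for y s w by (simp add: cW_def c_add add_A)
  show "cW i y s w = \<zero>\<^bsub>k\<^esub>" if "y \<in> I i" "s \<in> S i" for y s w
    using that perm_diagram_horizontal by (auto simp: Msub_def cW_def)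
  show "cW i (opW i a v z) s (v \<otimes>\<^bsub>W\<^esub> w) = a \<otimes>\<^bsub>k\<^esub> cW i z s w"
    if "a \<in> carrier k" "v \<in> carrier W" "s \<in> S i" "w \<in> carrier W" for a v s w
    using that by (simp add: cW_def opW_def c_op pd_closed mono_pd_coeff c_A)
  let ?t = "\<lambda>(s, x). op i (c i z s x) x (u i s)"
  let ?N = "{(s, x) \<in> csupp i z. \<not> only_horizontal x}"
  let ?H = "{(s, x) \<in> csupp i z. only_horizontal x}"
  have HN: "?H \<union> ?N = csupp i z" by auto
  have fin: "finite ?H" "finite ?N" by (rule finite_subset[OF _ csupp_finite[of i z]], blast)+
  have "sum ?t (?H \<union> ?N) = sum ?t ?H + sum ?t ?N" by (rule sum.union_disjoint[OF fin]) auto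
  then have "sum ?t (csupp i z) = sum ?t (?f ` ?B) + sum ?t ?N" unfolding HN im .
  moreover have "sum ?t (?f ` ?B) = (\<Sum>(s, w)\<in>?B. opW i (cW i z s w) w (u i s))"
    by (subst sum.reindex[OF injB]) (simp add: opW_def cW_def case_prod_beta)
  moreover have "sum ?t ?N \<in> I i"
  proof (rule subgrp_sum[OF subgrp_Msub], clarify)
    fix s x assume sx: "(s, x) \<in> csupp i z" "\<not> only_horizontal x"
    then show "op i (c i z s x) x (u i s) \<in> I i"
      using csupp_D[OF sx(1)] by (intro Msub_op[OF right_ideal_nonhor] c_closed) auto
  qed
  ultimately show "z - (\<Sum>(s, w)\<in>?B. opW i (cW i z s w) w (u i s)) \<in> I i"
    using subgrp_add[OF subgrp_Msub E_Msub[OF expansion[of z i]], of "sum ?t ?N" nonhor]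
    by (simp only: diff_add_eq diff_diff_eq2 add_diff_cancel_right)
qed

lemma kmod_dual_basis_W: "kmod_dual_basis k W (I i) (opW i) (S i) (u i) (cW i)"
  by (rule kmod_dual_basis.intro[OF cring_k W kmod_opW dual_basis_W])

lemma lin_dW: "lin k (carrier W) (I (Suc i)) (opW (Suc i)) (I i) (opW i) (d i)"
  unfolding lin_def opW_def
  by (auto intro: addv_d Msub_d[OF right_ideal_nonhor] E_Msub[OF d_op] pd_closed)

text \<open>The quotient of an exact complex by an acyclic subcomplex is exact: a relative cycle is
  first corrected inside the subcomplex.\<close>

lemma exact_dW:
  assumes "d i z \<in> I i" shows "\<exists>y. z - d (Suc i) y \<in> I (Suc i)"
proof -
  have "i > 0 \<Longrightarrow> d (i - 1) (d i z) \<in> E (i - 1)" using d_d[of "i - 1" z] by simp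
  then obtain t where t: "t \<in> I (Suc i)" "d i z - d i t \<in> E i" using acyclic_onD[OF acyclic_nonhor assms] by blast
  then have "d i (z - t) \<in> E i" by (simp add: addv_diff[OF addv_d])
  then obtain y where "z - t - d (Suc i) y \<in> E (Suc i)" using exact_d by blast
  from subgrp_add[OF subgrp_Msub E_Msub[OF this] t(1)] show ?thesis by (intro exI[of _ y]) (simp add: algebra_simps)
qed

lemma exact_0W: "aug P (ev 0 z) = \<zero>\<^bsub>k\<^esub> \<Longrightarrow> \<exists>y. z - d 0 y \<in> I 0"
  using exact_0 E_Msub by blast

lemma aug_I:
  assumes z: "z \<in> I 0" shows "aug P (ev 0 z) = \<zero>\<^bsub>k\<^esub>"
proof -
  obtain y where "z - d 0 y \<in> E 0" using acyclic_onD[OF acyclic_nonhor z] by auto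
  then have "ev 0 z = diff P 0 (ev (Suc 0) y)" by (simp add: E_iff ev_d)
  then show ?thesis using aug_diff ev_closed by simp
qed

lemma aug_ev_diff: "aug P (ev 0 (y - z)) = aug P (ev 0 y) \<ominus>\<^bsub>k\<^esub> aug P (ev 0 z)"
proof -
  have "aug P (ev 0 y) = aug P (ev 0 (y - z)) \<oplus>\<^bsub>k\<^esub> aug P (ev 0 z)"
    using aug_add[OF ev_closed ev_closed, of "y - z" z] ev_add[of 0 "y - z" z] by simp
  then show ?thesis
    using aug_closed[OF ev_closed] by (simp add: k.minus_eq k.a_assoc k.r_neg)
qed

text \<open>Permutation diagrams act as 1 on the trivial module, so w z - z has augmentation zero
  and is a boundary; this gives the trivial action on homology in degree 0.\<close>

lemma wreath_resolution_I: "wreath_resolution G k n I opW d S u cW"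
proof (rule wreath_resolution.intro)
  show "\<exists>y. opW 0 \<one>\<^bsub>k\<^esub> w z - z - d 0 y \<in> I 0" if w: "w \<in> carrier W" for w z
    by (rule exact_0W) (simp add: aug_ev_diff opW_def aug_op pd_closed w perm_diagram_horizontal
        aug_closed ev_closed k.minus_eq k.r_neg)
qed (use G.is_group kmod_dual_basis_W lin_dW exact_dW d_d E_Msub in auto)

end

section \<open>Homology of complexes of presented abelian groups\<close>

definition fcoset :: "'b set \<Rightarrow> ('b \<Rightarrow>\<^sub>0 int) set \<Rightarrow> ('b \<Rightarrow>\<^sub>0 int) \<Rightarrow> ('b \<Rightarrow>\<^sub>0 int) set" where
  "fcoset B K x = K #>\<^bsub>free_Abelian_group B\<^esub> x"

lemma fcoset_eq: "fcoset B K x = {h + x | h. h \<in> K}"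
  by (auto simp: fcoset_def r_coset_def)

text \<open>A bridge between the group records in which tensor products and homology are defined and
  the additive types in which the argument is carried out.\<close>

lemma subgroup_frag_iff:
  "subgroup K (free_Abelian_group B) \<longleftrightarrow> subgrp K \<and> (\<forall>x\<in>K. Poly_Mapping.keys x \<subseteq> B)"
proof
  assume K: "subgroup K (free_Abelian_group B)"
  have kB: "\<forall>x\<in>K. Poly_Mapping.keys x \<subseteq> B"
    using subsetD[OF subgroup.subset[OF K]] by (simp only: carrier_free_Abelian_group_iff ball_simps) simp
  have "x - y \<in> K" if "x \<in> K" "y \<in> K" for x y
    using subgroup.m_closed[OF K that(1) subgroup.m_inv_closed[OF K that(2)]] kB that by simp
  then show "subgrp K \<and> (\<forall>x\<in>K. Poly_Mapping.keys x \<subseteq> B)"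
    using kB subgroup.one_closed[OF K] by (simp add: subgrp_def)
next
  assume K: "subgrp K \<and> (\<forall>x\<in>K. Poly_Mapping.keys x \<subseteq> B)"
  interpret group "free_Abelian_group B" by simp
  show "subgroup K (free_Abelian_group B)"
  proof (rule subgroupI)
    show "K \<noteq> {}" using K subgrp_zero by blast
    show "inv\<^bsub>free_Abelian_group B\<^esub> a \<in> K" if "a \<in> K" for a using that K by (simp add: subgrp_minus)
  qed (use K in \<open>auto simp: subgrp_add\<close>)
qed

text \<open>The homology of a complex of factor groups is to be described by representatives; the
  differentials are additive on the whole type and are controlled on chains with generators in
  B.\<close>

locale presented_complex =
  fixes B :: "nat \<Rightarrow> 'b set" and K :: "nat \<Rightarrow> ('b \<Rightarrow>\<^sub>0 int) set" and d :: "nat \<Rightarrow> ('b \<Rightarrow>\<^sub>0 int) \<Rightarrow> ('b \<Rightarrow>\<^sub>0 int)"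
  assumes K: "subgroup (K i) (free_Abelian_group (B i))"
    and addv_d: "addv (d i)"
    and d_keys: "Poly_Mapping.keys x \<subseteq> B (Suc i) \<Longrightarrow> Poly_Mapping.keys (d i x) \<subseteq> B i"
    and d_K: "x \<in> K (Suc i) \<Longrightarrow> d i x \<in> K i"
    and d_d: "Poly_Mapping.keys x \<subseteq> B (Suc (Suc i)) \<Longrightarrow> d i (d (Suc i) x) \<in> K i"
begin

abbreviation "FA i \<equiv> free_Abelian_group (B i)"
abbreviation "cl i \<equiv> fcoset (B i) (K i)"

definition C :: "nat \<Rightarrow> ('b \<Rightarrow>\<^sub>0 int) set monoid" where "C i = FA i Mod K i"

definition dC :: "nat \<Rightarrow> ('b \<Rightarrow>\<^sub>0 int) set \<Rightarrow> ('b \<Rightarrow>\<^sub>0 int) set" where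
  "dC i \<xi> = the_elem ((\<lambda>c. cl i (d i c)) ` \<xi>)"

lemma subK: "subgrp (K i)"
  using K[of i] by (auto simp: subgroup_frag_iff)

lemma cl_eq: "cl i x = cl i y \<longleftrightarrow> x - y \<in> K i"
proof
  assume "cl i x = cl i y"
  moreover have "x \<in> cl i x" using subgrp_zero[OF subK[of i]] by (force simp: fcoset_eq)
  ultimately obtain h where "h \<in> K i" "x = h + y" by (auto simp: fcoset_eq)
  then show "x - y \<in> K i" by simp
next
  assume xy: "x - y \<in> K i"
  have "cl i x \<subseteq> cl i y" if "x - y \<in> K i" for x y
  proof
    fix z assume "z \<in> cl i x"
    then obtain h where "h \<in> K i" "z = h + x" by (auto simp: fcoset_eq)
    then have "h + (x - y) \<in> K i" "z = (h + (x - y)) + y" using that subgrp_add[OF subK[of i]] by auto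
    then show "z \<in> cl i y" unfolding fcoset_eq by blast
  qed
  then show "cl i x = cl i y" using xy subgrp_sym[OF subK xy] by blast
qed

lemma in_cl: "y \<in> cl i x \<Longrightarrow> y - x \<in> K i"
  by (auto simp: fcoset_eq)

lemma self_cl: "x \<in> cl i x"
  using subgrp_zero[OF subK[of i]] by (force simp: fcoset_eq)

lemma normal_K: "K i \<lhd> FA i"
  by (rule comm_group.subgroup_imp_normal[OF abelian_free_Abelian_group K])

lemma carrier_C: "\<xi> \<in> carrier (C i) \<longleftrightarrow> (\<exists>x. Poly_Mapping.keys x \<subseteq> B i \<and> \<xi> = cl i x)"
  unfolding C_def FactGroup_def RCOSETS_def fcoset_def by (simp add: Bex_def)

lemma mult_C: "Poly_Mapping.keys x \<subseteq> B i \<Longrightarrow> Poly_Mapping.keys y \<subseteq> B i \<Longrightarrow> cl i x \<otimes>\<^bsub>C i\<^esub> cl i y = cl i (x + y)"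
  using normal.rcos_sum[OF normal_K, of x i y] by (simp add: C_def FactGroup_def fcoset_def)

lemma one_C: "\<one>\<^bsub>C i\<^esub> = cl i 0"
  by (auto simp: C_def FactGroup_def fcoset_eq)

lemma comm_group_C: "comm_group (C i)"
  unfolding C_def by (rule comm_group.abelian_FactGroup[OF abelian_free_Abelian_group K])

lemma the_elem_cl:
  assumes "\<And>y. y \<in> cl i x \<Longrightarrow> f y = f x" shows "the_elem (f ` cl i x) = f x"
proof -
  have "f ` cl i x = (\<lambda>_. f x) ` cl i x" by (rule image_cong[OF refl assms])
  also have "\<dots> = {f x}" by (rule image_constant[OF self_cl])
  finally show ?thesis by simp
qed

lemma dC_cl: "dC i (cl (Suc i) x) = cl i (d i x)"
  unfolding dC_def
proof (rule the_elem_cl)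
  fix y assume "y \<in> cl (Suc i) x"
  from d_K[OF in_cl[OF this]] show "cl i (d i y) = cl i (d i x)" by (simp add: cl_eq addv_diff[OF addv_d])
qed

definition cyc :: "nat \<Rightarrow> ('b \<Rightarrow>\<^sub>0 int) \<Rightarrow> bool" where
  "cyc i x \<longleftrightarrow> Poly_Mapping.keys x \<subseteq> B i \<and> (i > 0 \<longrightarrow> d (i - 1) x \<in> K (i - 1))"

lemma cycles_iff: "\<xi> \<in> cycles C dC i \<longleftrightarrow> (\<exists>x. cyc i x \<and> \<xi> = cl i x)"
proof (cases i)
  case 0
  then show ?thesis by (simp add: carrier_C cyc_def)
next
  case (Suc j)
  have "dC j (cl (Suc j) x) = \<one>\<^bsub>C j\<^esub> \<longleftrightarrow> d j x \<in> K j" for x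
    by (simp add: dC_cl one_C cl_eq)
  then show ?thesis unfolding Suc by (auto simp: kernel_def carrier_C cyc_def)
qed

lemma boundaries_iff: "\<xi> \<in> boundaries C dC i \<longleftrightarrow> (\<exists>y. Poly_Mapping.keys y \<subseteq> B (Suc i) \<and> \<xi> = cl i (d i y))"
proof -
  have "\<xi> \<in> boundaries C dC i \<longleftrightarrow> (\<exists>y. Poly_Mapping.keys y \<subseteq> B (Suc i) \<and> \<xi> = dC i (cl (Suc i) y))"
    unfolding boundaries_def image_iff Bex_def carrier_C by blast
  then show ?thesis by (simp add: dC_cl)
qed

lemma cyc_diff: "cyc i x \<Longrightarrow> cyc i y \<Longrightarrow> cyc i (x - y)"
  using keys_diff[of x y] by (auto simp: cyc_def addv_diff[OF addv_d] intro: subgrp_diff[OF subK])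

lemma cyc_boundary: "Poly_Mapping.keys y \<subseteq> B (Suc i) \<Longrightarrow> cyc i (d i y)"
  using d_keys[of y i] d_d[of y "i - 1"] by (auto simp: cyc_def)

abbreviation "Z i \<equiv> C i\<lparr>carrier := cycles C dC i\<rparr>"

lemma inv_C: "Poly_Mapping.keys x \<subseteq> B i \<Longrightarrow> inv\<^bsub>C i\<^esub> (cl i x) = cl i (- x)"
proof -
  assume x: "Poly_Mapping.keys x \<subseteq> B i"
  interpret comm_group "C i" by (rule comm_group_C)
  show ?thesis
  proof (rule inv_equality)
    have x': "Poly_Mapping.keys (- x) \<subseteq> B i" using x by (simp add: keys_minus)
    show "cl i (- x) \<otimes>\<^bsub>C i\<^esub> cl i x = \<one>\<^bsub>C i\<^esub>" by (simp add: mult_C[OF x' x] one_C)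
    show "cl i x \<in> carrier (C i)" "cl i (- x) \<in> carrier (C i)" unfolding carrier_C using x x' by blast+
  qed
qed

lemma subgroup_C:
  assumes sub: "\<And>x. Q x \<Longrightarrow> Poly_Mapping.keys x \<subseteq> B i" and zero: "Q 0" and diff: "\<And>x y. Q x \<Longrightarrow> Q y \<Longrightarrow> Q (x - y)"
  shows "subgroup {cl i x | x. Q x} (C i)"
proof -
  interpret comm_group "C i" by (rule comm_group_C)
  have minus: "Q (- x)" if "Q x" for x using diff[OF zero that] by simp
  have add: "Q (x + y)" if "Q x" "Q y" for x y using diff[OF that(1) minus[OF that(2)]] by simp
  show ?thesis
  proof (rule subgroupI)
    show "{cl i x | x. Q x} \<subseteq> carrier (C i)" using sub carrier_C by blast
    show "{cl i x | x. Q x} \<noteq> {}" using zero by blast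
    fix a b assume "a \<in> {cl i x | x. Q x}" "b \<in> {cl i x | x. Q x}"
    then obtain x y where xy: "a = cl i x" "Q x" "b = cl i y" "Q y" by blast
    have "inv\<^bsub>C i\<^esub> a = cl i (- x)" using inv_C[OF sub[OF xy(2)]] xy(1) by simp
    then show "inv\<^bsub>C i\<^esub> a \<in> {cl i x | x. Q x}" using minus[OF xy(2)] by blast
    have "a \<otimes>\<^bsub>C i\<^esub> b = cl i (x + y)" using mult_C[OF sub[OF xy(2)] sub[OF xy(4)]] xy by simp
    then show "a \<otimes>\<^bsub>C i\<^esub> b \<in> {cl i x | x. Q x}" using add[OF xy(2,4)] by blast
  qed
qed

lemma subgroup_cycles: "subgroup (cycles C dC i) (C i)"
proof -
  have eq: "cycles C dC i = {cl i x | x. cyc i x}" using cycles_iff by blast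
  show ?thesis unfolding eq
    by (rule subgroup_C) (auto simp: cyc_diff, auto simp: cyc_def addv_zero[OF addv_d] subgrp_zero[OF subK])
qed

lemma subgroup_boundaries: "subgroup (boundaries C dC i) (C i)"
proof -
  have eq: "boundaries C dC i = {cl i x | x. \<exists>y. Poly_Mapping.keys y \<subseteq> B (Suc i) \<and> x = d i y}"
    using boundaries_iff by blast
  show ?thesis unfolding eq
  proof (rule subgroup_C)
    show "\<exists>y. Poly_Mapping.keys y \<subseteq> B (Suc i) \<and> 0 = d i y"
      by (rule exI[of _ 0]) (simp add: addv_zero[OF addv_d])
    fix x x' assume "\<exists>y. Poly_Mapping.keys y \<subseteq> B (Suc i) \<and> x = d i y"
      "\<exists>y. Poly_Mapping.keys y \<subseteq> B (Suc i) \<and> x' = d i y"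
    then obtain y y' where y: "Poly_Mapping.keys y \<subseteq> B (Suc i)" "x = d i y"
      "Poly_Mapping.keys y' \<subseteq> B (Suc i)" "x' = d i y'" by blast
    then show "\<exists>y. Poly_Mapping.keys y \<subseteq> B (Suc i) \<and> x - x' = d i y"
      using keys_diff[of y y'] by (intro exI[of _ "y - y'"]) (auto simp: addv_diff[OF addv_d])
  qed (use d_keys in blast)
qed

lemma group_Z: "comm_group (Z i)"
proof -
  interpret comm_group "C i" by (rule comm_group_C)
  have "group (Z i)" by (rule subgroup.subgroup_is_group[OF subgroup_cycles is_group])
  then show ?thesis
    by (rule group.group_comm_groupI) (use m_comm subgroup.subset[OF subgroup_cycles] in auto)
qed

lemma boundaries_cycles: "boundaries C dC i \<subseteq> cycles C dC i"
proof
  fix \<xi> assume "\<xi> \<in> boundaries C dC i"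
  then obtain y where "Poly_Mapping.keys y \<subseteq> B (Suc i)" "\<xi> = cl i (d i y)" using boundaries_iff by blast
  then show "\<xi> \<in> cycles C dC i" using cyc_boundary cycles_iff by blast
qed

lemma normal_boundaries: "boundaries C dC i \<lhd> Z i"
proof -
  interpret comm_group "C i" by (rule comm_group_C)
  have "subgroup (boundaries C dC i) (Z i)"
    by (rule subgroup_incl[OF subgroup_boundaries subgroup_cycles boundaries_cycles])
  then show ?thesis by (rule comm_group.subgroup_imp_normal[OF group_Z])
qed

end

section \<open>Isomorphisms between quotient groups and between homology groups\<close>

lemma (in group) rcoset_eq_iff:
  assumes H: "subgroup H G" and ab: "a \<in> carrier G" "b \<in> carrier G"
  shows "H #> a = H #> b \<longleftrightarrow> a \<otimes> inv b \<in> H"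
proof
  assume "H #> a = H #> b"
  from coset_mult_inv2[OF this ab subgroup.subset[OF H]] show "a \<otimes> inv b \<in> H"
    by (rule coset_join1[OF _ _ H]) (use ab in simp)
next
  assume "a \<otimes> inv b \<in> H"
  then have "H #> (a \<otimes> inv b) = H" by (intro coset_join2[OF _ H]) (use ab in simp)
  then show "H #> a = H #> b" by (rule coset_mult_inv1[OF _ ab subgroup.subset[OF H]])
qed

lemma quotient_map_iso:
  assumes Z: "group Z" and Z': "group Z'" and N: "N \<lhd> Z" and N': "N' \<lhd> Z'"
    and h: "h \<in> hom Z Z'" and hN: "\<And>x. x \<in> N \<Longrightarrow> h x \<in> N'"
    and inj: "\<And>x. \<lbrakk>x \<in> carrier Z; h x \<in> N'\<rbrakk> \<Longrightarrow> x \<in> N"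
    and surj: "\<And>y. y \<in> carrier Z' \<Longrightarrow> \<exists>x\<in>carrier Z. y \<otimes>\<^bsub>Z'\<^esub> inv\<^bsub>Z'\<^esub> h x \<in> N'"
  shows "(\<lambda>\<xi>. the_elem ((\<lambda>z. N' #>\<^bsub>Z'\<^esub> h z) ` \<xi>)) \<in> iso (Z Mod N) (Z' Mod N')"
proof -
  interpret Z: group Z by (rule Z)
  interpret Z': group Z' by (rule Z')
  interpret N: normal N Z by (rule N)
  interpret N': normal N' Z' by (rule N')
  interpret h: group_hom Z Z' h by (simp add: group_hom_def group_hom_axioms_def Z Z' h)
  let ?f = "\<lambda>\<xi>. the_elem ((\<lambda>z. N' #>\<^bsub>Z'\<^esub> h z) ` \<xi>)"
  note coset_eq = Z'.rcoset_eq_iff[OF N'.is_subgroup]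
  note coset_eqZ = Z.rcoset_eq_iff[OF N.is_subgroup]
  have f: "?f (N #>\<^bsub>Z\<^esub> x) = N' #>\<^bsub>Z'\<^esub> h x" if x: "x \<in> carrier Z" for x
  proof -
    have const: "N' #>\<^bsub>Z'\<^esub> h z = N' #>\<^bsub>Z'\<^esub> h x" if z: "z \<in> N #>\<^bsub>Z\<^esub> x" for z
    proof -
      obtain m where m: "m \<in> N" "z = m \<otimes>\<^bsub>Z\<^esub> x" using z by (auto simp: r_coset_def)
      then have "h z = h m \<otimes>\<^bsub>Z'\<^esub> h x" using x by simp
      then have "h z \<otimes>\<^bsub>Z'\<^esub> inv\<^bsub>Z'\<^esub> h x = h m" using m x by (simp add: Z'.m_assoc)
      then show ?thesis using coset_eq[of "h z" "h x"] hN[OF m(1)] m x by simp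
    qed
    have "(\<lambda>z. N' #>\<^bsub>Z'\<^esub> h z) ` (N #>\<^bsub>Z\<^esub> x) = (\<lambda>_. N' #>\<^bsub>Z'\<^esub> h x) ` (N #>\<^bsub>Z\<^esub> x)"
      by (rule image_cong[OF refl const])
    also have "\<dots> = {N' #>\<^bsub>Z'\<^esub> h x}" by (rule image_constant[OF Z.rcos_self[OF x N.is_subgroup]])
    finally show ?thesis by simp
  qed
  have car: "\<xi> \<in> carrier (Z Mod N) \<longleftrightarrow> (\<exists>x\<in>carrier Z. \<xi> = N #>\<^bsub>Z\<^esub> x)" for \<xi>
    by (auto simp: FactGroup_def RCOSETS_def)
  have car': "\<xi> \<in> carrier (Z' Mod N') \<longleftrightarrow> (\<exists>x\<in>carrier Z'. \<xi> = N' #>\<^bsub>Z'\<^esub> x)" for \<xi>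
    by (auto simp: FactGroup_def RCOSETS_def)
  have closed: "?f \<xi> \<in> carrier (Z' Mod N')" if \<xi>: "\<xi> \<in> carrier (Z Mod N)" for \<xi>
  proof -
    obtain x where x: "x \<in> carrier Z" "\<xi> = N #>\<^bsub>Z\<^esub> x" using \<xi> car by blast
    show ?thesis unfolding car' x(2) f[OF x(1)] using h.hom_closed[OF x(1)] by blast
  qed
  show ?thesis
  proof (rule isoI)
    show "?f \<in> hom (Z Mod N) (Z' Mod N')"
    proof (rule homI)
      show "?f \<xi> \<in> carrier (Z' Mod N')" if \<xi>: "\<xi> \<in> carrier (Z Mod N)" for \<xi>
        by (rule closed[OF \<xi>])
      fix \<xi> \<eta> assume "\<xi> \<in> carrier (Z Mod N)" "\<eta> \<in> carrier (Z Mod N)"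
      then obtain x y where xy: "x \<in> carrier Z" "y \<in> carrier Z" "\<xi> = N #>\<^bsub>Z\<^esub> x" "\<eta> = N #>\<^bsub>Z\<^esub> y"
        unfolding car by blast
      have 1: "\<xi> \<otimes>\<^bsub>Z Mod N\<^esub> \<eta> = N #>\<^bsub>Z\<^esub> (x \<otimes>\<^bsub>Z\<^esub> y)"
        unfolding xy(3,4) FactGroup_def using N.rcos_sum[OF xy(1,2)] by simp
      have 2: "(N' #>\<^bsub>Z'\<^esub> h x) \<otimes>\<^bsub>Z' Mod N'\<^esub> (N' #>\<^bsub>Z'\<^esub> h y) = N' #>\<^bsub>Z'\<^esub> (h x \<otimes>\<^bsub>Z'\<^esub> h y)"
        unfolding FactGroup_def using N'.rcos_sum[OF h.hom_closed[OF xy(1)] h.hom_closed[OF xy(2)]] by simp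
      show "?f (\<xi> \<otimes>\<^bsub>Z Mod N\<^esub> \<eta>) = ?f \<xi> \<otimes>\<^bsub>Z' Mod N'\<^esub> ?f \<eta>"
        unfolding 1 unfolding xy(3,4) f[OF xy(1)] f[OF xy(2)] f[OF Z.m_closed[OF xy(1,2)]] 2 h.hom_mult[OF xy(1,2)] ..
    qed
    show "bij_betw ?f (carrier (Z Mod N)) (carrier (Z' Mod N'))"
      unfolding bij_betw_def
    proof
      show "inj_on ?f (carrier (Z Mod N))"
      proof (rule inj_onI)
        fix \<xi> \<eta> assume "\<xi> \<in> carrier (Z Mod N)" "\<eta> \<in> carrier (Z Mod N)" and eq: "?f \<xi> = ?f \<eta>"
        then obtain x y where xy: "x \<in> carrier Z" "y \<in> carrier Z" "\<xi> = N #>\<^bsub>Z\<^esub> x" "\<eta> = N #>\<^bsub>Z\<^esub> y"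
          unfolding car by blast
        have "N' #>\<^bsub>Z'\<^esub> h x = N' #>\<^bsub>Z'\<^esub> h y"
          using eq unfolding xy(3,4) f[OF xy(1)] f[OF xy(2)] .
        then have "h (x \<otimes>\<^bsub>Z\<^esub> inv\<^bsub>Z\<^esub> y) \<in> N'" using coset_eq[of "h x" "h y"] xy(1,2) by simp
        then have "x \<otimes>\<^bsub>Z\<^esub> inv\<^bsub>Z\<^esub> y \<in> N" using xy(1,2) by (intro inj) simp_all
        then show "\<xi> = \<eta>" unfolding xy(3,4) using coset_eqZ[OF xy(1,2)] by simp
      qed
      show "?f ` carrier (Z Mod N) = carrier (Z' Mod N')"
      proof
        show "?f ` carrier (Z Mod N) \<subseteq> carrier (Z' Mod N')" using closed by blast
        show "carrier (Z' Mod N') \<subseteq> ?f ` carrier (Z Mod N)"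
        proof
          fix \<eta> assume "\<eta> \<in> carrier (Z' Mod N')"
          then obtain y where y: "y \<in> carrier Z'" "\<eta> = N' #>\<^bsub>Z'\<^esub> y" unfolding car' by blast
          obtain x where x: "x \<in> carrier Z" "y \<otimes>\<^bsub>Z'\<^esub> inv\<^bsub>Z'\<^esub> h x \<in> N'" using surj[OF y(1)] by blast
          then have "\<eta> = N' #>\<^bsub>Z'\<^esub> h x" using coset_eq[OF y(1) h.hom_closed[OF x(1)]] y(2) by simp
          then have "\<eta> = ?f (N #>\<^bsub>Z\<^esub> x)" unfolding f[OF x(1)] .
          moreover have "N #>\<^bsub>Z\<^esub> x \<in> carrier (Z Mod N)" using car x(1) by blast
          ultimately show "\<eta> \<in> ?f ` carrier (Z Mod N)" by (rule image_eqI)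
        qed
      qed
    qed
  qed
qed

text \<open>Injectivity and surjectivity on homology become statements about chains modulo
  \<open>K\<close> and \<open>K'\<close>, the form in which stability is proved. The map induced on
  cosets by \<open>the_elem\<close> is handled here once and for all.\<close>

lemma presented_homology_iso:
  fixes F :: "nat \<Rightarrow> ('b \<Rightarrow>\<^sub>0 int) \<Rightarrow> ('c \<Rightarrow>\<^sub>0 int)"
  assumes P: "presented_complex B K d" and P': "presented_complex B' K' d'"
    and addv_F: "\<And>i. addv (F i)"
    and F_keys: "\<And>i x. Poly_Mapping.keys x \<subseteq> B i \<Longrightarrow> Poly_Mapping.keys (F i x) \<subseteq> B' i"
    and F_K: "\<And>i x. x \<in> K i \<Longrightarrow> F i x \<in> K' i"
    and F_d: "\<And>i x. Poly_Mapping.keys x \<subseteq> B (Suc i) \<Longrightarrow> F i (d i x) - d' i (F (Suc i) x) \<in> K' i"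
    and inj: "\<And>x y. \<lbrakk>presented_complex.cyc B K d q x; Poly_Mapping.keys y \<subseteq> B' (Suc q); F q x - d' q y \<in> K' q\<rbrakk> \<Longrightarrow>
      \<exists>w. Poly_Mapping.keys w \<subseteq> B (Suc q) \<and> x - d q w \<in> K q"
    and surj: "\<And>y. presented_complex.cyc B' K' d' q y \<Longrightarrow>
      \<exists>x w. presented_complex.cyc B K d q x \<and> Poly_Mapping.keys w \<subseteq> B' (Suc q) \<and> y - F q x - d' q w \<in> K' q"
  shows "homology_map (presented_complex.C B' K') (presented_complex.dC B' K' d')
      (\<lambda>i \<xi>. the_elem ((\<lambda>c. fcoset (B' i) (K' i) (F i c)) ` \<xi>)) q
    \<in> iso (homology (presented_complex.C B K) (presented_complex.dC B K d) q)
        (homology (presented_complex.C B' K') (presented_complex.dC B' K' d') q)"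
proof -
  interpret P: presented_complex B K d by (rule P)
  interpret P': presented_complex B' K' d' by (rule P')
  let ?h = "\<lambda>\<xi>. the_elem ((\<lambda>c. P'.cl q (F q c)) ` \<xi>)"
  have h: "?h (P.cl q x) = P'.cl q (F q x)" for x
  proof (rule P.the_elem_cl)
    fix y assume "y \<in> P.cl q x"
    from F_K[OF P.in_cl[OF this]] show "P'.cl q (F q y) = P'.cl q (F q x)"
      by (simp add: P'.cl_eq addv_diff[OF addv_F])
  qed
  have F_cyc: "P'.cyc q (F q x)" if x: "P.cyc q x" for x
  proof (cases q)
    case 0
    then show ?thesis using x F_keys by (simp add: P.cyc_def P'.cyc_def)
  next
    case (Suc j)
    have "F j (d j x) - d' j (F (Suc j) x) \<in> K' j" using F_d x Suc by (simp add: P.cyc_def)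
    moreover have "F j (d j x) \<in> K' j" using F_K x Suc by (simp add: P.cyc_def)
    ultimately have "d' j (F (Suc j) x) \<in> K' j" using subgrp_cong[OF P'.subK] by blast
    then show ?thesis using x F_keys Suc by (simp add: P.cyc_def P'.cyc_def)
  qed
  have keys_cyc: "Poly_Mapping.keys x \<subseteq> B q" if "P.cyc q x" for x using that by (simp add: P.cyc_def)
  have keys_cyc': "Poly_Mapping.keys x \<subseteq> B' q" if "P'.cyc q x" for x using that by (simp add: P'.cyc_def)
  have car: "\<xi> \<in> carrier (P.Z q) \<longleftrightarrow> (\<exists>x. P.cyc q x \<and> \<xi> = P.cl q x)" for \<xi> by (simp add: P.cycles_iff)
  have car': "\<xi> \<in> carrier (P'.Z q) \<longleftrightarrow> (\<exists>x. P'.cyc q x \<and> \<xi> = P'.cl q x)" for \<xi> by (simp add: P'.cycles_iff)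
  interpret Z': comm_group "P'.Z q" by (rule P'.group_Z)
  interpret C': comm_group "P'.C q" by (rule P'.comm_group_C)
  have iso: "(\<lambda>\<xi>. the_elem ((\<lambda>z. boundaries P'.C P'.dC q #>\<^bsub>P'.Z q\<^esub> ?h z) ` \<xi>))
    \<in> iso (P.Z q Mod boundaries P.C P.dC q) (P'.Z q Mod boundaries P'.C P'.dC q)"
  proof (rule quotient_map_iso)
    show "group (P.Z q)" by (rule comm_group.axioms(2)[OF P.group_Z])
    show "group (P'.Z q)" by (rule comm_group.axioms(2)[OF P'.group_Z])
    show "boundaries P.C P.dC q \<lhd> P.Z q" by (rule P.normal_boundaries)
    show "boundaries P'.C P'.dC q \<lhd> P'.Z q" by (rule P'.normal_boundaries)
    show "?h \<in> hom (P.Z q) (P'.Z q)"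
    proof (rule homI)
      show "?h \<xi> \<in> carrier (P'.Z q)" if "\<xi> \<in> carrier (P.Z q)" for \<xi>
      proof -
        obtain x where x: "P.cyc q x" "\<xi> = P.cl q x" using \<open>\<xi> \<in> _\<close> unfolding car by blast
        have "?h \<xi> = P'.cl q (F q x)" using h x(2) by simp
        then show ?thesis unfolding car' using F_cyc[OF x(1)] by blast
      qed
      fix \<xi> \<eta> assume "\<xi> \<in> carrier (P.Z q)" "\<eta> \<in> carrier (P.Z q)"
      then obtain x y where xy: "P.cyc q x" "P.cyc q y" "\<xi> = P.cl q x" "\<eta> = P.cl q y" unfolding car by blast
      have "\<xi> \<otimes>\<^bsub>P.Z q\<^esub> \<eta> = P.cl q (x + y)" using P.mult_C keys_cyc xy by simp
      then show "?h (\<xi> \<otimes>\<^bsub>P.Z q\<^esub> \<eta>) = ?h \<xi> \<otimes>\<^bsub>P'.Z q\<^esub> ?h \<eta>"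
        using P'.mult_C[of "F q x" q "F q y"] F_keys keys_cyc xy by (simp add: h addv_add[OF addv_F])
    qed
    show "?h \<xi> \<in> boundaries P'.C P'.dC q" if "\<xi> \<in> boundaries P.C P.dC q" for \<xi>
    proof -
      obtain y where y: "Poly_Mapping.keys y \<subseteq> B (Suc q)" "\<xi> = P.cl q (d q y)" using \<open>\<xi> \<in> _\<close> P.boundaries_iff by blast
      then have "?h \<xi> = P'.cl q (d' q (F (Suc q) y))" using F_d[OF y(1)] by (simp add: h P'.cl_eq)
      then show ?thesis using P'.boundaries_iff F_keys[OF y(1)] by blast
    qed
    show "\<xi> \<in> boundaries P.C P.dC q" if \<xi>: "\<xi> \<in> carrier (P.Z q)" "?h \<xi> \<in> boundaries P'.C P'.dC q" for \<xi>
    proof -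
      obtain x where x: "P.cyc q x" "\<xi> = P.cl q x" using \<xi>(1) unfolding car by blast
      obtain y where y: "Poly_Mapping.keys y \<subseteq> B' (Suc q)" "?h \<xi> = P'.cl q (d' q y)"
        using \<xi>(2) P'.boundaries_iff by blast
      then have "F q x - d' q y \<in> K' q" using x by (simp add: h P'.cl_eq)
      then obtain w where "Poly_Mapping.keys w \<subseteq> B (Suc q)" "x - d q w \<in> K q" using inj[OF x(1) y(1)] by blast
      then show ?thesis using P.boundaries_iff P.cl_eq x(2) by blast
    qed
    show "\<exists>\<xi>\<in>carrier (P.Z q). \<eta> \<otimes>\<^bsub>P'.Z q\<^esub> inv\<^bsub>P'.Z q\<^esub> ?h \<xi> \<in> boundaries P'.C P'.dC q"
      if \<eta>: "\<eta> \<in> carrier (P'.Z q)" for \<eta>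
    proof -
      obtain y where y: "P'.cyc q y" "\<eta> = P'.cl q y" using \<eta> unfolding car' by blast
      obtain x w where x: "P.cyc q x" "Poly_Mapping.keys w \<subseteq> B' (Suc q)" "y - F q x - d' q w \<in> K' q"
        using surj[OF y(1)] by blast
      have kF: "Poly_Mapping.keys (F q x) \<subseteq> B' q" by (rule F_keys[OF keys_cyc[OF x(1)]])
      have "?h (P.cl q x) \<in> carrier (P'.Z q)" using h F_cyc[OF x(1)] unfolding car' by blast
      then have "inv\<^bsub>P'.Z q\<^esub> ?h (P.cl q x) = inv\<^bsub>P'.C q\<^esub> ?h (P.cl q x)"
        using C'.m_inv_consistent[OF P'.subgroup_cycles] by simp
      then have "inv\<^bsub>P'.Z q\<^esub> ?h (P.cl q x) = P'.cl q (- F q x)" by (simp add: h P'.inv_C[OF kF])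
      then have "\<eta> \<otimes>\<^bsub>P'.Z q\<^esub> inv\<^bsub>P'.Z q\<^esub> ?h (P.cl q x) = P'.cl q (y + - F q x)"
        using P'.mult_C[OF keys_cyc'[OF y(1)], of "- F q x"] kF y(2) by (simp add: keys_minus)
      also have "\<dots> = P'.cl q (d' q w)" using x(3) by (simp add: P'.cl_eq)
      finally have "\<eta> \<otimes>\<^bsub>P'.Z q\<^esub> inv\<^bsub>P'.Z q\<^esub> ?h (P.cl q x) \<in> boundaries P'.C P'.dC q"
        using P'.boundaries_iff x(2) by blast
      moreover have "P.cl q x \<in> carrier (P.Z q)" using x(1) unfolding car by blast
      ultimately show ?thesis by blast
    qed
  qed
  have "r_coset (P'.Z q) = r_coset (P'.C q)" by (intro ext) (simp add: r_coset_def)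
  then show ?thesis using iso unfolding homology_def homology_map_def by simp
qed

section \<open>Tensor products with the trivial module\<close>

lemma tensor_kernel_relation: "r \<in> tensor_relations A M N \<Longrightarrow> r \<in> tensor_kernel A M N"
  unfolding tensor_kernel_def by (rule generate.incl)

lemma tensor_kernel_subgroup:
  fixes M :: "('a, 'm, 's) module_scheme" and N :: "('a, 'n, 't) module_scheme"
  assumes M: "abelian_group M" and N: "abelian_group N"
    and "\<And>a x. \<lbrakk>a \<in> carrier A; x \<in> carrier M\<rbrakk> \<Longrightarrow> a \<odot>\<^bsub>M\<^esub> x \<in> carrier M"
    and "\<And>a x. \<lbrakk>a \<in> carrier A; x \<in> carrier N\<rbrakk> \<Longrightarrow> a \<odot>\<^bsub>N\<^esub> x \<in> carrier N"
  shows "subgroup (tensor_kernel A M N) (free_Abelian_group (carrier M \<times> carrier N))"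
  unfolding tensor_kernel_def
proof (rule group.generate_is_subgroup)
  interpret M: abelian_group M by (rule M)
  interpret N: abelian_group N by (rule N)
  let ?B = "carrier M \<times> carrier N"
  have "Poly_Mapping.keys (frag_of b - frag_of b') \<subseteq> ?B" if "b \<in> ?B" "b' \<in> ?B" for b b' :: "'m \<times> 'n"
    using keys_diff[of "frag_of b" "frag_of b'"] that by auto
  moreover have "Poly_Mapping.keys (frag_of b - frag_of b' - frag_of b'') \<subseteq> ?B"
    if "b \<in> ?B" "b' \<in> ?B" "b'' \<in> ?B" for b b' b'' :: "'m \<times> 'n"
    using keys_diff[of "frag_of b - frag_of b'" "frag_of b''"] keys_diff[of "frag_of b" "frag_of b'"] that by auto
  ultimately show "tensor_relations A M N \<subseteq> carrier (free_Abelian_group ?B)"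
    using assms(3,4) unfolding tensor_relations_def by auto
qed simp

text \<open>A subgroup given by generators is tested by an additive map on the generators.\<close>

lemma tensor_kernel_least:
  assumes N: "subgrp K" and x: "x \<in> tensor_kernel A M N" and f: "addv f"
    and rel: "\<And>r. r \<in> tensor_relations A M N \<Longrightarrow> f r \<in> K"
    and sub: "subgroup (tensor_kernel A M N) (free_Abelian_group (carrier M \<times> carrier N))"
  shows "f x \<in> K"
proof -
  let ?F = "free_Abelian_group (carrier M \<times> carrier N)"
  let ?H = "{x \<in> carrier ?F. f x \<in> K}"
  have "subgroup ?H ?F"
    unfolding subgroup_frag_iff subgrp_def
    using subgrp_zero[OF N] subgrp_diff[OF N] keys_diff by (fastforce simp: addv_zero[OF f] addv_diff[OF f])
  moreover have "tensor_relations A M N \<subseteq> ?H"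
    using rel subgroup.subset[OF sub] tensor_kernel_relation by blast
  ultimately have "generate ?F (tensor_relations A M N) \<subseteq> ?H"
    by (intro group.generate_subgroup_incl) simp_all
  then show ?thesis using x unfolding tensor_kernel_def by blast
qed

lemma abelian_group_trivial_module:
  assumes "cring k" shows "abelian_group (trivial_module k)"
proof -
  interpret cring k by fact
  show ?thesis
  proof (rule abelian_groupI)
    fix x assume "x \<in> carrier (trivial_module k)"
    then show "\<exists>y\<in>carrier (trivial_module k). y \<oplus>\<^bsub>trivial_module k\<^esub> x = \<zero>\<^bsub>trivial_module k\<^esub>"
      by (intro bexI[of _ "\<ominus>\<^bsub>k\<^esub> x"]) (simp_all add: trivial_module_def l_neg)
  qed (simp_all add: trivial_module_def a_ac)
qed

lemma tensor_kernel_trivial_module: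
  assumes k: "cring k" and M: "left_module (GB G k act \<delta> n) M"
  shows "subgroup (tensor_kernel (GB G k act \<delta> n) (trivial_module k) M)
    (free_Abelian_group (carrier k \<times> carrier M))"
proof -
  interpret cring k by (rule k)
  have "subgroup (tensor_kernel (GB G k act \<delta> n) (trivial_module k) M)
      (free_Abelian_group (carrier (trivial_module k :: ('c diagram \<Rightarrow> 'a, 'a) module) \<times> carrier M))"
  proof (rule tensor_kernel_subgroup[OF abelian_group_trivial_module[OF k]])
    show "abelian_group M" using M by (simp add: left_module_def)
    show "a \<odot>\<^bsub>M\<^esub> x \<in> carrier M" if "a \<in> carrier (GB G k act \<delta> n)" "x \<in> carrier M" for a x
      using left_module.lsmult_closed[OF M] that by blast
    fix a x assume "a \<in> carrier (GB G k act \<delta> n)" and x: "x \<in> carrier (trivial_module k :: ('c diagram \<Rightarrow> 'a, 'a) module)"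
    then have "a d \<in> carrier k" for d by (cases "d \<in> diagrams G n") (auto simp: GB_def finsupp_def)
    then show "a \<odot>\<^bsub>trivial_module k\<^esub> x \<in> carrier (trivial_module k :: ('c diagram \<Rightarrow> 'a, 'a) module)"
      using x by (simp add: trivial_module_def finsum_closed)
  qed
  then show ?thesis by (simp add: trivial_module_def)
qed

context GB_resolution
begin

abbreviation "triv \<equiv> (trivial_module k :: ('g diagram \<Rightarrow> 'k, 'k) module)"
abbreviation "T i \<equiv> tensor_kernel A triv (M i)"
abbreviation "N i \<equiv> coinv k (carrier W) (I i) (opW i)"
abbreviation "sc i a \<equiv> op i a (pd \<one>\<^bsub>W\<^esub>)"

lemma carrier_triv: "carrier triv = carrier k"
  by (simp add: trivial_module_def)

lemma smult_triv: "a \<odot>\<^bsub>triv\<^esub> b = \<epsilon> a \<otimes>\<^bsub>k\<^esub> b"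
  by (simp add: trivial_module_def \<epsilon>_def)

lemma add_triv: "a \<oplus>\<^bsub>triv\<^esub> b = a \<oplus>\<^bsub>k\<^esub> b"
  by (simp add: trivial_module_def)

lemma subgroup_T: "subgroup (T i) (free_Abelian_group (carrier k \<times> carrier (M i)))"
  by (rule tensor_kernel_trivial_module[OF cring_k module_M])

lemma subT: "subgrp (T i)" and keys_T: "x \<in> T i \<Longrightarrow> Poly_Mapping.keys x \<subseteq> carrier k \<times> carrier (M i)"
  using subgroup_T[of i] by (auto simp: subgroup_frag_iff)

lemma T_add_left:
  assumes "a \<in> carrier k" "b \<in> carrier k" "p \<in> carrier (M i)"
  shows "frag_of (a \<oplus>\<^bsub>k\<^esub> b, p) - frag_of (a, p) - frag_of (b, p) \<in> T i"
  by (rule tensor_kernel_relation) (use assms in \<open>auto simp: tensor_relations_def carrier_triv add_triv\<close>)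

lemma T_add_right:
  assumes "a \<in> carrier k" "p \<in> carrier (M i)" "q \<in> carrier (M i)"
  shows "frag_of (a, p \<oplus>\<^bsub>M i\<^esub> q) - frag_of (a, p) - frag_of (a, q) \<in> T i"
  by (rule tensor_kernel_relation) (use assms in \<open>auto simp: tensor_relations_def carrier_triv add_triv\<close>)

lemma T_act:
  assumes "\<alpha> \<in> carrier A" "a \<in> carrier k" "p \<in> carrier (M i)"
  shows "frag_of (\<epsilon> \<alpha> \<otimes>\<^bsub>k\<^esub> a, p) - frag_of (a, \<alpha> \<odot>\<^bsub>M i\<^esub> p) \<in> T i"
  by (rule tensor_kernel_relation) (use assms in \<open>auto simp: tensor_relations_def carrier_triv smult_triv\<close>)

text \<open>As with multiplicativity, additivity is transported from the module along the
  augmentation.\<close>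

lemma \<epsilon>_add:
  assumes a: "a \<in> carrier A" and b: "b \<in> carrier A" shows "\<epsilon> (a \<oplus>\<^bsub>A\<^esub> b) = \<epsilon> a \<oplus>\<^bsub>k\<^esub> \<epsilon> b"
proof -
  interpret left_module A "M 0" by (rule module_M)
  obtain p where p: "p \<in> carrier (M 0)" "aug P p = \<one>\<^bsub>k\<^esub>" using aug_surj by (metis imageE k.one_closed)
  have "\<epsilon> (a \<oplus>\<^bsub>A\<^esub> b) \<otimes>\<^bsub>k\<^esub> aug P p = \<epsilon> a \<otimes>\<^bsub>k\<^esub> aug P p \<oplus>\<^bsub>k\<^esub> \<epsilon> b \<otimes>\<^bsub>k\<^esub> aug P p"
    using a b p(1) by (simp add: aug_smult[symmetric] lsmult_l_distr aug_add lsmult_closed)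
  then show ?thesis using a b p(2) by (simp add: \<epsilon>_closed)
qed

lemma subN: "subgrp (N i)" by (rule subgrp_coinv)

lemma E_N: "z \<in> E i \<Longrightarrow> z \<in> N i" by (intro coinv_incl E_Msub)

lemma one_W: "\<one>\<^bsub>W\<^esub> \<in> carrier W"
proof -
  interpret W: group W by (rule W)
  show ?thesis by simp
qed

lemmas pd_one = pd_closed[OF one_W]

lemma op_sc:
  assumes "a \<in> carrier k" "b \<in> carrier k" "w \<in> carrier W"
  shows "op i b (pd w) (sc i a z) - op i (a \<otimes>\<^bsub>k\<^esub> b) (pd w) z \<in> E i"
    "sc i a (op i b (pd w) z) - op i (a \<otimes>\<^bsub>k\<^esub> b) (pd w) z \<in> E i"
proof -
  interpret W: group W by (rule W)
  show "op i b (pd w) (sc i a z) - op i (a \<otimes>\<^bsub>k\<^esub> b) (pd w) z \<in> E i"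
    using op_op[OF assms(2,1) pd_closed[OF assms(3)] pd_one, of i z] assms
    by (simp add: glue_pd loop_pd k.m_comm)
  show "sc i a (op i b (pd w) z) - op i (a \<otimes>\<^bsub>k\<^esub> b) (pd w) z \<in> E i"
    using op_op[OF assms(1,2) pd_one pd_closed[OF assms(3)], of i z] assms
    by (simp add: glue_pd loop_pd)
qed

lemma sc_N:
  assumes a: "a \<in> carrier k" and z: "z \<in> N i" shows "sc i a z \<in> N i"
proof (rule lin_coinv[OF _ k.one_closed z])
  show "lin k (carrier W) (I i) (opW i) (I i) (opW i) (sc i a)"
    unfolding lin_def opW_def
  proof (intro conjI ballI allI)
    show "addv (sc i a)" by (rule addv_op)
    show "sc i a y \<in> I i" if "y \<in> I i" for y by (rule op_I[OF a pd_one that])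
    show "sc i a (op i b (pd w) y) - op i b (pd w) (sc i a y) \<in> I i"
      if "b \<in> carrier k" "w \<in> carrier W" for b w y
      using subgrp_trans[OF subE op_sc(2) subgrp_sym[OF subE op_sc(1)], OF a that a that] by (rule E_Msub)
  qed
qed

text \<open>A horizontal diagram is a scalar times a group element, which acts trivially on
  coinvariants; any other diagram maps into the submodule divided out. On the quotient by
  \<open>N\<close> the algebra therefore acts through \<epsilon>.\<close>

lemma mono_N:
  assumes a: "a \<in> carrier k" and x: "x \<in> D"
  shows "op i a x z - sc i (\<epsilon> (mono k a x)) z \<in> N i"
proof (cases "only_horizontal x")
  case True
  then obtain w where w: "w \<in> carrier W" "x = pd w" using horizontal_perm[OF x _ G.is_group] by blast
  have "op i a x z - op i \<one>\<^bsub>k\<^esub> (pd w) (sc i a z) \<in> N i"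
    using subgrp_sym[OF subE op_sc(1)[OF a k.one_closed w(1), of i z]] a w(2) by (intro E_N) simp
  moreover have "op i \<one>\<^bsub>k\<^esub> (pd w) (sc i a z) - sc i a z \<in> N i"
    using coinv_action[OF w(1), of "opW i" k "sc i a z" "I i"] by (simp add: opW_def)
  ultimately have "op i a x z - sc i a z \<in> N i" by (rule subgrp_trans[OF subN])
  then show ?thesis using True a by (simp add: \<epsilon>_mono)
next
  case False
  have "op i a x z \<in> N i" by (rule coinv_incl, rule Msub_op[OF right_ideal_nonhor a _ x]) (use False in simp)
  moreover have "sc i \<zero>\<^bsub>k\<^esub> z \<in> E i"
    using subgrp_minus[OF subE op_add[OF k.zero_closed k.zero_closed pd_one, of i z]] by simp
  then have "sc i \<zero>\<^bsub>k\<^esub> z \<in> N i" by (rule E_N)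
  ultimately show ?thesis using subgrp_diff[OF subN, of "op i a x z"] False a by (simp add: \<epsilon>_mono)
qed

text \<open>The statement for single diagrams is extended to arbitrary elements of the algebra by
  induction on a finite set containing the support.\<close>

lemma act_N:
  assumes "\<alpha> \<in> carrier A" "p \<in> carrier (M i)"
  shows "frag_of (\<alpha> \<odot>\<^bsub>M i\<^esub> p) - sc i (\<epsilon> \<alpha>) (frag_of p) \<in> N i"
proof -
  interpret left_module A "M i" by (rule module_M)
  have "frag_of (\<alpha> \<odot>\<^bsub>M i\<^esub> p) - sc i (\<epsilon> \<alpha>) (frag_of p) \<in> N i"
    if "finite B" "\<alpha> \<in> carrier A" "{x. \<alpha> x \<noteq> \<zero>\<^bsub>k\<^esub>} \<subseteq> B" for B \<alpha>
    using that
  proof (induction B arbitrary: \<alpha> rule: finite_induct)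
    case empty
    then have "\<alpha> x = \<zero>\<^bsub>k\<^esub>" for x by blast
    then have \<alpha>: "\<alpha> = \<zero>\<^bsub>A\<^esub>" by (simp add: zero_A fun_eq_iff)
    have "\<epsilon> \<alpha> = \<zero>\<^bsub>k\<^esub>" by (simp add: \<epsilon>_def \<alpha> zero_A)
    moreover have "\<zero>\<^bsub>A\<^esub> \<odot>\<^bsub>M i\<^esub> p = mono k \<zero>\<^bsub>k\<^esub> (pd \<one>\<^bsub>W\<^esub>) \<odot>\<^bsub>M i\<^esub> p" by (simp add: zero_A mono_zero)
    ultimately have "frag_of (\<alpha> \<odot>\<^bsub>M i\<^esub> p) - sc i (\<epsilon> \<alpha>) (frag_of p) \<in> E i"
      using assms(2) by (simp add: E_iff ev_of ev_op pd_one \<alpha> lsmult_closed mono_closed)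
    then show ?case by (rule E_N)
  next
    case (insert x B)
    define \<beta> where "\<beta> = (\<lambda>y. if y = x then \<zero>\<^bsub>k\<^esub> else \<alpha> y)"
    have \<alpha>k: "\<alpha> y \<in> carrier k" for y by (rule A_val[OF insert.prems(1)])
    have "{y. \<beta> y \<noteq> \<zero>\<^bsub>k\<^esub>} \<subseteq> {y. \<alpha> y \<noteq> \<zero>\<^bsub>k\<^esub>}" by (auto simp: \<beta>_def)
    from finite_subset[OF this A_fin[OF insert.prems(1)]] have \<beta>: "\<beta> \<in> carrier A"
      using A_supp[OF insert.prems(1)] \<alpha>k by (auto simp: carrier_A finsupp_def \<beta>_def)
    have IH: "frag_of (\<beta> \<odot>\<^bsub>M i\<^esub> p) - sc i (\<epsilon> \<beta>) (frag_of p) \<in> N i"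
      by (rule insert.IH[OF \<beta>]) (use insert.prems(2) in \<open>auto simp: \<beta>_def split: if_splits\<close>)
    show ?case
    proof (cases "\<alpha> x = \<zero>\<^bsub>k\<^esub>")
      case True
      then have "\<alpha> = \<beta>" by (auto simp: \<beta>_def)
      then show ?thesis using IH by simp
    next
      case False
      then have x: "x \<in> D" by (rule A_supp[OF insert.prems(1)])
      let ?m = "mono k (\<alpha> x) x"
      have m: "?m \<in> carrier A" by (rule mono_closed[OF \<alpha>k x])
      have \<alpha>: "\<alpha> = ?m \<oplus>\<^bsub>A\<^esub> \<beta>" using \<alpha>k by (auto simp: add_A mono_def \<beta>_def)
      have 1: "frag_of (\<alpha> \<odot>\<^bsub>M i\<^esub> p) - (op i (\<alpha> x) x (frag_of p) + frag_of (\<beta> \<odot>\<^bsub>M i\<^esub> p)) \<in> N i"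
        by (rule E_N, subst \<alpha>) (use m \<beta> assms(2) \<alpha>k x in
          \<open>simp add: E_iff ev_of ev_op ev_add lsmult_l_distr lsmult_closed\<close>)
      have 2: "op i (\<alpha> x) x (frag_of p) + frag_of (\<beta> \<odot>\<^bsub>M i\<^esub> p) -
          (sc i (\<epsilon> ?m) (frag_of p) + sc i (\<epsilon> \<beta>) (frag_of p)) \<in> N i"
        by (rule subgrp_add_cong[OF subN mono_N[OF \<alpha>k x] IH])
      have 3: "sc i (\<epsilon> ?m) (frag_of p) + sc i (\<epsilon> \<beta>) (frag_of p) - sc i (\<epsilon> \<alpha>) (frag_of p) \<in> N i"
        by (rule subgrp_sym[OF subN], rule E_N, subst \<alpha>, subst \<epsilon>_add[OF m \<beta>],
            rule op_add[OF \<epsilon>_closed[OF m] \<epsilon>_closed[OF \<beta>] pd_one])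
      show ?thesis by (rule subgrp_trans[OF subN subgrp_trans[OF subN 1 2] 3])
    qed
  qed
  then show ?thesis using A_fin[OF assms(1)] assms(1) by blast
qed

text \<open>\<open>\<Theta>\<close> and \<open>\<Psi>\<close> induce mutually inverse isomorphisms between \<open>\<one> \<otimes> M\<close> and the coinvariants of \<open>M / I M\<close>.\<close>

definition \<Theta> :: "nat \<Rightarrow> ('k \<times> 'p \<Rightarrow>\<^sub>0 int) \<Rightarrow> ('p \<Rightarrow>\<^sub>0 int)" where
  "\<Theta> i = frag_extend (\<lambda>(a, p). sc i a (frag_of p))"

definition \<Psi> :: "nat \<Rightarrow> ('p \<Rightarrow>\<^sub>0 int) \<Rightarrow> ('k \<times> 'p \<Rightarrow>\<^sub>0 int)" where
  "\<Psi> i = frag_extend (\<lambda>p. frag_of (\<one>\<^bsub>k\<^esub>, ev i (frag_of p)))"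

lemma addv_\<Theta>: "addv (\<Theta> i)" and addv_\<Psi>: "addv (\<Psi> i)"
  by (simp_all add: \<Theta>_def \<Psi>_def addv_frag_extend)

lemma \<Theta>_of: "\<Theta> i (frag_of (a, p)) = sc i a (frag_of p)" and \<Psi>_of: "\<Psi> i (frag_of p) = frag_of (\<one>\<^bsub>k\<^esub>, ev i (frag_of p))"
  by (simp_all add: \<Theta>_def \<Psi>_def)

text \<open>Of the three kinds of tensor relations the first two hold by additivity; the balancing
  relation is the content of \<open>act_N\<close>.\<close>

lemma \<Theta>_T:
  assumes x: "x \<in> T i" shows "\<Theta> i x \<in> N i"
proof (rule tensor_kernel_least[OF subN x addv_\<Theta>])
  interpret left_module A "M i" by (rule module_M)
  show "subgroup (T i) (free_Abelian_group (carrier triv \<times> carrier (M i)))"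
    using subgroup_T by (simp only: carrier_triv)
  fix r assume "r \<in> tensor_relations A triv (M i)"
  then consider
      (1) a b p where "r = frag_of (a \<oplus>\<^bsub>k\<^esub> b, p) - frag_of (a, p) - frag_of (b, p)" "a \<in> carrier k" "b \<in> carrier k" "p \<in> carrier (M i)"
    | (2) a p q where "r = frag_of (a, p \<oplus>\<^bsub>M i\<^esub> q) - frag_of (a, p) - frag_of (a, q)" "a \<in> carrier k" "p \<in> carrier (M i)" "q \<in> carrier (M i)"
    | (3) \<alpha> a p where "r = frag_of (\<epsilon> \<alpha> \<otimes>\<^bsub>k\<^esub> a, p) - frag_of (a, \<alpha> \<odot>\<^bsub>M i\<^esub> p)" "\<alpha> \<in> carrier A" "a \<in> carrier k" "p \<in> carrier (M i)"
    unfolding tensor_relations_def carrier_triv smult_triv add_triv by blast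
  then show "\<Theta> i r \<in> N i"
  proof cases
    case 1
    then show ?thesis
      using op_add[OF 1(2,3) pd_one, of i "frag_of p", folded diff_diff_eq] unfolding 1(1)
      by (intro E_N) (simp add: addv_diff[OF addv_\<Theta>] \<Theta>_of)
  next
    case 2
    have "frag_of (p \<oplus>\<^bsub>M i\<^esub> q) - (frag_of p + frag_of q) \<in> E i"
      using 2 by (simp add: E_iff ev_of ev_add)
    from op_cong[OF 2(2) pd_one this, unfolded addv_add[OF addv_op], folded diff_diff_eq] show ?thesis
      unfolding 2(1) by (intro E_N) (simp add: addv_diff[OF addv_\<Theta>] \<Theta>_of)
  next
    case 3
    note e = \<epsilon>_closed[OF 3(2)]
    have "sc i a (frag_of (\<alpha> \<odot>\<^bsub>M i\<^esub> p) - sc i (\<epsilon> \<alpha>) (frag_of p)) \<in> N i" by (rule sc_N[OF 3(3) act_N[OF 3(2,4)]])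
    then have 1: "sc i a (sc i (\<epsilon> \<alpha>) (frag_of p)) - sc i a (frag_of (\<alpha> \<odot>\<^bsub>M i\<^esub> p)) \<in> N i"
      unfolding addv_diff[OF addv_op] by (rule subgrp_sym[OF subN])
    have 2: "sc i (\<epsilon> \<alpha> \<otimes>\<^bsub>k\<^esub> a) (frag_of p) - sc i a (sc i (\<epsilon> \<alpha>) (frag_of p)) \<in> N i"
      by (rule subgrp_sym[OF subN E_N[OF op_sc(1)[OF e 3(3) one_W]]])
    show ?thesis
      unfolding 3(1) addv_diff[OF addv_\<Theta>] \<Theta>_of by (rule subgrp_trans[OF subN 2 1])
  qed
qed

text \<open>\<Psi> is fixed on generators, and only modulo the tensor relations does it become the
  map sending z to 1 tensored with the value of z.\<close>

lemma \<Psi>_ev: "\<Psi> i z - frag_of (\<one>\<^bsub>k\<^esub>, ev i z) \<in> T i"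
proof -
  interpret abelian_group "M i" by (rule abelian_M)
  have "Poly_Mapping.keys z \<subseteq> UNIV" by simp
  then show ?thesis
  proof (induction z rule: frag_induction)
    case zero
    show ?case
      using T_add_right[OF k.one_closed zero_closed zero_closed] 
      by (simp add: addv_zero[OF addv_\<Psi>] module_ev_zero[OF abelian_M])
  next
    case (one p)
    then show ?case by (simp add: \<Psi>_of subgrp_zero[OF subT])
  next
    case (diff a b)
    have "ev i a = ev i (a - b) \<oplus>\<^bsub>M i\<^esub> ev i b" by (simp flip: ev_add)
    then have "frag_of (\<one>\<^bsub>k\<^esub>, ev i a) - frag_of (\<one>\<^bsub>k\<^esub>, ev i (a - b)) - frag_of (\<one>\<^bsub>k\<^esub>, ev i b) \<in> T i"
      using T_add_right[OF k.one_closed ev_closed ev_closed] by simp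
    from subgrp_add[OF subT this subgrp_diff[OF subT diff]] show ?case
      by (simp add: addv_diff[OF addv_\<Psi>] algebra_simps)
  qed
qed

lemma \<Psi>_E:
  assumes "y - z \<in> E i" shows "\<Psi> i y - \<Psi> i z \<in> T i"
proof -
  have "ev i y = ev i z" using assms by (simp add: E_iff)
  then show ?thesis using subgrp_trans[OF subT \<Psi>_ev, of i y "\<Psi> i z"] subgrp_sym[OF subT \<Psi>_ev[of i z]] by simp
qed

lemma \<Psi>_op:
  assumes a: "a \<in> carrier k" and x: "x \<in> D"
  shows "\<Psi> i (op i a x z) - frag_of (\<epsilon> (mono k a x), ev i z) \<in> T i"
proof -
  note m = mono_closed[OF a x]
  have "frag_of (\<one>\<^bsub>k\<^esub>, ev i (op i a x z)) - frag_of (\<epsilon> (mono k a x), ev i z) \<in> T i"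
    using subgrp_sym[OF subT T_act[OF m k.one_closed ev_closed]] by (simp add: ev_op[OF a x] \<epsilon>_closed[OF m])
  with \<Psi>_ev show ?thesis by (rule subgrp_trans[OF subT])
qed

lemma T_zero_left: "p \<in> carrier (M i) \<Longrightarrow> frag_of (\<zero>\<^bsub>k\<^esub>, p) \<in> T i"
  using subgrp_minus[OF subT T_add_left[OF k.zero_closed k.zero_closed, of p i]] by simp

text \<open>In the tensor product a diagram may be moved to the left factor, where it acts by
  \<epsilon>. So non-horizontal diagrams give zero and permutation diagrams disappear.\<close>

lemma \<Psi>_N:
  assumes z: "z \<in> N i" shows "\<Psi> i z \<in> T i"
proof (rule addv_coinv[OF addv_\<Psi> subT _ _ z])
  fix y assume y: "y \<in> I i"
  have "\<Psi> i (\<Sum>(s, x)\<in>csupp i y. op i (c i y s x) x (u i s)) \<in> T i"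
    unfolding addv_sum[OF addv_\<Psi>]
  proof (rule subgrp_sum[OF subT], clarsimp)
    fix s x assume sx: "(s, x) \<in> csupp i y"
    note m = Msub_expansion[OF y sx]
    have "\<Psi> i (op i (c i y s x) x (u i s)) - frag_of (\<zero>\<^bsub>k\<^esub>, ev i (u i s)) \<in> T i"
      using \<Psi>_op[OF c_closed[OF m(1)] m(3)] m(2) by (simp add: \<epsilon>_mono c_closed[OF m(1)])
    then show "\<Psi> i (op i (c i y s x) x (u i s)) \<in> T i"
      using subgrp_cong[OF subT] T_zero_left[OF ev_closed] by blast
  qed
  then show "\<Psi> i y \<in> T i" using subgrp_cong[OF subT \<Psi>_E[OF expansion]] by blast
next
  fix w y assume w: "w \<in> carrier W"
  have "\<Psi> i (op i \<one>\<^bsub>k\<^esub> (pd w) y) - frag_of (\<one>\<^bsub>k\<^esub>, ev i y) \<in> T i"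
    using \<Psi>_op[OF k.one_closed pd_closed[OF w]] by (simp add: \<epsilon>_mono perm_diagram_horizontal)
  then show "\<Psi> i (opW i \<one>\<^bsub>k\<^esub> w y) - \<Psi> i y \<in> T i"
    unfolding opW_def by (rule subgrp_trans[OF subT _ subgrp_sym[OF subT \<Psi>_ev]])
qed

lemma \<Psi>_\<Theta>:
  assumes x: "Poly_Mapping.keys x \<subseteq> carrier k \<times> carrier (M i)" shows "x - \<Psi> i (\<Theta> i x) \<in> T i"
  using x
proof (induction x rule: frag_induction)
  case zero
  show ?case by (simp add: addv_zero[OF addv_\<Psi>] addv_zero[OF addv_\<Theta>] subgrp_zero[OF subT])
next
  case (one b)
  then obtain a p where b: "b = (a, p)" "a \<in> carrier k" "p \<in> carrier (M i)" by auto
  show ?case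
    using subgrp_sym[OF subT \<Psi>_op[OF b(2) pd_one, of i "frag_of p"]] b
    by (simp add: \<Theta>_of \<epsilon>_mono perm_diagram_horizontal ev_of)
next
  case (diff a b)
  from subgrp_diff[OF subT diff] show ?case
    by (simp add: addv_diff[OF addv_\<Psi>] addv_diff[OF addv_\<Theta>] algebra_simps)
qed

lemma \<Theta>_\<Psi>: "\<Theta> i (\<Psi> i z) - z \<in> E i"
proof -
  have "Poly_Mapping.keys z \<subseteq> UNIV" by simp
  then show ?thesis
  proof (induction z rule: frag_induction)
    case zero
    show ?case by (simp add: addv_zero[OF addv_\<Psi>] addv_zero[OF addv_\<Theta>] subgrp_zero[OF subE])
  next
    case (one p)
    have "frag_of (ev i (frag_of p)) - frag_of p \<in> E i" by (simp add: E_iff ev_of ev_closed)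
    then show ?case using subgrp_trans[OF subE op_one] by (simp add: \<Psi>_of \<Theta>_of)
  next
    case (diff a b)
    from subgrp_diff[OF subE diff] show ?case
      by (simp add: addv_diff[OF addv_\<Psi>] addv_diff[OF addv_\<Theta>] algebra_simps)
  qed
qed

text \<open>Membership in the generated tensor kernel is thereby reduced to membership in the
  coinvariant subgroup, where the stability results apply.\<close>

lemma T_iff:
  assumes x: "Poly_Mapping.keys x \<subseteq> carrier k \<times> carrier (M i)" shows "x \<in> T i \<longleftrightarrow> \<Theta> i x \<in> N i"
  using \<Theta>_T \<Psi>_N[of "\<Theta> i x" i] subgrp_cong[OF subT \<Psi>_\<Theta>[OF x]] by blast

lemma keys_\<Psi>: "Poly_Mapping.keys (\<Psi> i z) \<subseteq> carrier k \<times> carrier (M i)"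
proof -
  have "\<Psi> i z \<in> {x. Poly_Mapping.keys x \<subseteq> carrier k \<times> carrier (M i)}"
    unfolding \<Psi>_def by (rule frag_extend_mem[OF subgrp_keys]) (simp add: ev_closed)
  then show ?thesis by simp
qed

end

section \<open>The map induced on Tor\<close>

text \<open>Unfolding shows that the groups, differentials and maps defining Tor are those of a
  presented complex; what remains are the conditions on representatives.\<close>

lemma Tor_map_iso:
  fixes P :: "('a, 'p, 'n) augmented_complex" and Q :: "('b, 'r, 'n1) augmented_complex"
    and A :: "('a, 'c) ring_scheme" and A' :: "('b, 'c1) ring_scheme"
    and f :: "nat \<Rightarrow> 'p \<Rightarrow> 'r" and g :: "'m \<Rightarrow> 'm1"
    and M :: "('a, 'm, 's) module_scheme" and M' :: "('b, 'm1, 's1) module_scheme"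
  defines "F \<equiv> \<lambda>i. frag_extend (\<lambda>(x, y). frag_of (g x, f i y))"
    and "D \<equiv> \<lambda>i. frag_extend (\<lambda>(x, y). frag_of (x, diff P i y))"
    and "D' \<equiv> \<lambda>i. frag_extend (\<lambda>(x, y). frag_of (x, diff Q i y))"
    and "B \<equiv> \<lambda>i. carrier M \<times> carrier (obj P i)" and "B' \<equiv> \<lambda>i. carrier M' \<times> carrier (obj Q i)"
    and "K \<equiv> \<lambda>i. tensor_kernel A M (obj P i)" and "K' \<equiv> \<lambda>i. tensor_kernel A' M' (obj Q i)"
  assumes P: "presented_complex B K D" and Q: "presented_complex B' K' D'"
    and F_keys: "\<And>i x. Poly_Mapping.keys x \<subseteq> B i \<Longrightarrow> Poly_Mapping.keys (F i x) \<subseteq> B' i"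
    and F_K: "\<And>i x. x \<in> K i \<Longrightarrow> F i x \<in> K' i"
    and F_d: "\<And>i x. Poly_Mapping.keys x \<subseteq> B (Suc i) \<Longrightarrow> F i (D i x) - D' i (F (Suc i) x) \<in> K' i"
    and inj: "\<And>x y. \<lbrakk>Poly_Mapping.keys x \<subseteq> B q; q > 0 \<Longrightarrow> D (q - 1) x \<in> K (q - 1);
      Poly_Mapping.keys y \<subseteq> B' (Suc q); F q x - D' q y \<in> K' q\<rbrakk> \<Longrightarrow>
      \<exists>w. Poly_Mapping.keys w \<subseteq> B (Suc q) \<and> x - D q w \<in> K q"
    and surj: "\<And>y. \<lbrakk>Poly_Mapping.keys y \<subseteq> B' q; q > 0 \<Longrightarrow> D' (q - 1) y \<in> K' (q - 1)\<rbrakk> \<Longrightarrow>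
      \<exists>x w. Poly_Mapping.keys x \<subseteq> B q \<and> (q > 0 \<longrightarrow> D (q - 1) x \<in> K (q - 1)) \<and>
        Poly_Mapping.keys w \<subseteq> B' (Suc q) \<and> y - F q x - D' q w \<in> K' q"
  shows "Tor_map A' M' Q g f q \<in> iso (Tor A M P q) (Tor A' M' Q q)"
proof -
  interpret P: presented_complex B K D by (rule P)
  interpret Q: presented_complex B' K' D' by (rule Q)
  have C: "Tor_complex A M P = P.C" "Tor_complex A' M' Q = Q.C"
    unfolding fun_eq_iff Tor_complex_def tensor_product_def P.C_def Q.C_def
    by (simp_all add: B_def B'_def K_def K'_def)
  have dC: "Tor_diff A M P = P.dC" "Tor_diff A' M' Q = Q.dC"
    unfolding fun_eq_iff Tor_diff_def tensor_map_def P.dC_def Q.dC_def fcoset_def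
    by (simp_all add: B_def B'_def K_def K'_def D_def D'_def)
  have F: "(\<lambda>i. tensor_map A' M' (obj Q i) g (f i)) = (\<lambda>i \<xi>. the_elem ((\<lambda>c. fcoset (B' i) (K' i) (F i c)) ` \<xi>))"
    unfolding fun_eq_iff tensor_map_def fcoset_def by (simp add: B'_def K'_def F_def)
  show ?thesis
    unfolding Tor_map_def Tor_def C dC F
  proof (rule presented_homology_iso[where F = F, OF P Q])
    show "addv (F i)" for i unfolding F_def by (rule addv_frag_extend)
    show "\<exists>w. Poly_Mapping.keys w \<subseteq> B (Suc q) \<and> x - D q w \<in> K q"
      if "P.cyc q x" "Poly_Mapping.keys y \<subseteq> B' (Suc q)" "F q x - D' q y \<in> K' q" for x y
      using inj[OF _ _ that(2,3)] that(1) by (simp add: P.cyc_def)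
    show "\<exists>x w. P.cyc q x \<and> Poly_Mapping.keys w \<subseteq> B' (Suc q) \<and> y - F q x - D' q w \<in> K' q"
      if "Q.cyc q y" for y
      using surj[of y] that unfolding P.cyc_def Q.cyc_def by blast
  qed (use F_keys F_K F_d in blast)+
qed

lemma keys_second:
  assumes "Poly_Mapping.keys x \<subseteq> U \<times> V" "\<And>p. p \<in> V \<Longrightarrow> f p \<in> V'"
  shows "Poly_Mapping.keys (frag_extend (\<lambda>(a, p). frag_of (a, f p)) x) \<subseteq> U \<times> V'"
proof -
  have "frag_extend (\<lambda>(a, p). frag_of (a, f p)) x \<in> {x. Poly_Mapping.keys x \<subseteq> U \<times> V'}"
    by (rule frag_extend_mem[OF subgrp_keys]) (use assms in auto)
  then show ?thesis by simp
qed

context GB_resolution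
begin

section \<open>The complex computing Tor, compared with coinvariants\<close>

definition DT :: "nat \<Rightarrow> ('k \<times> 'p \<Rightarrow>\<^sub>0 int) \<Rightarrow> ('k \<times> 'p \<Rightarrow>\<^sub>0 int)" where
  "DT i = frag_extend (\<lambda>(a, p). frag_of (a, diff P i p))"

abbreviation "gens i \<equiv> carrier k \<times> carrier (M i)"

lemma addv_DT: "addv (DT i)"
  by (simp add: DT_def addv_frag_extend)

lemma keys_DT: "Poly_Mapping.keys x \<subseteq> gens (Suc i) \<Longrightarrow> Poly_Mapping.keys (DT i x) \<subseteq> gens i"
  unfolding DT_def by (rule keys_second[OF _ diff_closed])

lemma \<Theta>_DT:
  assumes "Poly_Mapping.keys x \<subseteq> gens (Suc i)"
  shows "\<Theta> i (DT i x) - d i (\<Theta> (Suc i) x) \<in> E i"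
  using assms
proof (induction x rule: frag_induction)
  case zero
  show ?case by (simp add: addv_zero[OF addv_\<Theta>] addv_zero[OF addv_DT] addv_zero[OF addv_d] subgrp_zero[OF subE])
next
  case (one b)
  then obtain a p where b: "b = (a, p)" "a \<in> carrier k" "p \<in> carrier (M (Suc i))" by auto
  have "frag_of (diff P i p) - d i (frag_of p) \<in> E i"
    by (simp add: E_iff ev_of ev_d b(3) diff_closed)
  from subgrp_trans[OF subE op_cong[OF b(2) pd_one this] subgrp_sym[OF subE d_op[OF b(2) pd_one]]]
  show ?case by (simp add: b(1) DT_def \<Theta>_of)
next
  case (diff a b)
  from subgrp_diff[OF subE diff] show ?case
    by (simp add: addv_diff[OF addv_DT] addv_diff[OF addv_\<Theta>] addv_diff[OF addv_d] algebra_simps)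
qed

lemma d_N: "z \<in> N (Suc i) \<Longrightarrow> d i z \<in> N i"
  by (rule lin_coinv[OF lin_dW k.one_closed])

lemma DT_T_iff:
  assumes "Poly_Mapping.keys x \<subseteq> gens (Suc i)" shows "DT i x \<in> T i \<longleftrightarrow> d i (\<Theta> (Suc i) x) \<in> N i"
  using T_iff[OF keys_DT[OF assms]] subgrp_cong[OF subN E_N[OF \<Theta>_DT[OF assms]]] by simp

lemma DT_T: "x \<in> T (Suc i) \<Longrightarrow> DT i x \<in> T i"
  using DT_T_iff[OF keys_T] d_N[OF \<Theta>_T] by blast

text \<open>The laws of the Tor complex are not checked on tensors but transported along \<Theta>
  from the coinvariants.\<close>

lemma presented: "presented_complex gens T DT"
proof (rule presented_complex.intro)
  show "subgroup (T i) (free_Abelian_group (gens i))" for i by (rule subgroup_T)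
  show "Poly_Mapping.keys (DT i x) \<subseteq> gens i" if "Poly_Mapping.keys x \<subseteq> gens (Suc i)" for i x by (rule keys_DT[OF that])
  show "DT i x \<in> T i" if "x \<in> T (Suc i)" for i x by (rule DT_T[OF that])
  show "DT i (DT (Suc i) x) \<in> T i" if x: "Poly_Mapping.keys x \<subseteq> gens (Suc (Suc i))" for i x
  proof -
    have "d i (\<Theta> (Suc i) (DT (Suc i) x)) - d i (d (Suc i) (\<Theta> (Suc (Suc i)) x)) \<in> N i"
      using d_N[OF E_N[OF \<Theta>_DT[OF x]]] by (simp add: addv_diff[OF addv_d])
    moreover have "d i (d (Suc i) (\<Theta> (Suc (Suc i)) x)) \<in> N i" by (rule E_N[OF d_d])
    ultimately show ?thesis
      using DT_T_iff[OF keys_DT[OF x]] subgrp_cong[OF subN] by blast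
  qed
qed (rule addv_DT)

lemma \<Theta>_boundary:
  "\<Theta> i (DT i (\<Psi> (Suc i) w)) - d i w \<in> N i"
proof -
  have "d i (\<Theta> (Suc i) (\<Psi> (Suc i) w)) - d i w \<in> N i"
    using d_N[OF E_N[OF \<Theta>_\<Psi>]] by (simp add: addv_diff[OF addv_d])
  then show ?thesis by (rule subgrp_trans[OF subN E_N[OF \<Theta>_DT[OF keys_\<Psi>]]])
qed

end

section \<open>The comparison map between consecutive algebras\<close>

locale GB_comparison = P: GB_resolution G k act \<delta> m P + Q: GB_resolution G k act \<delta> "Suc m" Q
  for G :: "('g, 'x) monoid_scheme" and k :: "('k, 'y) ring_scheme" and act \<delta> m
    and P :: "('g diagram \<Rightarrow> 'k, 'p, 'k) augmented_complex"
    and Q :: "('g diagram \<Rightarrow> 'k, 'r, 'k) augmented_complex" +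
  fixes f :: "nat \<Rightarrow> 'p \<Rightarrow> 'r"
  assumes f: "comparison_map (GB G k act \<delta> m) (GB_inclusion G k m) (\<lambda>c. c) P Q f"
begin

lemma f_closed: "p \<in> carrier (P.M i) \<Longrightarrow> f i p \<in> carrier (Q.M i)"
  using f by (auto simp: comparison_map_def semilinear_hom_def)

lemma f_diff: "p \<in> carrier (P.M (Suc i)) \<Longrightarrow> f i (diff P i p) = diff Q i (f (Suc i) p)"
  using f by (auto simp: comparison_map_def)

lemma f_aug: "p \<in> carrier (P.M 0) \<Longrightarrow> aug Q (f 0 p) = aug P p"
  using f by (auto simp: comparison_map_def)

lemma f_add: "\<lbrakk>p \<in> carrier (P.M i); q \<in> carrier (P.M i)\<rbrakk> \<Longrightarrow> f i (p \<oplus>\<^bsub>P.M i\<^esub> q) = f i p \<oplus>\<^bsub>Q.M i\<^esub> f i q"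
  using f by (auto simp: comparison_map_def semilinear_hom_def)

lemma GB_inclusion_mono:
  assumes a: "a \<in> carrier k"
  shows "GB_inclusion G k m (mono k a x) = mono k a (add_strand G m x)"
proof
  fix y
  have "{x'. mono k a x x' \<noteq> \<zero>\<^bsub>k\<^esub> \<and> add_strand G m x' = y} =
      (if a \<noteq> \<zero>\<^bsub>k\<^esub> \<and> add_strand G m x = y then {x} else {})"
    by (auto simp: mono_def)
  then show "GB_inclusion G k m (mono k a x) y = mono k a (add_strand G m x) y"
    unfolding GB_inclusion_def using a by (auto simp: mono_def P.k.finsum_insert)
qed

lemma f_mono:
  assumes "a \<in> carrier k" "x \<in> P.D" "p \<in> carrier (P.M i)"
  shows "f i (mono k a x \<odot>\<^bsub>P.M i\<^esub> p) = mono k a (add_strand G m x) \<odot>\<^bsub>Q.M i\<^esub> f i p"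
  using f assms P.mono_closed by (auto simp: comparison_map_def semilinear_hom_def GB_inclusion_mono)

definition fl :: "nat \<Rightarrow> ('p \<Rightarrow>\<^sub>0 int) \<Rightarrow> ('r \<Rightarrow>\<^sub>0 int)" where
  "fl i = lift_map (P.M i) (f i)"

lemma addv_fl: "addv (fl i)"
  by (simp add: fl_def addv_lift_map)

lemma ev_fl: "Q.ev i (fl i z) = f i (P.ev i z)"
  unfolding fl_def by (rule ev_lift_map[OF P.abelian_M Q.abelian_M]) (auto simp: f_closed f_add)

lemma fl_E: "y - z \<in> P.E i \<Longrightarrow> fl i y - fl i z \<in> Q.E i"
  by (simp add: P.E_iff Q.E_iff ev_fl)

lemma strand_closed: "x \<in> P.D \<Longrightarrow> add_strand G m x \<in> Q.D"
  by (rule add_strand_closed[OF P.G.is_group])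

lemma fl_op:
  assumes "a \<in> carrier k" "x \<in> P.D"
  shows "fl i (P.op i a x z) - Q.op i a (add_strand G m x) (fl i z) \<in> Q.E i"
  using assms by (simp add: Q.E_iff ev_fl P.ev_op Q.ev_op f_mono strand_closed P.ev_closed)

lemma fl_d: "fl i (P.d i x) - Q.d i (fl (Suc i) x) \<in> Q.E i"
  by (simp add: Q.E_iff ev_fl P.ev_d Q.ev_d f_diff P.ev_closed)

text \<open>The extra strand is horizontal, so a diagram that is not horizontal remains so and the
  ideal for m strands maps into the one for m+1.\<close>

lemma fl_I:
  assumes z: "z \<in> P.I i" shows "fl i z \<in> Q.I i"
proof -
  let ?z = "\<Sum>(s, x)\<in>P.csupp i z. P.op i (P.c i z s x) x (P.u i s)"
  have "fl i ?z \<in> Q.I i"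
    unfolding addv_sum[OF addv_fl]
  proof (rule subgrp_sum[OF Q.subgrp_Msub], clarsimp)
    fix s x assume sx: "(s, x) \<in> P.csupp i z"
    note m = P.Msub_expansion[OF z sx]
    note c = P.c_closed[OF m(1), of z x]
    have "Q.op i (P.c i z s x) (add_strand G m x) (fl i (P.u i s)) \<in> Q.I i"
      by (rule Q.Msub_op[OF Q.right_ideal_nonhor c _ strand_closed[OF m(3)]])
        (use m(2) in \<open>simp add: add_strand_horizontal\<close>)
    then show "fl i (P.op i (P.c i z s x) x (P.u i s)) \<in> Q.I i"
      using subgrp_cong[OF Q.subgrp_Msub Q.E_Msub[OF fl_op[OF c m(3)]]] by blast
  qed
  then show ?thesis
    using subgrp_cong[OF Q.subgrp_Msub Q.E_Msub[OF fl_E[OF P.expansion]]] by blast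
qed

lemma lin_fl: "lin k (carrier P.W) (P.I i) (P.opW i) (Q.I i) (Q.opW i) (fl i)"
  unfolding lin_def P.opW_def Q.opW_def
proof (intro conjI ballI allI)
  show "addv (fl i)" by (rule addv_fl)
  show "fl i z \<in> Q.I i" if "z \<in> P.I i" for z by (rule fl_I[OF that])
  show "fl i (P.op i a (P.pd w) z) - Q.op i a (Q.pd w) (fl i z) \<in> Q.I i"
    if "a \<in> carrier k" "w \<in> carrier P.W" for a w z
    using Q.E_Msub[OF fl_op[OF that(1) P.pd_closed[OF that(2)]], of i z] that(2)
    by (simp add: add_strand_perm)
qed

text \<open>The resolution for m+1 strands is restricted to the wreath product on m points. On both
  sides the augmentation identifies the homology in degree 0 with k, and f is compatible with it, so
  f is an isomorphism there.\<close>

lemma comparison: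
  "resolution_comparison k Q.W (carrier P.W) P.I P.opW P.d P.S P.u P.cW Q.I Q.opW Q.d Q.S Q.u Q.cW fl"
proof (rule resolution_comparison.intro)
  show "group Q.W" by (rule Q.W)
  show sub: "subgroup (carrier P.W) Q.W" by (rule subgroup_wreath[OF P.G.is_group]) simp
  show "kmod_dual_basis k (Q.W\<lparr>carrier := carrier P.W\<rparr>) (P.I i) (P.opW i) (P.S i) (P.u i) (P.cW i)" for i
    using P.kmod_dual_basis_W[of i] wreath_as_subgroup[of G m "Suc m"] by simp
  show "lin k (carrier P.W) (Q.I (Suc i)) (Q.opW (Suc i)) (Q.I i) (Q.opW i) (Q.d i)" for i
    by (rule lin_mono[OF Q.lin_dW subgroup.subset[OF sub]])
  show "fl i (P.d i x) - Q.d i (fl (Suc i) x) \<in> Q.I i" for i x by (rule Q.E_Msub[OF fl_d])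
  show "P.d i (P.d (Suc i) x) \<in> P.I i" for i x by (rule P.E_Msub[OF P.d_d])
  show "Q.d i (Q.d (Suc i) x) \<in> Q.I i" for i x by (rule Q.E_Msub[OF Q.d_d])
  have aug_fl: "aug Q (Q.ev 0 (fl 0 x)) = aug P (P.ev 0 x)" for x
    by (simp add: ev_fl f_aug P.ev_closed)
  \<comment> \<open>An element with the augmentation of y exists because the augmentation of
    \<open>P\<close> is onto; the difference then has augmentation zero and bounds.\<close>
  show "\<exists>x v. y - fl 0 x - Q.d 0 v \<in> Q.I 0" for y
  proof -
    have "aug Q (Q.ev 0 y) \<in> carrier k" by (rule Q.aug_closed[OF Q.ev_closed])
    then obtain p where p: "p \<in> carrier (P.M 0)" "aug P p = aug Q (Q.ev 0 y)" using P.aug_surj by (metis imageE)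
    have "aug Q (Q.ev 0 (y - fl 0 (frag_of p))) = \<zero>\<^bsub>k\<^esub>"
      by (simp add: Q.aug_ev_diff aug_fl P.ev_of p Q.aug_closed Q.ev_closed P.k.minus_eq P.k.r_neg)
    then show ?thesis using Q.exact_0W by blast
  qed
  show "\<exists>w. x - P.d 0 w \<in> P.I 0" if "fl 0 x + Q.d 0 v \<in> Q.I 0" for x v
  proof (rule P.exact_0W)
    have "\<zero>\<^bsub>k\<^esub> = aug Q (Q.ev 0 (fl 0 x)) \<oplus>\<^bsub>k\<^esub> aug Q (Q.ev 0 (Q.d 0 v))"
      using Q.aug_I[OF that] by (simp add: Q.ev_add Q.aug_add Q.ev_closed)
    then show "aug P (P.ev 0 x) = \<zero>\<^bsub>k\<^esub>"
      by (simp add: aug_fl Q.ev_d Q.aug_diff Q.ev_closed P.aug_closed P.ev_closed)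
  qed
qed (rule Q.kmod_dual_basis_W P.lin_dW lin_fl | erule P.exact_dW Q.exact_dW)+

definition FT :: "nat \<Rightarrow> ('k \<times> 'p \<Rightarrow>\<^sub>0 int) \<Rightarrow> ('k \<times> 'r \<Rightarrow>\<^sub>0 int)" where
  "FT i = frag_extend (\<lambda>(a, p). frag_of (a, f i p))"

lemma addv_FT: "addv (FT i)"
  by (simp add: FT_def addv_frag_extend)

lemma keys_FT: "Poly_Mapping.keys x \<subseteq> P.gens i \<Longrightarrow> Poly_Mapping.keys (FT i x) \<subseteq> Q.gens i"
  unfolding FT_def by (rule keys_second[OF _ f_closed])

lemma add_strand_pd_one: "add_strand G m (P.pd \<one>\<^bsub>P.W\<^esub>) = Q.pd \<one>\<^bsub>Q.W\<^esub>"
  using add_strand_perm[OF P.one_W] by (simp add: wreath_def)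

lemma \<Theta>_FT:
  assumes "Poly_Mapping.keys x \<subseteq> P.gens i"
  shows "Q.\<Theta> i (FT i x) - fl i (P.\<Theta> i x) \<in> Q.E i"
  using assms
proof (induction x rule: frag_induction)
  case zero
  show ?case
    by (simp add: addv_zero[OF P.addv_\<Theta>] addv_zero[OF Q.addv_\<Theta>] addv_zero[OF addv_FT] addv_zero[OF addv_fl] subgrp_zero[OF Q.subE])
next
  case (one b)
  then obtain a p where b: "b = (a, p)" "a \<in> carrier k" "p \<in> carrier (P.M i)" by auto
  have "frag_of (f i p) - fl i (frag_of p) \<in> Q.E i"
    by (simp add: Q.E_iff ev_fl Q.ev_of P.ev_of b(3) f_closed)
  from subgrp_trans[OF Q.subE Q.op_cong[OF b(2) Q.pd_one this]
      subgrp_sym[OF Q.subE fl_op[OF b(2) P.pd_one, unfolded add_strand_pd_one]]]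
  show ?case by (simp add: b(1) FT_def P.\<Theta>_of Q.\<Theta>_of)
next
  case (diff a b)
  from subgrp_diff[OF Q.subE diff] show ?case
    by (simp add: addv_diff[OF P.addv_\<Theta>] addv_diff[OF Q.addv_\<Theta>] addv_diff[OF addv_FT] addv_diff[OF addv_fl] algebra_simps)
qed

lemma FT_T: "x \<in> P.T i \<Longrightarrow> FT i x \<in> Q.T i"
proof -
  assume x: "x \<in> P.T i"
  note kx = P.keys_T[OF x]
  have "fl i (P.\<Theta> i x) \<in> coinv k (carrier P.W) (Q.I i) (Q.opW i)"
    by (rule lin_coinv[OF lin_fl P.k.one_closed P.\<Theta>_T[OF x]])
  then have "fl i (P.\<Theta> i x) \<in> Q.N i"
    by (rule subsetD[OF coinv_mono, rotated]) (rule wreath_mono, simp)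
  then show ?thesis
    using Q.T_iff[OF keys_FT[OF kx]] subgrp_cong[OF Q.subN Q.E_N[OF \<Theta>_FT[OF kx]]] by simp
qed

lemma FT_DT:
  assumes x: "Poly_Mapping.keys x \<subseteq> P.gens (Suc i)"
  shows "FT i (P.DT i x) - Q.DT i (FT (Suc i) x) \<in> Q.T i"
proof -
  have "FT i (P.DT i x) = Q.DT i (FT (Suc i) x)"
    using x
  proof (induction x rule: frag_induction)
    case zero
    show ?case by (simp add: addv_zero[OF P.addv_DT] addv_zero[OF Q.addv_DT] addv_zero[OF addv_FT])
  next
    case (one b)
    then show ?case by (auto simp: P.DT_def Q.DT_def FT_def f_diff)
  next
    case (diff a b)
    then show ?case by (simp add: addv_diff[OF P.addv_DT] addv_diff[OF Q.addv_DT] addv_diff[OF addv_FT])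
  qed
  then show ?thesis by (simp add: subgrp_zero[OF Q.subT])
qed

abbreviation "N' i \<equiv> coinv k (carrier P.W) (Q.I i) (Q.opW i)"

lemma subN': "subgrp (N' i)" and N'_N: "z \<in> N' i \<Longrightarrow> z \<in> Q.N i"
  using subsetD[OF coinv_mono[OF wreath_mono, of m "Suc m"]] by (auto simp: subgrp_coinv)

lemma fl_cycle:
  assumes "P.d i x \<in> P.N i" shows "Q.d i (fl (Suc i) x) \<in> N' i"
  using lin_coinv[OF lin_fl P.k.one_closed assms] subgrp_cong[OF subN' coinv_incl[OF Q.E_Msub[OF fl_d]]] by blast

text \<open>The group stability is taken in the quotient resolution of \<open>Q\<close>:
  \<open>N'\<close> stands for coinvariants under the wreath product on m points, \<open>Q.N\<close>
  for those on m+1 points.\<close>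

lemma coinv_stability:
  assumes q: "2 * q + 2 \<le> Suc m"
  shows "\<lbrakk>q > 0 \<Longrightarrow> Q.d (q - 1) y \<in> Q.N (q - 1)\<rbrakk> \<Longrightarrow>
      \<exists>x v. (q > 0 \<longrightarrow> Q.d (q - 1) x \<in> N' (q - 1)) \<and> y - x - Q.d q v \<in> Q.N q"
    and "\<lbrakk>q > 0 \<Longrightarrow> Q.d (q - 1) x \<in> N' (q - 1); x - Q.d q v \<in> Q.N q\<rbrakk> \<Longrightarrow> \<exists>w. x - Q.d q w \<in> N' q"
proof -
  interpret R: wreath_resolution G k "Suc m" Q.I Q.opW Q.d Q.S Q.u Q.cW by (rule Q.wreath_resolution_I)
  interpret C: stability_complex "\<lambda>p i. R.C (Suc m - p) i" Q.d "\<lambda>p i. R.e (Suc m) p i" "Suc m"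
    by (rule R.stability_complex_words) simp
  have "C.stab_surj 0 q" "C.stab_inj 0 q" using R.wreath_stability[OF order_refl q] by blast+
  note * = this[unfolded C.stab_surj_def C.stab_inj_def C.cyc_def, unfolded R.C_def]
  show "\<lbrakk>q > 0 \<Longrightarrow> Q.d (q - 1) y \<in> Q.N (q - 1)\<rbrakk> \<Longrightarrow>
      \<exists>x v. (q > 0 \<longrightarrow> Q.d (q - 1) x \<in> N' (q - 1)) \<and> y - x - Q.d q v \<in> Q.N q"
    using *(1) by simp
  show "\<lbrakk>q > 0 \<Longrightarrow> Q.d (q - 1) x \<in> N' (q - 1); x - Q.d q v \<in> Q.N q\<rbrakk> \<Longrightarrow> \<exists>w. x - Q.d q w \<in> N' q"
    using *(2) by auto
qed

text \<open>The map on Tor factors through the homology of the \<open>N'\<close>-coinvariants of the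
  resolution for m+1 strands. The second factor is injective by stability and the first by
  comparison of resolutions.\<close>

lemma FT_inj:
  assumes q: "2 * q + 2 \<le> Suc m" and x: "Poly_Mapping.keys x \<subseteq> P.gens q"
    and dx: "q > 0 \<Longrightarrow> P.DT (q - 1) x \<in> P.T (q - 1)"
    and y: "Poly_Mapping.keys y \<subseteq> Q.gens (Suc q)" "FT q x - Q.DT q y \<in> Q.T q"
  shows "\<exists>w. Poly_Mapping.keys w \<subseteq> P.gens (Suc q) \<and> x - P.DT q w \<in> P.T q"
proof -
  interpret R: resolution_comparison k Q.W "carrier P.W" P.I P.opW P.d P.S P.u P.cW Q.I Q.opW Q.d Q.S Q.u Q.cW fl
    by (rule comparison)
  let ?x = "P.\<Theta> q x"
  have dx': "P.d (q - 1) ?x \<in> P.N (q - 1)" if "q > 0"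
    using P.DT_T_iff[of x "q - 1"] x dx that by simp
  have dfx: "Q.d (q - 1) (fl q ?x) \<in> N' (q - 1)" if "q > 0"
    using fl_cycle[of "q - 1" ?x] dx'[OF that] that by simp
  have fx: "fl q ?x - Q.d q (Q.\<Theta> (Suc q) y) \<in> Q.N q"
  proof -
    have "Q.\<Theta> q (FT q x) - Q.\<Theta> q (Q.DT q y) \<in> Q.N q"
      using Q.\<Theta>_T[OF y(2)] by (simp add: addv_diff[OF Q.addv_\<Theta>])
    from subgrp_trans[OF Q.subN subgrp_trans[OF Q.subN
        subgrp_sym[OF Q.subN Q.E_N[OF \<Theta>_FT[OF x]]] this] Q.E_N[OF Q.\<Theta>_DT[OF y(1)]]]
    show ?thesis .
  qed
  obtain v where v: "fl q ?x - Q.d q v \<in> N' q" by (rule exE[OF coinv_stability(2)[OF q dfx fx]])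
  obtain w where w: "?x - P.d q w \<in> P.N q" by (rule exE[OF R.comparison_inj[OF dx' v]])
  have 1: "P.\<Theta> q (x - P.DT q (P.\<Psi> (Suc q) w)) \<in> P.N q"
    using subgrp_trans[OF P.subN w subgrp_sym[OF P.subN P.\<Theta>_boundary]] by (simp add: addv_diff[OF P.addv_\<Theta>])
  have "Poly_Mapping.keys (x - P.DT q (P.\<Psi> (Suc q) w)) \<subseteq> P.gens q"
    using keys_diff[of x "P.DT q (P.\<Psi> (Suc q) w)"] x P.keys_DT[OF P.keys_\<Psi>[of "Suc q" w]] by blast
  from P.T_iff[OF this] 1 show ?thesis using P.keys_\<Psi> by blast
qed

text \<open>The same factorisation, with the cycle lifted first along stability and then along the
  comparison; the two bounding chains v and w add up.\<close>

lemma FT_surj: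
  assumes q: "2 * q + 2 \<le> Suc m" and y: "Poly_Mapping.keys y \<subseteq> Q.gens q"
    and dy: "q > 0 \<Longrightarrow> Q.DT (q - 1) y \<in> Q.T (q - 1)"
  shows "\<exists>x w. Poly_Mapping.keys x \<subseteq> P.gens q \<and> (q > 0 \<longrightarrow> P.DT (q - 1) x \<in> P.T (q - 1)) \<and>
    Poly_Mapping.keys w \<subseteq> Q.gens (Suc q) \<and> y - FT q x - Q.DT q w \<in> Q.T q"
proof -
  interpret R: resolution_comparison k Q.W "carrier P.W" P.I P.opW P.d P.S P.u P.cW Q.I Q.opW Q.d Q.S Q.u Q.cW fl
    by (rule comparison)
  let ?y = "Q.\<Theta> q y"
  have dy': "Q.d (q - 1) ?y \<in> Q.N (q - 1)" if "q > 0"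
    using Q.DT_T_iff[of y "q - 1"] y dy that by simp
  from coinv_stability(1)[OF q dy'] obtain z v where z: "q > 0 \<longrightarrow> Q.d (q - 1) z \<in> N' (q - 1)" "?y - z - Q.d q v \<in> Q.N q"
    by blast
  from R.comparison_surj[OF z(1)[rule_format]] obtain x w where x: "q > 0 \<longrightarrow> P.d (q - 1) x \<in> P.N (q - 1)" "z - fl q x - Q.d q w \<in> N' q"
    by blast
  let ?X = "P.\<Psi> q x" and ?w = "Q.\<Psi> (Suc q) (v + w)"
  have dX: "P.DT (q - 1) ?X \<in> P.T (q - 1)" if q: "q > 0"
  proof -
    have "P.d (q - 1) (P.\<Theta> q ?X) - P.d (q - 1) x \<in> P.N (q - 1)"
      using P.d_N[OF P.E_N[OF P.\<Theta>_\<Psi>], of "q - 1" x] q by (simp add: addv_diff[OF P.addv_d])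
    then have "P.d (q - 1) (P.\<Theta> q ?X) \<in> P.N (q - 1)" using x(1) q subgrp_cong[OF P.subN] by blast
    then show ?thesis using P.DT_T_iff[of ?X "q - 1"] P.keys_\<Psi> q by simp
  qed
  have "fl q (P.\<Theta> q ?X) - fl q x \<in> Q.N q" by (rule Q.E_N[OF fl_E[OF P.\<Theta>_\<Psi>]])
  then have 1: "Q.\<Theta> q (FT q ?X) - fl q x \<in> Q.N q"
    by (rule subgrp_trans[OF Q.subN Q.E_N[OF \<Theta>_FT[OF P.keys_\<Psi>]]])
  have 2: "Q.\<Theta> q (Q.DT q ?w) - Q.d q (v + w) \<in> Q.N q" by (rule Q.\<Theta>_boundary)
  have 3: "?y - (fl q x + Q.d q (v + w)) \<in> Q.N q"
    using subgrp_add[OF Q.subN z(2) N'_N[OF x(2)]] by (simp add: addv_add[OF Q.addv_d] algebra_simps)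
  \<comment> \<open>The representatives of \<open>FT\<close> and \<open>Q.DT\<close> under \<Theta>
    agree with the chains used above only modulo \<open>Q.N\<close>; this identity collects the
    three congruences.\<close>
  have "(a - (b + c)) - ((e - b) + (g - c)) = a - e - g" for a b c e g :: "'r \<Rightarrow>\<^sub>0 int"
    by simp
  from subgrp_diff[OF Q.subN 3 subgrp_add[OF Q.subN 1 2], unfolded this]
  have "Q.\<Theta> q (y - FT q ?X - Q.DT q ?w) \<in> Q.N q" by (simp add: addv_diff[OF Q.addv_\<Theta>])
  moreover have "Poly_Mapping.keys (y - FT q ?X - Q.DT q ?w) \<subseteq> Q.gens q"
    using keys_diff[of "y - FT q ?X" "Q.DT q ?w"] keys_diff[of y "FT q ?X"] y keys_FT[OF P.keys_\<Psi>, of q x]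
      Q.keys_DT[OF Q.keys_\<Psi>[of "Suc q" "v + w"]] by blast
  ultimately have "y - FT q ?X - Q.DT q ?w \<in> Q.T q" by (simp only: Q.T_iff)
  then show ?thesis by (intro exI[of _ ?X] exI[of _ ?w] conjI impI dX P.keys_\<Psi> Q.keys_\<Psi>)
qed

theorem stability:
  assumes q: "2 * q + 2 \<le> Suc m"
  shows "Tor_map Q.A Q.triv Q (\<lambda>c. c) f q \<in> iso (Tor P.A P.triv P q) (Tor Q.A Q.triv Q q)"
proof -
  note * = Tor_map_iso[where M = P.triv and M' = Q.triv and A = P.A and A' = Q.A and P = P and Q = Q and f = f
      and g = "\<lambda>c. c" and q = q, unfolded P.carrier_triv, folded P.DT_def Q.DT_def FT_def]
  show ?thesis
    by (rule *[OF P.presented Q.presented keys_FT FT_T FT_DT FT_inj[OF q] FT_surj[OF q]])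
qed

end

section \<open>The case of the zero ring\<close>

lemma tensor_kernel_zero_ring:
  assumes k: "cring k" and one_zero: "\<one>\<^bsub>k\<^esub> = \<zero>\<^bsub>k\<^esub>" and M: "left_module (GB G k act \<delta> n) M"
  shows "tensor_kernel (GB G k act \<delta> n) (trivial_module k) M =
    {x. Poly_Mapping.keys x \<subseteq> carrier k \<times> carrier M}" (is "?T = _")
proof
  interpret cring k by (rule k)
  have k0: "a = \<zero>\<^bsub>k\<^esub>" if "a \<in> carrier k" for a
    using l_one[OF that] l_null[OF that] by (simp add: one_zero)
  have sub: "subgrp ?T" and keys: "\<forall>x\<in>?T. Poly_Mapping.keys x \<subseteq> carrier k \<times> carrier M"
    using tensor_kernel_trivial_module[OF k M] by (auto simp: subgroup_frag_iff)
  show "?T \<subseteq> {x. Poly_Mapping.keys x \<subseteq> carrier k \<times> carrier M}" using keys by blast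
  have gen: "frag_of b \<in> ?T" if b: "b \<in> carrier k \<times> carrier M" for b
  proof -
    obtain p where p: "b = (\<zero>\<^bsub>k\<^esub>, p)" "p \<in> carrier M" using b k0 by auto
    \<comment> \<open>With 0 as the only scalar, additivity applied to 0 + 0 shows that every
      generator is a relation.\<close>
    have "frag_of (a \<oplus>\<^bsub>k\<^esub> b, p) - frag_of (a, p) - frag_of (b, p) \<in> ?T"
      if "a \<in> carrier k" "b \<in> carrier k" for a b
      by (rule tensor_kernel_relation) (use that p(2) in \<open>auto simp: tensor_relations_def trivial_module_def\<close>)
    from subgrp_minus[OF sub this[OF zero_closed zero_closed]] show ?thesis by (simp add: p(1))
  qed
  show "{x. Poly_Mapping.keys x \<subseteq> carrier k \<times> carrier M} \<subseteq> ?T"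
  proof
    fix x :: "_ \<Rightarrow>\<^sub>0 int" assume "x \<in> {x. Poly_Mapping.keys x \<subseteq> carrier k \<times> carrier M}"
    then have "frag_extend frag_of x \<in> ?T" by (intro frag_extend_mem[OF sub] gen) auto
    then show "x \<in> ?T" by (simp flip: frag_expansion)
  qed
qed

text \<open>All chains are relations, so both Tor groups are trivial and zero witnesses serve
  everywhere.\<close>

lemma Tor_map_iso_zero_ring:
  fixes P :: "('g diagram \<Rightarrow> 'k, 'p, 'k) augmented_complex" and Q :: "('g diagram \<Rightarrow> 'k, 'r, 'k) augmented_complex"
  assumes k: "cring k" and one_zero: "\<one>\<^bsub>k\<^esub> = \<zero>\<^bsub>k\<^esub>"
    and P: "\<And>i. left_module (GB G k act \<delta> m) (obj P i)" and Q: "\<And>i. left_module (GB G k act \<delta> n) (obj Q i)"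
    and dP: "\<And>i p. p \<in> carrier (obj P (Suc i)) \<Longrightarrow> diff P i p \<in> carrier (obj P i)"
    and dQ: "\<And>i p. p \<in> carrier (obj Q (Suc i)) \<Longrightarrow> diff Q i p \<in> carrier (obj Q i)"
    and f: "\<And>i p. p \<in> carrier (obj P i) \<Longrightarrow> f i p \<in> carrier (obj Q i)"
  shows "Tor_map (GB G k act \<delta> n) (trivial_module k) Q (\<lambda>c. c) f q
    \<in> iso (Tor (GB G k act \<delta> m) (trivial_module k) P q) (Tor (GB G k act \<delta> n) (trivial_module k) Q q)"
proof -
  let ?triv = "trivial_module k :: ('g diagram \<Rightarrow> 'k, 'k) module"
  define DP where "DP i = frag_extend (\<lambda>(a, p). frag_of (a :: 'k, diff P i p))" for i
  define DQ where "DQ i = frag_extend (\<lambda>(a, p). frag_of (a :: 'k, diff Q i p))" for i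
  define F where "F i = frag_extend (\<lambda>(a, p). frag_of (a :: 'k, f i p))" for i
  define KP where "KP i = tensor_kernel (GB G k act \<delta> m) ?triv (obj P i)" for i
  define KQ where "KQ i = tensor_kernel (GB G k act \<delta> n) ?triv (obj Q i)" for i
  let ?B = "\<lambda>i. carrier k \<times> carrier (obj P i)" and ?B' = "\<lambda>i. carrier k \<times> carrier (obj Q i)"
  have carrier: "carrier ?triv = carrier k" by (simp add: trivial_module_def)
  have KP: "x \<in> KP i \<longleftrightarrow> Poly_Mapping.keys x \<subseteq> ?B i" for x i
    unfolding KP_def tensor_kernel_zero_ring[OF k one_zero P] by simp
  have KQ: "x \<in> KQ i \<longleftrightarrow> Poly_Mapping.keys x \<subseteq> ?B' i" for x i
    unfolding KQ_def tensor_kernel_zero_ring[OF k one_zero Q] by simp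
  have keys_DP: "Poly_Mapping.keys (DP i x) \<subseteq> ?B i" if "Poly_Mapping.keys x \<subseteq> ?B (Suc i)" for i x
    unfolding DP_def by (rule keys_second[OF that dP])
  have keys_DQ: "Poly_Mapping.keys (DQ i x) \<subseteq> ?B' i" if "Poly_Mapping.keys x \<subseteq> ?B' (Suc i)" for i x
    unfolding DQ_def by (rule keys_second[OF that dQ])
  have keys_F: "Poly_Mapping.keys (F i x) \<subseteq> ?B' i" if "Poly_Mapping.keys x \<subseteq> ?B i" for i x
    unfolding F_def by (rule keys_second[OF that f])
  have presP: "presented_complex ?B KP DP"
  proof (rule presented_complex.intro)
    show "subgroup (KP i) (free_Abelian_group (?B i))" for i
      unfolding KP_def by (rule tensor_kernel_trivial_module[OF k P])
    show "addv (DP i)" for i unfolding DP_def by (rule addv_frag_extend)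
  qed (simp_all only: KP keys_DP)
  have presQ: "presented_complex ?B' KQ DQ"
  proof (rule presented_complex.intro)
    show "subgroup (KQ i) (free_Abelian_group (?B' i))" for i
      unfolding KQ_def by (rule tensor_kernel_trivial_module[OF k Q])
    show "addv (DQ i)" for i unfolding DQ_def by (rule addv_frag_extend)
  qed (simp_all only: KQ keys_DQ)
  note * = Tor_map_iso[where M = ?triv and M' = ?triv and A = "GB G k act \<delta> m" and A' = "GB G k act \<delta> n" and P = P
      and Q = Q and f = f and g = "\<lambda>c. c" and q = q, unfolded carrier, folded DP_def DQ_def F_def KP_def KQ_def]
  show ?thesis
  proof (rule *[OF presP presQ])
    show "F i x \<in> KQ i" if "x \<in> KP i" for i x using that keys_F by (simp only: KP KQ)
    show "F i (DP i x) - DQ i (F (Suc i) x) \<in> KQ i" if x: "Poly_Mapping.keys x \<subseteq> ?B (Suc i)" for i x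
      using keys_diff[of "F i (DP i x)" "DQ i (F (Suc i) x)"] keys_F[OF keys_DP[OF x]] keys_DQ[OF keys_F[OF x]]
      unfolding KQ by blast
    show "\<exists>w. Poly_Mapping.keys w \<subseteq> ?B (Suc q) \<and> x - DP q w \<in> KP q" if "Poly_Mapping.keys x \<subseteq> ?B q" for x
      using that by (intro exI[of _ 0]) (simp add: KP DP_def)
    show "\<exists>x w. Poly_Mapping.keys x \<subseteq> ?B q \<and> (0 < q \<longrightarrow> DP (q - 1) x \<in> KP (q - 1)) \<and>
        Poly_Mapping.keys w \<subseteq> ?B' (Suc q) \<and> y - F q x - DQ q w \<in> KQ q" if "Poly_Mapping.keys y \<subseteq> ?B' q" for y
      using that by (intro exI[of _ 0]) (simp add: KP KQ DP_def DQ_def F_def)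
  qed (rule keys_F)
qed

theorem corollary8p4:
  fixes G :: "('g, 'x) monoid_scheme" and k :: "('k, 'y) ring_scheme"
    and act :: "'g \<Rightarrow> 'k \<Rightarrow> 'k" and \<delta> :: 'k and n q :: nat
    and P :: "('g diagram \<Rightarrow> 'k, 'p, 'k) augmented_complex"
    and Q :: "('g diagram \<Rightarrow> 'k, 'r, 'k) augmented_complex"
    and f :: "nat \<Rightarrow> 'p \<Rightarrow> 'r"
  assumes "comm_group G"
    and "commutative_G_ring G k act"
    and "\<delta> \<in> Units k"
    and "n \<ge> 2 * q + 2"
    and "projective_resolution (GB G k act \<delta> (n - 1)) (trivial_module k) P"
    and "projective_resolution (GB G k act \<delta> n) (trivial_module k) Q"
    and "comparison_map (GB G k act \<delta> (n - 1)) (GB_inclusion G k (n - 1)) (\<lambda>c. c) P Q f"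
  shows "Tor_map (GB G k act \<delta> n) (trivial_module k) Q (\<lambda>c. c) f q
    \<in> iso (Tor (GB G k act \<delta> (n - 1)) (trivial_module k) P q)
          (Tor (GB G k act \<delta> n) (trivial_module k) Q q)"
proof -
  obtain m where n: "n = Suc m" using assms(4) by (cases n) auto
  have P: "projective_resolution (GB G k act \<delta> m) (trivial_module k) P"
    and Q: "projective_resolution (GB G k act \<delta> (Suc m)) (trivial_module k) Q"
    and f: "comparison_map (GB G k act \<delta> m) (GB_inclusion G k m) (\<lambda>c. c) P Q f"
    using assms(5-7) by (simp_all add: n)
  have modP: "left_module (GB G k act \<delta> m) (obj P i)" for i
    using P by (simp add: projective_resolution_def projective_module_def)
  have modQ: "left_module (GB G k act \<delta> (Suc m)) (obj Q i)" for i
    using Q by (simp add: projective_resolution_def projective_module_def)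
  show ?thesis
  proof (cases "\<one>\<^bsub>k\<^esub> = \<zero>\<^bsub>k\<^esub>")
    case True
    have k: "cring k" using assms(2) by (simp add: commutative_G_ring_def)
    show ?thesis
      unfolding n diff_Suc_1
    proof (rule Tor_map_iso_zero_ring[OF k True modP modQ])
      show "diff P i p \<in> carrier (obj P i)" if "p \<in> carrier (obj P (Suc i))" for i p
        using P that by (auto simp: projective_resolution_def semilinear_hom_def)
      show "diff Q i p \<in> carrier (obj Q i)" if "p \<in> carrier (obj Q (Suc i))" for i p
        using Q that by (auto simp: projective_resolution_def semilinear_hom_def)
      show "f i p \<in> carrier (obj Q i)" if "p \<in> carrier (obj P i)" for i p
        using f that by (auto simp: comparison_map_def semilinear_hom_def)
    qed
  next
    case False
    \<comment> \<open>The modules of the resolutions are modules over a ring by definition, which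
      supplies the ring axioms for both algebras.\<close>
    have ring: "ring (GB G k act \<delta> m)" "ring (GB G k act \<delta> (Suc m))"
      using modP[of 0] modQ[of 0] by (simp_all add: left_module_def)
    interpret GB_comparison G k act \<delta> m P Q f
      by (intro GB_comparison.intro GB_resolution.intro GB_algebra.intro GB_resolution_axioms.intro
          GB_comparison_axioms.intro assms(1-3) False ring P Q f)
    show ?thesis unfolding n diff_Suc_1 by (rule stability) (use assms(4) n in simp)
  qed
qed

end
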